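(* Let $\alpha\in\mathbb{R}$ with $|\alpha|<1$ and $I=(0,1)$. There exist constants $\epsilon>0$ and $C>0$, with $C$ independent of $\epsilon$, such that for every $\varphi\in C^1(\mathbb{R})$ with $\|\varphi\|_{C^1(\mathbb{R})}\le\epsilon$, the system $$\begin{cases} u_t+u_{xxx}-u_{xxxxx}+uu_x=0, & (x,t)\in I\times\mathbb{R},\\ u(0,t)=\varphi(t),\quad u(1,t)=u_x(1,t)=u_x(0,t)=0, & t\in\mathbb{R},\\ u_{xx}(1,t)=\alpha u_{xx}(0,t), & t\in\mathbb{R},\end{cases}$$ admits a unique (mild) solution $u$ with $\|u\|_X\le C\epsilon$, and the following holds: if $\varphi$ is quasi-periodic, then this solution $u$ is quasi-periodic. Moreover, if $\varphi$ is $\overline{\omega}$-quasi-periodic in $t$, then $u$ is $\overline{\omega}$-quasi-periodic in $t$ (uniformly with respect to $x\in I$).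
   Context: $C^1(\mathbb{R})$: continuously differentiable complex-valued functions on $\mathbb{R}$, $\|\varphi\|_{C^1(\mathbb{R})}=\sup_{\mathbb{R}}|\varphi|+\sup_{\mathbb{R}}|\varphi'|$. $L^2(I)$ and $H^2(I)$ consist of complex-valued functions. $X=C_b(\mathbb{R},H^2(I))$ is the space of bounded continuous functions $\mathbb{R}\to H^2(I)$, with $\|u\|_X=\sup_{t\in\mathbb{R}}\|u(t)\|_{H^2(I)}$. $\{S(t)\}_{t\ge0}$ is the $C_0$-semigroup of contractions on $L^2(I)$ generated by the operator $v\mapsto -v_{xxx}+v_{xxxxx}$ with domain $\{v\in H^5(I): v(0)=v(1)=v_x(0)=v_x(1)=0,\ v_{xx}(1)=\alpha v_{xx}(0)\}$. Notion of solution. Put $A(x)=\frac{\alpha-1}{\alpha+1}x^2+\frac{2}{\alpha+1}x-1$, $a(x,t)=-A(x)\varphi(t)$, $b(x,t)=-A'(x)\varphi(t)$, $f(x,t)=A(x)\varphi'(t)-A(x)A'(x)\varphi(t)^2$. A function $u\in X$ is a (mild) solution of the system if $y(x,t)=u(x,t)+A(x)\varphi(t)$ satisfies $$y(t)=S(t-r)y(r)+\int_r^t S(t-s)\,(-yy_x-ay_x-by+f)(s)\,ds\qquad\text{for all } r\in\mathbb{R},\ t\ge r.$$ The boundary conditions are understood only through this integral equation. Quasi-periodicity. Real numbers $\omega_1,\dots,\omega_k$ are rationally independent if $m_1\omega_1+\dots+m_k\omega_k=0$ with $m_1,\dots,m_k\in\mathbb{Q}$ implies $m_1=\dots=m_k=0$.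 Let $\overline{\omega}=(\omega_1,\dots,\omega_k)$ have rationally independent entries and let $e_1,\dots,e_k$ be the standard basis of $\mathbb{R}^k$. A function $\varphi:\mathbb{R}\to\mathbb{R}$ is $\overline{\omega}$-quasi-periodic in $t$ if there is $\Phi\in C(\mathbb{R}^k,\mathbb{R})$ with $\Phi(v+2\pi e_i)=\Phi(v)$ for all $v\in\mathbb{R}^k$, $i=1,\dots,k$, and $\varphi(t)=\Phi(t\overline{\omega})$ for all $t\in\mathbb{R}$. A continuous function $g:I\times\mathbb{R}\to\mathbb{R}$ is $\overline{\omega}$-quasi-periodic in $t$ uniformly with respect to $x\in I$ if there is $F\in C(I\times\mathbb{R}^k,\mathbb{R})$ with $F(x,v+2\pi e_i)=F(x,v)$ for all $x\in I$, $v\in\mathbb{R}^k$, $i=1,\dots,k$, and $g(x,t)=F(x,t\overline{\omega})$ for all $x\in I$, $t\in\mathbb{R}$. A function is quasi-periodic if it is $\overline{\omega}$-quasi-periodic for some such $k$ and $\overline{\omega}$. *)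

theory Defs
  imports "HOL-Analysis.Analysis"
begin

section \<open>The complex Hilbert space \<open>L\<^sup>2(0,1)\<close> as a type\<close>

abbreviation lebI :: "real measure" where
  "lebI \<equiv> lebesgue_on {0<..<1}"

definition sq_integrable :: "(real \<Rightarrow> complex) \<Rightarrow> bool" where
  "sq_integrable f \<longleftrightarrow> f \<in> borel_measurable lebI \<and> integrable lebI (\<lambda>x. (cmod (f x))\<^sup>2)"

definition L2_eq :: "(real \<Rightarrow> complex) \<Rightarrow> (real \<Rightarrow> complex) \<Rightarrow> bool" where
  "L2_eq f g \<longleftrightarrow> sq_integrable f \<and> sq_integrable g \<and> (AE x in lebI. f x = g x)"

lemma sq_integrable_zero: "sq_integrable (\<lambda>x. 0)"
  by (simp add: sq_integrable_def)

lemma sq_integrable_mult: "sq_integrable f \<Longrightarrow> sq_integrable (\<lambda>x. c * f x)"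
  by (auto simp: sq_integrable_def norm_mult power_mult_distrib)

lemma cmod_add_sq_le: "(cmod (a + b))\<^sup>2 \<le> 2 * (cmod a)\<^sup>2 + 2 * (cmod b)\<^sup>2"
proof -
  have "(cmod (a + b))\<^sup>2 \<le> (cmod a + cmod b)\<^sup>2"
    by (simp add: norm_triangle_ineq power_mono)
  also have "\<dots> \<le> 2 * (cmod a)\<^sup>2 + 2 * (cmod b)\<^sup>2"
    using sum_squares_bound[of "cmod a" "cmod b"] by (simp add: power2_sum)
  finally show ?thesis .
qed

lemma sq_integrable_add:
  assumes "sq_integrable f" "sq_integrable g"
  shows "sq_integrable (\<lambda>x. f x + g x)"
proof -
  have [measurable]: "f \<in> borel_measurable lebI" "g \<in> borel_measurable lebI"
    using assms by (auto simp: sq_integrable_def)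
  have "integrable lebI (\<lambda>x. 2 * (cmod (f x))\<^sup>2 + 2 * (cmod (g x))\<^sup>2)"
    using assms by (auto simp: sq_integrable_def)
  then have "integrable lebI (\<lambda>x. (cmod (f x + g x))\<^sup>2)"
    by (rule Bochner_Integration.integrable_bound) (use cmod_add_sq_le in auto)
  then show ?thesis by (simp add: sq_integrable_def)
qed

quotient_type L2I = "real \<Rightarrow> complex" / partial: L2_eq
  morphisms rep_L2 abs_L2
proof (rule part_equivpI)
  show "\<exists>x. L2_eq x x"
    using sq_integrable_zero by (auto simp: L2_eq_def)
  show "symp L2_eq"
    by (auto simp: symp_def L2_eq_def)
  show "transp L2_eq"
    by (auto simp: transp_def L2_eq_def)
qed

instantiation L2I :: real_vector
begin

lift_definition zero_L2I :: L2I is "\<lambda>x. 0"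
  by (simp add: L2_eq_def sq_integrable_zero)

lift_definition plus_L2I :: "L2I \<Rightarrow> L2I \<Rightarrow> L2I" is "\<lambda>f g x. f x + g x"
  by (auto simp: L2_eq_def intro: sq_integrable_add)

lift_definition uminus_L2I :: "L2I \<Rightarrow> L2I" is "\<lambda>f x. - f x"
  by (auto simp: L2_eq_def dest: sq_integrable_mult[where c = "-1"])

definition minus_L2I :: "L2I \<Rightarrow> L2I \<Rightarrow> L2I" where
  "minus_L2I v w = v + - w"

lift_definition scaleR_L2I :: "real \<Rightarrow> L2I \<Rightarrow> L2I" is "\<lambda>c f x. c *\<^sub>R f x"
  by (auto simp: L2_eq_def scaleR_conv_of_real intro: sq_integrable_mult)

instance
proof
  fix u v w :: L2I and a b :: real
  note [simp] = L2_eq_def sq_integrable_zero sq_integrable_add scaleR_conv_of_real sq_integrable_mult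
  show "u + v + w = u + (v + w)" by transfer (simp add: add.assoc)
  show "u + v = v + u" by transfer (simp add: add.commute)
  show "0 + u = u" by transfer simp
  show "- u + u = 0" by transfer simp
  show "u - v = u + - v" by (simp add: minus_L2I_def)
  show "a *\<^sub>R (u + v) = a *\<^sub>R u + a *\<^sub>R v" by transfer (simp add: distrib_left)
  show "(a + b) *\<^sub>R u = a *\<^sub>R u + b *\<^sub>R u" by transfer (simp add: distrib_right)
  show "a *\<^sub>R b *\<^sub>R u = (a * b) *\<^sub>R u" by transfer (simp add: mult.assoc)
  show "1 *\<^sub>R u = u" by transfer simp
qed

end

lift_definition scaleC_L2 :: "complex \<Rightarrow> L2I \<Rightarrow> L2I" is "\<lambda>c f x. c * f x"
  by (auto simp: L2_eq_def intro: sq_integrable_mult)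

instantiation L2I :: real_normed_vector
begin

lift_definition norm_L2I :: "L2I \<Rightarrow> real" is "\<lambda>f. sqrt (\<integral>x. (cmod (f x))\<^sup>2 \<partial>lebI)"
  by (auto simp: L2_eq_def sq_integrable_def intro!: integral_cong_AE)

definition dist_L2I :: "L2I \<Rightarrow> L2I \<Rightarrow> real" where
  "dist_L2I v w = norm (v - w)"

definition sgn_L2I :: "L2I \<Rightarrow> L2I" where
  "sgn_L2I v = v /\<^sub>R norm v"

definition uniformity_L2I :: "(L2I \<times> L2I) filter" where
  "uniformity_L2I = (INF e\<in>{0 <..}. principal {(v, w). dist v w < e})"

definition open_L2I :: "L2I set \<Rightarrow> bool" where
  "open_L2I U \<longleftrightarrow> (\<forall>v\<in>U. \<forall>\<^sub>F (v', w) in uniformity. v' = v \<longrightarrow> w \<in> U)"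

instance
proof
  fix u v :: L2I and a :: real and U :: "L2I set"
  show "dist u v = norm (u - v)" by (rule dist_L2I_def)
  show "sgn u = u /\<^sub>R norm u" by (rule sgn_L2I_def)
  show "uniformity = (INF e\<in>{0 <..}. principal {(x, y :: L2I). dist x y < e})"
    by (rule uniformity_L2I_def)
  show "open U = (\<forall>x\<in>U. \<forall>\<^sub>F (x', y) in uniformity. x' = x \<longrightarrow> y \<in> U)"
    by (rule open_L2I_def)
  show "norm u = 0 \<longleftrightarrow> u = 0"
    by transfer (auto simp: L2_eq_def sq_integrable_def integral_nonneg_eq_0_iff_AE)
  show "norm (a *\<^sub>R u) = \<bar>a\<bar> * norm u"
    by transfer (simp add: power_mult_distrib real_sqrt_mult)
  show "norm (u + v) \<le> norm u + norm v"
  proof transfer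
    fix f g :: "real \<Rightarrow> complex"
    assume "L2_eq f f" "L2_eq g g"
    then have f: "sq_integrable f" and g: "sq_integrable g"
      by (auto simp: L2_eq_def)
    define a where "a = sqrt (\<integral>x. (cmod (f x))\<^sup>2 \<partial>lebI)"
    define b where "b = sqrt (\<integral>x. (cmod (g x))\<^sup>2 \<partial>lebI)"
    have a2: "(\<integral>x. (cmod (f x))\<^sup>2 \<partial>lebI) = a\<^sup>2" and b2: "(\<integral>x. (cmod (g x))\<^sup>2 \<partial>lebI) = b\<^sup>2"
      by (simp_all add: a_def b_def)
    have ab0: "a \<ge> 0" "b \<ge> 0" by (simp_all add: a_def b_def)
    have fi: "integrable lebI (\<lambda>x. (cmod (f x))\<^sup>2)" and gi: "integrable lebI (\<lambda>x. (cmod (g x))\<^sup>2)"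
      and fgi: "integrable lebI (\<lambda>x. (cmod (f x + g x))\<^sup>2)"
      and [measurable]: "f \<in> borel_measurable lebI" "g \<in> borel_measurable lebI"
      using f g sq_integrable_add[OF f g] by (auto simp: sq_integrable_def)
    have "(\<integral>x. (cmod (f x + g x))\<^sup>2 \<partial>lebI) \<le> (a + b)\<^sup>2"
    proof (cases "a = 0 \<or> b = 0")
      case True
      then have "(AE x in lebI. f x = 0) \<or> (AE x in lebI. g x = 0)"
        using a2 b2 fi gi by (auto simp: integral_nonneg_eq_0_iff_AE)
      then consider "AE x in lebI. f x = 0" | "AE x in lebI. g x = 0" by blast
      then show ?thesis
      proof cases
        case 1
        then have "(\<integral>x. (cmod (f x + g x))\<^sup>2 \<partial>lebI) = b\<^sup>2"
          unfolding b2[symmetric] by (intro integral_cong_AE) auto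
        then show ?thesis using ab0 by (simp add: power_mono)
      next
        case 2
        then have "(\<integral>x. (cmod (f x + g x))\<^sup>2 \<partial>lebI) = a\<^sup>2"
          unfolding a2[symmetric] by (intro integral_cong_AE) auto
        then show ?thesis using ab0 by (simp add: power_mono)
      qed
    next
      case False
      with ab0 have ab: "a > 0" "b > 0" by auto
      have pt: "(cmod (f x + g x))\<^sup>2 \<le> (1 + b / a) * (cmod (f x))\<^sup>2 + (1 + a / b) * (cmod (g x))\<^sup>2" for x
      proof -
        have "(cmod (f x + g x))\<^sup>2 \<le> (cmod (f x) + cmod (g x))\<^sup>2"
          by (simp add: norm_triangle_ineq power_mono)
        moreover have "0 \<le> (b * cmod (f x) - a * cmod (g x))\<^sup>2 / (a * b)"
          using ab by simp
        moreover have "(b * cmod (f x) - a * cmod (g x))\<^sup>2 / (a * b)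
            = (b / a) * (cmod (f x))\<^sup>2 + (a / b) * (cmod (g x))\<^sup>2 - 2 * cmod (f x) * cmod (g x)"
          using ab by (simp add: field_simps power2_eq_square)
        ultimately show ?thesis by (simp add: power2_sum algebra_simps)
      qed
      have "(\<integral>x. (cmod (f x + g x))\<^sup>2 \<partial>lebI)
          \<le> (\<integral>x. (1 + b / a) * (cmod (f x))\<^sup>2 + (1 + a / b) * (cmod (g x))\<^sup>2 \<partial>lebI)"
        using fi gi fgi pt by (intro integral_mono) auto
      also have "\<dots> = (1 + b / a) * a\<^sup>2 + (1 + a / b) * b\<^sup>2"
        using fi gi by (simp add: a2 b2)
      also have "\<dots> = (a + b)\<^sup>2"
        using ab by (simp add: field_simps power2_eq_square)
      finally show ?thesis .
    qed
    then show "sqrt (\<integral>x. (cmod (f x + g x))\<^sup>2 \<partial>lebI)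
        \<le> sqrt (\<integral>x. (cmod (f x))\<^sup>2 \<partial>lebI) + sqrt (\<integral>x. (cmod (g x))\<^sup>2 \<partial>lebI)"
      using ab0 unfolding a_def[symmetric] b_def[symmetric]
      by (intro real_le_lsqrt) auto
  qed
qed

end

section \<open>Sobolev spaces on \<open>(0,1)\<close>\<close>

definition test_fun :: "(real \<Rightarrow> real) \<Rightarrow> bool" where
  "test_fun \<psi> \<longleftrightarrow> (\<forall>n x. (deriv ^^ n) \<psi> differentiable (at x)) \<and>
     (\<exists>a b. 0 < a \<and> b < 1 \<and> (\<forall>x. x \<notin> {a..b} \<longrightarrow> \<psi> x = 0))"

definition has_weak_deriv :: "nat \<Rightarrow> L2I \<Rightarrow> L2I \<Rightarrow> bool" where
  "has_weak_deriv n v w \<longleftrightarrow> (\<forall>\<psi>. test_fun \<psi> \<longrightarrow>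
     (\<integral>x. (deriv ^^ n) \<psi> x *\<^sub>R rep_L2 v x \<partial>lebI) = (-1) ^ n * (\<integral>x. \<psi> x *\<^sub>R rep_L2 w x \<partial>lebI))"

definition wderiv :: "nat \<Rightarrow> L2I \<Rightarrow> L2I" where
  "wderiv n v = (THE w. has_weak_deriv n v w)"

definition sobolev :: "nat \<Rightarrow> L2I set" where
  "sobolev m = {v. \<forall>j\<le>m. \<exists>w. has_weak_deriv j v w}"

definition sobolev_norm :: "nat \<Rightarrow> L2I \<Rightarrow> real" where
  "sobolev_norm m v = sqrt (\<Sum>j\<le>m. (norm (wderiv j v))\<^sup>2)"

text \<open>The value at \<open>p \<in> [0,1]\<close> of the representative that is continuous on the closed interval
  (it exists and is unique for elements of \<open>H\<^sup>1\<close>).\<close>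
definition trace_at :: "L2I \<Rightarrow> real \<Rightarrow> complex" where
  "trace_at v p = (THE c. \<exists>g. continuous_on {0..1} g \<and> (AE x in lebI. rep_L2 v x = g x) \<and> g p = c)"

section \<open>The semigroup\<close>

definition C0_contraction_semigroup :: "(real \<Rightarrow> L2I \<Rightarrow> L2I) \<Rightarrow> bool" where
  "C0_contraction_semigroup S \<longleftrightarrow>
     (\<forall>t\<ge>0. (\<forall>v w. S t (v + w) = S t v + S t w) \<and> (\<forall>c v. S t (scaleC_L2 c v) = scaleC_L2 c (S t v)) \<and>
            (\<forall>v. norm (S t v) \<le> norm v)) \<and>
     (\<forall>v. S 0 v = v) \<and>
     (\<forall>s\<ge>0. \<forall>t\<ge>0. \<forall>v. S (s + t) v = S s (S t v)) \<and>
     (\<forall>v. ((\<lambda>t. S t v) \<longlongrightarrow> v) (at_right 0))"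

definition generated_by :: "(real \<Rightarrow> L2I \<Rightarrow> L2I) \<Rightarrow> L2I set \<Rightarrow> (L2I \<Rightarrow> L2I) \<Rightarrow> bool" where
  "generated_by S D G \<longleftrightarrow>
     (\<forall>v w. ((\<lambda>h. (S h v - v) /\<^sub>R h) \<longlongrightarrow> w) (at_right 0) \<longleftrightarrow> v \<in> D \<and> w = G v)"

definition kawahara_dom :: "real \<Rightarrow> L2I set" where
  "kawahara_dom \<alpha> = {v \<in> sobolev 5.
     trace_at v 0 = 0 \<and> trace_at v 1 = 0 \<and>
     trace_at (wderiv 1 v) 0 = 0 \<and> trace_at (wderiv 1 v) 1 = 0 \<and>
     trace_at (wderiv 2 v) 1 = of_real \<alpha> * trace_at (wderiv 2 v) 0}"

definition kawahara_op :: "L2I \<Rightarrow> L2I" where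
  "kawahara_op v = - wderiv 3 v + wderiv 5 v"

section \<open>Mild solutions\<close>

definition lift_A :: "real \<Rightarrow> real \<Rightarrow> real" where
  "lift_A \<alpha> x = (\<alpha> - 1) / (\<alpha> + 1) * x\<^sup>2 + 2 / (\<alpha> + 1) * x - 1"

definition coeff_a :: "real \<Rightarrow> (real \<Rightarrow> complex) \<Rightarrow> real \<Rightarrow> real \<Rightarrow> complex" where
  "coeff_a \<alpha> \<phi> x t = - of_real (lift_A \<alpha> x) * \<phi> t"

definition coeff_b :: "real \<Rightarrow> (real \<Rightarrow> complex) \<Rightarrow> real \<Rightarrow> real \<Rightarrow> complex" where
  "coeff_b \<alpha> \<phi> x t = - of_real (deriv (lift_A \<alpha>) x) * \<phi> t"

definition force_f :: "real \<Rightarrow> (real \<Rightarrow> complex) \<Rightarrow> real \<Rightarrow> real \<Rightarrow> complex" where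
  "force_f \<alpha> \<phi> x t = of_real (lift_A \<alpha> x) * vector_derivative \<phi> (at t)
     - of_real (lift_A \<alpha> x) * of_real (deriv (lift_A \<alpha>) x) * (\<phi> t)\<^sup>2"

definition nonlin :: "real \<Rightarrow> (real \<Rightarrow> complex) \<Rightarrow> (real \<Rightarrow> L2I) \<Rightarrow> real \<Rightarrow> L2I" where
  "nonlin \<alpha> \<phi> y s = abs_L2 (\<lambda>x.
     - rep_L2 (y s) x * rep_L2 (wderiv 1 (y s)) x
     - coeff_a \<alpha> \<phi> x s * rep_L2 (wderiv 1 (y s)) x
     - coeff_b \<alpha> \<phi> x s * rep_L2 (y s) x
     + force_f \<alpha> \<phi> x s)"

definition shifted :: "real \<Rightarrow> (real \<Rightarrow> complex) \<Rightarrow> (real \<Rightarrow> L2I) \<Rightarrow> real \<Rightarrow> L2I" where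
  "shifted \<alpha> \<phi> u t = u t + abs_L2 (\<lambda>x. of_real (lift_A \<alpha> x) * \<phi> t)"

definition in_X :: "(real \<Rightarrow> L2I) \<Rightarrow> bool" where
  "in_X u \<longleftrightarrow> (\<forall>t. u t \<in> sobolev 2) \<and>
     (\<forall>t. ((\<lambda>s. sobolev_norm 2 (u s - u t)) \<longlongrightarrow> 0) (at t)) \<and>
     bdd_above (range (\<lambda>t. sobolev_norm 2 (u t)))"

definition norm_X :: "(real \<Rightarrow> L2I) \<Rightarrow> real" where
  "norm_X u = (SUP t. sobolev_norm 2 (u t))"

text \<open>For \<open>u\<close> in \<open>X\<close> and \<open>\<phi>\<close> of class \<open>C\<^sup>1\<close> the integrand is continuous in \<open>L\<^sup>2(0,1)\<close>, so that
  the gauge integral of an \<open>L\<^sup>2\<close>-valued function used here is the usual (Bochner or Riemann) one.\<close>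
definition mild_solution ::
  "(real \<Rightarrow> L2I \<Rightarrow> L2I) \<Rightarrow> real \<Rightarrow> (real \<Rightarrow> complex) \<Rightarrow> (real \<Rightarrow> L2I) \<Rightarrow> bool" where
  "mild_solution S \<alpha> \<phi> u \<longleftrightarrow> in_X u \<and>
     (let y = shifted \<alpha> \<phi> u in
       \<forall>r t. r \<le> t \<longrightarrow>
         ((\<lambda>s. S (t - s) (nonlin \<alpha> \<phi> y s)) has_integral (y t - S (t - r) (y r))) {r..t})"

text \<open>Extended-valued, so that \<open>C1_norm \<phi> \<le> \<epsilon>\<close> includes boundedness of \<open>\<phi>\<close> and \<open>\<phi>'\<close>.\<close>
definition C1_norm :: "(real \<Rightarrow> complex) \<Rightarrow> ennreal" where
  "C1_norm \<phi> = (SUP t. ennreal (cmod (\<phi> t))) + (SUP t. ennreal (cmod (vector_derivative \<phi> (at t))))"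

section \<open>Quasi-periodicity\<close>

text \<open>Vectors of \<open>\<real>\<^sup>k\<close> are the points of \<^const>\<open>Euclidean_space\<close> \<open>k\<close>: functions on \<open>nat\<close> (indexed from \<open>0\<close>)
  that vanish from index \<open>k\<close> on.\<close>
definition frequency_vector :: "nat \<Rightarrow> (nat \<Rightarrow> real) \<Rightarrow> bool" where
  "frequency_vector k \<omega> \<longleftrightarrow> 1 \<le> k \<and> \<omega> \<in> topspace (Euclidean_space k) \<and>
     (\<forall>m :: nat \<Rightarrow> rat. (\<Sum>i<k. of_rat (m i) * \<omega> i) = 0 \<longrightarrow> (\<forall>i<k. m i = 0))"

definition quasi_periodic_wrt :: "nat \<Rightarrow> (nat \<Rightarrow> real) \<Rightarrow> (real \<Rightarrow> real) \<Rightarrow> bool" where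
  "quasi_periodic_wrt k \<omega> \<phi> \<longleftrightarrow> (\<exists>\<Phi>. continuous_map (Euclidean_space k) euclideanreal \<Phi> \<and>
     (\<forall>v\<in>topspace (Euclidean_space k). \<forall>i<k. \<Phi> (v(i := v i + 2 * pi)) = \<Phi> v) \<and>
     (\<forall>t. \<phi> t = \<Phi> (\<lambda>i. t * \<omega> i)))"

definition unif_quasi_periodic_wrt :: "nat \<Rightarrow> (nat \<Rightarrow> real) \<Rightarrow> (real \<Rightarrow> real \<Rightarrow> real) \<Rightarrow> bool" where
  "unif_quasi_periodic_wrt k \<omega> g \<longleftrightarrow>
     continuous_on ({0<..<1} \<times> UNIV) (\<lambda>(x, t). g x t) \<and>
     (\<exists>F. continuous_map (prod_topology (top_of_set {0<..<1}) (Euclidean_space k)) euclideanreal (\<lambda>(x, v). F x v) \<and>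
       (\<forall>x\<in>{0<..<1}. \<forall>v\<in>topspace (Euclidean_space k). \<forall>i<k. F x (v(i := v i + 2 * pi)) = F x v) \<and>
       (\<forall>x\<in>{0<..<1}. \<forall>t. g x t = F x (\<lambda>i. t * \<omega> i)))"

text \<open>The notions are defined for real-valued functions; a complex-valued function has the property
  if it is (the complexification of) a real-valued function that has it. A function into \<open>H\<^sup>2(0,1)\<close>
  is identified with the function of \<open>(x,t)\<close> given by the continuous representatives.\<close>
definition qp_data :: "nat \<Rightarrow> (nat \<Rightarrow> real) \<Rightarrow> (real \<Rightarrow> complex) \<Rightarrow> bool" where
  "qp_data k \<omega> \<phi> \<longleftrightarrow> (\<exists>\<phi>\<^sub>0. \<phi> = (\<lambda>t. of_real (\<phi>\<^sub>0 t)) \<and> quasi_periodic_wrt k \<omega> \<phi>\<^sub>0)"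

definition qp_solution :: "nat \<Rightarrow> (nat \<Rightarrow> real) \<Rightarrow> (real \<Rightarrow> L2I) \<Rightarrow> bool" where
  "qp_solution k \<omega> u \<longleftrightarrow> (\<exists>g. (\<forall>t. AE x in lebI. rep_L2 (u t) x = of_real (g x t)) \<and>
     unif_quasi_periodic_wrt k \<omega> g)"

end

theory Submission
  imports Defs
begin

text \<open>
Put \<open>A(x)\<close> for the lifting polynomial and \<open>y = u + A \<phi>\<close>. The boundary conditions become homogeneous and
\<open>y\<close> satisfies, in the mild sense on the whole line,
\<open>y' = - y\<^sub>x\<^sub>x\<^sub>x + y\<^sub>x\<^sub>x\<^sub>x\<^sub>x\<^sub>x + N(\<phi>, y) + \<phi>' A\<close>, where \<open>N\<close> is locally Lipschitz from \<open>H\<^sup>2\<close> to \<open>L\<^sup>2\<close>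
and quadratically small (\<open>rhs_lipschitz\<close>). Everything rests on two properties of the linear semigroup,
both drawn from one weighted energy inequality (\<open>dissipation\<close>): pairing the generator with
\<open>(x + \<kappa>) v\<close> gains \<open>\<parallel>v\<^sub>x\<^sub>x\<parallel>\<^sup>2\<close>, and the boundary term has the right sign for \<open>\<kappa> = 1 / (1 - \<alpha>\<^sup>2)\<close>
because \<open>\<bar>\<alpha>\<bar> < 1\<close>.

\<^item> Exponential decay (\<open>S_decay\<close>), since \<open>\<parallel>v\<parallel> \<le> \<parallel>v\<^sub>x\<parallel> \<le> \<parallel>v\<^sub>x\<^sub>x\<parallel>\<close> under the boundary conditions.

\<^item> Smoothing (\<open>S_in_H2\<close>): \<open>\<parallel>S(t) v\<parallel>\<close> in \<open>H\<^sup>2\<close> is at most \<open>M t\<^sup>-\<^sup>1\<^sup>/\<^sup>2 \<parallel>v\<parallel>\<close> in \<open>L\<^sup>2\<close>. The argument is Nash's: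
with \<open>z = G S(t) v\<close>, an interpolation inequality (\<open>nash_inequality\<close>) bounds the dissipation of \<open>z\<close> from below by
a power \<open>7/5\<close> of its energy, and the resulting differential inequality yields
\<open>\<parallel>z\<parallel>\<^sup>2 \<le> K \<parallel>v\<parallel>\<^sup>2 t\<^sup>-\<^sup>5\<^sup>/\<^sup>2\<close>; interpolating between \<open>v\<close> and \<open>G v\<close> gives the bound in \<open>H\<^sup>2\<close>.

The singularity \<open>t\<^sup>-\<^sup>1\<^sup>/\<^sup>2\<close> is integrable. So a bounded continuous source in \<open>L\<^sup>2\<close> has a bounded response, which is
continuous with values in \<open>H\<^sup>2\<close> and bounded there by a constant times the source (\<open>mild_exists\<close>, \<open>mild_H2_le\<close>,
\<open>mild_continuous_H2\<close>). For small data the contraction principle gives the solution (\<open>solution_exists\<close>) and a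
difference estimate gives uniqueness (\<open>solution_unique\<close>).

Quasi-periodicity is reformulated without the torus: a function is called recurrent for \<open>\<omega>\<close> if its translates by
\<open>h\<close> are uniformly close to it as soon as all \<open>h \<omega>\<^sub>i\<close> are close to multiples of \<open>2 \<pi>\<close>. Quasi-periodic functions are
recurrent by uniform continuity on the torus; conversely a recurrent function extends from a dense orbit to the
torus, by Kronecker's theorem (\<open>recurrent_extension\<close>). It remains to see that the solution inherits recurrence
from \<open>\<phi>\<close>. The obstacle is the source \<open>\<phi>' A\<close>: the derivative of a quasi-periodic function of class \<open>C\<^sup>1\<close> may fail
to be quasi-periodic even if it is bounded. The response to \<open>(\<phi>(t + h) - \<phi>(t))' A\<close> is small nevertheless,
because after replacing \<open>A\<close> by an element of the domain of the generator the time derivative can be integrated by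
parts (\<open>oscillation_small\<close>). Finally the solution is real because its complex conjugate solves the same problem.
\<close>

section \<open>Smooth bump functions and the fundamental lemma\<close>

text \<open>For \<open>i = j = 0\<close> this is the usual bump on \<open>(a, b)\<close>, with a sharpness parameter \<open>c\<close>: as \<open>c\<close> tends to \<open>0\<close>
  it tends to the indicator function. The factors with \<open>i\<close> and \<open>j\<close> are the ones that differentiation creates.\<close>

definition bump_quot :: "real \<Rightarrow> real \<Rightarrow> real \<Rightarrow> nat \<Rightarrow> nat \<Rightarrow> real \<Rightarrow> real" where
  "bump_quot c a b i j x =
     (if a < x \<and> x < b then exp (- c / (x - a)) / (x - a) ^ i * (exp (- c / (b - x)) / (b - x) ^ j) else 0)"

text \<open>A single term of the exponential series of \<open>c / y\<close> suffices.\<close>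

lemma exp_minus_inverse_bound:
  fixes c y :: real
  assumes "c > 0" "y > 0"
  shows "exp (- c / y) / y ^ n \<le> fact (n + m) / c ^ (n + m) * y ^ m"
proof -
  have "(c / y) ^ (n + m) / fact (n + m) \<le> exp (c / y)"
  proof -
    have "(\<Sum>k\<in>{n + m}. inverse (fact k) * (c / y) ^ k) \<le> (\<Sum>k. inverse (fact k) * (c / y) ^ k)"
      using assms summable_exp[of "c / y"] by (intro sum_le_suminf) auto
    then show ?thesis
      by (simp add: exp_def divide_inverse mult.commute)
  qed
  then have "exp (- c / y) \<le> inverse ((c / y) ^ (n + m) / fact (n + m))"
    using assms le_imp_inverse_le[of "(c / y) ^ (n + m) / fact (n + m)" "exp (c / y)"]
    by (simp add: exp_minus)
  then have "exp (- c / y) / y ^ n \<le> inverse ((c / y) ^ (n + m) / fact (n + m)) / y ^ n"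
    using assms by (intro divide_right_mono) auto
  also have "\<dots> = fact (n + m) / c ^ (n + m) * y ^ m"
    using assms by (simp add: field_simps power_add)
  finally show ?thesis .
qed

lemma has_derivative_zero_of_quadratic_bound:
  fixes f :: "real \<Rightarrow> real"
  assumes "\<And>x. \<bar>f x\<bar> \<le> C * (x - a)\<^sup>2"
  shows "(f has_real_derivative 0) (at a)"
proof -
  have "f a = 0" using assms[of a] by simp
  have "((\<lambda>x. C * \<bar>x - a\<bar>) \<longlongrightarrow> C * \<bar>a - a\<bar>) (at a)"
    by (intro tendsto_intros)
  then have lim: "((\<lambda>x. C * \<bar>x - a\<bar>) \<longlongrightarrow> 0) (at a)" by simp
  have "norm ((f x - f a) / (x - a)) \<le> C * \<bar>x - a\<bar>" if "x \<noteq> a" for x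
  proof -
    have "norm ((f x - f a) / (x - a)) = \<bar>f x\<bar> / \<bar>x - a\<bar>"
      using \<open>f a = 0\<close> by (simp add: abs_divide)
    also have "\<dots> \<le> C * (x - a)\<^sup>2 / \<bar>x - a\<bar>"
      using assms by (intro divide_right_mono) auto
    also have "\<dots> = C * \<bar>x - a\<bar>"
      using that by (simp add: power2_eq_square field_simps abs_if)
    finally show ?thesis .
  qed
  then have "((\<lambda>x. (f x - f a) / (x - a)) \<longlongrightarrow> 0) (at a)"
    by (intro Lim_null_comparison[OF _ lim]) (auto simp: eventually_at_filter)
  then show ?thesis by (simp add: has_field_derivative_iff)
qed

lemma bump_quot_le:
  assumes "c > 0" "a < b"
  shows "\<exists>C. \<forall>x. \<bar>bump_quot c a b i j x\<bar> \<le> C * (x - a)\<^sup>2"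
    and "\<exists>C. \<forall>x. \<bar>bump_quot c a b i j x\<bar> \<le> C * (x - b)\<^sup>2"
proof -
  define C where "C = (\<lambda>i m. fact (i + m) / c ^ (i + m))"
  have C: "C i m \<ge> 0" for i m using assms by (simp add: C_def)
  have e: "exp (- c / y) / y ^ i \<le> C i m * y ^ m" if "y > 0" for y i m
    unfolding C_def by (rule exp_minus_inverse_bound) (use assms that in auto)
  have "\<bar>bump_quot c a b i j x\<bar> \<le> (C i 2 * C j 0) * (x - a)\<^sup>2" for x
  proof (cases "a < x \<and> x < b")
    case True
    then have "\<bar>bump_quot c a b i j x\<bar> = exp (- c / (x - a)) / (x - a) ^ i * (exp (- c / (b - x)) / (b - x) ^ j)"
      by (auto simp: bump_quot_def)
    also have "\<dots> \<le> (C i 2 * (x - a)\<^sup>2) * (C j 0 * (b - x) ^ 0)"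
      using True by (intro mult_mono e) (auto intro!: C mult_nonneg_nonneg)
    finally show ?thesis by (simp add: mult_ac)
  qed (use C in \<open>auto simp: bump_quot_def\<close>)
  then show "\<exists>C. \<forall>x. \<bar>bump_quot c a b i j x\<bar> \<le> C * (x - a)\<^sup>2" by blast
  have "\<bar>bump_quot c a b i j x\<bar> \<le> (C i 0 * C j 2) * (x - b)\<^sup>2" for x
  proof (cases "a < x \<and> x < b")
    case True
    then have "\<bar>bump_quot c a b i j x\<bar> = exp (- c / (x - a)) / (x - a) ^ i * (exp (- c / (b - x)) / (b - x) ^ j)"
      by (auto simp: bump_quot_def)
    also have "\<dots> \<le> (C i 0 * (x - a) ^ 0) * (C j 2 * (b - x)\<^sup>2)"
      using True by (intro mult_mono e) (auto intro!: C mult_nonneg_nonneg)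
    finally show ?thesis by (simp add: mult_ac power2_commute)
  qed (use C in \<open>auto simp: bump_quot_def\<close>)
  then show "\<exists>C. \<forall>x. \<bar>bump_quot c a b i j x\<bar> \<le> C * (x - b)\<^sup>2" by blast
qed

lemma exp_quot_deriv:
  fixes c y :: real
  assumes "y > 0"
  shows "((\<lambda>y. exp (- c / y) / y ^ n) has_real_derivative
    (c * (exp (- c / y) / y ^ (n + 2)) - real n * (exp (- c / y) / y ^ (n + 1)))) (at y)"
proof -
  have E: "((\<lambda>y. exp (- c / y)) has_real_derivative exp (- c / y) * (c / y\<^sup>2)) (at y)"
    using assms by (auto intro!: derivative_eq_intros simp: power2_eq_square)
  have Y: "((\<lambda>y. y ^ n) has_real_derivative real n * y ^ (n - 1)) (at y)"
    by (auto intro!: derivative_eq_intros)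
  have "y ^ n \<noteq> 0" using assms by simp
  from DERIV_divide[OF E Y this] show ?thesis
  proof (rule DERIV_cong)
    define e where "e = exp (- c / y)"
    define w where "w = y ^ n"
    have w: "w \<noteq> 0" using assms by (simp add: w_def)
    have n1: "real n * y ^ (n - 1) = real n * w / y"
      using assms by (cases n) (simp_all add: w_def)
    have "(e * (c / y\<^sup>2) * w - e * (real n * w / y)) / (w * w)
        = c * (e / (w * y\<^sup>2)) - real n * (e / (w * y))"
      using assms w by (simp add: field_simps power2_eq_square)
    then show "(exp (- c / y) * (c / y\<^sup>2) * y ^ n - exp (- c / y) * (real n * y ^ (n - 1))) / (y ^ n * y ^ n)
       = c * (exp (- c / y) / y ^ (n + 2)) - real n * (exp (- c / y) / y ^ (n + 1))"
      unfolding n1 by (simp add: e_def w_def power_add power2_eq_square mult.commute)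
  qed
qed

text \<open>Inside the interval this is the product rule; at the end points the quadratic bounds give the derivative \<open>0\<close>.\<close>

lemma bump_quot_deriv:
  assumes "c > 0" "a < b"
  shows "(bump_quot c a b i j has_real_derivative
    (c * bump_quot c a b (i + 2) j x - c * bump_quot c a b i (j + 2) x
     - real i * bump_quot c a b (i + 1) j x + real j * bump_quot c a b i (j + 1) x)) (at x)"
proof -
  consider "x < a \<or> b < x" | "x = a" | "x = b" | "a < x" "x < b" by linarith
  then show ?thesis
  proof cases
    case 1
    then have "open (- {a..b})" "x \<in> - {a..b}" by auto
    moreover have "bump_quot c a b i j y = 0" if "y \<in> - {a..b}" for y
      using that by (auto simp: bump_quot_def)
    ultimately have "(bump_quot c a b i j has_real_derivative 0) (at x)"
      by (subst DERIV_cong_ev[OF refl _ refl, of _ "\<lambda>_. 0"])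
         (auto simp: eventually_nhds intro!: exI[of _ "- {a..b}"])
    then show ?thesis using 1 by (auto simp: bump_quot_def)
  next
    case 2
    obtain C where "\<And>x. \<bar>bump_quot c a b i j x\<bar> \<le> C * (x - a)\<^sup>2"
      using bump_quot_le(1)[OF assms] by blast
    from has_derivative_zero_of_quadratic_bound[OF this]
    have "(bump_quot c a b i j has_real_derivative 0) (at x)" using 2 by simp
    moreover have "bump_quot c a b i' j' x = 0" for i' j' using 2 by (simp add: bump_quot_def)
    ultimately show ?thesis by simp
  next
    case 3
    obtain C where "\<And>x. \<bar>bump_quot c a b i j x\<bar> \<le> C * (x - b)\<^sup>2"
      using bump_quot_le(2)[OF assms] by blast
    from has_derivative_zero_of_quadratic_bound[OF this]
    have "(bump_quot c a b i j has_real_derivative 0) (at x)" using 3 by simp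
    moreover have "bump_quot c a b i' j' x = 0" for i' j' using 3 by (simp add: bump_quot_def)
    ultimately show ?thesis by simp
  next
    case 4
    define P where "P i x = exp (- c / (x - a)) / (x - a) ^ i" for i x
    define Q where "Q j x = exp (- c / (b - x)) / (b - x) ^ j" for j x
    have PQ: "bump_quot c a b i j x = P i x * Q j x" for i j
      using 4 by (simp add: bump_quot_def P_def Q_def)
    have A: "(P i has_real_derivative (c * P (i + 2) x - real i * P (i + 1) x)) (at x)"
    proof -
      have "((\<lambda>x. x - a) has_real_derivative 1) (at x)"
        by (auto intro!: derivative_eq_intros)
      from DERIV_chain2[where g = "\<lambda>x. x - a" and f = "\<lambda>y. exp (- c / y) / y ^ i", OF exp_quot_deriv this] 4
      show ?thesis by (simp add: P_def[abs_def])
    qed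
    have "((\<lambda>x. b - x) has_real_derivative -1) (at x)"
      by (auto intro!: derivative_eq_intros)
    from DERIV_chain2[where g = "\<lambda>x. b - x" and f = "\<lambda>y. exp (- c / y) / y ^ j", OF exp_quot_deriv this] 4
    have B: "(Q j has_real_derivative (- (c * Q (j + 2) x) + real j * Q (j + 1) x)) (at x)"
      by (simp add: Q_def[abs_def])
    have "((\<lambda>x. P i x * Q j x) has_real_derivative
      (c * bump_quot c a b (i + 2) j x - c * bump_quot c a b i (j + 2) x
     - real i * bump_quot c a b (i + 1) j x + real j * bump_quot c a b i (j + 1) x)) (at x)"
      by (rule DERIV_cong[OF DERIV_mult[OF A B]]) (simp add: PQ algebra_simps)
    moreover have "eventually (\<lambda>y. bump_quot c a b i j y = P i y * Q j y) (nhds x)"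
      unfolding eventually_nhds
      by (rule exI[of _ "{a<..<b}"]) (use 4 in \<open>auto simp: bump_quot_def P_def Q_def\<close>)
    ultimately show ?thesis
      by (subst DERIV_cong_ev[OF refl _ refl]) auto
  qed
qed

text \<open>The linear span of the quotients is closed under differentiation, which makes its members smooth.\<close>

inductive bump_span :: "real \<Rightarrow> real \<Rightarrow> real \<Rightarrow> (real \<Rightarrow> real) \<Rightarrow> bool" for c a b where
  quot: "bump_span c a b (bump_quot c a b i j)"
| add: "bump_span c a b f \<Longrightarrow> bump_span c a b g \<Longrightarrow> bump_span c a b (\<lambda>x. f x + g x)"
| scale: "bump_span c a b f \<Longrightarrow> bump_span c a b (\<lambda>x. r * f x)"

lemma bump_span_deriv:
  assumes "bump_span c a b f" "c > 0" "a < b"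
  shows "(\<forall>x. f differentiable (at x)) \<and> bump_span c a b (deriv f)"
proof -
  have "\<exists>f'. bump_span c a b f' \<and> (\<forall>x. (f has_real_derivative f' x) (at x))"
    using assms(1)
  proof induction
    case (quot i j)
    let ?f' = "\<lambda>x. (c * bump_quot c a b (i + 2) j x + (- c) * bump_quot c a b i (j + 2) x)
     + ((- real i) * bump_quot c a b (i + 1) j x + real j * bump_quot c a b i (j + 1) x)"
    have "bump_span c a b ?f'"
      by (intro bump_span.intros)
    moreover have "(bump_quot c a b i j has_real_derivative ?f' x) (at x)" for x
      using bump_quot_deriv[OF assms(2,3), of i j x] by (simp add: algebra_simps)
    ultimately show ?case by blast
  next
    case (add f g)
    then obtain f' g' where "bump_span c a b f'" "\<And>x. (f has_real_derivative f' x) (at x)"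
      "bump_span c a b g'" "\<And>x. (g has_real_derivative g' x) (at x)" by blast
    then show ?case
      by (intro exI[of _ "\<lambda>x. f' x + g' x"]) (auto intro: bump_span.intros DERIV_add)
  next
    case (scale f r)
    then obtain f' where "bump_span c a b f'" "\<And>x. (f has_real_derivative f' x) (at x)" by blast
    then show ?case
      by (intro exI[of _ "\<lambda>x. r * f' x"]) (auto intro: bump_span.intros DERIV_cmult)
  qed
  then obtain f' where f': "bump_span c a b f'" "\<And>x. (f has_real_derivative f' x) (at x)" by blast
  then have "deriv f = f'" by (auto intro: DERIV_imp_deriv)
  with f' show ?thesis by (auto simp: real_differentiable_def)
qed

lemma test_fun_bump:
  assumes "c > 0" "0 < a" "a < b" "b < 1"
  shows "test_fun (bump_quot c a b 0 0)"
proof -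
  have sp: "bump_span c a b ((deriv ^^ n) (bump_quot c a b 0 0))" for n
    by (induction n) (use bump_span_deriv assms bump_span.quot in auto)
  have "\<forall>x. x \<notin> {a..b} \<longrightarrow> bump_quot c a b 0 0 x = 0"
    by (auto simp: bump_quot_def)
  then have "\<exists>a' b'. 0 < a' \<and> b' < 1 \<and> (\<forall>x. x \<notin> {a'..b'} \<longrightarrow> bump_quot c a b 0 0 x = 0)"
    using assms by (intro exI[of _ a] exI[of _ b]) simp
  moreover have "\<forall>n x. (deriv ^^ n) (bump_quot c a b 0 0) differentiable (at x)"
    using bump_span_deriv[OF sp assms(1,3)] by simp
  ultimately show ?thesis by (simp add: test_fun_def)
qed

lemma bump_quot_le_1:
  assumes "c > 0" shows "\<bar>bump_quot c a b 0 0 x\<bar> \<le> 1"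
  using assms by (auto simp: bump_quot_def intro!: mult_le_one)

lemma deriv_funpow_swap: "(deriv ^^ n) (deriv \<psi>) = (deriv ^^ Suc n) (\<psi> :: real \<Rightarrow> real)"
  by (simp add: funpow_swap1)

lemma test_fun_has_derivative: "test_fun \<psi> \<Longrightarrow> (\<psi> has_real_derivative deriv \<psi> x) (at x)"
  unfolding test_fun_def using DERIV_deriv_iff_real_differentiable
  by (metis funpow_0)

lemma test_fun_deriv:
  assumes "test_fun \<psi>" shows "test_fun (deriv \<psi>)"
proof -
  from assms obtain a b where ab: "0 < a" "b < 1" "\<And>x. x \<notin> {a..b} \<Longrightarrow> \<psi> x = 0"
    unfolding test_fun_def by blast
  have "deriv \<psi> x = 0" if "x \<notin> {a..b}" for x
  proof -
    have "(\<psi> has_real_derivative 0) (at x)"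
      by (subst DERIV_cong_ev[OF refl _ refl, of _ "\<lambda>_. 0"])
         (use that ab in \<open>auto simp: eventually_nhds intro!: exI[of _ "- {a..b}"]\<close>)
    then show ?thesis by (rule DERIV_imp_deriv)
  qed
  moreover have "(deriv ^^ n) (deriv \<psi>) differentiable (at x)" for n x
    using assms unfolding test_fun_def deriv_funpow_swap by blast
  ultimately show ?thesis
    unfolding test_fun_def using ab by blast
qed

lemma test_fun_funpow: "test_fun \<psi> \<Longrightarrow> test_fun ((deriv ^^ n) \<psi>)"
  by (induction n) (auto intro: test_fun_deriv)

lemma test_fun_continuous: "test_fun \<psi> \<Longrightarrow> continuous_on A \<psi>"
  by (meson DERIV_isCont continuous_at_imp_continuous_on test_fun_has_derivative)

lemma test_fun_measurable: "test_fun \<psi> \<Longrightarrow> \<psi> \<in> borel_measurable lebI"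
  using test_fun_continuous[of \<psi> UNIV]
  by (intro measurable_restrict_space1 measurable_completion) (auto intro: borel_measurable_continuous_onI)

lemma test_fun_zero_outside: "test_fun \<psi> \<Longrightarrow> x \<le> 0 \<or> 1 \<le> x \<Longrightarrow> \<psi> x = 0"
  unfolding test_fun_def by force

lemma test_fun_bounded:
  assumes "test_fun \<psi>" obtains B where "\<And>x. \<bar>\<psi> x\<bar> \<le> B" "B \<ge> 0"
proof -
  have "compact (\<psi> ` {0..1})"
    using test_fun_continuous[OF assms] by (intro compact_continuous_image) auto
  then obtain B where B: "\<And>x. x \<in> {0..1} \<Longrightarrow> \<bar>\<psi> x\<bar> \<le> B"
    using compact_imp_bounded[of "\<psi> ` {0..1}"] unfolding bounded_iff by (metis image_eqI real_norm_def)
  have "B \<ge> 0" using B[of 0] by auto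
  moreover have "\<bar>\<psi> x\<bar> \<le> B" for x
    using B[of x] test_fun_zero_outside[OF assms, of x] \<open>B \<ge> 0\<close> by (cases "x \<in> {0..1}") auto
  ultimately show ?thesis using that by blast
qed

lemma finite_measure_lebI: "finite_measure lebI"
  by (rule finite_measure_lebesgue_on) simp

interpretation lebI: finite_measure lebI
  by (rule finite_measure_lebI)

lemma integrable_test_mult:
  fixes f :: "real \<Rightarrow> 'a::{banach, second_countable_topology}"
  assumes "test_fun \<psi>" "integrable lebI f"
  shows "integrable lebI (\<lambda>x. \<psi> x *\<^sub>R f x)"
proof -
  obtain B where B: "\<And>x. \<bar>\<psi> x\<bar> \<le> B" "B \<ge> 0" using test_fun_bounded[OF assms(1)] by blast
  have [measurable]: "f \<in> borel_measurable lebI" using assms by auto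
  have [measurable]: "\<psi> \<in> borel_measurable lebI" using assms test_fun_measurable by auto
  show ?thesis
    by (rule Bochner_Integration.integrable_bound[of _ "\<lambda>x. B * norm (f x)"])
       (use assms B in \<open>auto intro!: mult_right_mono AE_I2 simp: abs_of_nonneg\<close>)
qed

lemma borel_measurable_lebI_of_borel:
  "f \<in> borel_measurable borel \<Longrightarrow> f \<in> borel_measurable lebI"
  by (intro measurable_restrict_space1 measurable_completion) auto

text \<open>Bumps on slightly smaller intervals, with sharpness tending to \<open>0\<close>, converge boundedly to the indicator function.\<close>

lemma integral_interval_zero_of_test:
  fixes f :: "real \<Rightarrow> real"
  assumes f: "integrable lebI f"
    and test: "\<And>\<psi>. test_fun \<psi> \<Longrightarrow> (\<integral>x. \<psi> x * f x \<partial>lebI) = 0"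
    and ab: "0 \<le> a" "a < b" "b \<le> 1"
  shows "(\<integral>x. indicator {a<..<b} x * f x \<partial>lebI) = 0"
proof -
  have [measurable]: "f \<in> borel_measurable lebI" using f by auto
  obtain N :: nat where N: "2 / real (Suc N) < b - a"
    using reals_Archimedean[of "(b - a) / 2"] ab by (auto simp: field_simps)
  define e where "e n = 1 / real (Suc (n + N))" for n
  have e: "e n > 0" "a + e n < b - e n" for n
  proof -
    show "e n > 0" by (simp add: e_def)
    have "e n \<le> 1 / real (Suc N)" unfolding e_def by (intro divide_left_mono) auto
    then show "a + e n < b - e n" using N by simp
  qed
  define \<psi> where "\<psi> n = bump_quot (e n) (a + e n) (b - e n) 0 0" for n
  have \<psi>: "test_fun (\<psi> n)" for n
    unfolding \<psi>_def using e[of n] ab by (intro test_fun_bump) auto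
  have e0: "e \<longlonglongrightarrow> 0"
    unfolding e_def using LIMSEQ_ignore_initial_segment[OF LIMSEQ_inverse_real_of_nat, of N]
    by (simp add: divide_inverse)
  have lim: "(\<lambda>n. \<psi> n x) \<longlonglongrightarrow> indicator {a<..<b} x" for x
  proof (cases "a < x \<and> x < b")
    case True
    have "(\<lambda>n. a + e n) \<longlonglongrightarrow> a + 0" "(\<lambda>n. b - e n) \<longlonglongrightarrow> b - 0" by (intro tendsto_intros e0)+
    then have "eventually (\<lambda>n. a + e n < x) sequentially" "eventually (\<lambda>n. x < b - e n) sequentially"
      using True by (auto dest: order_tendstoD)
    then have ev: "eventually (\<lambda>n. exp (- e n / (x - (a + e n))) * exp (- e n / ((b - e n) - x)) = \<psi> n x) sequentially"
      by eventually_elim (auto simp: \<psi>_def bump_quot_def)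
    have "(\<lambda>n. exp (- e n / (x - (a + e n))) * exp (- e n / ((b - e n) - x)))
       \<longlonglongrightarrow> exp (- 0 / (x - (a + 0))) * exp (- 0 / ((b - 0) - x))"
      using True by (intro tendsto_intros e0) auto
    then have "(\<lambda>n. \<psi> n x) \<longlonglongrightarrow> exp (- 0 / (x - (a + 0))) * exp (- 0 / ((b - 0) - x))"
      using ev by (rule Lim_transform_eventually)
    then show ?thesis using True by simp
  next
    case False
    then have "\<psi> n x = 0" for n
      using e(1)[of n] by (auto simp: \<psi>_def bump_quot_def)
    then show ?thesis using False by (auto simp: indicator_def)
  qed
  have "(\<lambda>n. \<integral>x. \<psi> n x * f x \<partial>lebI) \<longlonglongrightarrow> (\<integral>x. indicator {a<..<b} x * f x \<partial>lebI)"
  proof (rule integral_dominated_convergence[where w = "\<lambda>x. norm (f x)"])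
    show "integrable lebI (\<lambda>x. norm (f x))" using f by simp
    show "(\<lambda>x. indicator {a<..<b} x * f x) \<in> borel_measurable lebI"
      using borel_measurable_lebI_of_borel[of "indicator {a<..<b} :: real \<Rightarrow> real"]
      by (intro borel_measurable_times) auto
    show "(\<lambda>x. \<psi> n x * f x) \<in> borel_measurable lebI" for n
      using test_fun_measurable[OF \<psi>[of n]] by (intro borel_measurable_times) auto
    show "AE x in lebI. (\<lambda>n. \<psi> n x * f x) \<longlonglongrightarrow> indicator {a<..<b} x * f x"
      by (intro AE_I2 tendsto_mult lim tendsto_const)
    show "AE x in lebI. norm (\<psi> n x * f x) \<le> norm (f x)" for n
      using bump_quot_le_1[OF e(1), of n] by (auto simp: \<psi>_def abs_mult intro!: mult_left_le_one_le AE_I2)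
  qed
  then show ?thesis
    using test[OF \<psi>] by (simp add: LIMSEQ_const_iff)
qed

lemma integral_borel_zero_of_test:
  fixes f :: "real \<Rightarrow> real"
  assumes f: "integrable lebI f"
    and test: "\<And>\<psi>. test_fun \<psi> \<Longrightarrow> (\<integral>x. \<psi> x * f x \<partial>lebI) = 0"
    and A: "A \<in> sets borel"
  shows "(\<integral>x. indicator A x * f x \<partial>lebI) = 0"
proof -
  have [measurable]: "f \<in> borel_measurable lebI" using f by auto
  have ind[measurable]: "(indicator A :: real \<Rightarrow> real) \<in> borel_measurable lebI" if "A \<in> sets borel" for A
    using that by (intro borel_measurable_lebI_of_borel) auto
  have int: "integrable lebI (\<lambda>x. indicator A x * f x)" if "A \<in> sets borel" for A
  proof (rule Bochner_Integration.integrable_bound[OF f])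
    show "(\<lambda>x. indicator A x * f x) \<in> borel_measurable lebI"
      using ind[OF that] by (intro borel_measurable_times) auto
  qed (auto simp: indicator_def)
  have total: "(\<integral>x. f x \<partial>lebI) = 0"
  proof -
    have "(\<integral>x. f x \<partial>lebI) = (\<integral>x. indicator {0<..<1} x * f x \<partial>lebI)"
      by (intro Bochner_Integration.integral_cong) auto
    also have "\<dots> = 0" by (rule integral_interval_zero_of_test[OF f test]) auto
    finally show ?thesis .
  qed
  show ?thesis using A
  proof (induction rule: borel_set_induct)
    case empty
    then show ?case by simp
  next
    case (interval a b)
    have "{a, b} \<in> null_sets lebesgue"
      by (intro null_sets_completionI finite_imp_null_set_lborel) auto
    then have "AE x in lebesgue. x \<notin> {a, b}" by (rule AE_not_in)
    then have "AE x in lebI. x \<notin> {a, b}"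
      by (subst AE_restrict_space_iff) (auto elim: eventually_mono)
    moreover have "AE x in lebI. 0 < x \<and> x < 1" by (rule AE_I2) simp
    ultimately have AE: "AE x in lebI. indicator {a..b} x * f x = indicator {max a 0<..<min b 1} x * f x"
      by eventually_elim (auto simp: indicator_def)
    have "(\<integral>x. indicator {a..b} x * f x \<partial>lebI) = (\<integral>x. indicator {max a 0<..<min b 1} x * f x \<partial>lebI)"
      by (intro integral_cong_AE AE borel_measurable_integrable int) auto
    also have "\<dots> = 0"
    proof (cases "max a 0 < min b 1")
      case True
      then show ?thesis by (intro integral_interval_zero_of_test[OF f test]) auto
    next
      case False
      then have "{max a 0<..<min b 1} = {}" by (intro greaterThanLessThan_empty) linarith
      show ?thesis unfolding \<open>{max a 0<..<min b 1} = {}\<close> by simp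
    qed
    finally show ?case .
  next
    case (compl A)
    have "(\<integral>x. indicator (- A) x * f x \<partial>lebI) = (\<integral>x. f x - indicator A x * f x \<partial>lebI)"
      by (intro Bochner_Integration.integral_cong) (auto simp: indicator_def)
    also have "\<dots> = 0" using compl f int total by simp
    finally show ?case .
  next
    case (union A)
    have "(\<lambda>n. \<integral>x. indicator (\<Union>i<n. A i) x * f x \<partial>lebI) \<longlonglongrightarrow> (\<integral>x. indicator (\<Union>(range A)) x * f x \<partial>lebI)"
    proof (rule integral_dominated_convergence[where w = "\<lambda>x. norm (f x)"])
      show "integrable lebI (\<lambda>x. norm (f x))" using f by simp
      show "(\<lambda>x. indicator (\<Union>(range A)) x * f x) \<in> borel_measurable lebI"
        using union by (intro borel_measurable_times ind) auto
      show "(\<lambda>x. indicator (\<Union>i<n. A i) x * f x) \<in> borel_measurable lebI" for n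
        using union by (intro borel_measurable_times ind) auto
      show "AE x in lebI. (\<lambda>n. indicator (\<Union>i<n. A i) x * f x) \<longlonglongrightarrow> indicator (\<Union>(range A)) x * f x"
        by (intro AE_I2 tendsto_mult tendsto_const LIMSEQ_indicator_UN)
      show "AE x in lebI. norm (indicator (\<Union>i<n. A i) x * f x) \<le> norm (f x)" for n
        by (auto simp: indicator_def)
    qed
    moreover have "(\<integral>x. indicator (\<Union>i<n. A i) x * f x \<partial>lebI) = 0" for n
    proof -
      have eq: "indicator (\<Union>i<n. A i) x * f x = (\<Sum>i<n. indicator (A i) x * f x)" for x
      proof -
        have "indicator (\<Union>i<n. A i) x = (\<Sum>i<n. indicator (A i) x :: real)"
          using union by (intro indicator_UN_disjoint) (auto simp: disjoint_family_on_def)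
        then show ?thesis by (simp only: sum_distrib_right)
      qed
      have "(\<integral>x. indicator (\<Union>i<n. A i) x * f x \<partial>lebI) = (\<Sum>i<n. \<integral>x. indicator (A i) x * f x \<partial>lebI)"
        unfolding eq by (rule Bochner_Integration.integral_sum) (rule int[OF union(2)])
      also have "\<dots> = 0" by (simp only: union(3) sum.neutral_const)
      finally show ?thesis .
    qed
    ultimately show ?case by (simp add: LIMSEQ_const_iff)
  qed
qed

text \<open>The fundamental lemma of the calculus of variations. By Dynkin's \<open>\<pi>\<close>-\<open>\<lambda>\<close> argument the integral of \<open>f\<close>
  vanishes over every Borel set, hence over \<open>{f > 0}\<close>, which is Borel up to a null set.\<close>

lemma AE_zero_of_test_real:
  fixes f :: "real \<Rightarrow> real"
  assumes f: "integrable lebI f"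
    and test: "\<And>\<psi>. test_fun \<psi> \<Longrightarrow> (\<integral>x. \<psi> x * f x \<partial>lebI) = 0"
  shows "AE x in lebI. f x = 0"
proof -
  have nonpos: "AE x in lebI. g x \<le> 0"
    if g: "integrable lebI g" and gt: "\<And>\<psi>. test_fun \<psi> \<Longrightarrow> (\<integral>x. \<psi> x * g x \<partial>lebI) = 0" for g :: "real \<Rightarrow> real"
  proof -
    have [measurable]: "g \<in> borel_measurable lebI" using g by auto
    define S where "S = {x \<in> space lebI. g x > 0}"
    have "S \<in> sets lebI" unfolding S_def by measurable
    then have "S \<in> sets lebesgue" by (subst (asm) sets_restrict_space_iff) auto
    define C T where "C = main_part lborel S" and "T = null_part lborel S"
    have Cb: "C \<in> sets borel" and CT: "C \<union> T = S"
      using main_part_sets[OF \<open>S \<in> sets lebesgue\<close>] main_part_null_part_Un[OF \<open>S \<in> sets lebesgue\<close>]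
      by (simp_all add: C_def T_def)
    obtain N where "N \<in> null_sets lborel" "T \<subseteq> N"
      using null_part[OF \<open>S \<in> sets lebesgue\<close>] by (auto simp: T_def)
    then have "AE x in lebesgue. x \<notin> T"
      by (intro AE_I'[of N]) (auto intro: null_sets_completionI)
    then have AT: "AE x in lebI. x \<notin> T" by (auto simp: AE_restrict_space_iff elim: eventually_mono)
    have [measurable]: "(indicator S :: real \<Rightarrow> real) \<in> borel_measurable lebI"
      using \<open>S \<in> sets lebI\<close> by (rule borel_measurable_indicator)
    have [measurable]: "(indicator C :: real \<Rightarrow> real) \<in> borel_measurable lebI"
      using Cb by (intro borel_measurable_lebI_of_borel) auto
    have "(\<integral>x. indicator S x * g x \<partial>lebI) = (\<integral>x. indicator C x * g x \<partial>lebI)"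
    proof (rule integral_cong_AE)
      show "(\<lambda>x. indicator S x * g x) \<in> borel_measurable lebI" "(\<lambda>x. indicator C x * g x) \<in> borel_measurable lebI"
        by measurable
      show "AE x in lebI. indicator S x * g x = indicator C x * g x"
        using AT by eventually_elim (use CT in \<open>auto simp: indicator_def\<close>)
    qed
    also have "\<dots> = 0" by (rule integral_borel_zero_of_test[OF g gt Cb])
    finally have z: "(\<integral>x. indicator S x * g x \<partial>lebI) = 0" .
    have "integrable lebI (\<lambda>x. indicator S x * g x)"
    proof (rule Bochner_Integration.integrable_bound[OF g])
      show "(\<lambda>x. indicator S x * g x) \<in> borel_measurable lebI" by measurable
    qed (auto simp: indicator_def)
    then have "AE x in lebI. indicator S x * g x = 0"
      using z by (subst (asm) integral_nonneg_eq_0_iff_AE) (auto simp: S_def indicator_def)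
    then show ?thesis
      by (rule AE_mp) (auto simp: S_def indicator_def split: if_splits intro!: AE_I2)
  qed
  have "AE x in lebI. f x \<le> 0" by (rule nonpos[OF f test])
  moreover have "AE x in lebI. - f x \<le> 0" by (rule nonpos) (use f test in auto)
  ultimately show ?thesis by eventually_elim auto
qed

lemma AE_zero_of_test:
  fixes f :: "real \<Rightarrow> complex"
  assumes f: "integrable lebI f"
    and test: "\<And>\<psi>. test_fun \<psi> \<Longrightarrow> (\<integral>x. \<psi> x *\<^sub>R f x \<partial>lebI) = 0"
  shows "AE x in lebI. f x = 0"
proof -
  have "AE x in lebI. Re (f x) = 0"
  proof (rule AE_zero_of_test_real)
    show "(\<integral>x. \<psi> x * Re (f x) \<partial>lebI) = 0" if "test_fun \<psi>" for \<psi>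
      using integral_Re[OF integrable_test_mult[OF that f]] test[OF that] by simp
  qed (use f in auto)
  moreover have "AE x in lebI. Im (f x) = 0"
  proof (rule AE_zero_of_test_real)
    show "(\<integral>x. \<psi> x * Im (f x) \<partial>lebI) = 0" if "test_fun \<psi>" for \<psi>
      using integral_Im[OF integrable_test_mult[OF that f]] test[OF that] by simp
  qed (use f in auto)
  ultimately show ?thesis by eventually_elim (simp add: complex_eq_iff)
qed

section \<open>The Hilbert space \<open>L\<^sup>2(0,1)\<close>\<close>

lemma L2_eq_rep: "L2_eq (rep_L2 v) (rep_L2 v)"
  using Quotient3_rep_reflp[OF Quotient3_L2I] .

lemma sq_integrable_rep [simp, intro]: "sq_integrable (rep_L2 v)"
  using L2_eq_rep by (simp add: L2_eq_def)

lemma rep_measurable [measurable, simp]: "rep_L2 v \<in> borel_measurable lebI"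
  using sq_integrable_rep by (auto simp: sq_integrable_def)

lemma abs_rep_L2 [simp]: "abs_L2 (rep_L2 v) = v"
  using Quotient3_abs_rep[OF Quotient3_L2I] .

lemma abs_L2_eqI: "sq_integrable f \<Longrightarrow> sq_integrable g \<Longrightarrow> AE x in lebI. f x = g x \<Longrightarrow> abs_L2 f = abs_L2 g"
  using Quotient3_rel[OF Quotient3_L2I, of f g] by (auto simp: L2_eq_def)

lemma rep_abs_L2: "sq_integrable f \<Longrightarrow> AE x in lebI. rep_L2 (abs_L2 f) x = f x"
proof -
  assume "sq_integrable f"
  then have "L2_eq f f" by (simp add: L2_eq_def)
  then have "L2_eq (rep_L2 (abs_L2 f)) f"
    using rep_abs_rsp_left[OF Quotient3_L2I] by fast
  then show ?thesis by (simp add: L2_eq_def)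
qed

lemma L2_eqI: "AE x in lebI. rep_L2 v x = rep_L2 w x \<Longrightarrow> v = w"
  using abs_L2_eqI[of "rep_L2 v" "rep_L2 w"] by simp

lemma rep_plus: "AE x in lebI. rep_L2 (v + w) x = rep_L2 v x + rep_L2 w x"
proof -
  have "v + w = abs_L2 (\<lambda>x. rep_L2 v x + rep_L2 w x)"
    using plus_L2I.abs_eq[OF L2_eq_rep L2_eq_rep, of v w] by simp
  then show ?thesis by (simp add: rep_abs_L2 sq_integrable_add)
qed

lemma rep_zero: "AE x in lebI. rep_L2 0 x = 0"
  using rep_abs_L2[OF sq_integrable_zero] by (simp add: zero_L2I.abs_eq)

lemma rep_scaleC: "AE x in lebI. rep_L2 (scaleC_L2 c v) x = c * rep_L2 v x"
proof -
  have "scaleC_L2 c v = abs_L2 (\<lambda>x. c * rep_L2 v x)"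
    using scaleC_L2.abs_eq[OF L2_eq_rep, of c v] by simp
  then show ?thesis by (simp add: rep_abs_L2 sq_integrable_mult)
qed

lemma rep_scaleR: "AE x in lebI. rep_L2 (r *\<^sub>R v) x = r *\<^sub>R rep_L2 v x"
proof -
  have "r *\<^sub>R v = abs_L2 (\<lambda>x. r *\<^sub>R rep_L2 v x)"
    using scaleR_L2I.abs_eq[OF L2_eq_rep, of r v] by simp
  then show ?thesis by (simp add: rep_abs_L2 sq_integrable_mult scaleR_conv_of_real)
qed

lemma rep_uminus: "AE x in lebI. rep_L2 (- v) x = - rep_L2 v x"
  using rep_scaleR[of "-1" v] by simp

lemma rep_minus: "AE x in lebI. rep_L2 (v - w) x = rep_L2 v x - rep_L2 w x"
  using rep_plus[of v "- w"] rep_uminus[of w] by (auto elim: AE_mp)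

lemma norm_L2: "norm v = sqrt (\<integral>x. (cmod (rep_L2 v x))\<^sup>2 \<partial>lebI)"
  using norm_L2I.abs_eq[OF L2_eq_rep, of v] by simp

lemma norm_L2_sq: "(norm v)\<^sup>2 = (\<integral>x. (cmod (rep_L2 v x))\<^sup>2 \<partial>lebI)"
  by (simp add: norm_L2)

lemma norm_abs_L2: "sq_integrable f \<Longrightarrow> norm (abs_L2 f) = sqrt (\<integral>x. (cmod (f x))\<^sup>2 \<partial>lebI)"
  by (simp add: norm_L2I.abs_eq L2_eq_def)

lemma sq_integrable_integrable: "sq_integrable f \<Longrightarrow> integrable lebI (\<lambda>x. (cmod (f x))\<^sup>2)"
  by (simp add: sq_integrable_def)

lemma integrable_mult_sq:
  assumes "sq_integrable f" "sq_integrable g" shows "integrable lebI (\<lambda>x. f x * g x)"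
proof -
  have [measurable]: "f \<in> borel_measurable lebI" "g \<in> borel_measurable lebI"
    using assms by (auto simp: sq_integrable_def)
  have "integrable lebI (\<lambda>x. (cmod (f x))\<^sup>2 + (cmod (g x))\<^sup>2)"
    using assms by (auto simp: sq_integrable_def)
  then show ?thesis
  proof (rule Bochner_Integration.integrable_bound)
    have "cmod (f x) * cmod (g x) \<le> (cmod (f x))\<^sup>2 + (cmod (g x))\<^sup>2" for x
      using sum_squares_bound[of "cmod (f x)" "cmod (g x)"] mult_nonneg_nonneg[OF norm_ge_zero norm_ge_zero, of "f x" "g x"]
      by linarith
    then show "AE x in lebI. norm (f x * g x) \<le> norm ((cmod (f x))\<^sup>2 + (cmod (g x))\<^sup>2)"
      by (intro AE_I2) (simp add: norm_mult)
  qed simp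
qed

lemma sq_integrable_const: "sq_integrable (\<lambda>x. c)"
  by (auto simp: sq_integrable_def)

lemma sq_integrable_imp_integrable: "sq_integrable f \<Longrightarrow> integrable lebI f"
  using integrable_mult_sq[OF _ sq_integrable_const[of 1], of f] by simp

lemma integrable_rep [simp, intro]: "integrable lebI (rep_L2 v)"
  by (rule sq_integrable_imp_integrable) simp

lemma sq_integrable_cnj: "sq_integrable f \<Longrightarrow> sq_integrable (\<lambda>x. cnj (f x))"
proof -
  assume "sq_integrable f"
  then have f: "f \<in> borel_measurable lebI" "integrable lebI (\<lambda>x. (cmod (f x))\<^sup>2)"
    by (auto simp: sq_integrable_def)
  have "cnj \<in> borel_measurable borel"
    by (intro borel_measurable_continuous_onI continuous_intros)
  from measurable_compose[OF f(1) this] f(2) show ?thesis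
    by (simp add: sq_integrable_def)
qed

lemma sq_integrable_mult_bounded:
  assumes "sq_integrable f" "m \<in> borel_measurable lebI" "AE x in lebI. cmod (m x) \<le> B"
  shows "sq_integrable (\<lambda>x. m x * f x)"
proof -
  have [measurable]: "f \<in> borel_measurable lebI" "m \<in> borel_measurable lebI"
    using assms by (auto simp: sq_integrable_def)
  have "integrable lebI (\<lambda>x. B\<^sup>2 * (cmod (f x))\<^sup>2)"
    using assms by (auto simp: sq_integrable_def)
  then have "integrable lebI (\<lambda>x. (cmod (m x * f x))\<^sup>2)"
  proof (rule Bochner_Integration.integrable_bound)
    show "AE x in lebI. norm ((cmod (m x * f x))\<^sup>2) \<le> norm (B\<^sup>2 * (cmod (f x))\<^sup>2)"
      using assms(3)
    proof eventually_elim
      case (elim x)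
      then have "(cmod (m x))\<^sup>2 \<le> B\<^sup>2" by (intro power_mono) auto
      then show ?case by (auto simp: norm_mult power_mult_distrib intro!: mult_right_mono)
    qed
  qed simp
  then show ?thesis by (simp add: sq_integrable_def)
qed

lemma norm_mult_bounded_le:
  assumes "sq_integrable f" "m \<in> borel_measurable lebI" "AE x in lebI. cmod (m x) \<le> B" "B \<ge> 0"
  shows "norm (abs_L2 (\<lambda>x. m x * f x)) \<le> B * norm (abs_L2 f)"
proof -
  have sq: "sq_integrable (\<lambda>x. m x * f x)" using sq_integrable_mult_bounded assms by blast
  have "(\<integral>x. (cmod (m x * f x))\<^sup>2 \<partial>lebI) \<le> (\<integral>x. B\<^sup>2 * (cmod (f x))\<^sup>2 \<partial>lebI)"
  proof (rule integral_mono_AE)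
    show "integrable lebI (\<lambda>x. (cmod (m x * f x))\<^sup>2)" "integrable lebI (\<lambda>x. B\<^sup>2 * (cmod (f x))\<^sup>2)"
      using sq assms by (auto simp: sq_integrable_def)
    show "AE x in lebI. (cmod (m x * f x))\<^sup>2 \<le> B\<^sup>2 * (cmod (f x))\<^sup>2"
      using assms(3)
    proof eventually_elim
      case (elim x)
      then have "(cmod (m x))\<^sup>2 \<le> B\<^sup>2" by (intro power_mono) auto
      then show ?case by (auto simp: norm_mult power_mult_distrib intro!: mult_right_mono)
    qed
  qed
  then have "norm (abs_L2 (\<lambda>x. m x * f x)) \<le> sqrt (B\<^sup>2 * (\<integral>x. (cmod (f x))\<^sup>2 \<partial>lebI))"
    using sq by (simp add: norm_abs_L2)
  also have "\<dots> = B * norm (abs_L2 f)"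
    using assms by (simp add: norm_abs_L2 real_sqrt_mult)
  finally show ?thesis .
qed

subsection \<open>Inner product\<close>

instantiation L2I :: real_inner
begin

definition inner_L2I :: "L2I \<Rightarrow> L2I \<Rightarrow> real" where
  "inner_L2I v w = (\<integral>x. Re (rep_L2 v x * cnj (rep_L2 w x)) \<partial>lebI)"

lemma integrable_inner_L2: "integrable lebI (\<lambda>x. Re (rep_L2 v x * cnj (rep_L2 w x)))"
  by (intro integrable_Re integrable_mult_sq sq_integrable_cnj) auto

instance
proof
  fix x y z :: L2I and r :: real
  show "inner x y = inner y x"
    unfolding inner_L2I_def by (rule Bochner_Integration.integral_cong) (auto simp: mult.commute)
  have "inner (x + y) z = (\<integral>t. Re (rep_L2 x t * cnj (rep_L2 z t)) + Re (rep_L2 y t * cnj (rep_L2 z t)) \<partial>lebI)"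
    unfolding inner_L2I_def
  proof (rule integral_cong_AE)
    show "AE t in lebI. Re (rep_L2 (x + y) t * cnj (rep_L2 z t)) = Re (rep_L2 x t * cnj (rep_L2 z t)) + Re (rep_L2 y t * cnj (rep_L2 z t))"
      using rep_plus[of x y] by eventually_elim (simp add: algebra_simps)
  qed (use integrable_inner_L2 in \<open>auto intro!: borel_measurable_add dest: borel_measurable_integrable\<close>)
  then show "inner (x + y) z = inner x z + inner y z"
    unfolding inner_L2I_def using integrable_inner_L2 by simp
  have "inner (r *\<^sub>R x) y = (\<integral>t. r * Re (rep_L2 x t * cnj (rep_L2 y t)) \<partial>lebI)"
    unfolding inner_L2I_def
  proof (rule integral_cong_AE)
    show "AE t in lebI. Re (rep_L2 (r *\<^sub>R x) t * cnj (rep_L2 y t)) = r * Re (rep_L2 x t * cnj (rep_L2 y t))"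
      using rep_scaleR[of r x] by eventually_elim (simp add: algebra_simps)
  qed (use integrable_inner_L2 in \<open>auto intro!: borel_measurable_times dest: borel_measurable_integrable\<close>)
  then show "inner (r *\<^sub>R x) y = r * inner x y"
    unfolding inner_L2I_def by simp
  have i: "inner x x = (norm x)\<^sup>2"
    unfolding inner_L2I_def norm_L2_sq by (rule Bochner_Integration.integral_cong) (auto simp: complex_mult_cnj cmod_power2)
  show "0 \<le> inner x x" "inner x x = 0 \<longleftrightarrow> x = 0" "norm x = sqrt (inner x x)"
    by (simp_all add: i)
qed

end

lemma L1_norm_le_L2: "(\<integral>x. cmod (rep_L2 v x) \<partial>lebI) \<le> norm v"
proof -
  let ?w = "abs_L2 (\<lambda>x. of_real (cmod (rep_L2 v x)))" and ?o = "abs_L2 (\<lambda>x. 1)"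
  have sw: "sq_integrable (\<lambda>x. complex_of_real (cmod (rep_L2 v x)))"
    using sq_integrable_rep[of v] by (auto simp: sq_integrable_def)
  have so: "sq_integrable (\<lambda>x. 1)" by (rule sq_integrable_const)
  have "(\<integral>x. cmod (rep_L2 v x) \<partial>lebI) = inner ?w ?o"
    unfolding inner_L2I_def
  proof (rule integral_cong_AE)
    show "AE x in lebI. cmod (rep_L2 v x) = Re (rep_L2 ?w x * cnj (rep_L2 ?o x))"
      using rep_abs_L2[OF sw] rep_abs_L2[OF so] by eventually_elim simp
  qed (use integrable_inner_L2 in \<open>auto dest: borel_measurable_integrable\<close>)
  also have "\<dots> \<le> norm ?w * norm ?o" by (rule norm_cauchy_schwarz)
  also have "norm ?w = norm v" using sw by (simp add: norm_abs_L2 norm_L2[of v])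
  also have "norm ?o = 1" using norm_abs_L2[OF so] by (simp add: measure_restrict_space)
  finally show ?thesis by simp
qed

subsection \<open>Completeness\<close>

text \<open>The proof of completeness is that of Riesz and Fischer: an absolutely convergent series of
  \<open>L\<^sup>2\<close> functions converges pointwise almost everywhere.\<close>

lemma summable_rep_of_summable_norm:
  assumes "summable (\<lambda>n. norm (d n))"
  shows "AE x in lebI. summable (\<lambda>n. rep_L2 (d n) x)"
proof -
  have "(\<integral>\<^sup>+x. (\<Sum>n. ennreal (cmod (rep_L2 (d n) x))) \<partial>lebI) = (\<Sum>n. \<integral>\<^sup>+x. ennreal (cmod (rep_L2 (d n) x)) \<partial>lebI)"
    by (rule nn_integral_suminf) measurable
  also have "\<dots> \<le> (\<Sum>n. ennreal (norm (d n)))"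
  proof (rule suminf_le)
    show "(\<integral>\<^sup>+x. ennreal (cmod (rep_L2 (d n) x)) \<partial>lebI) \<le> ennreal (norm (d n))" for n
      using L1_norm_le_L2[of "d n"] by (subst nn_integral_eq_integral) (auto intro: ennreal_leI)
  qed auto
  also have "\<dots> < \<infinity>"
    using assms by (subst suminf_ennreal2) auto
  finally have "(\<integral>\<^sup>+x. (\<Sum>n. ennreal (cmod (rep_L2 (d n) x))) \<partial>lebI) \<noteq> \<infinity>" by simp
  then have "AE x in lebI. (\<Sum>n. ennreal (cmod (rep_L2 (d n) x))) \<noteq> \<infinity>"
    by (intro nn_integral_PInf_AE) auto
  then show ?thesis
  proof eventually_elim
    case (elim x)
    then have "summable (\<lambda>n. cmod (rep_L2 (d n) x))"
      by (intro summable_suminf_not_top) auto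
    then show ?case by (rule summable_norm_cancel)
  qed
qed

lemma L2_limit_of_AE_limit:
  assumes C: "Cauchy X" and f[measurable]: "f \<in> borel_measurable lebI"
    and lim: "AE x in lebI. (\<lambda>n. rep_L2 (X n) x) \<longlonglongrightarrow> f x"
  shows "\<exists>v. X \<longlonglongrightarrow> v"
proof -
  have bound: "\<exists>M. \<forall>m\<ge>M. (\<integral>\<^sup>+x. ennreal ((cmod (f x - rep_L2 (X m) x))\<^sup>2) \<partial>lebI) \<le> ennreal (e\<^sup>2)" if e: "e > 0" for e
  proof -
    obtain M where M: "\<And>m n. m \<ge> M \<Longrightarrow> n \<ge> M \<Longrightarrow> norm (X n - X m) < e"
      using CauchyD[OF C e] by blast
    have "(\<integral>\<^sup>+x. ennreal ((cmod (f x - rep_L2 (X m) x))\<^sup>2) \<partial>lebI) \<le> ennreal (e\<^sup>2)" if m: "m \<ge> M" for m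
    proof -
      have "(\<integral>\<^sup>+x. ennreal ((cmod (f x - rep_L2 (X m) x))\<^sup>2) \<partial>lebI)
        = (\<integral>\<^sup>+x. liminf (\<lambda>n. ennreal ((cmod (rep_L2 (X n) x - rep_L2 (X m) x))\<^sup>2)) \<partial>lebI)"
      proof (rule nn_integral_cong_AE)
        show "AE x in lebI. ennreal ((cmod (f x - rep_L2 (X m) x))\<^sup>2) = liminf (\<lambda>n. ennreal ((cmod (rep_L2 (X n) x - rep_L2 (X m) x))\<^sup>2))"
          using lim
        proof eventually_elim
          case (elim x)
          then have "(\<lambda>n. ennreal ((cmod (rep_L2 (X n) x - rep_L2 (X m) x))\<^sup>2)) \<longlonglongrightarrow> ennreal ((cmod (f x - rep_L2 (X m) x))\<^sup>2)"
            by (intro tendsto_intros)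
          then show ?case by (intro lim_imp_Liminf[symmetric]) auto
        qed
      qed
      also have "\<dots> \<le> liminf (\<lambda>n. \<integral>\<^sup>+x. ennreal ((cmod (rep_L2 (X n) x - rep_L2 (X m) x))\<^sup>2) \<partial>lebI)"
        by (rule nn_integral_liminf) measurable
      also have "\<dots> \<le> limsup (\<lambda>n. \<integral>\<^sup>+x. ennreal ((cmod (rep_L2 (X n) x - rep_L2 (X m) x))\<^sup>2) \<partial>lebI)"
        by (rule Liminf_le_Limsup) simp
      also have "\<dots> \<le> ennreal (e\<^sup>2)"
      proof (rule Limsup_bounded)
        show "eventually (\<lambda>n. (\<integral>\<^sup>+x. ennreal ((cmod (rep_L2 (X n) x - rep_L2 (X m) x))\<^sup>2) \<partial>lebI) \<le> ennreal (e\<^sup>2)) sequentially"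
          using eventually_ge_at_top[of M]
        proof eventually_elim
          case (elim n)
          have "(\<integral>\<^sup>+x. ennreal ((cmod (rep_L2 (X n) x - rep_L2 (X m) x))\<^sup>2) \<partial>lebI)
             = (\<integral>\<^sup>+x. ennreal ((cmod (rep_L2 (X n - X m) x))\<^sup>2) \<partial>lebI)"
            by (rule nn_integral_cong_AE) (use rep_minus[of "X n" "X m"] in \<open>eventually_elim, simp\<close>)
          also have "\<dots> = ennreal ((norm (X n - X m))\<^sup>2)"
            unfolding norm_L2_sq using sq_integrable_rep by (intro nn_integral_eq_integral) (auto simp: sq_integrable_def)
          also have "\<dots> \<le> ennreal (e\<^sup>2)"
            using M[OF m elim] by (intro ennreal_leI power_mono) auto
          finally show ?case .
        qed
      qed
      finally show ?thesis .
    qed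
    then show ?thesis by blast
  qed
  obtain M1 where M1: "(\<integral>\<^sup>+x. ennreal ((cmod (f x - rep_L2 (X M1) x))\<^sup>2) \<partial>lebI) \<le> ennreal (1\<^sup>2)"
    using bound[of 1] by auto
  have sqd: "sq_integrable (\<lambda>x. f x - rep_L2 (X M1) x)"
    unfolding sq_integrable_def
  proof
    show "integrable lebI (\<lambda>x. (cmod (f x - rep_L2 (X M1) x))\<^sup>2)"
    proof (rule integrableI_bounded)
      show "(\<integral>\<^sup>+x. ennreal (norm ((cmod (f x - rep_L2 (X M1) x))\<^sup>2)) \<partial>lebI) < \<infinity>"
        using M1 by (simp add: le_less_trans[OF _ ennreal_one_less_top])
    qed simp
  qed simp
  have sqf: "sq_integrable f"
    using sq_integrable_add[OF sqd sq_integrable_rep[of "X M1"]] by simp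
  define v where "v = abs_L2 f"
  have "X \<longlonglongrightarrow> v"
  proof (rule metric_LIMSEQ_I)
    fix r :: real assume r: "0 < r"
    obtain M where M: "\<And>m. m \<ge> M \<Longrightarrow> (\<integral>\<^sup>+x. ennreal ((cmod (f x - rep_L2 (X m) x))\<^sup>2) \<partial>lebI) \<le> ennreal ((r/2)\<^sup>2)"
      using bound[of "r/2"] r by auto
    have "dist (X m) v < r" if "m \<ge> M" for m
    proof -
      have "ennreal ((norm (v - X m))\<^sup>2) = (\<integral>\<^sup>+x. ennreal ((cmod (rep_L2 (v - X m) x))\<^sup>2) \<partial>lebI)"
        unfolding norm_L2_sq using sq_integrable_rep by (intro nn_integral_eq_integral[symmetric]) (auto simp: sq_integrable_def)
      also have "\<dots> = (\<integral>\<^sup>+x. ennreal ((cmod (f x - rep_L2 (X m) x))\<^sup>2) \<partial>lebI)"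
        by (rule nn_integral_cong_AE) (use rep_minus[of v "X m"] rep_abs_L2[OF sqf] in \<open>eventually_elim, simp add: v_def\<close>)
      also have "\<dots> \<le> ennreal ((r/2)\<^sup>2)" by (rule M[OF that])
      finally have "(norm (v - X m))\<^sup>2 \<le> (r/2)\<^sup>2" by (simp add: ennreal_le_iff)
      then have "norm (v - X m) \<le> r/2" using r by (simp add: power2_le_iff_abs_le)
      then show ?thesis using r by (simp add: dist_norm norm_minus_commute)
    qed
    then show "\<exists>no. \<forall>n\<ge>no. dist (X n) v < r" by blast
  qed
  then show ?thesis by blast
qed

instance L2I :: complete_space
proof
  fix X :: "nat \<Rightarrow> L2I" assume C: "Cauchy X"
  have "\<exists>M. \<forall>m\<ge>M. \<forall>n\<ge>M. norm (X m - X n) < (1/2)^k" for k :: nat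
    using CauchyD[OF C, of "(1/2)^k"] by auto
  then obtain M where M: "\<And>k m n. m \<ge> M k \<Longrightarrow> n \<ge> M k \<Longrightarrow> norm (X m - X n) < (1/2)^k"
    by metis
  define r where "r k = k + (\<Sum>i\<le>k. M i)" for k
  have r: "strict_mono r" by (auto simp: strict_mono_Suc_iff r_def)
  have rM: "r k \<ge> M k" for k
    unfolding r_def using member_le_sum[of k "{..k}" M] by auto
  define Y where "Y = X \<circ> r"
  define d where "d n = Y (Suc n) - Y n" for n
  have "norm (d n) \<le> (1/2)^n" for n
  proof -
    have "r (Suc n) \<ge> r n" using r by (simp add: strict_mono_less_eq)
    then show ?thesis unfolding d_def Y_def comp_def
      using M[of n "r (Suc n)" "r n"] rM[of n] by (simp add: less_imp_le)
  qed
  then have "summable (\<lambda>n. norm (d n))"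
    by (intro summable_comparison_test'[OF summable_geometric[of "1/2 :: real"]]) auto
  then have "AE x in lebI. summable (\<lambda>n. rep_L2 (d n) x)"
    by (rule summable_rep_of_summable_norm)
  moreover have "AE x in lebI. \<forall>n. rep_L2 (d n) x = rep_L2 (Y (Suc n)) x - rep_L2 (Y n) x"
    unfolding AE_all_countable d_def using rep_minus by blast
  ultimately have "AE x in lebI. convergent (\<lambda>n. rep_L2 (Y n) x)"
  proof eventually_elim
    case (elim x)
    have "(\<Sum>k<n. rep_L2 (d k) x) = rep_L2 (Y n) x - rep_L2 (Y 0) x" for n
      using elim(2) by (induction n) auto
    moreover have "convergent (\<lambda>n. (\<Sum>k<n. rep_L2 (d k) x))"
      using elim(1) by (simp add: summable_iff_convergent)
    ultimately show ?case
      using convergent_diff_const_right_iff by fastforce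
  qed
  then have "AE x in lebI. (\<lambda>n. rep_L2 (Y n) x) \<longlonglongrightarrow> lim (\<lambda>n. rep_L2 (Y n) x)"
    by eventually_elim (simp add: convergent_LIMSEQ_iff)
  moreover have "(\<lambda>x. lim (\<lambda>n. rep_L2 (Y n) x)) \<in> borel_measurable lebI"
    by (rule borel_measurable_lim_metric) simp
  moreover have "Cauchy Y" unfolding Y_def using C r by (rule Cauchy_subseq_Cauchy)
  ultimately obtain v where "Y \<longlonglongrightarrow> v" using L2_limit_of_AE_limit by blast
  then show "convergent X"
    unfolding convergent_def using Cauchy_converges_subseq[OF C r] Y_def by blast
qed

instance L2I :: banach ..

subsection \<open>Multiplication, conjugation and complex scalars\<close>

definition mult_op :: "(real \<Rightarrow> complex) \<Rightarrow> L2I \<Rightarrow> L2I" where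
  "mult_op m v = abs_L2 (\<lambda>x. m x * rep_L2 v x)"

definition bounded_multiplier :: "(real \<Rightarrow> complex) \<Rightarrow> bool" where
  "bounded_multiplier m \<longleftrightarrow> m \<in> borel_measurable lebI \<and> (\<exists>B. AE x in lebI. cmod (m x) \<le> B)"

lemma bounded_multiplier_continuous:
  assumes "continuous_on {0..1} m" shows "bounded_multiplier m"
proof -
  have "continuous_on {0<..<1} m" using assms by (rule continuous_on_subset) auto
  then have "m \<in> borel_measurable lebI"
    by (rule continuous_imp_measurable_on_sets_lebesgue) auto
  moreover have "bounded (m ` {0..1})"
    using assms by (intro compact_imp_bounded compact_continuous_image) auto
  then obtain B where "\<And>x. x \<in> {0..1} \<Longrightarrow> cmod (m x) \<le> B"
    unfolding bounded_iff by (metis image_eqI)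
  then have "AE x in lebI. cmod (m x) \<le> B" by (intro AE_I2) auto
  ultimately show ?thesis unfolding bounded_multiplier_def by blast
qed

lemma sq_integrable_mult_op: "bounded_multiplier m \<Longrightarrow> sq_integrable (\<lambda>x. m x * rep_L2 v x)"
  unfolding bounded_multiplier_def using sq_integrable_mult_bounded[OF sq_integrable_rep] by blast

lemma rep_mult_op: "bounded_multiplier m \<Longrightarrow> AE x in lebI. rep_L2 (mult_op m v) x = m x * rep_L2 v x"
  unfolding mult_op_def by (rule rep_abs_L2[OF sq_integrable_mult_op])

lemma bounded_linear_mult_op:
  assumes "bounded_multiplier m" shows "bounded_linear (mult_op m)"
proof -
  obtain B where m: "m \<in> borel_measurable lebI" and B: "AE x in lebI. cmod (m x) \<le> B"
    using assms by (auto simp: bounded_multiplier_def)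
  have B': "AE x in lebI. cmod (m x) \<le> \<bar>B\<bar>" using B by eventually_elim auto
  show ?thesis
  proof (rule bounded_linear_intro[where K = "\<bar>B\<bar>"])
    fix v w :: L2I and r :: real
    show "mult_op m (v + w) = mult_op m v + mult_op m w"
      by (rule L2_eqI) (use rep_plus[of v w] rep_plus[of "mult_op m v" "mult_op m w"] rep_mult_op[OF assms, of v]
         rep_mult_op[OF assms, of w] rep_mult_op[OF assms, of "v + w"] in \<open>eventually_elim, simp add: algebra_simps\<close>)
    show "mult_op m (r *\<^sub>R v) = r *\<^sub>R mult_op m v"
      by (rule L2_eqI) (use rep_scaleR[of r v] rep_scaleR[of r "mult_op m v"] rep_mult_op[OF assms, of v]
         rep_mult_op[OF assms, of "r *\<^sub>R v"] in \<open>eventually_elim, simp add: algebra_simps\<close>)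
    show "norm (mult_op m v) \<le> norm v * \<bar>B\<bar>"
      using norm_mult_bounded_le[OF sq_integrable_rep m B', of v] by (simp add: mult_op_def mult.commute)
  qed
qed

definition cnj_L2 :: "L2I \<Rightarrow> L2I" where
  "cnj_L2 v = abs_L2 (\<lambda>x. cnj (rep_L2 v x))"

lemma rep_cnj_L2: "AE x in lebI. rep_L2 (cnj_L2 v) x = cnj (rep_L2 v x)"
  unfolding cnj_L2_def by (rule rep_abs_L2) (simp add: sq_integrable_cnj)

lemma norm_cnj_L2 [simp]: "norm (cnj_L2 v) = norm v"
  unfolding cnj_L2_def by (simp add: norm_abs_L2 sq_integrable_cnj norm_L2[of v])

lemma bounded_linear_cnj_L2: "bounded_linear cnj_L2"
proof (rule bounded_linear_intro[where K = 1])
  fix v w :: L2I and r :: real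
  show "cnj_L2 (v + w) = cnj_L2 v + cnj_L2 w"
    by (rule L2_eqI) (use rep_plus[of v w] rep_plus[of "cnj_L2 v" "cnj_L2 w"] rep_cnj_L2[of v]
       rep_cnj_L2[of w] rep_cnj_L2[of "v + w"] in \<open>eventually_elim, simp\<close>)
  show "cnj_L2 (r *\<^sub>R v) = r *\<^sub>R cnj_L2 v"
    by (rule L2_eqI) (use rep_scaleR[of r v] rep_scaleR[of r "cnj_L2 v"] rep_cnj_L2[of v]
       rep_cnj_L2[of "r *\<^sub>R v"] in \<open>eventually_elim, simp\<close>)
qed simp

lemma norm_scaleC_L2 [simp]: "norm (scaleC_L2 c v) = cmod c * norm v"
proof -
  have "scaleC_L2 c v = abs_L2 (\<lambda>x. c * rep_L2 v x)"
    using scaleC_L2.abs_eq[OF L2_eq_rep, of c v] by simp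
  then show ?thesis
    by (simp add: norm_abs_L2 sq_integrable_mult norm_mult power_mult_distrib real_sqrt_mult norm_L2[of v])
qed

lemma bounded_bilinear_scaleC_L2: "bounded_bilinear scaleC_L2"
proof (rule bounded_bilinear.intro)
  fix v w :: L2I and r :: real and c c' :: complex
  show "scaleC_L2 (c + c') v = scaleC_L2 c v + scaleC_L2 c' v"
    by (rule L2_eqI) (use rep_scaleC[of "c + c'" v] rep_scaleC[of c v] rep_scaleC[of c' v]
      rep_plus[of "scaleC_L2 c v" "scaleC_L2 c' v"] in \<open>eventually_elim, simp add: algebra_simps\<close>)
  show "scaleC_L2 c (v + w) = scaleC_L2 c v + scaleC_L2 c w"
    by (rule L2_eqI) (use rep_scaleC[of c "v + w"] rep_scaleC[of c v] rep_scaleC[of c w] rep_plus[of v w]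
      rep_plus[of "scaleC_L2 c v" "scaleC_L2 c w"] in \<open>eventually_elim, simp add: algebra_simps\<close>)
  show "scaleC_L2 (r *\<^sub>R c) v = r *\<^sub>R scaleC_L2 c v"
    by (rule L2_eqI) (use rep_scaleC[of "r *\<^sub>R c" v] rep_scaleC[of c v] rep_scaleR[of r "scaleC_L2 c v"]
      in \<open>eventually_elim, simp add: algebra_simps\<close>)
  show "scaleC_L2 c (r *\<^sub>R v) = r *\<^sub>R scaleC_L2 c v"
    by (rule L2_eqI) (use rep_scaleC[of c "r *\<^sub>R v"] rep_scaleC[of c v] rep_scaleR[of r v] rep_scaleR[of r "scaleC_L2 c v"]
      in \<open>eventually_elim, simp add: algebra_simps\<close>)
  show "\<exists>K. \<forall>c v. norm (scaleC_L2 c v) \<le> cmod c * norm v * K"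
    by (intro exI[of _ 1]) simp
qed

section \<open>Primitives of integrable functions and integration by parts\<close>

lemma ident_measurable_lebI [measurable]: "(\<lambda>x. x) \<in> borel_measurable lebI"
  by (intro measurable_restrict_space1 measurable_completion) auto

text \<open>The upper limit is a cut-off in the integrand, so that all primitives are integrals for one fixed measure, as
  Fubini's theorem and dominated convergence want it.\<close>

definition prim :: "(real \<Rightarrow> 'a::{banach,second_countable_topology}) \<Rightarrow> real \<Rightarrow> 'a" where
  "prim f x = (\<integral>s. (if s < x then f s else 0) \<partial>lebI)"

lemma cutoff_measurable [measurable]:
  fixes f :: "real \<Rightarrow> 'a::{banach,second_countable_topology}"
  assumes [measurable]: "f \<in> borel_measurable lebI"
  shows "(\<lambda>s. if s < x then f s else 0) \<in> borel_measurable lebI"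
  by measurable

lemma integrable_cutoff:
  fixes f :: "real \<Rightarrow> 'a::{banach,second_countable_topology}"
  assumes "integrable lebI f" shows "integrable lebI (\<lambda>s. if s < x then f s else 0)"
proof (rule Bochner_Integration.integrable_bound[OF assms])
  have "f \<in> borel_measurable lebI" using assms by (rule borel_measurable_integrable)
  then show "(\<lambda>s. if s < x then f s else 0) \<in> borel_measurable lebI" by (rule cutoff_measurable)
qed simp

lemma prim_0 [simp]: "prim f 0 = 0"
proof -
  have "prim f 0 = (\<integral>s. 0 \<partial>lebI)"
    unfolding prim_def by (rule Bochner_Integration.integral_cong) auto
  then show ?thesis by simp
qed

lemma prim_1: "prim f 1 = (\<integral>s. f s \<partial>lebI)"
  unfolding prim_def by (rule Bochner_Integration.integral_cong) auto

lemma prim_add: "integrable lebI f \<Longrightarrow> integrable lebI g \<Longrightarrow> prim (\<lambda>x. f x + g x) y = prim f y + prim g y"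
  unfolding prim_def
  by (subst Bochner_Integration.integral_add[symmetric, OF integrable_cutoff integrable_cutoff])
     (auto intro: Bochner_Integration.integral_cong)

lemma prim_mult_left: "prim (\<lambda>x. c * f x) y = c * prim f (y :: real)" for f :: "real \<Rightarrow> real"
  unfolding prim_def by (subst integral_mult_right_zero[symmetric]) (rule Bochner_Integration.integral_cong, auto)

lemma norm_prim_diff_le:
  fixes f :: "real \<Rightarrow> 'a::{banach,second_countable_topology}"
  assumes "integrable lebI f"
  shows "norm (prim f x - prim f y) \<le> (\<integral>s. norm (f s) \<partial>lebI)"
proof -
  have "prim f x - prim f y = (\<integral>s. (if s < x then f s else 0) - (if s < y then f s else 0) \<partial>lebI)"
    unfolding prim_def using integrable_cutoff[OF assms] by simp
  also have "norm \<dots> \<le> (\<integral>s. norm (f s) \<partial>lebI)"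
    using assms integrable_cutoff[OF assms]
    by (intro order_trans[OF integral_norm_bound] integral_mono) auto
  finally show ?thesis .
qed

lemma AE_lebI_neq: "AE s in lebI. s \<noteq> x"
proof -
  have "{x} \<in> null_sets lebesgue"
    by (intro null_sets_completionI finite_imp_null_set_lborel) auto
  then have "AE s in lebesgue. s \<notin> {x}" by (rule AE_not_in)
  then show ?thesis
    by (subst AE_restrict_space_iff) (auto elim: eventually_mono)
qed

lemma isCont_prim:
  fixes f :: "real \<Rightarrow> 'a::{banach,second_countable_topology}"
  assumes "integrable lebI f" shows "isCont (prim f) x"
  unfolding continuous_at_sequentially comp_def
proof (intro allI impI)
  fix u :: "nat \<Rightarrow> real" assume u: "u \<longlonglongrightarrow> x"
  have m: "f \<in> borel_measurable lebI" using assms by (rule borel_measurable_integrable)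
  show "(\<lambda>n. prim f (u n)) \<longlonglongrightarrow> prim f x"
    unfolding prim_def
  proof (rule integral_dominated_convergence[where w = "\<lambda>s. norm (f s)"])
    show "AE s in lebI. (\<lambda>n. if s < u n then f s else 0) \<longlonglongrightarrow> (if s < x then f s else 0)"
      using AE_lebI_neq[of x]
    proof eventually_elim
      case (elim s)
      have "eventually (\<lambda>n. (s < u n) = (s < x)) sequentially"
        using elim order_tendstoD[OF u, of s]
        by (cases "s < x") (auto elim!: eventually_mono)
      then have "eventually (\<lambda>n. (if s < u n then f s else 0) = (if s < x then f s else 0)) sequentially"
        by eventually_elim simp
      then show ?case by (rule tendsto_eventually)
    qed
  next
    show "(\<lambda>s. if s < x then f s else 0) \<in> borel_measurable lebI"
      "(\<lambda>s. if s < u n then f s else 0) \<in> borel_measurable lebI" for n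
      using cutoff_measurable[OF m] by blast+
    show "AE s in lebI. norm (if s < u n then f s else 0) \<le> norm (f s)" for n
      by (rule AE_I2) simp
    show "integrable lebI (\<lambda>s. norm (f s))" using assms by (rule integrable_norm)
  qed
qed

lemma lebI_integral_continuous:
  fixes f :: "real \<Rightarrow> 'a::euclidean_space"
  assumes "continuous_on {0..1} f"
  shows "integrable lebI f" "(\<integral>x. f x \<partial>lebI) = integral {0..1} f"
proof -
  have "f absolutely_integrable_on {0..1}" using assms by (rule absolutely_integrable_continuous_real)
  then have "f absolutely_integrable_on {0<..<1}"
    by (rule set_integrable_subset) auto
  then show i: "integrable lebI f"
    by (simp add: integrable_restrict_space set_integrable_def)
  show "(\<integral>x. f x \<partial>lebI) = integral {0..1} f"
    using lebesgue_integral_eq_integral[OF i] integral_open_interval[of 0 1 f] by (simp only: box_real) simp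
qed

text \<open>Absolute continuity of \<open>F\<close> on \<open>[0,1]\<close> with almost everywhere derivative \<open>f\<close>, in integral form.\<close>

definition primitive_of :: "(real \<Rightarrow> 'a::{banach,second_countable_topology}) \<Rightarrow> (real \<Rightarrow> 'a) \<Rightarrow> bool" where
  "primitive_of F f \<longleftrightarrow> integrable lebI f \<and> (\<forall>x\<in>{0..1}. F x = F 0 + prim f x)"

lemma primitive_ofD:
  assumes "primitive_of F f"
  shows "integrable lebI f" "x \<in> {0..1} \<Longrightarrow> F x = F 0 + prim f x" "(\<integral>x. f x \<partial>lebI) = F 1 - F 0"
proof -
  show "integrable lebI f" using assms unfolding primitive_of_def by blast
  show P: "F x = F 0 + prim f x" if "x \<in> {0..1}" for x
    using assms that unfolding primitive_of_def by blast
  show "(\<integral>x. f x \<partial>lebI) = F 1 - F 0" using P[of 1] by (simp add: prim_1)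
qed

lemma primitive_of_continuous:
  assumes "primitive_of F f" shows "continuous_on {0..1} F"
proof -
  have "continuous_on {0..1} (\<lambda>x. F 0 + prim f x)"
    using isCont_prim[OF primitive_ofD(1)[OF assms]]
    by (intro continuous_intros continuous_at_imp_continuous_on) auto
  then show ?thesis
    by (rule continuous_on_eq) (rule primitive_ofD(2)[OF assms, symmetric])
qed

lemma primitive_of_add: "primitive_of F f \<Longrightarrow> primitive_of G g \<Longrightarrow> primitive_of (\<lambda>x. F x + G x) (\<lambda>x. f x + g x)"
proof -
  assume F: "primitive_of F f" and G: "primitive_of G g"
  have "F x + G x = F 0 + G 0 + prim (\<lambda>x. f x + g x) x" if x: "x \<in> {0..1}" for x
    using primitive_ofD(2)[OF F x] primitive_ofD(2)[OF G x] prim_add[OF primitive_ofD(1)[OF F] primitive_ofD(1)[OF G], of x]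
    by (simp add: add_ac)
  then show ?thesis
    using primitive_ofD(1)[OF F] primitive_ofD(1)[OF G] unfolding primitive_of_def
    by (intro conjI ballI Bochner_Integration.integrable_add)
qed

lemma primitive_of_cmult: "primitive_of F f \<Longrightarrow> primitive_of (\<lambda>x. c * F x) (\<lambda>x. c * f x)" for F f :: "real \<Rightarrow> real"
  unfolding primitive_of_def prim_mult_left by (metis distrib_left integrable_mult_right)

lemma primitive_of_diff:
  fixes F f G g :: "real \<Rightarrow> real"
  assumes "primitive_of F f" "primitive_of G g" shows "primitive_of (\<lambda>x. F x - G x) (\<lambda>x. f x - g x)"
  using primitive_of_add[OF assms(1) primitive_of_cmult[OF assms(2), of "-1"]] by simp

lemma prim_Re: "integrable lebI f \<Longrightarrow> Re (prim f x) = prim (\<lambda>x. Re (f x)) x"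
  unfolding prim_def by (subst integral_Re[symmetric, OF integrable_cutoff]) (auto intro!: Bochner_Integration.integral_cong)

lemma prim_Im: "integrable lebI f \<Longrightarrow> Im (prim f x) = prim (\<lambda>x. Im (f x)) x"
  unfolding prim_def by (subst integral_Im[symmetric, OF integrable_cutoff]) (auto intro!: Bochner_Integration.integral_cong)

lemma primitive_of_Re: "primitive_of F f \<Longrightarrow> primitive_of (\<lambda>x. Re (F x)) (\<lambda>x. Re (f x))"
  unfolding primitive_of_def using prim_Re by (metis integrable_Re plus_complex.sel(1))

lemma primitive_of_Im: "primitive_of F f \<Longrightarrow> primitive_of (\<lambda>x. Im (F x)) (\<lambda>x. Im (f x))"
  unfolding primitive_of_def using prim_Im by (metis integrable_Im plus_complex.sel(2))

lemma integrable_continuous_mult: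
  fixes F g :: "real \<Rightarrow> real"
  assumes F: "continuous_on {0..1} F" and g: "integrable lebI g"
  shows "integrable lebI (\<lambda>x. F x * g x)"
proof -
  have "compact (F ` {0..1})" using F by (intro compact_continuous_image) auto
  then obtain B where B: "\<And>x. x \<in> {0..1} \<Longrightarrow> \<bar>F x\<bar> \<le> B"
    using compact_imp_bounded[of "F ` {0..1}"] unfolding bounded_iff by (metis image_eqI real_norm_def)
  have [measurable]: "F \<in> borel_measurable lebI" "g \<in> borel_measurable lebI"
    using lebI_integral_continuous(1)[OF F] g by auto
  show ?thesis
  proof (rule Bochner_Integration.integrable_bound[of _ "\<lambda>x. B * \<bar>g x\<bar>"])
    show "AE x in lebI. norm (F x * g x) \<le> norm (B * \<bar>g x\<bar>)"
    proof (rule AE_I2)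
      fix x assume "x \<in> space lebI"
      then have "\<bar>F x\<bar> \<le> \<bar>B\<bar>" using B[of x] by simp
      then show "norm (F x * g x) \<le> norm (B * \<bar>g x\<bar>)" by (simp add: abs_mult mult_right_mono)
    qed
  qed (use g in auto)
qed

text \<open>Fubini's theorem on the triangle \<open>s < x\<close> and its mirror image, which together fill the square.\<close>

lemma integral_prim_mult:
  fixes f g :: "real \<Rightarrow> real"
  assumes f: "integrable lebI f" and g: "integrable lebI g"
  shows "(\<integral>x. prim f x * g x \<partial>lebI) + (\<integral>x. f x * prim g x \<partial>lebI) = (\<integral>x. f x \<partial>lebI) * (\<integral>x. g x \<partial>lebI)"
proof -
  interpret pair_sigma_finite lebI lebI ..
  have [measurable]: "f \<in> borel_measurable lebI" "g \<in> borel_measurable lebI"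
    using f g by auto
  let ?h = "\<lambda>x s. (if s < x then f s else 0) * g x"
  let ?k = "\<lambda>x s. (if x < s then f s else 0) * g x"
  have fg: "integrable (lebI \<Otimes>\<^sub>M lebI) (\<lambda>(x, s). f s * g x)"
  proof (rule Fubini_integrable)
    show "integrable lebI (\<lambda>x. \<integral>s. norm (case (x, s) of (x, s) \<Rightarrow> f s * g x) \<partial>lebI)"
      using f g by (simp add: abs_mult)
    show "AE x in lebI. integrable lebI (\<lambda>s. case (x, s) of (x, s) \<Rightarrow> f s * g x)"
      using f by simp
  qed measurable
  have h: "integrable (lebI \<Otimes>\<^sub>M lebI) (\<lambda>(x, s). ?h x s)"
    by (rule Bochner_Integration.integrable_bound[OF fg]) (auto simp: abs_mult)
  have k: "integrable (lebI \<Otimes>\<^sub>M lebI) (\<lambda>(x, s). ?k x s)"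
    by (rule Bochner_Integration.integrable_bound[OF fg]) (auto simp: abs_mult)
  have "(\<integral>x. f x * prim g x \<partial>lebI) = (\<integral>s. (\<integral>x. ?k x s \<partial>lebI) \<partial>lebI)"
    unfolding prim_def by (intro Bochner_Integration.integral_cong refl, subst integral_mult_right_zero[symmetric])
      (rule Bochner_Integration.integral_cong, auto)
  also have "\<dots> = (\<integral>x. (\<integral>s. ?k x s \<partial>lebI) \<partial>lebI)"
    by (rule Fubini_integral[OF k])
  finally have "(\<integral>x. prim f x * g x \<partial>lebI) + (\<integral>x. f x * prim g x \<partial>lebI)
     = (\<integral>x. (\<integral>s. ?h x s \<partial>lebI) + (\<integral>s. ?k x s \<partial>lebI) \<partial>lebI)"
    using integrable_fst[OF h] integrable_fst[OF k] by (simp add: prim_def)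
  also have "\<dots> = (\<integral>x. (\<integral>s. f s \<partial>lebI) * g x \<partial>lebI)"
  proof (rule Bochner_Integration.integral_cong[OF refl])
    fix x
    have c2: "integrable lebI (\<lambda>s. if x < s then f s else 0)"
      by (rule Bochner_Integration.integrable_bound[OF f]) auto
    have "(\<integral>s. ?h x s \<partial>lebI) + (\<integral>s. ?k x s \<partial>lebI) = (\<integral>s. ?h x s + ?k x s \<partial>lebI)"
      using integrable_cutoff[OF f] c2 by (intro Bochner_Integration.integral_add[symmetric]) auto
    also have "\<dots> = (\<integral>s. f s * g x \<partial>lebI)"
    proof (rule integral_cong_AE)
      show "AE s in lebI. ?h x s + ?k x s = f s * g x"
        using AE_lebI_neq[of x] by eventually_elim auto
    qed auto
    finally show "(\<integral>s. ?h x s \<partial>lebI) + (\<integral>s. ?k x s \<partial>lebI) = (\<integral>s. f s \<partial>lebI) * g x" by simp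
  qed
  finally show ?thesis by simp
qed

lemma prim_cutoff: "prim (\<lambda>s. if s < y then f s else 0) x = prim f (min x y)"
  unfolding prim_def by (rule Bochner_Integration.integral_cong) auto

text \<open>Cutting both functions off at \<open>y\<close> reduces this to integration by parts over the whole interval.\<close>

lemma prim_prim_mult:
  fixes f g :: "real \<Rightarrow> real"
  assumes f: "integrable lebI f" and g: "integrable lebI g"
  shows "prim (\<lambda>x. prim f x * g x + f x * prim g x) y = prim f y * prim g y"
proof -
  let ?f = "\<lambda>s. if s < y then f s else 0" and ?g = "\<lambda>s. if s < y then g s else 0"
  have cp: "continuous_on {0..1} (prim h)" if "integrable lebI h" for h :: "real \<Rightarrow> real"
    using isCont_prim[OF that] by (intro continuous_at_imp_continuous_on) auto
  have i: "integrable lebI (\<lambda>x. prim f x * g x)" "integrable lebI (\<lambda>x. f x * prim g x)"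
    using integrable_continuous_mult[OF cp[OF f] g] integrable_continuous_mult[OF cp[OF g] f]
    by (simp_all add: mult.commute)
  have 1: "(\<integral>x. prim ?f x * ?g x \<partial>lebI) = prim (\<lambda>x. prim f x * g x) y"
    unfolding prim_cutoff unfolding prim_def[of "\<lambda>x. prim f x * g x"]
    by (rule Bochner_Integration.integral_cong) auto
  have 2: "(\<integral>x. ?f x * prim ?g x \<partial>lebI) = prim (\<lambda>x. f x * prim g x) y"
    unfolding prim_cutoff unfolding prim_def[of "\<lambda>x. f x * prim g x"]
    by (rule Bochner_Integration.integral_cong) auto
  show ?thesis
    using integral_prim_mult[OF integrable_cutoff[OF f, of y] integrable_cutoff[OF g, of y]]
    unfolding 1 2 prim_add[OF i] by (simp add: prim_def)
qed

lemma primitive_of_mult: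
  fixes F f G g :: "real \<Rightarrow> real"
  assumes F: "primitive_of F f" and G: "primitive_of G g"
  shows "primitive_of (\<lambda>x. F x * G x) (\<lambda>x. f x * G x + F x * g x)"
proof -
  note f = primitive_ofD(1)[OF F] and g = primitive_ofD(1)[OF G]
  have cp: "continuous_on {0..1} (prim h)" if "integrable lebI h" for h :: "real \<Rightarrow> real"
    using isCont_prim[OF that] by (intro continuous_at_imp_continuous_on) auto
  have i: "integrable lebI (\<lambda>x. prim f x * g x)" "integrable lebI (\<lambda>x. f x * prim g x)"
    using integrable_continuous_mult[OF cp[OF f] g] integrable_continuous_mult[OF cp[OF g] f]
    by (simp_all add: mult.commute)
  have j: "integrable lebI (\<lambda>x. f x * G x)" "integrable lebI (\<lambda>x. F x * g x)"
    using integrable_continuous_mult[OF primitive_of_continuous[OF G] f] integrable_continuous_mult[OF primitive_of_continuous[OF F] g]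
    by (simp_all add: mult.commute)
  have "F x * G x = F 0 * G 0 + prim (\<lambda>x. f x * G x + F x * g x) x" if x: "x \<in> {0..1}" for x
  proof -
    have "prim (\<lambda>x. f x * G x + F x * g x) x
        = prim (\<lambda>x. (G 0 * f x + F 0 * g x) + (prim f x * g x + f x * prim g x)) x"
      unfolding prim_def[of "\<lambda>x. f x * G x + F x * g x"]
        prim_def[of "\<lambda>x. (G 0 * f x + F 0 * g x) + (prim f x * g x + f x * prim g x)"]
    proof (rule Bochner_Integration.integral_cong[OF refl])
      fix s assume "s \<in> space lebI"
      then have s: "s \<in> {0..1}" by simp
      show "(if s < x then f s * G s + F s * g s else 0) =
        (if s < x then G 0 * f s + F 0 * g s + (prim f s * g s + f s * prim g s) else 0)"
        unfolding primitive_ofD(2)[OF F s] primitive_ofD(2)[OF G s]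
        by (simp add: algebra_simps)
    qed
    also have "\<dots> = G 0 * prim f x + F 0 * prim g x + prim f x * prim g x"
      using f g i by (simp add: prim_add prim_mult_left flip: prim_prim_mult[OF f g])
    finally show ?thesis
      unfolding primitive_ofD(2)[OF F x] primitive_ofD(2)[OF G x] by (simp add: algebra_simps)
  qed
  then show ?thesis
    using j unfolding primitive_of_def by (intro conjI ballI Bochner_Integration.integrable_add)
qed

lemma primitive_of_C1:
  fixes F f :: "real \<Rightarrow> real"
  assumes F: "\<And>x. (F has_real_derivative f x) (at x)" and f: "continuous_on {0..1} f"
  shows "primitive_of F f"
proof -
  note i = lebI_integral_continuous(1)[OF f]
  have "F x = F 0 + prim f x" if x: "x \<in> {0..1}" for x
  proof -
    have "prim f x = integral {0<..<1} (\<lambda>s. if s \<in> {..<x} then f s else 0)"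
      unfolding prim_def using lebesgue_integral_eq_integral[OF integrable_cutoff[OF i], of x] by simp
    also have "\<dots> = integral ({..<x} \<inter> {0<..<1}) f" by (rule integral_restrict_Int)
    also have "{..<x} \<inter> {0<..<1} = {0<..<x}" using x by auto
    also have "integral {0<..<x} f = integral {0..x} f" using integral_open_interval[of 0 x f] by simp
    also have "\<dots> = F x - F 0"
      using x F by (intro integral_unique fundamental_theorem_of_calculus)
        (auto simp: has_real_derivative_iff_has_vector_derivative[symmetric] intro: has_field_derivative_at_within)
    finally show ?thesis by simp
  qed
  with i show ?thesis unfolding primitive_of_def by blast
qed

lemma primitive_of_test_fun: "test_fun \<psi> \<Longrightarrow> primitive_of \<psi> (deriv \<psi>)"
  by (intro primitive_of_C1 test_fun_has_derivative test_fun_continuous test_fun_deriv)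

lemma integration_by_parts_test:
  fixes F f :: "real \<Rightarrow> complex"
  assumes F: "primitive_of F f" and \<psi>: "test_fun \<psi>"
  shows "(\<integral>x. deriv \<psi> x *\<^sub>R F x \<partial>lebI) = - (\<integral>x. \<psi> x *\<^sub>R f x \<partial>lebI)"
proof -
  note i = primitive_ofD(1)[OF F]
  have iF: "integrable lebI F" by (rule lebI_integral_continuous(1)[OF primitive_of_continuous[OF F]])
  have real: "(\<integral>x. deriv \<psi> x * H x \<partial>lebI) = - (\<integral>x. \<psi> x * h x \<partial>lebI)"
    if H: "primitive_of H h" for H h :: "real \<Rightarrow> real"
  proof -
    have "(\<integral>x. deriv \<psi> x * H x + \<psi> x * h x \<partial>lebI) = 0"
      using primitive_ofD(3)[OF primitive_of_mult[OF primitive_of_test_fun[OF \<psi>] H]]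
      by (simp add: test_fun_zero_outside[OF \<psi>])
    moreover have "integrable lebI (\<lambda>x. deriv \<psi> x * H x)" "integrable lebI (\<lambda>x. \<psi> x * h x)"
      using integrable_test_mult[OF test_fun_deriv[OF \<psi>], of H] integrable_test_mult[OF \<psi>, of h]
        lebI_integral_continuous(1)[OF primitive_of_continuous[OF H]] primitive_ofD(1)[OF H] by auto
    ultimately show ?thesis by simp
  qed
  show ?thesis
  proof (rule complex_eqI)
    show "Re (\<integral>x. deriv \<psi> x *\<^sub>R F x \<partial>lebI) = Re (- (\<integral>x. \<psi> x *\<^sub>R f x \<partial>lebI))"
      using real[OF primitive_of_Re[OF F]]
        integral_Re[OF integrable_test_mult[OF test_fun_deriv[OF \<psi>] iF]] integral_Re[OF integrable_test_mult[OF \<psi> i]]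
      by simp
    show "Im (\<integral>x. deriv \<psi> x *\<^sub>R F x \<partial>lebI) = Im (- (\<integral>x. \<psi> x *\<^sub>R f x \<partial>lebI))"
      using real[OF primitive_of_Im[OF F]]
        integral_Im[OF integrable_test_mult[OF test_fun_deriv[OF \<psi>] iF]] integral_Im[OF integrable_test_mult[OF \<psi> i]]
      by simp
  qed
qed

section \<open>Weak derivatives\<close>

definition test_pairing :: "(real \<Rightarrow> real) \<Rightarrow> L2I \<Rightarrow> complex" where
  "test_pairing \<psi> v = (\<integral>x. \<psi> x *\<^sub>R rep_L2 v x \<partial>lebI)"

lemma has_weak_deriv_iff:
  "has_weak_deriv n v w \<longleftrightarrow> (\<forall>\<psi>. test_fun \<psi> \<longrightarrow> test_pairing ((deriv ^^ n) \<psi>) v = (-1) ^ n * test_pairing \<psi> w)"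
  by (simp add: has_weak_deriv_def test_pairing_def)

lemma test_pairing_AE:
  assumes "test_fun \<psi>" "sq_integrable f" "AE x in lebI. rep_L2 v x = f x"
  shows "test_pairing \<psi> v = (\<integral>x. \<psi> x *\<^sub>R f x \<partial>lebI)"
  unfolding test_pairing_def
proof (rule integral_cong_AE)
  show "(\<lambda>x. \<psi> x *\<^sub>R rep_L2 v x) \<in> borel_measurable lebI" "(\<lambda>x. \<psi> x *\<^sub>R f x) \<in> borel_measurable lebI"
    using integrable_test_mult[OF assms(1) integrable_rep] integrable_test_mult[OF assms(1) sq_integrable_imp_integrable[OF assms(2)]]
    by (auto dest: borel_measurable_integrable)
qed (use assms(3) in \<open>auto elim: eventually_mono\<close>)

lemma bounded_linear_test_pairing:
  assumes \<psi>: "test_fun \<psi>" shows "bounded_linear (test_pairing \<psi>)"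
proof -
  obtain B where B: "\<And>x. \<bar>\<psi> x\<bar> \<le> B" "B \<ge> 0" using test_fun_bounded[OF \<psi>] by blast
  note i = integrable_test_mult[OF \<psi> integrable_rep]
  show ?thesis
  proof (rule bounded_linear_intro[where K = B])
    fix v w :: L2I and r :: real
    have "test_pairing \<psi> (v + w) = (\<integral>x. \<psi> x *\<^sub>R (rep_L2 v x + rep_L2 w x) \<partial>lebI)"
      by (rule test_pairing_AE[OF \<psi>]) (auto intro: sq_integrable_add rep_plus)
    then show "test_pairing \<psi> (v + w) = test_pairing \<psi> v + test_pairing \<psi> w"
      using i by (simp add: test_pairing_def scaleR_add_right)
    have "test_pairing \<psi> (r *\<^sub>R v) = (\<integral>x. \<psi> x *\<^sub>R (r *\<^sub>R rep_L2 v x) \<partial>lebI)"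
      by (rule test_pairing_AE[OF \<psi>]) (auto simp: scaleR_conv_of_real intro: sq_integrable_mult rep_scaleR[unfolded scaleR_conv_of_real])
    also have "\<dots> = r *\<^sub>R test_pairing \<psi> v"
      unfolding test_pairing_def scaleR_left_commute[of _ r] by (rule integral_scaleR_right)
    finally show "test_pairing \<psi> (r *\<^sub>R v) = r *\<^sub>R test_pairing \<psi> v" .
    have "norm (test_pairing \<psi> v) \<le> (\<integral>x. norm (\<psi> x *\<^sub>R rep_L2 v x) \<partial>lebI)"
      unfolding test_pairing_def by (rule integral_norm_bound)
    also have "\<dots> \<le> (\<integral>x. B * cmod (rep_L2 v x) \<partial>lebI)"
    proof (rule integral_mono)
      show "integrable lebI (\<lambda>x. norm (\<psi> x *\<^sub>R rep_L2 v x))" using i by (rule integrable_norm)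
      show "integrable lebI (\<lambda>x. B * cmod (rep_L2 v x))" by (intro integrable_mult_right integrable_norm integrable_rep)
      show "norm (\<psi> x *\<^sub>R rep_L2 v x) \<le> B * cmod (rep_L2 v x)" for x
        using B(1)[of x] by (auto intro: mult_right_mono)
    qed
    also have "\<dots> \<le> norm v * B"
      using L1_norm_le_L2[of v] B(2) by (simp add: mult.commute mult_left_mono)
    finally show "norm (test_pairing \<psi> v) \<le> norm v * B" .
  qed
qed

lemma test_pairing_scaleC: "test_fun \<psi> \<Longrightarrow> test_pairing \<psi> (scaleC_L2 c v) = c * test_pairing \<psi> v"
proof -
  assume \<psi>: "test_fun \<psi>"
  have "test_pairing \<psi> (scaleC_L2 c v) = (\<integral>x. \<psi> x *\<^sub>R (c * rep_L2 v x) \<partial>lebI)"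
    by (rule test_pairing_AE[OF \<psi>]) (auto intro: sq_integrable_mult rep_scaleC)
  also have "\<dots> = (\<integral>x. c * (\<psi> x *\<^sub>R rep_L2 v x) \<partial>lebI)" by simp
  also have "\<dots> = c * test_pairing \<psi> v" unfolding test_pairing_def by (rule integral_mult_right_zero)
  finally show ?thesis .
qed

lemma test_pairing_cnj: "test_fun \<psi> \<Longrightarrow> test_pairing \<psi> (cnj_L2 v) = cnj (test_pairing \<psi> v)"
proof -
  assume \<psi>: "test_fun \<psi>"
  have "test_pairing \<psi> (cnj_L2 v) = (\<integral>x. \<psi> x *\<^sub>R (cnj (rep_L2 v x)) \<partial>lebI)"
    by (rule test_pairing_AE[OF \<psi>]) (auto intro: sq_integrable_cnj rep_cnj_L2)
  also have "\<dots> = (\<integral>x. cnj (\<psi> x *\<^sub>R rep_L2 v x) \<partial>lebI)" by simp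
  also have "\<dots> = cnj (test_pairing \<psi> v)" unfolding test_pairing_def
    by (rule integral_bounded_linear[OF bounded_linear_cnj integrable_test_mult[OF \<psi> integrable_rep]])
  finally show ?thesis .
qed

lemma test_pairing_zeroD:
  assumes "\<And>\<psi>. test_fun \<psi> \<Longrightarrow> test_pairing \<psi> v = 0" shows "v = 0"
proof (rule L2_eqI)
  have "AE x in lebI. rep_L2 v x = 0"
    using assms by (intro AE_zero_of_test) (auto simp: test_pairing_def)
  then show "AE x in lebI. rep_L2 v x = rep_L2 0 x"
    using rep_zero by eventually_elim simp
qed

lemma has_weak_deriv_unique:
  assumes "has_weak_deriv n v w" "has_weak_deriv n v w'" shows "w = w'"
proof -
  have "w - w' = 0"
  proof (rule test_pairing_zeroD)
    fix \<psi> assume \<psi>: "test_fun \<psi>"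
    interpret bounded_linear "test_pairing \<psi>" by (rule bounded_linear_test_pairing[OF \<psi>])
    show "test_pairing \<psi> (w - w') = 0"
      using assms \<psi> unfolding has_weak_deriv_iff diff by (metis mult_cancel_left power_not_zero right_minus_eq zero_neq_neg_one)
  qed
  then show ?thesis by simp
qed

lemma wderiv_eqI: "has_weak_deriv n v w \<Longrightarrow> wderiv n v = w"
  unfolding wderiv_def using has_weak_deriv_unique by (blast intro: the_equality)

lemma has_weak_deriv_0 [simp, intro]: "has_weak_deriv 0 v v"
  by (simp add: has_weak_deriv_def)

lemma wderiv_0 [simp]: "wderiv 0 v = v"
  by (simp add: wderiv_eqI)

lemma has_weak_deriv_wderiv: "v \<in> sobolev m \<Longrightarrow> j \<le> m \<Longrightarrow> has_weak_deriv j v (wderiv j v)"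
  unfolding sobolev_def using wderiv_eqI by auto

lemma has_weak_deriv_add:
  assumes "has_weak_deriv n v w" "has_weak_deriv n v' w'" shows "has_weak_deriv n (v + v') (w + w')"
  unfolding has_weak_deriv_iff
  using assms bounded_linear_test_pairing[THEN bounded_linear.linear, THEN linear_add] test_fun_funpow
  by (simp add: has_weak_deriv_iff distrib_left)

lemma has_weak_deriv_scaleC:
  assumes "has_weak_deriv n v w" shows "has_weak_deriv n (scaleC_L2 c v) (scaleC_L2 c w)"
  using assms test_fun_funpow by (simp add: has_weak_deriv_iff test_pairing_scaleC)

lemma has_weak_deriv_scaleR:
  assumes "has_weak_deriv n v w" shows "has_weak_deriv n (r *\<^sub>R v) (r *\<^sub>R w)"
  unfolding has_weak_deriv_iff
  using assms bounded_linear_test_pairing[THEN bounded_linear.linear, THEN linear_scale] test_fun_funpow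
  by (simp add: has_weak_deriv_iff)

lemma has_weak_deriv_cnj:
  assumes "has_weak_deriv n v w" shows "has_weak_deriv n (cnj_L2 v) (cnj_L2 w)"
  using assms test_fun_funpow by (simp add: has_weak_deriv_iff test_pairing_cnj)

lemma has_weak_deriv_limit:
  assumes "\<And>k. has_weak_deriv n (v k) (w k)" "v \<longlonglongrightarrow> v'" "w \<longlonglongrightarrow> w'" shows "has_weak_deriv n v' w'"
  unfolding has_weak_deriv_iff
proof (intro allI impI)
  fix \<psi> assume \<psi>: "test_fun \<psi>"
  have "(\<lambda>k. test_pairing ((deriv ^^ n) \<psi>) (v k)) \<longlonglongrightarrow> test_pairing ((deriv ^^ n) \<psi>) v'"
    by (rule bounded_linear.tendsto[OF bounded_linear_test_pairing[OF test_fun_funpow[OF \<psi>]] assms(2)])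
  moreover have "(\<lambda>k. (-1) ^ n * test_pairing \<psi> (w k)) \<longlonglongrightarrow> (-1) ^ n * test_pairing \<psi> w'"
    by (intro tendsto_mult_left bounded_linear.tendsto[OF bounded_linear_test_pairing[OF \<psi>] assms(3)])
  ultimately show "test_pairing ((deriv ^^ n) \<psi>) v' = (-1) ^ n * test_pairing \<psi> w'"
    using assms(1) \<psi> by (auto simp: has_weak_deriv_iff intro: LIMSEQ_unique)
qed

lemma has_weak_deriv_step:
  assumes "has_weak_deriv j v w" "has_weak_deriv (Suc j) v z" shows "has_weak_deriv 1 w z"
  unfolding has_weak_deriv_iff
proof (intro allI impI)
  fix \<psi> assume \<psi>: "test_fun \<psi>"
  have "(-1) ^ j * test_pairing (deriv \<psi>) w = test_pairing ((deriv ^^ Suc j) \<psi>) v"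
    using assms(1) test_fun_deriv[OF \<psi>] unfolding has_weak_deriv_iff deriv_funpow_swap[symmetric] by simp
  also have "\<dots> = (-1) ^ Suc j * test_pairing \<psi> z"
    using assms(2) \<psi> unfolding has_weak_deriv_iff by blast
  also have "\<dots> = (-1) ^ j * (- test_pairing \<psi> z)" by simp
  finally have "test_pairing (deriv \<psi>) w = - test_pairing \<psi> z"
    unfolding mult_cancel_left by simp
  then show "test_pairing ((deriv ^^ 1) \<psi>) w = (-1) ^ 1 * test_pairing \<psi> z" by simp
qed

lemma has_weak_deriv_Suc:
  assumes "has_weak_deriv 1 v w" "has_weak_deriv n w z" shows "has_weak_deriv (Suc n) v z"
  unfolding has_weak_deriv_iff
proof (intro allI impI)
  fix \<psi> assume \<psi>: "test_fun \<psi>"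
  have "test_pairing ((deriv ^^ Suc n) \<psi>) v = - test_pairing ((deriv ^^ n) \<psi>) w"
    using assms(1) test_fun_funpow[OF \<psi>, of n] unfolding has_weak_deriv_iff by simp
  then show "test_pairing ((deriv ^^ Suc n) \<psi>) v = (-1) ^ Suc n * test_pairing \<psi> z"
    using assms(2) \<psi> by (simp add: has_weak_deriv_iff)
qed

lemma has_weak_deriv_of_primitive:
  assumes F: "primitive_of F f" "sq_integrable f"
  shows "has_weak_deriv 1 (abs_L2 F) (abs_L2 f)"
  unfolding has_weak_deriv_iff
proof (intro allI impI)
  fix \<psi> assume \<psi>: "test_fun \<psi>"
  have "continuous_on {0..1} F" by (rule primitive_of_continuous[OF F(1)])
  then have "continuous_on {0..1} (\<lambda>x. (cmod (F x))\<^sup>2)" by (intro continuous_intros)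
  then have sF: "sq_integrable F"
    using lebI_integral_continuous(1)[OF primitive_of_continuous[OF F(1)]] lebI_integral_continuous(1)
    by (auto simp: sq_integrable_def)
  have "test_pairing (deriv \<psi>) (abs_L2 F) = (\<integral>x. deriv \<psi> x *\<^sub>R F x \<partial>lebI)"
    by (intro test_pairing_AE test_fun_deriv \<psi> sF rep_abs_L2)
  also have "\<dots> = - (\<integral>x. \<psi> x *\<^sub>R f x \<partial>lebI)" by (rule integration_by_parts_test[OF F(1) \<psi>])
  also have "(\<integral>x. \<psi> x *\<^sub>R f x \<partial>lebI) = test_pairing \<psi> (abs_L2 f)"
    by (intro test_pairing_AE[symmetric] \<psi> F rep_abs_L2)
  finally show "test_pairing ((deriv ^^ 1) \<psi>) (abs_L2 F) = (-1) ^ 1 * test_pairing \<psi> (abs_L2 f)" by simp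
qed

subsection \<open>Continuous representatives\<close>

text \<open>The primitive vanishes to the right of the support because the total integral is \<open>0\<close>.\<close>

lemma test_fun_primitive:
  assumes \<eta>: "test_fun \<eta>" and z: "(\<integral>x. \<eta> x \<partial>lebI) = 0"
  shows "\<exists>\<psi>. test_fun \<psi> \<and> deriv \<psi> = \<eta>"
proof -
  obtain a b where ab: "0 < a" "b < 1" "\<And>x. x \<notin> {a..b} \<Longrightarrow> \<eta> x = 0"
    using \<eta> unfolding test_fun_def by blast
  define a' b' where "a' = min a (1/2)" and "b' = max b (1/2)"
  have ab': "0 < a'" "a' < 1" "b' < 1" "a' \<le> b'" "0 < b'" "\<And>x. x \<notin> {a'..b'} \<Longrightarrow> \<eta> x = 0"
  proof -
    show "\<eta> x = 0" if "x \<notin> {a'..b'}" for x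
      using that by (intro ab(3)) (auto simp: a'_def b'_def min_def max_def split: if_splits)
  qed (use ab in \<open>auto simp: a'_def b'_def\<close>)
  have c: "continuous_on S \<eta>" for S by (rule test_fun_continuous[OF \<eta>])
  define \<psi> where "\<psi> x = integral {0..x} \<eta>" for x
  have left: "\<psi> x = 0" if "x < a'" for x
  proof -
    have "\<psi> x = integral {0..x} (\<lambda>_. 0)" unfolding \<psi>_def
      by (rule Henstock_Kurzweil_Integration.integral_cong) (use that ab'(6) in auto)
    then show ?thesis by simp
  qed
  have tot: "integral {0..1} \<eta> = 0" using lebI_integral_continuous(2)[OF c] z by simp
  have right: "\<psi> x = 0" if x: "x > b'" for x
  proof -
    have i: "\<eta> integrable_on {s..t}" for s t by (rule integrable_continuous_real[OF c])
    have zero: "integral {s..t} \<eta> = 0" if "s > b'" for s t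
    proof -
      have "integral {s..t} \<eta> = integral {s..t} (\<lambda>_. 0)"
        by (rule Henstock_Kurzweil_Integration.integral_cong) (use that ab'(6) in auto)
      then show ?thesis by simp
    qed
    show ?thesis
    proof (cases "x \<le> 1")
      case True
      have "integral {0..x} \<eta> + integral {x..1} \<eta> = integral {0..1} \<eta>"
        using True x ab' by (intro Henstock_Kurzweil_Integration.integral_combine i) auto
      then show ?thesis using zero[OF x] tot by (simp add: \<psi>_def)
    next
      case False
      have "integral {0..1} \<eta> + integral {1..x} \<eta> = integral {0..x} \<eta>"
        using False by (intro Henstock_Kurzweil_Integration.integral_combine i) auto
      then show ?thesis using zero[of 1] ab' tot by (simp add: \<psi>_def)
    qed
  qed
  have der: "(\<psi> has_real_derivative \<eta> x) (at x)" for x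
  proof (cases "x \<in> {a'..b'}")
    case True
    then have "((\<lambda>x. integral {0..x} \<eta>) has_real_derivative \<eta> x) (at x within {0..1})"
      using ab' by (intro integral_has_real_derivative c) auto
    moreover have "at x within {0..1} = at x"
      using True ab' by (intro at_within_interior) auto
    ultimately show ?thesis by (simp add: \<psi>_def[abs_def])
  next
    case False
    then have "(\<psi> has_real_derivative 0) (at x)"
      by (subst DERIV_cong_ev[OF refl _ refl, of _ "\<lambda>_. 0"])
         (use left right in \<open>auto simp: eventually_nhds intro!: exI[of _ "- {a'..b'}"]\<close>)
    then show ?thesis using ab'(6)[OF False] by simp
  qed
  then have d: "deriv \<psi> = \<eta>" by (auto intro: DERIV_imp_deriv)
  have "(deriv ^^ n) \<psi> differentiable (at x)" for n x
  proof (cases n)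
    case 0
    then show ?thesis using der by (auto simp: real_differentiable_def)
  next
    case (Suc m)
    then have "(deriv ^^ n) \<psi> = (deriv ^^ m) \<eta>" using deriv_funpow_swap[of m \<psi>] d by simp
    then show ?thesis using \<eta> by (simp add: test_fun_def)
  qed
  moreover have "\<forall>x. x \<notin> {a'..b'} \<longrightarrow> \<psi> x = 0" using left right by auto
  ultimately show ?thesis using d ab' unfolding test_fun_def by blast
qed

lemma test_fun_lincomb:
  assumes "test_fun \<eta>" "test_fun \<rho>" shows "test_fun (\<lambda>x. \<eta> x - c * \<rho> x)"
proof -
  have d: "(deriv ^^ n) (\<lambda>x. \<eta> x - c * \<rho> x) = (\<lambda>x. (deriv ^^ n) \<eta> x - c * (deriv ^^ n) \<rho> x)" for n
  proof (induction n)
    case (Suc n)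
    have "deriv (\<lambda>x. (deriv ^^ n) \<eta> x - c * (deriv ^^ n) \<rho> x) = (\<lambda>x. deriv ((deriv ^^ n) \<eta>) x - c * deriv ((deriv ^^ n) \<rho>) x)"
      using test_fun_has_derivative[OF test_fun_funpow[OF assms(1), of n]] test_fun_has_derivative[OF test_fun_funpow[OF assms(2), of n]]
      by (intro ext DERIV_imp_deriv DERIV_diff DERIV_cmult) auto
    then show ?case using Suc by simp
  qed simp
  obtain a b a' b' where ab: "0 < a" "b < 1" "\<And>x. x \<notin> {a..b} \<Longrightarrow> \<eta> x = 0" "0 < a'" "b' < 1" "\<And>x. x \<notin> {a'..b'} \<Longrightarrow> \<rho> x = 0"
    using assms unfolding test_fun_def by metis
  have "\<forall>x. x \<notin> {min a a'..max b b'} \<longrightarrow> \<eta> x - c * \<rho> x = 0"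
  proof (intro allI impI)
    fix x assume "x \<notin> {min a a'..max b b'}"
    then have "x \<notin> {a..b}" "x \<notin> {a'..b'}" by (auto simp: min_def max_def split: if_splits)
    then show "\<eta> x - c * \<rho> x = 0" using ab by simp
  qed
  moreover have "0 < min a a'" "max b b' < 1" using ab by auto
  moreover have "(\<lambda>x. (deriv ^^ n) \<eta> x - c * (deriv ^^ n) \<rho> x) differentiable (at x)" for n x
    using assms by (auto simp: test_fun_def)
  ultimately show ?thesis unfolding test_fun_def d by blast
qed

text \<open>With a fixed test function \<open>\<rho>\<close> of non-zero integral, every test function is a multiple of \<open>\<rho>\<close> plus the
  derivative of a test function.\<close>

lemma AE_const_of_test_deriv:
  fixes g :: "real \<Rightarrow> complex"
  assumes g: "integrable lebI g"
    and z: "\<And>\<psi>. test_fun \<psi> \<Longrightarrow> (\<integral>x. deriv \<psi> x *\<^sub>R g x \<partial>lebI) = 0"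
  shows "\<exists>c. AE x in lebI. g x = c"
proof -
  have "\<not> (AE x in lebI. (1::real) = 0)"
  proof
    assume "AE x in lebI. (1::real) = 0"
    then have "(\<integral>x. (1::real) \<partial>lebI) = (\<integral>x. 0 \<partial>lebI)"
      by (intro integral_cong_AE) auto
    then show False by (simp add: measure_restrict_space)
  qed
  then obtain \<rho> where \<rho>: "test_fun \<rho>" "(\<integral>x. \<rho> x \<partial>lebI) \<noteq> 0"
    using AE_zero_of_test_real[of "\<lambda>_. 1"] by auto
  define c where "c = (\<integral>x. \<rho> x *\<^sub>R g x \<partial>lebI) / of_real (\<integral>x. \<rho> x \<partial>lebI)"
  have "AE x in lebI. g x - c = 0"
  proof (rule AE_zero_of_test)
    show "integrable lebI (\<lambda>x. g x - c)" using g by simp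
    fix \<eta> assume \<eta>: "test_fun \<eta>"
    define k where "k = (\<integral>x. \<eta> x \<partial>lebI) / (\<integral>x. \<rho> x \<partial>lebI)"
    have i: "integrable lebI \<eta>" "integrable lebI \<rho>"
      using integrable_test_mult[OF \<eta>, of "\<lambda>_. 1 :: real"] integrable_test_mult[OF \<rho>(1), of "\<lambda>_. 1 :: real"] by auto
    have "(\<integral>x. \<eta> x - k * \<rho> x \<partial>lebI) = 0" using i \<rho>(2) by (simp add: k_def)
    then obtain \<psi> where \<psi>: "test_fun \<psi>" "deriv \<psi> = (\<lambda>x. \<eta> x - k * \<rho> x)"
      using test_fun_primitive[OF test_fun_lincomb[OF \<eta> \<rho>(1)]] by blast
    have "0 = (\<integral>x. (\<eta> x - k * \<rho> x) *\<^sub>R g x \<partial>lebI)" using z[OF \<psi>(1)] \<psi>(2) by simp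
    also have "\<dots> = (\<integral>x. \<eta> x *\<^sub>R g x - k *\<^sub>R (\<rho> x *\<^sub>R g x) \<partial>lebI)" by (simp add: scaleR_diff_left)
    also have "\<dots> = (\<integral>x. \<eta> x *\<^sub>R g x \<partial>lebI) - (\<integral>x. k *\<^sub>R (\<rho> x *\<^sub>R g x) \<partial>lebI)"
      using integrable_test_mult[OF \<eta> g] integrable_test_mult[OF \<rho>(1) g]
      by (intro Bochner_Integration.integral_diff integrable_scaleR_right)
    also have "\<dots> = (\<integral>x. \<eta> x *\<^sub>R g x \<partial>lebI) - k *\<^sub>R (\<integral>x. \<rho> x *\<^sub>R g x \<partial>lebI)"
      by (simp only: integral_scaleR_right)
    finally have e: "(\<integral>x. \<eta> x *\<^sub>R g x \<partial>lebI) = k *\<^sub>R (\<integral>x. \<rho> x *\<^sub>R g x \<partial>lebI)" by simp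
    have "(\<integral>x. \<eta> x *\<^sub>R (g x - c) \<partial>lebI) = (\<integral>x. \<eta> x *\<^sub>R g x - \<eta> x *\<^sub>R c \<partial>lebI)" by (simp add: scaleR_diff_right)
    also have "\<dots> = (\<integral>x. \<eta> x *\<^sub>R g x \<partial>lebI) - (\<integral>x. \<eta> x \<partial>lebI) *\<^sub>R c"
      using integrable_test_mult[OF \<eta> g] i by simp
    also have "\<dots> = 0" unfolding e k_def c_def using \<rho>(2) by (simp add: scaleR_conv_of_real)
    finally show "(\<integral>x. \<eta> x *\<^sub>R (g x - c) \<partial>lebI) = 0" .
  qed
  then show ?thesis by auto
qed

lemma continuous_AE_eq_imp_eq:
  fixes g g' :: "real \<Rightarrow> complex"
  assumes "continuous_on {0..1} g" "continuous_on {0..1} g'" "AE x in lebI. g x = g' x" "p \<in> {0..1}"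
  shows "g p = g' p"
proof -
  let ?h = "\<lambda>x. cmod (g x - g' x)"
  have c: "continuous_on {0..1} ?h" using assms by (intro continuous_intros)
  have "(\<integral>x. ?h x \<partial>lebI) = (\<integral>x. 0 \<partial>lebI)"
    using lebI_integral_continuous(1)[OF c] assms(3) by (intro integral_cong_AE) (auto elim: eventually_mono)
  then have "integral {0..1} ?h = 0" using lebI_integral_continuous(2)[OF c] by simp
  then have "\<forall>x\<in>{0..1}. ?h x = 0" using integral_eq_0_iff[OF c] by auto
  then show ?thesis using assms(4) by auto
qed

lemma trace_at_eqI:
  assumes "continuous_on {0..1} g" "AE x in lebI. rep_L2 v x = g x" "p \<in> {0..1}"
  shows "trace_at v p = g p"
  unfolding trace_at_def
proof (rule the_equality)
  show "\<exists>g'. continuous_on {0..1} g' \<and> (AE x in lebI. rep_L2 v x = g' x) \<and> g' p = g p"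
    using assms by blast
  fix c assume "\<exists>g'. continuous_on {0..1} g' \<and> (AE x in lebI. rep_L2 v x = g' x) \<and> g' p = c"
  then obtain g' where g': "continuous_on {0..1} g'" "AE x in lebI. rep_L2 v x = g' x" "g' p = c" by blast
  have "AE x in lebI. g x = g' x" using assms(2) g'(2) by eventually_elim simp
  then show "c = g p" using continuous_AE_eq_imp_eq[OF assms(1) g'(1) _ assms(3)] g'(3) by simp
qed

text \<open>The difference of \<open>v\<close> and the primitive of its weak derivative is almost everywhere constant. So \<open>v\<close> has an
  absolutely continuous representative, and this is the one whose values \<open>trace_at\<close> takes.\<close>

lemma weak_deriv_primitive:
  assumes "has_weak_deriv 1 v w"
  shows "primitive_of (trace_at v) (rep_L2 w)" "AE x in lebI. rep_L2 v x = trace_at v x"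
proof -
  let ?V = "prim (rep_L2 w)"
  have i: "integrable lebI (rep_L2 w)" by simp
  have P: "primitive_of ?V (rep_L2 w)" by (simp add: primitive_of_def)
  have iV: "integrable lebI ?V" by (rule lebI_integral_continuous(1)[OF primitive_of_continuous[OF P]])
  have "(\<integral>x. deriv \<psi> x *\<^sub>R (rep_L2 v x - ?V x) \<partial>lebI) = 0" if \<psi>: "test_fun \<psi>" for \<psi>
  proof -
    have "(\<integral>x. deriv \<psi> x *\<^sub>R rep_L2 v x \<partial>lebI) = - (\<integral>x. \<psi> x *\<^sub>R rep_L2 w x \<partial>lebI)"
      using assms \<psi> by (simp add: has_weak_deriv_def)
    then show ?thesis
      using integration_by_parts_test[OF P \<psi>] integrable_test_mult[OF test_fun_deriv[OF \<psi>] iV]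
        integrable_test_mult[OF test_fun_deriv[OF \<psi>] integrable_rep[of v]]
      by (simp add: scaleR_diff_right)
  qed
  then obtain c where c: "AE x in lebI. rep_L2 v x - ?V x = c"
    using AE_const_of_test_deriv[of "\<lambda>x. rep_L2 v x - ?V x"] iV by auto
  let ?g = "\<lambda>x. c + ?V x"
  have g: "AE x in lebI. rep_L2 v x = ?g x" using c by eventually_elim (simp add: algebra_simps)
  have cg: "continuous_on {0..1} ?g"
    by (intro continuous_intros primitive_of_continuous[OF P])
  have t: "trace_at v x = ?g x" if "x \<in> {0..1}" for x by (rule trace_at_eqI[OF cg g that])
  have "AE x in lebI. x \<in> {0..1}" by (rule AE_I2) simp
  with g show "AE x in lebI. rep_L2 v x = trace_at v x"
    by eventually_elim (simp add: t)
  show "primitive_of (trace_at v) (rep_L2 w)"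
    by (simp add: primitive_of_def t)
qed

section \<open>Interpolation inequalities\<close>

lemma primitive_of_AE_cong:
  assumes "primitive_of F f" "AE x in lebI. f x = g x" "g \<in> borel_measurable lebI"
  shows "primitive_of F g"
proof -
  note f = primitive_ofD(1)[OF assms(1)]
  have m: "f \<in> borel_measurable lebI" using f by (rule borel_measurable_integrable)
  have "integrable lebI g" using f integrable_cong_AE[OF m assms(3,2)] by simp
  moreover have "prim f = prim g"
    unfolding prim_def[abs_def]
    by (intro ext integral_cong_AE cutoff_measurable m assms(3)) (use assms(2) in \<open>auto elim: eventually_mono\<close>)
  ultimately show ?thesis using assms(1) unfolding primitive_of_def by metis
qed

lemma weak_deriv_trace_measurable:
  assumes "has_weak_deriv 1 v w" shows "trace_at v \<in> borel_measurable lebI"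
  using lebI_integral_continuous(1)[OF primitive_of_continuous[OF weak_deriv_primitive(1)[OF assms]]]
  by (rule borel_measurable_integrable)

lemma weak_deriv_primitive_trace:
  assumes "has_weak_deriv 1 v w" "has_weak_deriv 1 w z"
  shows "primitive_of (trace_at v) (trace_at w)"
  by (rule primitive_of_AE_cong[OF weak_deriv_primitive(1)[OF assms(1)] weak_deriv_primitive(2)[OF assms(2)]
      weak_deriv_trace_measurable[OF assms(2)]])

lemma cmod_sq_Re: "(cmod z)\<^sup>2 = Re (z * cnj z)"
  unfolding cmod_power2 by (simp add: power2_eq_square)

lemma integral_norm_mult_le: "(\<integral>x. cmod (rep_L2 v x) * cmod (rep_L2 w x) \<partial>lebI) \<le> norm v * norm w"
  "integrable lebI (\<lambda>x. cmod (rep_L2 v x) * cmod (rep_L2 w x))"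
proof -
  let ?a = "\<lambda>v. abs_L2 (\<lambda>x. of_real (cmod (rep_L2 v x)))"
  have s: "sq_integrable (\<lambda>x. complex_of_real (cmod (rep_L2 v x)))" for v
    using sq_integrable_rep[of v] by (auto simp: sq_integrable_def)
  have n: "norm (?a v) = norm v" for v using s by (simp add: norm_abs_L2 norm_L2[of v])
  show i: "integrable lebI (\<lambda>x. cmod (rep_L2 v x) * cmod (rep_L2 w x))"
    using integrable_norm[OF integrable_mult_sq[OF sq_integrable_rep[of v] sq_integrable_rep[of w]]] by (simp add: norm_mult)
  have "(\<integral>x. cmod (rep_L2 v x) * cmod (rep_L2 w x) \<partial>lebI) = inner (?a v) (?a w)"
    unfolding inner_L2I_def
  proof (rule integral_cong_AE)
    show "AE x in lebI. cmod (rep_L2 v x) * cmod (rep_L2 w x) = Re (rep_L2 (?a v) x * cnj (rep_L2 (?a w) x))"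
      using rep_abs_L2[OF s[of v]] rep_abs_L2[OF s[of w]] by eventually_elim simp
  qed (use i integrable_inner_L2 in \<open>auto dest: borel_measurable_integrable\<close>)
  also have "\<dots> \<le> norm (?a v) * norm (?a w)" by (rule norm_cauchy_schwarz)
  finally show "(\<integral>x. cmod (rep_L2 v x) * cmod (rep_L2 w x) \<partial>lebI) \<le> norm v * norm w" by (simp add: n)
qed

lemma primitive_of_Re_mult_cnj:
  assumes "primitive_of F f" "primitive_of G g"
  shows "primitive_of (\<lambda>x. Re (F x * cnj (G x))) (\<lambda>x. Re (f x * cnj (G x)) + Re (F x * cnj (g x)))"
proof -
  have e: "(\<lambda>x. Re (F x * cnj (G x))) = (\<lambda>x. Re (F x) * Re (G x) + Im (F x) * Im (G x))" by auto
  show ?thesis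
    unfolding e using primitive_of_add[OF primitive_of_mult[OF primitive_of_Re[OF assms(1)] primitive_of_Re[OF assms(2)]]
      primitive_of_mult[OF primitive_of_Im[OF assms(1)] primitive_of_Im[OF assms(2)]]]
    by (simp add: algebra_simps)
qed

lemma inner_by_parts:
  assumes v: "has_weak_deriv 1 v v'" and w: "has_weak_deriv 1 w w'"
  shows "inner v' w + inner v w' = Re (trace_at v 1 * cnj (trace_at w 1)) - Re (trace_at v 0 * cnj (trace_at w 0))"
proof -
  note P = primitive_of_Re_mult_cnj[OF weak_deriv_primitive(1)[OF v] weak_deriv_primitive(1)[OF w]]
  have "inner v' w + inner v w' = (\<integral>x. Re (rep_L2 v' x * cnj (rep_L2 w x)) + Re (rep_L2 v x * cnj (rep_L2 w' x)) \<partial>lebI)"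
    unfolding inner_L2I_def using integrable_inner_L2 by simp
  also have "\<dots> = (\<integral>x. Re (rep_L2 v' x * cnj (trace_at w x)) + Re (trace_at v x * cnj (rep_L2 w' x)) \<partial>lebI)"
  proof (rule integral_cong_AE)
    show "AE x in lebI. Re (rep_L2 v' x * cnj (rep_L2 w x)) + Re (rep_L2 v x * cnj (rep_L2 w' x))
        = Re (rep_L2 v' x * cnj (trace_at w x)) + Re (trace_at v x * cnj (rep_L2 w' x))"
      using weak_deriv_primitive(2)[OF v] weak_deriv_primitive(2)[OF w] by eventually_elim simp
    show "(\<lambda>x. Re (rep_L2 v' x * cnj (rep_L2 w x)) + Re (rep_L2 v x * cnj (rep_L2 w' x))) \<in> borel_measurable lebI"
      by (intro borel_measurable_add borel_measurable_integrable integrable_inner_L2)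
  qed (use primitive_ofD(1)[OF P] in \<open>rule borel_measurable_integrable\<close>)
  also have "\<dots> = Re (trace_at v 1 * cnj (trace_at w 1)) - Re (trace_at v 0 * cnj (trace_at w 0))"
    by (rule primitive_ofD(3)[OF P])
  finally show ?thesis .
qed

text \<open>\<open>\<bar>v(x)\<bar>\<^sup>2\<close> differs from its mean by at most the integral of \<open>\<bar>(\<bar>v\<bar>\<^sup>2)'\<bar>\<close>.\<close>

lemma trace_sq_le:
  assumes v: "has_weak_deriv 1 v v'" and x: "x \<in> {0..1}"
  shows "(cmod (trace_at v x))\<^sup>2 \<le> (norm v)\<^sup>2 + 2 * norm v * norm v'"
proof -
  note Pv = weak_deriv_primitive[OF v]
  note P = primitive_of_Re_mult_cnj[OF Pv(1) Pv(1)]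
  let ?h = "\<lambda>x. Re (rep_L2 v' x * cnj (trace_at v x)) + Re (trace_at v x * cnj (rep_L2 v' x))"
  have sq: "(cmod (trace_at v y))\<^sup>2 = Re (trace_at v y * cnj (trace_at v y))" for y
    by (rule cmod_sq_Re)
  have D: "(\<integral>s. norm (?h s) \<partial>lebI) \<le> 2 * (norm v * norm v')"
  proof -
    have "(\<integral>s. norm (?h s) \<partial>lebI) \<le> (\<integral>s. 2 * (cmod (rep_L2 v s) * cmod (rep_L2 v' s)) \<partial>lebI)"
    proof (rule integral_mono_AE)
      show "integrable lebI (\<lambda>s. norm (?h s))" using primitive_ofD(1)[OF P] by (rule integrable_norm)
      show "integrable lebI (\<lambda>s. 2 * (cmod (rep_L2 v s) * cmod (rep_L2 v' s)))"
        by (intro integrable_mult_right integral_norm_mult_le)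
      show "AE s in lebI. norm (?h s) \<le> 2 * (cmod (rep_L2 v s) * cmod (rep_L2 v' s))"
        using Pv(2)
      proof eventually_elim
        case (elim s)
        have "norm (?h s) \<le> cmod (rep_L2 v' s * cnj (trace_at v s)) + cmod (trace_at v s * cnj (rep_L2 v' s))"
          unfolding real_norm_def
          by (intro order_trans[OF abs_triangle_ineq] add_mono abs_Re_le_cmod)
        then show ?case using elim by (simp add: norm_mult mult.commute)
      qed
    qed
    also have "\<dots> = 2 * (\<integral>s. cmod (rep_L2 v s) * cmod (rep_L2 v' s) \<partial>lebI)" by simp
    also have "\<dots> \<le> 2 * (norm v * norm v')" by (intro mult_left_mono integral_norm_mult_le) simp
    finally show ?thesis .
  qed
  have diff: "(cmod (trace_at v x))\<^sup>2 \<le> (cmod (trace_at v y))\<^sup>2 + 2 * (norm v * norm v')" if y: "y \<in> {0..1}" for y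
  proof -
    have "(cmod (trace_at v x))\<^sup>2 - (cmod (trace_at v y))\<^sup>2 = prim ?h x - prim ?h y"
      unfolding sq using primitive_ofD(2)[OF P x] primitive_ofD(2)[OF P y] by linarith
    also have "\<dots> \<le> norm (prim ?h x - prim ?h y)" by simp
    also have "\<dots> \<le> 2 * (norm v * norm v')"
      by (rule order_trans[OF norm_prim_diff_le[OF primitive_ofD(1)[OF P]] D])
    finally show ?thesis by simp
  qed
  have i: "integrable lebI (\<lambda>y. (cmod (rep_L2 v y))\<^sup>2)" by (rule sq_integrable_integrable) simp
  have "(\<integral>y. (cmod (trace_at v x))\<^sup>2 \<partial>lebI) \<le> (\<integral>y. (cmod (rep_L2 v y))\<^sup>2 + 2 * (norm v * norm v') \<partial>lebI)"
  proof (rule integral_mono_AE)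
    have "AE y in lebI. y \<in> {0..1}" by (rule AE_I2) simp
    with Pv(2) show "AE y in lebI. (cmod (trace_at v x))\<^sup>2 \<le> (cmod (rep_L2 v y))\<^sup>2 + 2 * (norm v * norm v')"
      by eventually_elim (use diff in simp)
  qed (use i in auto)
  then show ?thesis
    using i by (simp add: norm_L2_sq measure_restrict_space mult.assoc)
qed

lemma trace_le:
  assumes v: "has_weak_deriv 1 v v'" and x: "x \<in> {0..1}"
  shows "cmod (trace_at v x) \<le> norm v + norm v'"
proof (rule power2_le_imp_le)
  show "(cmod (trace_at v x))\<^sup>2 \<le> (norm v + norm v')\<^sup>2"
    using trace_sq_le[OF assms] zero_le_power2[of "norm v'"] unfolding power2_sum by linarith
qed simp

text \<open>The bound on the derivative is \<open>trace_le\<close> for \<open>v'\<close>. It gives equicontinuity in \<open>x\<close> for bounded sets of \<open>H\<^sup>2\<close>.\<close>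

lemma trace_lipschitz:
  assumes v: "has_weak_deriv 1 v v'" and v': "has_weak_deriv 1 v' v''" and xy: "x \<in> {0..1}" "y \<in> {0..1}"
  shows "cmod (trace_at v x - trace_at v y) \<le> (norm v' + norm v'') * \<bar>x - y\<bar>"
proof -
  have *: "cmod (trace_at v x - trace_at v y) \<le> (norm v' + norm v'') * (y - x)" if "x \<le> y" "x \<in> {0..1}" "y \<in> {0..1}" for x y
  proof -
    note P = weak_deriv_primitive(1)[OF v]
    define B where "B = norm v' + norm v''"
    have "trace_at v y - trace_at v x = prim (rep_L2 v') y - prim (rep_L2 v') x"
      using primitive_ofD(2)[OF P that(2)] primitive_ofD(2)[OF P that(3)] by (metis add_diff_cancel_left)
    also have "\<dots> = (\<integral>s. (if s < y then rep_L2 v' s else 0) - (if s < x then rep_L2 v' s else 0) \<partial>lebI)"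
      unfolding prim_def using integrable_cutoff[OF integrable_rep[of v']] by simp
    also have "cmod \<dots> \<le> (\<integral>s. cmod ((if s < y then rep_L2 v' s else 0) - (if s < x then rep_L2 v' s else 0)) \<partial>lebI)"
      by (rule integral_norm_bound)
    also have "\<dots> \<le> (\<integral>s. B * (if s < y then 1 else 0) - B * (if s < x then 1 else 0) \<partial>lebI)"
    proof (rule integral_mono_AE)
      have one: "integrable lebI (\<lambda>s. if s < y then 1 else 0 :: real)" for y
        by (rule integrable_cutoff) simp
      show "integrable lebI (\<lambda>s. B * (if s < y then 1 else 0) - B * (if s < x then 1 else 0))"
        by (intro Bochner_Integration.integrable_diff integrable_mult_right one)
      show "integrable lebI (\<lambda>s. cmod ((if s < y then rep_L2 v' s else 0) - (if s < x then rep_L2 v' s else 0)))"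
        by (intro integrable_norm Bochner_Integration.integrable_diff integrable_cutoff integrable_rep)
      have "AE s in lebI. s \<in> {0..1}" by (rule AE_I2) simp
      with weak_deriv_primitive(2)[OF v']
      show "AE s in lebI. cmod ((if s < y then rep_L2 v' s else 0) - (if s < x then rep_L2 v' s else 0))
          \<le> B * (if s < y then 1 else 0) - B * (if s < x then 1 else 0)"
        by eventually_elim (use trace_le[OF v'] that in \<open>auto simp: B_def\<close>)
    qed
    also have "\<dots> = B * prim (\<lambda>_. 1) y - B * prim (\<lambda>_. 1) x"
    proof -
      have one: "integrable lebI (\<lambda>s. if s < y then 1 else 0 :: real)" for y
        by (rule integrable_cutoff) simp
      show ?thesis unfolding prim_def
        by (subst Bochner_Integration.integral_diff) (use one in \<open>auto\<close>)
    qed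
    also have "\<dots> = B * (y - x)"
    proof -
      have "primitive_of (\<lambda>x::real. x) (\<lambda>_. 1)" by (rule primitive_of_C1) auto
      from primitive_ofD(2)[OF this that(2)] primitive_ofD(2)[OF this that(3)]
      show ?thesis by (simp add: right_diff_distrib)
    qed
    finally show ?thesis by (simp add: B_def norm_minus_commute)
  qed
  show ?thesis
    using *[of x y] *[of y x] xy by (cases "x \<le> y") (auto simp: norm_minus_commute abs_if)
qed

lemma poincare:
  assumes v: "has_weak_deriv 1 v v'" and z: "trace_at v 0 = 0"
  shows "norm v \<le> norm v'"
proof -
  note P = weak_deriv_primitive[OF v]
  have b: "cmod (trace_at v x) \<le> norm v'" if x: "x \<in> {0..1}" for x
  proof -
    have "trace_at v x = prim (rep_L2 v') x - prim (rep_L2 v') 0"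
      using primitive_ofD(2)[OF P(1) x] z by simp
    then show ?thesis
      using norm_prim_diff_le[OF integrable_rep, of v' x 0] L1_norm_le_L2[of v'] by simp
  qed
  have "(\<integral>x. (cmod (rep_L2 v x))\<^sup>2 \<partial>lebI) \<le> (\<integral>x. (norm v')\<^sup>2 \<partial>lebI)"
  proof (rule integral_mono_AE)
    have "AE y in lebI. y \<in> {0..1}" by (rule AE_I2) simp
    with P(2) show "AE x in lebI. (cmod (rep_L2 v x))\<^sup>2 \<le> (norm v')\<^sup>2"
      by eventually_elim (use b in \<open>simp add: power_mono\<close>)
    show "integrable lebI (\<lambda>x. (cmod (rep_L2 v x))\<^sup>2)" by (rule sq_integrable_integrable) simp
  qed simp
  then have "(norm v)\<^sup>2 \<le> (norm v')\<^sup>2" by (simp add: norm_L2_sq[of v] measure_restrict_space)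
  then show ?thesis by (rule power2_le_imp_le) simp
qed

text \<open>Young's inequality absorbs the powers of \<open>b\<close> on the right; the constant is crude.\<close>

lemma interpolation_arith:
  fixes n b h :: real
  assumes n: "n \<ge> 0" "b \<ge> 0" "h \<ge> 0"
    and le: "b\<^sup>2 \<le> n * h + 2 * (sqrt (n * (n + 2 * b)) * sqrt (b * (b + 2 * h)))"
  shows "b\<^sup>2 \<le> 144 * (n * (n + h))"
proof (cases "b \<le> n")
  case True
  have "b\<^sup>2 \<le> n\<^sup>2" using True n by (simp add: power_mono)
  moreover have "n\<^sup>2 \<le> 144 * (n * (n + h))" using n by (simp add: power2_eq_square algebra_simps)
  ultimately show ?thesis by linarith
next
  case False
  have "n * n \<le> n * b" using n False by (intro mult_left_mono) auto
  then have "n * (n + 2 * b) \<le> 3 * n * b" by (simp add: distrib_left mult.commute)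
  then have "sqrt (n * (n + 2 * b)) * sqrt (b * (b + 2 * h)) \<le> sqrt (3 * n * b) * sqrt (b * (b + 2 * h))"
    using n by (intro mult_right_mono real_sqrt_le_mono) auto
  also have "\<dots> = b * sqrt (3 * n * (b + 2 * h))"
    using n by (simp add: real_sqrt_mult)
  finally have "b\<^sup>2 \<le> n * h + 2 * (b * sqrt (3 * n * (b + 2 * h)))" using le by linarith
  moreover have "2 * (b * r) \<le> b\<^sup>2 / 2 + 2 * r\<^sup>2" for r
    using zero_le_power2[of "b / 2 - r"] by (simp add: power2_diff power_divide algebra_simps)
  from this[of "sqrt (3 * n * (b + 2 * h))"]
  have "2 * (b * sqrt (3 * n * (b + 2 * h))) \<le> b\<^sup>2 / 2 + 2 * (3 * n * (b + 2 * h))"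
    using n by simp
  ultimately have 1: "b\<^sup>2 \<le> 26 * (n * h) + 12 * (n * b)" by (simp add: algebra_simps)
  have "12 * (n * b) \<le> b\<^sup>2 / 2 + 72 * n\<^sup>2"
    using zero_le_power2[of "b - 12 * n"] by (simp add: power2_diff power_mult_distrib algebra_simps)
  with 1 have "b\<^sup>2 \<le> 52 * (n * h) + 144 * n\<^sup>2" by linarith
  moreover have "0 \<le> n * h" using n by simp
  ultimately show ?thesis by (simp add: power2_eq_square distrib_left)
qed

text \<open>Without boundary conditions, integrating \<open>\<parallel>v'\<parallel>\<^sup>2\<close> by parts leaves boundary terms; \<open>trace_sq_le\<close> controls them.
  They are the reason for the lower order term \<open>\<parallel>v\<parallel>\<^sup>2\<close> on the right.\<close>

lemma interpolation:
  assumes v: "has_weak_deriv 1 v v'" and v': "has_weak_deriv 1 v' v''"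
  shows "(norm v')\<^sup>2 \<le> 144 * (norm v * (norm v + norm v''))"
proof (rule interpolation_arith)
  define N where "N = sqrt (norm v * (norm v + 2 * norm v'))"
  define N' where "N' = sqrt (norm v' * (norm v' + 2 * norm v''))"
  have t: "cmod (trace_at v x) \<le> N" "cmod (trace_at v' x) \<le> N'" if "x \<in> {0..1}" for x
    using trace_sq_le[OF v that] trace_sq_le[OF v' that]
    by (auto simp: N_def N'_def power2_eq_square algebra_simps intro!: real_le_rsqrt)
  have r: "\<bar>Re (trace_at v x * cnj (trace_at v' x))\<bar> \<le> N * N'" if "x \<in> {0..1}" for x
  proof -
    have "\<bar>Re (trace_at v x * cnj (trace_at v' x))\<bar> \<le> cmod (trace_at v x * cnj (trace_at v' x))" by (rule abs_Re_le_cmod)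
    also have "\<dots> \<le> N * N'" unfolding norm_mult complex_mod_cnj
      by (intro mult_mono t that) (auto simp: N_def)
    finally show ?thesis .
  qed
  have "(norm v')\<^sup>2 + inner v v'' \<le> 2 * (N * N')"
    using inner_by_parts[OF v v'] r[of 1] r[of 0] by (simp add: power2_norm_eq_inner)
  moreover have "- inner v v'' \<le> norm v * norm v''"
    using Cauchy_Schwarz_ineq2[of v v''] by linarith
  ultimately show "(norm v')\<^sup>2 \<le> norm v * norm v'' + 2 * (sqrt (norm v * (norm v + 2 * norm v')) * sqrt (norm v' * (norm v' + 2 * norm v'')))"
    unfolding N_def N'_def by linarith
qed auto

section \<open>The generator\<close>

lemma kawahara_dom_weak_deriv:
  assumes "v \<in> kawahara_dom \<alpha>" "j < 5"
  shows "has_weak_deriv 1 (wderiv j v) (wderiv (Suc j) v)"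
  using assms has_weak_deriv_wderiv[of v 5 j] has_weak_deriv_wderiv[of v 5 "Suc j"]
  by (intro has_weak_deriv_step) (auto simp: kawahara_dom_def)

lemma kawahara_chain:
  assumes v: "v \<in> kawahara_dom \<alpha>"
  shows "has_weak_deriv 1 v (wderiv 1 v)" "has_weak_deriv 1 (wderiv 1 v) (wderiv 2 v)"
    "has_weak_deriv 1 (wderiv 2 v) (wderiv 3 v)" "has_weak_deriv 1 (wderiv 3 v) (wderiv 4 v)"
    "has_weak_deriv 1 (wderiv 4 v) (wderiv 5 v)"
  using kawahara_dom_weak_deriv[OF v, of 0] kawahara_dom_weak_deriv[OF v, of 1] kawahara_dom_weak_deriv[OF v, of 2]
    kawahara_dom_weak_deriv[OF v, of 3] kawahara_dom_weak_deriv[OF v, of 4]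
  by (simp_all add: eval_nat_numeral)

lemma kawahara_bc:
  assumes v: "v \<in> kawahara_dom \<alpha>"
  shows "trace_at v 0 = 0" "trace_at v 1 = 0" "trace_at (wderiv 1 v) 0 = 0" "trace_at (wderiv 1 v) 1 = 0"
    "trace_at (wderiv 2 v) 1 = of_real \<alpha> * trace_at (wderiv 2 v) 0"
  using v by (auto simp: kawahara_dom_def)

text \<open>The shift is chosen so that the increasing weight still lets the boundary term at \<open>x = 0\<close> dominate the one at
  \<open>x = 1\<close>, because \<open>\<bar>v\<^sub>x\<^sub>x(1)\<bar>\<^sup>2 = \<alpha>\<^sup>2 \<bar>v\<^sub>x\<^sub>x(0)\<bar>\<^sup>2\<close>; see \<open>dissipation\<close>.\<close>

definition weight :: "real \<Rightarrow> L2I \<Rightarrow> L2I" where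
  "weight \<alpha> = mult_op (\<lambda>x. of_real (x + 1 / (1 - \<alpha>\<^sup>2)))"

lemma weight_multiplier: "bounded_multiplier (\<lambda>x. of_real (x + \<kappa>))"
  by (intro bounded_multiplier_continuous continuous_intros)

lemma bounded_linear_weight: "bounded_linear (weight \<alpha>)"
  unfolding weight_def by (rule bounded_linear_mult_op[OF weight_multiplier])

lemma inner_weight: "inner (weight \<alpha> v) w = (\<integral>x. (x + 1 / (1 - \<alpha>\<^sup>2)) * Re (rep_L2 v x * cnj (rep_L2 w x)) \<partial>lebI)"
  "integrable lebI (\<lambda>x. (x + 1 / (1 - \<alpha>\<^sup>2)) * Re (rep_L2 v x * cnj (rep_L2 w x)))"
proof -
  show i: "integrable lebI (\<lambda>x. (x + 1 / (1 - \<alpha>\<^sup>2)) * Re (rep_L2 v x * cnj (rep_L2 w x)))"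
    by (intro integrable_continuous_mult continuous_intros integrable_inner_L2)
  have "AE x in lebI. Re (rep_L2 (weight \<alpha> v) x * cnj (rep_L2 w x)) = (x + 1 / (1 - \<alpha>\<^sup>2)) * Re (rep_L2 v x * cnj (rep_L2 w x))"
    using rep_mult_op[OF weight_multiplier[of "1 / (1 - \<alpha>\<^sup>2)"], of v]
  proof eventually_elim
    case (elim x)
    have e: "rep_L2 (weight \<alpha> v) x * cnj (rep_L2 w x) = of_real (x + 1 / (1 - \<alpha>\<^sup>2)) * (rep_L2 v x * cnj (rep_L2 w x))"
      unfolding weight_def elim by (rule mult.assoc)
    show ?case unfolding e by simp
  qed
  then show "inner (weight \<alpha> v) w = (\<integral>x. (x + 1 / (1 - \<alpha>\<^sup>2)) * Re (rep_L2 v x * cnj (rep_L2 w x)) \<partial>lebI)"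
    unfolding inner_L2I_def using i integrable_inner_L2 by (intro integral_cong_AE) (auto dest: borel_measurable_integrable)
qed

lemma inner_weight_commute: "inner (weight \<alpha> v) w = inner v (weight \<alpha> w)"
proof -
  have "inner (weight \<alpha> v) w = inner (weight \<alpha> w) v"
    unfolding inner_weight(1) by (intro Bochner_Integration.integral_cong refl) (simp add: mult.commute)
  then show ?thesis by (simp add: inner_commute)
qed

lemma weight_bounds:
  assumes "\<bar>\<alpha>\<bar> < 1"
  shows "(norm v)\<^sup>2 \<le> inner (weight \<alpha> v) v" "inner (weight \<alpha> v) v \<le> (1 + 1 / (1 - \<alpha>\<^sup>2)) * (norm v)\<^sup>2"
proof -
  have "\<alpha>\<^sup>2 < 1" using assms by (simp add: abs_square_less_1)
  then have k: "1 / (1 - \<alpha>\<^sup>2) \<ge> 1" by simp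
  have sq: "Re (rep_L2 v x * cnj (rep_L2 v x)) = (cmod (rep_L2 v x))\<^sup>2" for x
    by (rule cmod_sq_Re[symmetric])
  have i: "integrable lebI (\<lambda>x. (cmod (rep_L2 v x))\<^sup>2)" by (rule sq_integrable_integrable) simp
  note j = inner_weight(2)[of \<alpha> v v, unfolded sq]
  show "(norm v)\<^sup>2 \<le> inner (weight \<alpha> v) v"
    unfolding inner_weight(1) norm_L2_sq sq
  proof (rule integral_mono_AE[OF i j], rule AE_I2)
    fix x assume "x \<in> space lebI"
    then show "(cmod (rep_L2 v x))\<^sup>2 \<le> (x + 1 / (1 - \<alpha>\<^sup>2)) * (cmod (rep_L2 v x))\<^sup>2"
      using k mult_right_mono[of 1 "x + 1 / (1 - \<alpha>\<^sup>2)" "(cmod (rep_L2 v x))\<^sup>2"] by simp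
  qed
  have "inner (weight \<alpha> v) v \<le> (\<integral>x. (1 + 1 / (1 - \<alpha>\<^sup>2)) * (cmod (rep_L2 v x))\<^sup>2 \<partial>lebI)"
    unfolding inner_weight(1) sq
    by (intro integral_mono_AE j integrable_mult_right i AE_I2 mult_right_mono) auto
  then show "inner (weight \<alpha> v) v \<le> (1 + 1 / (1 - \<alpha>\<^sup>2)) * (norm v)\<^sup>2"
    by (simp add: norm_L2_sq)
qed

text \<open>The antiderivative comes from integrating \<open>(x + \<kappa>) p\<^sub>0 (p\<^sub>5 - p\<^sub>3)\<close> by parts until only squares are left. Every
  term of it except \<open>(x + \<kappa>) p\<^sub>2\<^sup>2 / 2\<close> vanishes at the end points.\<close>

lemma energy_identity_real:
  fixes p0 p1 p2 p3 p4 p5 :: "real \<Rightarrow> real" and \<kappa> :: real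
  assumes p: "primitive_of p0 p1" "primitive_of p1 p2" "primitive_of p2 p3" "primitive_of p3 p4" "primitive_of p4 p5"
    and bc: "p0 0 = 0" "p0 1 = 0" "p1 0 = 0" "p1 1 = 0"
  defines "e \<equiv> (\<lambda>x. (x + \<kappa>) * (p0 x * (p5 x - p3 x)) + 5/2 * (p2 x)\<^sup>2 + 3/2 * (p1 x)\<^sup>2)"
  shows "integrable lebI e" "(\<integral>x. e x \<partial>lebI) = ((1 + \<kappa>) * (p2 1)\<^sup>2 - \<kappa> * (p2 0)\<^sup>2) / 2"
proof -
  have m: "primitive_of (\<lambda>x. x + \<kappa>) (\<lambda>_. 1)"
    by (rule primitive_of_C1) (auto intro!: derivative_eq_intros)
  note mult = primitive_of_mult and m1 = primitive_of_mult[OF m p(2)] and m2 = primitive_of_mult[OF m p(3)]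
  let ?P = "\<lambda>x. (x + \<kappa>) * (p0 x * p4 x) - (p0 x + (x + \<kappa>) * p1 x) * p3 x + 2 * (p1 x * p2 x)
      + 1/2 * ((x + \<kappa>) * (p2 x * p2 x)) - (x + \<kappa>) * (p0 x * p2 x) + p0 x * p1 x + 1/2 * ((x + \<kappa>) * (p1 x * p1 x))"
  have "primitive_of ?P (\<lambda>x. (1 * (p0 x * p4 x) + (x + \<kappa>) * (p1 x * p4 x + p0 x * p5 x))
      - ((p1 x + (1 * p1 x + (x + \<kappa>) * p2 x)) * p3 x + (p0 x + (x + \<kappa>) * p1 x) * p4 x)
      + 2 * (p2 x * p2 x + p1 x * p3 x)
      + 1/2 * (1 * (p2 x * p2 x) + (x + \<kappa>) * (p3 x * p2 x + p2 x * p3 x))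
      - (1 * (p0 x * p2 x) + (x + \<kappa>) * (p1 x * p2 x + p0 x * p3 x))
      + (p1 x * p1 x + p0 x * p2 x)
      + 1/2 * (1 * (p1 x * p1 x) + (x + \<kappa>) * (p2 x * p1 x + p1 x * p2 x)))"
    by (intro primitive_of_add primitive_of_diff primitive_of_mult primitive_of_cmult m p)
  also have "(\<lambda>x. (1 * (p0 x * p4 x) + (x + \<kappa>) * (p1 x * p4 x + p0 x * p5 x))
      - ((p1 x + (1 * p1 x + (x + \<kappa>) * p2 x)) * p3 x + (p0 x + (x + \<kappa>) * p1 x) * p4 x)
      + 2 * (p2 x * p2 x + p1 x * p3 x)
      + 1/2 * (1 * (p2 x * p2 x) + (x + \<kappa>) * (p3 x * p2 x + p2 x * p3 x))
      - (1 * (p0 x * p2 x) + (x + \<kappa>) * (p1 x * p2 x + p0 x * p3 x))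
      + (p1 x * p1 x + p0 x * p2 x)
      + 1/2 * (1 * (p1 x * p1 x) + (x + \<kappa>) * (p2 x * p1 x + p1 x * p2 x))) = e"
    unfolding e_def by (rule ext) (simp add: power2_eq_square field_simps)
  finally have P: "primitive_of ?P e" .
  show "integrable lebI e" by (rule primitive_ofD(1)[OF P])
  show "(\<integral>x. e x \<partial>lebI) = ((1 + \<kappa>) * (p2 1)\<^sup>2 - \<kappa> * (p2 0)\<^sup>2) / 2"
    unfolding primitive_ofD(3)[OF P] by (simp add: bc power2_eq_square field_simps)
qed

text \<open>The real identity applies to the real and the imaginary part separately.\<close>

lemma energy_density_split:
  fixes t0 t1 t2 t3 r5 :: complex and k :: real
  shows "k * Re (t0 * cnj (- t3 + r5)) + 5/2 * (cmod t2)\<^sup>2 + 3/2 * (cmod t1)\<^sup>2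
    = (k * (Re t0 * (Re r5 - Re t3)) + 5/2 * (Re t2)\<^sup>2 + 3/2 * (Re t1)\<^sup>2)
      + (k * (Im t0 * (Im r5 - Im t3)) + 5/2 * (Im t2)\<^sup>2 + 3/2 * (Im t1)\<^sup>2)"
  unfolding cmod_power2 by (simp add: algebra_simps)

text \<open>The boundary contribution is \<open>((1 + \<kappa>) \<alpha>\<^sup>2 - \<kappa>) / 2\<close> times \<open>\<bar>v\<^sub>x\<^sub>x(0)\<bar>\<^sup>2\<close>; with \<open>\<kappa> = 1 / (1 - \<alpha>\<^sup>2)\<close> the factor
  is \<open>(\<alpha>\<^sup>2 - 1) / 2 < 0\<close>. The fifth derivative gains \<open>\<parallel>v\<^sub>x\<^sub>x\<parallel>\<^sup>2\<close>, the third one \<open>\<parallel>v\<^sub>x\<parallel>\<^sup>2\<close>.\<close>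

lemma dissipation:
  assumes \<alpha>: "\<bar>\<alpha>\<bar> < 1" and v: "v \<in> kawahara_dom \<alpha>"
  shows "inner (weight \<alpha> v) (kawahara_op v) \<le> - (5/2) * (norm (wderiv 2 v))\<^sup>2 - (3/2) * (norm (wderiv 1 v))\<^sup>2"
proof -
  define \<kappa> where "\<kappa> = 1 / (1 - \<alpha>\<^sup>2)"
  have a1: "\<alpha>\<^sup>2 < 1" using \<alpha> by (simp add: abs_square_less_1)
  note ch = kawahara_chain[OF v]
  note T = weak_deriv_primitive(2)[OF ch(1)] weak_deriv_primitive(2)[OF ch(2)] weak_deriv_primitive(2)[OF ch(3)]
    weak_deriv_primitive(2)[OF ch(4)] weak_deriv_primitive(2)[OF ch(5)]
  have pr: "primitive_of (trace_at v) (trace_at (wderiv 1 v))" "primitive_of (trace_at (wderiv 1 v)) (trace_at (wderiv 2 v))"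
     "primitive_of (trace_at (wderiv 2 v)) (trace_at (wderiv 3 v))" "primitive_of (trace_at (wderiv 3 v)) (trace_at (wderiv 4 v))"
    using ch by (auto intro: weak_deriv_primitive_trace)
  note p5 = weak_deriv_primitive(1)[OF ch(5)]
  let ?e = "\<lambda>R x. (x + \<kappa>) * (R (trace_at v x) * (R (rep_L2 (wderiv 5 v) x) - R (trace_at (wderiv 3 v) x)))
      + 5/2 * (R (trace_at (wderiv 2 v) x))\<^sup>2 + 3/2 * (R (trace_at (wderiv 1 v) x))\<^sup>2"
  note Re = energy_identity_real[OF pr[THEN primitive_of_Re] p5[THEN primitive_of_Re], of \<kappa>]
  note Im = energy_identity_real[OF pr[THEN primitive_of_Im] p5[THEN primitive_of_Im], of \<kappa>]
  define b where "b = trace_at (wderiv 2 v) 0"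
  have bc: "trace_at (wderiv 2 v) 1 = of_real \<alpha> * b" using kawahara_bc(5)[OF v] by (simp add: b_def)
  have "inner (weight \<alpha> v) (kawahara_op v) + 5/2 * (norm (wderiv 2 v))\<^sup>2 + 3/2 * (norm (wderiv 1 v))\<^sup>2
     = (\<integral>x. (x + \<kappa>) * Re (rep_L2 v x * cnj (rep_L2 (kawahara_op v) x)) + 5/2 * (cmod (rep_L2 (wderiv 2 v) x))\<^sup>2
         + 3/2 * (cmod (rep_L2 (wderiv 1 v) x))\<^sup>2 \<partial>lebI)"
    unfolding inner_weight(1) norm_L2_sq \<kappa>_def[symmetric]
    using inner_weight(2)[of \<alpha> v "kawahara_op v"] sq_integrable_integrable[OF sq_integrable_rep]
    by (simp add: \<kappa>_def)
  also have "\<dots> = (\<integral>x. ?e Re x + ?e Im x \<partial>lebI)"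
  proof (rule integral_cong_AE)
    show "(\<lambda>x. ?e Re x + ?e Im x) \<in> borel_measurable lebI"
      using Re(1) Im(1) kawahara_bc[OF v] by (intro borel_measurable_add borel_measurable_integrable) auto
    show "(\<lambda>x. (x + \<kappa>) * Re (rep_L2 v x * cnj (rep_L2 (kawahara_op v) x)) + 5/2 * (cmod (rep_L2 (wderiv 2 v) x))\<^sup>2
         + 3/2 * (cmod (rep_L2 (wderiv 1 v) x))\<^sup>2) \<in> borel_measurable lebI"
      using inner_weight(2)[of \<alpha> v "kawahara_op v"] sq_integrable_integrable[OF sq_integrable_rep]
      by (intro borel_measurable_add borel_measurable_times borel_measurable_const borel_measurable_integrable)
         (auto simp: \<kappa>_def)
    have "AE x in lebI. rep_L2 (kawahara_op v) x = - rep_L2 (wderiv 3 v) x + rep_L2 (wderiv 5 v) x"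
      unfolding kawahara_op_def using rep_plus[of "- wderiv 3 v" "wderiv 5 v"] rep_uminus[of "wderiv 3 v"]
      by eventually_elim simp
    then show "AE x in lebI. (x + \<kappa>) * Re (rep_L2 v x * cnj (rep_L2 (kawahara_op v) x)) + 5/2 * (cmod (rep_L2 (wderiv 2 v) x))\<^sup>2
         + 3/2 * (cmod (rep_L2 (wderiv 1 v) x))\<^sup>2 = ?e Re x + ?e Im x"
      using T
    proof eventually_elim
      case (elim x)
      show ?case unfolding elim by (rule energy_density_split)
    qed
  qed
  also have "\<dots> = (\<integral>x. ?e Re x \<partial>lebI) + (\<integral>x. ?e Im x \<partial>lebI)"
    using Re(1) Im(1) kawahara_bc[OF v] by (intro Bochner_Integration.integral_add) auto
  also have "\<dots> = ((1 + \<kappa>) * \<alpha>\<^sup>2 - \<kappa>) * (cmod b)\<^sup>2 / 2"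
  proof -
    have "(\<integral>x. ?e Re x \<partial>lebI) = ((1 + \<kappa>) * (\<alpha> * Re b)\<^sup>2 - \<kappa> * (Re b)\<^sup>2) / 2"
      "(\<integral>x. ?e Im x \<partial>lebI) = ((1 + \<kappa>) * (\<alpha> * Im b)\<^sup>2 - \<kappa> * (Im b)\<^sup>2) / 2"
      using Re(2) Im(2) kawahara_bc(1-4)[OF v] by (simp_all add: bc b_def[symmetric])
    then show ?thesis unfolding cmod_power2 by (simp add: power_mult_distrib field_simps)
  qed
  also have "(1 + \<kappa>) * \<alpha>\<^sup>2 - \<kappa> = \<alpha>\<^sup>2 - 1"
  proof -
    have "\<kappa> * (1 - \<alpha>\<^sup>2) = 1" using a1 by (simp add: \<kappa>_def)
    then show ?thesis by (simp add: algebra_simps)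
  qed
  also have "(\<alpha>\<^sup>2 - 1) * (cmod b)\<^sup>2 / 2 \<le> 0"
    using a1 by (simp add: mult_nonpos_nonneg)
  finally show ?thesis by linarith
qed

lemma kawahara_poincare:
  assumes "v \<in> kawahara_dom \<alpha>"
  shows "norm v \<le> norm (wderiv 1 v)" "norm (wderiv 1 v) \<le> norm (wderiv 2 v)"
  using poincare kawahara_chain[OF assms] kawahara_bc[OF assms] by blast+

text \<open>No boundary terms appear here: values and first derivatives vanish at both ends.\<close>

lemma kawahara_inner_by_parts:
  assumes v: "v \<in> kawahara_dom \<alpha>" and w: "w \<in> kawahara_dom \<alpha>"
  shows "inner v (wderiv 5 w) = inner (wderiv 2 v) (wderiv 3 w)"
    and "inner v (wderiv 4 w) = inner (wderiv 2 v) (wderiv 2 w)"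
    and "inner v (wderiv 3 w) = inner (wderiv 2 v) (wderiv 1 w)"
    and "inner (wderiv 1 v) (wderiv 3 w) = - inner (wderiv 2 v) (wderiv 2 w)"
proof -
  note cv = kawahara_chain[OF v] and cw = kawahara_chain[OF w] and bv = kawahara_bc[OF v]
  show "inner v (wderiv 5 w) = inner (wderiv 2 v) (wderiv 3 w)"
    using inner_by_parts[OF cv(1) cw(5)] inner_by_parts[OF cv(2) cw(4)] bv by simp
  show "inner v (wderiv 4 w) = inner (wderiv 2 v) (wderiv 2 w)"
    using inner_by_parts[OF cv(1) cw(4)] inner_by_parts[OF cv(2) cw(3)] bv by simp
  show "inner v (wderiv 3 w) = inner (wderiv 2 v) (wderiv 1 w)"
    using inner_by_parts[OF cv(1) cw(3)] inner_by_parts[OF cv(2) cw(2)] bv by simp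
  show "inner (wderiv 1 v) (wderiv 3 w) = - inner (wderiv 2 v) (wderiv 2 w)"
    using inner_by_parts[OF cv(2) cw(3)] bv by simp
qed

lemma kawahara_interp_2:
  assumes v: "v \<in> kawahara_dom \<alpha>"
  shows "(norm (wderiv 2 v))\<^sup>2 \<le> norm v * norm (wderiv 4 v)"
    and "norm (wderiv 2 v) \<le> norm (wderiv 3 v)" and "norm (wderiv 2 v) \<le> norm (wderiv 4 v)"
proof -
  let ?a = "norm (wderiv 2 v)"
  show 1: "?a\<^sup>2 \<le> norm v * norm (wderiv 4 v)"
    using kawahara_inner_by_parts(2)[OF v v] Cauchy_Schwarz_ineq2[of v "wderiv 4 v"] by (simp add: power2_norm_eq_inner)
  have "?a\<^sup>2 \<le> norm (wderiv 1 v) * norm (wderiv 3 v)"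
    using kawahara_inner_by_parts(4)[OF v v] Cauchy_Schwarz_ineq2[of "wderiv 1 v" "wderiv 3 v"] by (simp add: power2_norm_eq_inner)
  also have "\<dots> \<le> ?a * norm (wderiv 3 v)" by (intro mult_right_mono kawahara_poincare[OF v]) simp
  finally show "?a \<le> norm (wderiv 3 v)" by (cases "?a = 0") (auto simp: power2_eq_square)
  have "norm v * norm (wderiv 4 v) \<le> ?a * norm (wderiv 4 v)"
    using kawahara_poincare[OF v] by (intro mult_right_mono) auto
  with 1 have "?a\<^sup>2 \<le> ?a * norm (wderiv 4 v)" by linarith
  then show "?a \<le> norm (wderiv 4 v)" by (cases "?a = 0") (auto simp: power2_eq_square)
qed

text \<open>In the application \<open>a\<close>, \<open>b\<close>, \<open>c\<close>, \<open>e\<close> are the norms of the derivatives of orders \<open>2\<close> to \<open>5\<close>, and \<open>z\<close> is the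
  norm of the generator. Two interpolations between neighbours absorb the intermediate orders; the constants are crude.\<close>

lemma elliptic_arith:
  fixes a b c e z :: real
  assumes n: "0 \<le> a" "0 \<le> b" "0 \<le> c" "0 \<le> z"
    and b: "b\<^sup>2 \<le> 144 * (a * (a + c))" and c: "c\<^sup>2 \<le> 144 * (b * (b + e))" and e: "e \<le> z + b"
  shows "b \<le> 3457 * (a + z)"
proof -
  have "c\<^sup>2 \<le> (24 * (b + z))\<^sup>2"
  proof -
    have "b * (b + e) \<le> b * (b + (z + b))" using n e by (intro mult_left_mono) auto
    with c have "c\<^sup>2 \<le> 144 * (b * (b + (z + b)))" by linarith
    also have "\<dots> \<le> (24 * (b + z))\<^sup>2"
    proof -
      have "(24 * (b + z))\<^sup>2 = 576 * b\<^sup>2 + 1152 * (b * z) + 576 * z\<^sup>2"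
        "144 * (b * (b + (z + b))) = 288 * b\<^sup>2 + 144 * (b * z)"
        by (simp_all add: power2_eq_square algebra_simps)
      moreover have "0 \<le> b\<^sup>2" "0 \<le> z\<^sup>2" "0 \<le> b * z" using n by auto
      ultimately show ?thesis by linarith
    qed
    finally show ?thesis .
  qed
  then have "c \<le> 24 * (b + z)" by (rule power2_le_imp_le) (use n in simp)
  then have "a * (a + c) \<le> a * (a + 24 * (b + z))" using n by (intro mult_left_mono) auto
  with b have 1: "b\<^sup>2 \<le> 144 * a\<^sup>2 + 3456 * (a * b) + 3456 * (a * z)" by (simp add: power2_eq_square algebra_simps)
  have "3456 * (a * b) \<le> b\<^sup>2 / 2 + 5971968 * a\<^sup>2"
    using zero_le_power2[of "b - 3456 * a"] by (simp add: power2_diff power_mult_distrib algebra_simps)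
  with 1 have "b\<^sup>2 \<le> 11944224 * a\<^sup>2 + 6912 * (a * z)" by linarith
  also have "\<dots> \<le> (3457 * (a + z))\<^sup>2"
  proof -
    have "(3457 * (a + z))\<^sup>2 = 11950849 * a\<^sup>2 + 23901698 * (a * z) + 11950849 * z\<^sup>2"
      by (simp add: power2_eq_square algebra_simps)
    moreover have "0 \<le> a\<^sup>2" "0 \<le> z\<^sup>2" "0 \<le> a * z" using n by auto
    ultimately show ?thesis by linarith
  qed
  finally show ?thesis by (rule power2_le_imp_le) (use n in simp)
qed

text \<open>Dissipation controls \<open>v\<^sub>x\<^sub>x\<close> by the generator, and the generator is \<open>v\<^sub>x\<^sub>x\<^sub>x\<^sub>x\<^sub>x\<close> up to an interpolated lower order term.\<close>

lemma kawahara_elliptic: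
  assumes \<alpha>: "\<bar>\<alpha>\<bar> < 1"
  obtains C where "C \<ge> 1" "\<And>v. v \<in> kawahara_dom \<alpha> \<Longrightarrow> norm (wderiv 3 v) \<le> C * norm (kawahara_op v)"
    "\<And>v. v \<in> kawahara_dom \<alpha> \<Longrightarrow> norm (wderiv 5 v) \<le> C * norm (kawahara_op v)"
proof -
  obtain W where W: "W > 0" "\<And>v. norm (weight \<alpha> v) \<le> norm v * W"
    using bounded_linear.pos_bounded[OF bounded_linear_weight] by blast
  define C where "C = 3457 * (W + 1) + 1"
  have b3: "norm (wderiv 3 v) \<le> 3457 * (W + 1) * norm (kawahara_op v)" if v: "v \<in> kawahara_dom \<alpha>" for v
  proof -
    let ?a = "norm (wderiv 2 v)" and ?z = "norm (kawahara_op v)"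
    have "(5/2) * ?a\<^sup>2 \<le> - inner (weight \<alpha> v) (kawahara_op v)"
      using dissipation[OF \<alpha> v] zero_le_power2[of "norm (wderiv 1 v)"] by linarith
    also have "\<dots> \<le> norm (weight \<alpha> v) * ?z"
      using Cauchy_Schwarz_ineq2[of "weight \<alpha> v" "kawahara_op v"] by linarith
    also have "\<dots> \<le> (?a * W) * ?z"
    proof (rule mult_right_mono)
      have "norm v \<le> ?a" using kawahara_poincare[OF v] by linarith
      then have "norm v * W \<le> ?a * W" using W by (intro mult_right_mono) auto
      then show "norm (weight \<alpha> v) \<le> ?a * W" using W(2)[of v] by linarith
    qed simp
    finally have le: "(5/2) * ?a\<^sup>2 \<le> ?a * (W * ?z)" by (simp add: mult_ac)
    moreover have "?a\<^sup>2 \<le> (5/2) * ?a\<^sup>2" by simp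
    ultimately have "?a * ?a \<le> ?a * (W * ?z)" unfolding power2_eq_square by linarith
    then have a: "?a \<le> W * ?z" using W by (cases "?a = 0") auto
    have "wderiv 5 v = kawahara_op v + wderiv 3 v" by (simp add: kawahara_op_def)
    then have "norm (wderiv 5 v) \<le> ?z + norm (wderiv 3 v)" by (metis norm_triangle_ineq)
    then have "norm (wderiv 3 v) \<le> 3457 * (?a + ?z)"
      using interpolation[OF kawahara_chain(3,4)[OF v]] interpolation[OF kawahara_chain(4,5)[OF v]]
      by (intro elliptic_arith) auto
    then show ?thesis using a by (simp add: algebra_simps)
  qed
  have b5: "norm (wderiv 5 v) \<le> C * norm (kawahara_op v)" if v: "v \<in> kawahara_dom \<alpha>" for v
  proof -
    have "wderiv 5 v = kawahara_op v + wderiv 3 v" by (simp add: kawahara_op_def)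
    then have "norm (wderiv 5 v) \<le> norm (kawahara_op v) + norm (wderiv 3 v)" by (metis norm_triangle_ineq)
    then show ?thesis using b3[OF v] by (simp add: C_def algebra_simps)
  qed
  have "norm (wderiv 3 v) \<le> C * norm (kawahara_op v)" if v: "v \<in> kawahara_dom \<alpha>" for v
  proof -
    have "3457 * (W + 1) * norm (kawahara_op v) \<le> C * norm (kawahara_op v)"
      by (intro mult_right_mono) (simp_all add: C_def)
    then show ?thesis using b3[OF v] by linarith
  qed
  moreover have "C \<ge> 1" using W by (simp add: C_def)
  ultimately show thesis using that b5 by blast
qed

text \<open>With \<open>n\<close>, \<open>a\<close>, \<open>b\<close>, \<open>c\<close>, \<open>z\<close> for the norms of orders \<open>0\<close>, \<open>2\<close>, \<open>3\<close>, \<open>4\<close> and of the generator, which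
  stands for order \<open>5\<close>: the order \<open>4\<close> is eliminated from three
  interpolations between neighbours. The exponents are those that scaling dictates.\<close>

lemma interp_arith:
  fixes a b c n z P Q :: real
  assumes nn: "0 \<le> a" "0 \<le> b" "0 \<le> c" "0 \<le> n" "0 \<le> z" "0 \<le> P" "0 \<le> Q"
    and a: "a\<^sup>2 \<le> n * c" and b: "b\<^sup>2 \<le> P * (a * c)" and c: "c\<^sup>2 \<le> Q * (b * z)"
  shows "a ^ 5 \<le> sqrt (Q ^ 4 * P\<^sup>2) * (n ^ 3 * z\<^sup>2)"
    and "b ^ 5 \<le> sqrt (P ^ 5 * sqrt (Q ^ 4 * P\<^sup>2) * (Q ^ 4 * P\<^sup>2)) * (n\<^sup>2 * z ^ 3)"
proof -
  define L where "L = Q ^ 4 * P\<^sup>2"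
  have L: "L \<ge> 0" using nn by (simp add: L_def)
  have c5: "c ^ 5 \<le> L * (n * z ^ 4)"
  proof (cases "c = 0")
    case True
    then show ?thesis using L nn by simp
  next
    case False
    then have c0: "c > 0" using nn by simp
    have "c * c ^ 3 = (c\<^sup>2)\<^sup>2" by (simp add: power2_eq_square power3_eq_cube)
    also have "\<dots> \<le> (Q * (b * z))\<^sup>2" using c nn by (intro power_mono) auto
    also have "\<dots> = b\<^sup>2 * (Q\<^sup>2 * z\<^sup>2)" by (simp add: power_mult_distrib)
    also have "\<dots> \<le> P * (a * c) * (Q\<^sup>2 * z\<^sup>2)" using b by (intro mult_right_mono) auto
    finally have "c * c ^ 3 \<le> c * (Q\<^sup>2 * P * (a * z\<^sup>2))" by (simp add: mult_ac)
    then have c3: "c ^ 3 \<le> Q\<^sup>2 * P * (a * z\<^sup>2)" using c0 by simp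
    have "c * c ^ 5 = (c ^ 3)\<^sup>2" by (simp add: power2_eq_square eval_nat_numeral)
    also have "\<dots> \<le> (Q\<^sup>2 * P * (a * z\<^sup>2))\<^sup>2" using c3 nn by (intro power_mono) auto
    also have "\<dots> = a\<^sup>2 * (L * z ^ 4)" by (simp add: L_def power_mult_distrib power_mult[symmetric])
    also have "\<dots> \<le> (n * c) * (L * z ^ 4)" using a L by (intro mult_right_mono) auto
    finally have "c * c ^ 5 \<le> c * (L * (n * z ^ 4))" by (simp add: mult_ac)
    then show ?thesis using c0 by simp
  qed
  have "(a ^ 5)\<^sup>2 = (a\<^sup>2) ^ 5" by (simp add: power_mult[symmetric] mult.commute)
  also have "\<dots> \<le> (n * c) ^ 5" using a by (intro power_mono) auto
  also have "\<dots> = n ^ 5 * c ^ 5" by (rule power_mult_distrib)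
  also have "\<dots> \<le> n ^ 5 * (L * (n * z ^ 4))" using c5 nn by (intro mult_left_mono) auto
  also have "\<dots> = (sqrt L * (n ^ 3 * z\<^sup>2))\<^sup>2"
    using L by (simp add: power_mult_distrib power_mult[symmetric] eval_nat_numeral mult_ac)
  finally have a5: "a ^ 5 \<le> sqrt L * (n ^ 3 * z\<^sup>2)"
    by (rule power2_le_imp_le) (use L nn in auto)
  then show "a ^ 5 \<le> sqrt (Q ^ 4 * P\<^sup>2) * (n ^ 3 * z\<^sup>2)" by (simp only: L_def)
  have "(b ^ 5)\<^sup>2 = (b\<^sup>2) ^ 5" by (simp add: power_mult[symmetric] mult.commute)
  also have "\<dots> \<le> (P * (a * c)) ^ 5" using b by (intro power_mono) auto
  also have "\<dots> = P ^ 5 * (a ^ 5 * c ^ 5)" by (simp add: power_mult_distrib)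
  also have "\<dots> \<le> P ^ 5 * ((sqrt L * (n ^ 3 * z\<^sup>2)) * (L * (n * z ^ 4)))"
    using a5 c5 nn L by (intro mult_left_mono mult_mono) auto
  also have "\<dots> = (sqrt (P ^ 5 * sqrt L * L) * (n\<^sup>2 * z ^ 3))\<^sup>2"
    using L nn by (simp add: power_mult_distrib power_mult[symmetric] eval_nat_numeral mult_ac)
  finally have "b ^ 5 \<le> sqrt (P ^ 5 * sqrt L * L) * (n\<^sup>2 * z ^ 3)"
    by (rule power2_le_imp_le) (use L nn in auto)
  then show "b ^ 5 \<le> sqrt (P ^ 5 * sqrt (Q ^ 4 * P\<^sup>2) * (Q ^ 4 * P\<^sup>2)) * (n\<^sup>2 * z ^ 3)" by (simp only: L_def)
qed

lemma kawahara_interpolation: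
  assumes \<alpha>: "\<bar>\<alpha>\<bar> < 1"
  obtains C where "C \<ge> 0"
    "\<And>v. v \<in> kawahara_dom \<alpha> \<Longrightarrow> norm (wderiv 2 v) ^ 5 \<le> C * (norm v ^ 3 * (norm (kawahara_op v))\<^sup>2)"
    "\<And>v. v \<in> kawahara_dom \<alpha> \<Longrightarrow> norm (wderiv 3 v) ^ 5 \<le> C * ((norm v)\<^sup>2 * norm (kawahara_op v) ^ 3)"
proof -
  obtain C0 where C0: "C0 \<ge> 1" "\<And>v. v \<in> kawahara_dom \<alpha> \<Longrightarrow> norm (wderiv 3 v) \<le> C0 * norm (kawahara_op v)"
    "\<And>v. v \<in> kawahara_dom \<alpha> \<Longrightarrow> norm (wderiv 5 v) \<le> C0 * norm (kawahara_op v)"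
    using kawahara_elliptic[OF \<alpha>] by blast
  define P Q where "P = (288::real)" and "Q = 288 * C0"
  define A B where "A = sqrt (Q ^ 4 * P\<^sup>2)" and "B = sqrt (P ^ 5 * sqrt (Q ^ 4 * P\<^sup>2) * (Q ^ 4 * P\<^sup>2))"
  have AB: "A \<ge> 0" "B \<ge> 0" using C0(1) by (auto simp: A_def B_def P_def Q_def)
  have main: "norm (wderiv 2 v) ^ 5 \<le> A * (norm v ^ 3 * (norm (kawahara_op v))\<^sup>2)"
    "norm (wderiv 3 v) ^ 5 \<le> B * ((norm v)\<^sup>2 * norm (kawahara_op v) ^ 3)" if v: "v \<in> kawahara_dom \<alpha>" for v
  proof -
    let ?a = "norm (wderiv 2 v)" and ?b = "norm (wderiv 3 v)" and ?c = "norm (wderiv 4 v)" and ?z = "norm (kawahara_op v)"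
    have "?b\<^sup>2 \<le> 144 * (?a * (?a + ?c))" by (rule interpolation[OF kawahara_chain(3,4)[OF v]])
    also have "\<dots> \<le> 144 * (?a * (?c + ?c))"
      using kawahara_interp_2(3)[OF v] by (intro mult_left_mono add_mono) auto
    finally have b: "?b\<^sup>2 \<le> P * (?a * ?c)" by (simp add: P_def algebra_simps)
    have "?c\<^sup>2 \<le> 144 * (?b * (?b + norm (wderiv 5 v)))" by (rule interpolation[OF kawahara_chain(4,5)[OF v]])
    also have "\<dots> \<le> 144 * (?b * (C0 * ?z + C0 * ?z))"
      using C0(2,3)[OF v] by (intro mult_left_mono add_mono) auto
    finally have c: "?c\<^sup>2 \<le> Q * (?b * ?z)" by (simp add: Q_def algebra_simps)
    show "?a ^ 5 \<le> A * (norm v ^ 3 * ?z\<^sup>2)" "?b ^ 5 \<le> B * ((norm v)\<^sup>2 * ?z ^ 3)"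
      unfolding A_def B_def
      by (rule interp_arith[OF _ _ _ _ _ _ _ kawahara_interp_2(1)[OF v] b c]; use C0(1) in \<open>simp add: P_def Q_def\<close>)+
  qed
  show thesis
  proof (rule that[of "A + B"])
    show "A + B \<ge> 0" using AB by simp
    fix v assume v: "v \<in> kawahara_dom \<alpha>"
    have "A * (norm v ^ 3 * (norm (kawahara_op v))\<^sup>2) \<le> (A + B) * (norm v ^ 3 * (norm (kawahara_op v))\<^sup>2)"
      "B * ((norm v)\<^sup>2 * norm (kawahara_op v) ^ 3) \<le> (A + B) * ((norm v)\<^sup>2 * norm (kawahara_op v) ^ 3)"
      using AB by (auto intro!: mult_right_mono)
    with main[OF v] show "norm (wderiv 2 v) ^ 5 \<le> (A + B) * (norm v ^ 3 * (norm (kawahara_op v))\<^sup>2)"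
      "norm (wderiv 3 v) ^ 5 \<le> (A + B) * ((norm v)\<^sup>2 * norm (kawahara_op v) ^ 3)" by linarith+
  qed
qed

text \<open>Expand \<open>\<parallel>G w\<parallel>\<^sup>2 = \<langle>G w, - w\<^sub>x\<^sub>x\<^sub>x + w\<^sub>x\<^sub>x\<^sub>x\<^sub>x\<^sub>x\<rangle>\<close> and move two derivatives onto the left factor. What
  remains on the right is of order \<open>3\<close> and lies between \<open>w\<close> and \<open>G w\<close>.\<close>

lemma nash_inequality:
  assumes \<alpha>: "\<bar>\<alpha>\<bar> < 1"
  obtains C where "C \<ge> 0"
    "\<And>w. w \<in> kawahara_dom \<alpha> \<Longrightarrow> kawahara_op w \<in> kawahara_dom \<alpha> \<Longrightarrow>
      norm (kawahara_op w) ^ 7 \<le> C * (norm (wderiv 2 (kawahara_op w)) ^ 5 * (norm w)\<^sup>2)"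
proof -
  obtain C where C: "C \<ge> 0" "\<And>v. v \<in> kawahara_dom \<alpha> \<Longrightarrow> norm (wderiv 3 v) ^ 5 \<le> C * ((norm v)\<^sup>2 * norm (kawahara_op v) ^ 3)"
    by (rule kawahara_interpolation[OF \<alpha>]) blast
  show thesis
  proof (rule that[of "32 * C"])
    show "32 * C \<ge> 0" using C by simp
    fix w assume w: "w \<in> kawahara_dom \<alpha>" and z: "kawahara_op w \<in> kawahara_dom \<alpha>"
    let ?z = "norm (kawahara_op w)" and ?D = "norm (wderiv 2 (kawahara_op w))" and ?b = "norm (wderiv 3 w)"
    have "?z\<^sup>2 = inner (kawahara_op w) (- wderiv 3 w + wderiv 5 w)"
      by (simp add: power2_norm_eq_inner kawahara_op_def)
    also have "\<dots> = inner (wderiv 2 (kawahara_op w)) (wderiv 3 w - wderiv 1 w)"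
      using kawahara_inner_by_parts(1,3)[OF z w] by (simp add: inner_diff_right)
    also have "\<dots> \<le> ?D * norm (wderiv 3 w - wderiv 1 w)" by (rule norm_cauchy_schwarz)
    also have "\<dots> \<le> ?D * (2 * ?b)"
    proof (rule mult_left_mono)
      show "norm (wderiv 3 w - wderiv 1 w) \<le> 2 * ?b"
        using norm_triangle_ineq4[of "wderiv 3 w" "wderiv 1 w"] kawahara_poincare(2)[OF w] kawahara_interp_2(2)[OF w] by linarith
    qed simp
    finally have "?z\<^sup>2 \<le> 2 * ?D * ?b" by simp
    then have "(?z\<^sup>2) ^ 5 \<le> (2 * ?D * ?b) ^ 5" by (intro power_mono) auto
    also have "\<dots> = 32 * ?D ^ 5 * ?b ^ 5" by (simp add: power_mult_distrib)
    also have "\<dots> \<le> 32 * ?D ^ 5 * (C * ((norm w)\<^sup>2 * ?z ^ 3))" using C(2)[OF w] by (intro mult_left_mono) auto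
    finally have "?z ^ 3 * ?z ^ 7 \<le> ?z ^ 3 * (32 * C * (?D ^ 5 * (norm w)\<^sup>2))"
      by (simp add: power_mult[symmetric] power_add[symmetric] mult_ac)
    then show "?z ^ 7 \<le> 32 * C * (?D ^ 5 * (norm w)\<^sup>2)"
    proof (cases "?z = 0")
      case False
      with \<open>?z ^ 3 * ?z ^ 7 \<le> ?z ^ 3 * (32 * C * (?D ^ 5 * (norm w)\<^sup>2))\<close> show ?thesis
        by (subst (asm) mult_le_cancel_left_pos) auto
    qed (use C in simp)
  qed
qed

subsection \<open>Complex conjugation\<close>

lemma wderiv_cnj: "v \<in> sobolev m \<Longrightarrow> j \<le> m \<Longrightarrow> wderiv j (cnj_L2 v) = cnj_L2 (wderiv j v)"
  by (rule wderiv_eqI[OF has_weak_deriv_cnj[OF has_weak_deriv_wderiv]])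

lemma sobolev_cnj: "v \<in> sobolev m \<Longrightarrow> cnj_L2 v \<in> sobolev m"
  unfolding sobolev_def using has_weak_deriv_cnj by blast

lemma trace_at_cnj:
  assumes "has_weak_deriv 1 v w" "p \<in> {0..1}"
  shows "trace_at (cnj_L2 v) p = cnj (trace_at v p)"
proof (rule trace_at_eqI)
  show "continuous_on {0..1} (\<lambda>p. cnj (trace_at v p))"
    by (intro continuous_intros primitive_of_continuous[OF weak_deriv_primitive(1)[OF assms(1)]])
  show "AE x in lebI. rep_L2 (cnj_L2 v) x = cnj (trace_at v x)"
    using rep_cnj_L2[of v] weak_deriv_primitive(2)[OF assms(1)] by eventually_elim simp
qed (rule assms)

lemma kawahara_cnj:
  assumes v: "v \<in> kawahara_dom \<alpha>"
  shows "cnj_L2 v \<in> kawahara_dom \<alpha>" "kawahara_op (cnj_L2 v) = cnj_L2 (kawahara_op v)"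
proof -
  have s: "v \<in> sobolev 5" using v by (simp add: kawahara_dom_def)
  note bc = kawahara_bc[OF v] and ch = kawahara_chain[OF v]
  note w = wderiv_cnj[OF s]
  show "cnj_L2 v \<in> kawahara_dom \<alpha>"
    unfolding kawahara_dom_def
    using sobolev_cnj[OF s] bc trace_at_cnj[OF ch(1)] trace_at_cnj[OF ch(2)] trace_at_cnj[OF ch(3)]
    by (simp add: w)
  interpret bounded_linear cnj_L2 by (rule bounded_linear_cnj_L2)
  show "kawahara_op (cnj_L2 v) = cnj_L2 (kawahara_op v)"
    unfolding kawahara_op_def by (simp add: w diff)
qed

section \<open>Contraction semigroups\<close>

lemma nonincreasing_of_deriv:
  fixes f :: "real \<Rightarrow> real"
  assumes "\<And>s. 0 \<le> s \<Longrightarrow> s \<le> t \<Longrightarrow> (f has_real_derivative f' s) (at s within {0..})"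
    and "\<And>s. 0 \<le> s \<Longrightarrow> s \<le> t \<Longrightarrow> f' s \<le> 0" and "0 \<le> t"
  shows "f t \<le> f 0"
proof (rule DERIV_nonpos_imp_decreasing_open[OF \<open>0 \<le> t\<close>])
  fix s assume s: "0 < s" "s < t"
  have "at s within {0..} = at s" using s by (intro at_within_interior) auto
  then show "\<exists>y. (f has_real_derivative y) (at s) \<and> y \<le> 0"
    using assms(1)[of s] assms(2)[of s] s by auto
next
  have "continuous (at s within {0..t}) f" if "s \<in> {0..t}" for s
  proof (rule continuous_within_subset)
    show "continuous (at s within {0..}) f"
      by (rule DERIV_continuous[OF assms(1)]) (use that in auto)
  qed auto
  then show "continuous_on {0..t} f"
    unfolding continuous_on_eq_continuous_within by blast
qed

text \<open>The generator is defined by limits at \<open>0\<close> from the right, whereas derivatives of orbits live on closed half-lines.\<close>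

lemma right_difference_quotient:
  fixes f :: "real \<Rightarrow> 'a::real_normed_vector"
  assumes "(f has_vector_derivative f') (at x within S)" "eventually (\<lambda>y. y \<in> S) (at_right x)"
  shows "((\<lambda>k. (f (x + k) - f x) /\<^sub>R k) \<longlongrightarrow> f') (at_right 0)"
proof -
  have "at_right x \<le> at x within S"
  proof (rule filter_leI)
    fix P assume "eventually P (at x within S)"
    then have "eventually (\<lambda>y. y \<noteq> x \<longrightarrow> y \<in> S \<longrightarrow> P y) (nhds x)" by (simp add: eventually_at_filter)
    then have "eventually (\<lambda>y. y \<noteq> x \<longrightarrow> y \<in> S \<longrightarrow> P y) (at_right x)"
      unfolding eventually_at_filter by (rule eventually_mono) auto
    moreover have "eventually (\<lambda>y. y \<noteq> x) (at_right x)" by (auto simp: eventually_at_filter)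
    ultimately show "eventually P (at_right x)" using assms(2) by eventually_elim auto
  qed
  moreover have "((\<lambda>y. (1 / norm (y - x)) *\<^sub>R (f y - (f x + (y - x) *\<^sub>R f'))) \<longlongrightarrow> 0) (at x within S)"
    using assms(1) by (simp add: has_vector_derivative_def has_derivative_within)
  ultimately have "((\<lambda>y. (1 / norm (y - x)) *\<^sub>R (f y - (f x + (y - x) *\<^sub>R f'))) \<longlongrightarrow> 0) (at_right x)"
    by (rule tendsto_mono)
  then have "((\<lambda>k. (1 / norm k) *\<^sub>R (f (k + x) - (f x + k *\<^sub>R f'))) \<longlongrightarrow> 0) (at_right 0)"
    by (simp add: filterlim_at_right_to_0[of _ _ x])
  moreover have "eventually (\<lambda>k. (1 / norm k) *\<^sub>R (f (k + x) - (f x + k *\<^sub>R f')) = (f (x + k) - f x) /\<^sub>R k - f') (at_right (0::real))"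
    by (auto simp: eventually_at_filter algebra_simps divide_inverse)
  ultimately have "((\<lambda>k. (f (x + k) - f x) /\<^sub>R k - f') \<longlongrightarrow> 0) (at_right 0)"
    by (rule Lim_transform_eventually)
  then show ?thesis by (simp add: LIM_zero_iff)
qed

locale contraction_semigroup =
  fixes S :: "real \<Rightarrow> 'a::banach \<Rightarrow> 'a" and D :: "'a set" and G :: "'a \<Rightarrow> 'a"
  assumes S_add: "0 \<le> t \<Longrightarrow> S t (v + w) = S t v + S t w"
    and S_scaleR: "0 \<le> t \<Longrightarrow> S t (r *\<^sub>R v) = r *\<^sub>R S t v"
    and S_norm: "0 \<le> t \<Longrightarrow> norm (S t v) \<le> norm v"
    and S_0 [simp]: "S 0 v = v"
    and S_plus: "0 \<le> s \<Longrightarrow> 0 \<le> t \<Longrightarrow> S (s + t) v = S s (S t v)"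
    and S_lim: "((\<lambda>t. S t v) \<longlongrightarrow> v) (at_right 0)"
    and gen: "((\<lambda>h. (S h v - v) /\<^sub>R h) \<longlongrightarrow> w) (at_right 0) \<longleftrightarrow> v \<in> D \<and> w = G v"
begin

lemma S_bounded_linear: "0 \<le> t \<Longrightarrow> bounded_linear (S t)"
  by (rule bounded_linear_intro[where K = 1]) (auto simp: S_add S_scaleR S_norm)

lemma S_diff: "0 \<le> t \<Longrightarrow> S t (v - w) = S t v - S t w"
  using S_bounded_linear by (simp add: bounded_linear.linear linear_diff)

lemma S_zero [simp]: "0 \<le> t \<Longrightarrow> S t 0 = 0"
  using S_bounded_linear by (simp add: bounded_linear.linear linear_0)

lemma S_diff_le:
  assumes "0 \<le> s" "0 \<le> t" shows "norm (S t v - S s v) \<le> norm (S \<bar>t - s\<bar> v - v)"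
proof -
  have *: "norm (S t v - S s v) \<le> norm (S (t - s) v - v)" if "0 \<le> s" "s \<le> t" for s t
  proof -
    have "S t v - S s v = S s (S (t - s) v - v)"
      using S_plus[of s "t - s" v] that by (simp add: S_diff)
    then show ?thesis using S_norm[OF that(1)] by metis
  qed
  show ?thesis using *[of s t] *[of t s] assms by (cases "s \<le> t") (auto simp: norm_minus_commute)
qed

lemma continuous_on_S: "continuous_on {0..} (\<lambda>t. S t v)"
  unfolding continuous_on_iff
proof (intro ballI allI impI)
  fix t e :: real assume t: "t \<in> {0..}" and e: "0 < e"
  from tendstoD[OF S_lim e, of v] obtain d where d: "d > 0" "\<And>h. 0 < h \<Longrightarrow> h < d \<Longrightarrow> dist (S h v) v < e"
    unfolding eventually_at_right_field by auto
  have "dist (S s v) (S t v) < e" if s: "s \<in> {0..}" "dist s t < d" for s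
  proof (cases "s = t")
    case False
    then have "norm (S \<bar>s - t\<bar> v - v) < e" using d(2)[of "\<bar>s - t\<bar>"] s by (simp add: dist_norm)
    then show ?thesis using S_diff_le[of t s v] s t by (simp add: dist_norm)
  qed (use e in simp)
  then show "\<exists>d>0. \<forall>s\<in>{0..}. dist s t < d \<longrightarrow> dist (S s v) (S t v) < e" using d(1) by blast
qed

lemma continuous_on_S_compose [continuous_intros]:
  fixes \<tau> :: "'b::topological_space \<Rightarrow> real"
  assumes \<tau>: "continuous_on A \<tau>" "\<And>s. s \<in> A \<Longrightarrow> 0 \<le> \<tau> s" and f: "continuous_on A f"
  shows "continuous_on A (\<lambda>s. S (\<tau> s) (f s))"
  unfolding continuous_on_def
proof
  fix a assume a: "a \<in> A"
  have inA: "eventually (\<lambda>s. s \<in> A) (at a within A)" by (simp add: eventually_at_topological) blast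
  have "((\<lambda>s. norm (f s - f a)) \<longlongrightarrow> 0) (at a within A)"
    using f a by (auto simp: continuous_on_def tendsto_norm_zero_iff LIM_zero_iff)
  then have 1: "((\<lambda>s. S (\<tau> s) (f s - f a)) \<longlongrightarrow> 0) (at a within A)"
    by (rule Lim_null_comparison[rotated]) (use inA in eventually_elim, simp add: S_norm \<tau>)
  have "continuous_on A (\<lambda>s. S (\<tau> s) (f a))"
    by (rule continuous_on_compose2[OF continuous_on_S \<tau>(1)]) (use \<tau>(2) in auto)
  then have 2: "((\<lambda>s. S (\<tau> s) (f a)) \<longlongrightarrow> S (\<tau> a) (f a)) (at a within A)"
    using a by (simp add: continuous_on_def)
  have "((\<lambda>s. S (\<tau> s) (f s - f a) + S (\<tau> s) (f a)) \<longlongrightarrow> 0 + S (\<tau> a) (f a)) (at a within A)"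
    by (intro tendsto_add 1 2)
  then have "((\<lambda>s. S (\<tau> s) (f s - f a) + S (\<tau> s) (f a)) \<longlongrightarrow> S (\<tau> a) (f a)) (at a within A)" by simp
  then show "((\<lambda>s. S (\<tau> s) (f s)) \<longlongrightarrow> S (\<tau> a) (f a)) (at a within A)"
    by (rule Lim_transform_eventually) (use inA in eventually_elim, simp add: S_diff \<tau>)
qed

lemma S_D:
  assumes v: "v \<in> D" and t: "0 \<le> t"
  shows "S t v \<in> D" "G (S t v) = S t (G v)"
proof -
  have "((\<lambda>h. S t ((S h v - v) /\<^sub>R h)) \<longlongrightarrow> S t (G v)) (at_right 0)"
    using v gen[of v "G v"] by (intro bounded_linear.tendsto[OF S_bounded_linear[OF t]]) simp
  moreover have "eventually (\<lambda>h. S t ((S h v - v) /\<^sub>R h) = (S h (S t v) - S t v) /\<^sub>R h) (at_right 0)"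
    unfolding eventually_at_filter
  proof (rule always_eventually, intro allI impI)
    fix h :: real assume "h \<noteq> 0" "h \<in> {0<..}"
    then show "S t ((S h v - v) /\<^sub>R h) = (S h (S t v) - S t v) /\<^sub>R h"
      using t S_plus[of t h v] S_plus[of h t v] by (simp add: S_diff S_scaleR add.commute)
  qed
  ultimately have "((\<lambda>h. (S h (S t v) - S t v) /\<^sub>R h) \<longlongrightarrow> S t (G v)) (at_right 0)"
    by (rule Lim_transform_eventually)
  then show "S t v \<in> D" "G (S t v) = S t (G v)" unfolding gen by auto
qed

lemma S_has_vector_derivative:
  assumes v: "v \<in> D" and t: "0 \<le> t"
  shows "((\<lambda>t. S t v) has_vector_derivative S t (G v)) (at t within {0..})"
  unfolding has_vector_derivative_def has_derivative_within
proof (intro conjI bounded_linear_scaleR_left tendstoI)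
  fix e :: real assume e: "0 < e"
  have "((\<lambda>h. (S h v - v) /\<^sub>R h) \<longlongrightarrow> G v) (at_right 0)" using v gen by blast
  from tendstoD[OF this, of "e/2"] e obtain d1 where d1: "d1 > 0"
    "\<And>h. 0 < h \<Longrightarrow> h < d1 \<Longrightarrow> norm ((S h v - v) /\<^sub>R h - G v) < e / 2"
    unfolding eventually_at_right_field by (auto simp: dist_norm)
  from tendstoD[OF S_lim, of "e/2" "G v"] e obtain d2 where d2: "d2 > 0"
    "\<And>h. 0 < h \<Longrightarrow> h < d2 \<Longrightarrow> norm (S h (G v) - G v) < e / 2"
    unfolding eventually_at_right_field by (auto simp: dist_norm)
  have "dist ((1 / norm (y - t)) *\<^sub>R (S y v - (S t v + (y - t) *\<^sub>R S t (G v)))) 0 < e"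
    if y: "y \<in> {0..}" "y \<noteq> t" "dist y t < min d1 d2" for y
  proof -
    define h where "h = \<bar>y - t\<bar>"
    define m where "m = min t y"
    have h: "0 < h" "h < d1" "h < d2" using y by (auto simp: h_def dist_real_def)
    have m: "0 \<le> m" using y t by (simp add: m_def)
    define q where "q = S m ((S h v - v) /\<^sub>R h)"
    have qh: "h *\<^sub>R q = S (m + h) v - S m v"
      using S_plus[of m h v] h(1) m by (simp add: q_def S_scaleR S_diff)
    have q: "S y v - S t v = (y - t) *\<^sub>R q"
    proof (cases "t < y")
      case True
      then have e: "m + h = y" "m = t" "h = y - t" by (auto simp: h_def m_def)
      have "S (m + h) v = S y v" by (simp only: e(1))
      then show ?thesis using qh by (simp only: e(2,3))
    next
      case False
      then have e: "m + h = t" "m = y" "h = t - y" by (auto simp: h_def m_def)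
      have "(t - y) *\<^sub>R q = S t v - S y v" proof -
        have "S (m + h) v = S t v" by (simp only: e(1))
        then show ?thesis using qh by (simp only: e(2,3))
      qed
      then show ?thesis by (simp add: algebra_simps)
    qed
    have "norm (q - S t (G v)) \<le> norm (q - S m (G v)) + norm (S m (G v) - S t (G v))"
      using norm_triangle_ineq[of "q - S m (G v)" "S m (G v) - S t (G v)"] by simp
    also have "norm (q - S m (G v)) \<le> norm ((S h v - v) /\<^sub>R h - G v)"
      unfolding q_def S_diff[OF m, symmetric] by (rule S_norm[OF m])
    also have "norm (S m (G v) - S t (G v)) \<le> e / 2"
    proof (cases "m = t")
      case False
      then have "norm (S m (G v) - S t (G v)) \<le> norm (S h (G v) - G v)"
        using S_diff_le[OF t m, of "G v"] by (auto simp: m_def h_def min_def abs_minus_commute split: if_splits)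
      then show ?thesis using d2(2)[OF h(1) h(3)] by linarith
    qed (use e in simp)
    finally have "norm (q - S t (G v)) < e" using d1(2)[OF h(1,2)] by linarith
    moreover have "S y v - (S t v + (y - t) *\<^sub>R S t (G v)) = (y - t) *\<^sub>R (q - S t (G v))"
      using q by (simp add: algebra_simps)
    ultimately show ?thesis using y(2) by simp
  qed
  then show "eventually (\<lambda>y. dist ((1 / norm (y - t)) *\<^sub>R (S y v - (S t v + (y - t) *\<^sub>R S t (G v)))) 0 < e) (at t within {0..})"
    unfolding eventually_at using d1(1) d2(1) by (intro exI[of _ "min d1 d2"]) auto
qed

lemma D_scaleR:
  assumes "v \<in> D" shows "r *\<^sub>R v \<in> D" "G (r *\<^sub>R v) = r *\<^sub>R G v"
proof -
  have "((\<lambda>h. r *\<^sub>R ((S h v - v) /\<^sub>R h)) \<longlongrightarrow> r *\<^sub>R G v) (at_right 0)"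
    using assms gen by (intro tendsto_intros) blast
  moreover have "eventually (\<lambda>h. r *\<^sub>R ((S h v - v) /\<^sub>R h) = (S h (r *\<^sub>R v) - r *\<^sub>R v) /\<^sub>R h) (at_right 0)"
    unfolding eventually_at_filter by (rule always_eventually) (auto simp: S_scaleR algebra_simps)
  ultimately have "((\<lambda>h. (S h (r *\<^sub>R v) - r *\<^sub>R v) /\<^sub>R h) \<longlongrightarrow> r *\<^sub>R G v) (at_right 0)"
    by (rule Lim_transform_eventually)
  then show "r *\<^sub>R v \<in> D" "G (r *\<^sub>R v) = r *\<^sub>R G v" unfolding gen by auto
qed

lemma D_diff:
  assumes "v \<in> D" "w \<in> D" shows "v - w \<in> D" "G (v - w) = G v - G w"
proof -
  have "((\<lambda>h. (S h v - v) /\<^sub>R h - (S h w - w) /\<^sub>R h) \<longlongrightarrow> G v - G w) (at_right 0)"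
    using assms gen by (intro tendsto_diff) blast+
  moreover have "eventually (\<lambda>h. (S h v - v) /\<^sub>R h - (S h w - w) /\<^sub>R h = (S h (v - w) - (v - w)) /\<^sub>R h) (at_right 0)"
    unfolding eventually_at_filter by (rule always_eventually) (auto simp: S_diff algebra_simps)
  ultimately have "((\<lambda>h. (S h (v - w) - (v - w)) /\<^sub>R h) \<longlongrightarrow> G v - G w) (at_right 0)"
    by (rule Lim_transform_eventually)
  then show "v - w \<in> D" "G (v - w) = G v - G w" unfolding gen by auto
qed

text \<open>Time integrals of orbits lie in the domain; their means over short intervals show that the domain is dense.\<close>

definition orbit_integral :: "'a \<Rightarrow> real \<Rightarrow> 'a" where
  "orbit_integral v x = integral {0..x} (\<lambda>s. S s v)"

lemma orbit_integral_deriv: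
  assumes "0 \<le> x" "x \<le> b"
  shows "((orbit_integral v) has_vector_derivative S x v) (at x within {0..b})"
  unfolding orbit_integral_def
  by (rule integral_has_vector_derivative) (use assms in \<open>auto intro: continuous_on_subset[OF continuous_on_S]\<close>)

lemma orbit_integral_shift:
  assumes k: "0 \<le> k" and h: "0 \<le> h"
  shows "S k (orbit_integral v h) = orbit_integral v (h + k) - orbit_integral v k"
proof -
  have 1: "((\<lambda>s. S (s + k) v) has_integral orbit_integral v (h + k) - orbit_integral v (0 + k)) {0..h}"
  proof (rule fundamental_theorem_of_calculus[OF h])
    fix s assume s: "s \<in> {0..h}"
    have "((\<lambda>x. x + k) has_vector_derivative 1) (at s within {0..h})"
      by (auto intro!: derivative_eq_intros)
    moreover have "(orbit_integral v has_vector_derivative S (s + k) v) (at (s + k) within (\<lambda>x. x + k) ` {0..h})"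
      by (rule has_vector_derivative_within_subset[OF orbit_integral_deriv[of "s + k" "h + k"]]) (use s k in auto)
    ultimately have "(orbit_integral v \<circ> (\<lambda>x. x + k) has_vector_derivative 1 *\<^sub>R S (s + k) v) (at s within {0..h})"
      by (rule vector_diff_chain_within)
    then show "((\<lambda>x. orbit_integral v (x + k)) has_vector_derivative S (s + k) v) (at s within {0..h})"
      by (simp add: comp_def)
  qed
  have 2: "((\<lambda>s. S (s + k) v) has_integral S k (orbit_integral v h)) {0..h}"
  proof -
    have "(\<lambda>s. S s v) integrable_on {0..h}"
      by (intro integrable_continuous_real continuous_on_subset[OF continuous_on_S]) auto
    then have "((\<lambda>s. S s v) has_integral orbit_integral v h) {0..h}"
      unfolding orbit_integral_def by (rule integrable_integral)
    from has_integral_linear[OF this S_bounded_linear[OF k]]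
    show ?thesis
      by (rule has_integral_eq[rotated]) (use k in \<open>auto simp: S_plus[symmetric] add.commute\<close>)
  qed
  show ?thesis using has_integral_unique[OF 2 1] by simp
qed

lemma orbit_integral_D:
  assumes h: "0 \<le> h" shows "orbit_integral v h \<in> D" "G (orbit_integral v h) = S h v - v"
proof -
  have "((\<lambda>k. (orbit_integral v (h + k) - orbit_integral v h) /\<^sub>R k) \<longlongrightarrow> S h v) (at_right 0)"
    by (rule right_difference_quotient[OF orbit_integral_deriv[of h "h + 1"]])
       (use h in \<open>auto simp: eventually_at_right_field intro!: exI[of _ "h + 1"]\<close>)
  moreover have "((\<lambda>k. (orbit_integral v (0 + k) - orbit_integral v 0) /\<^sub>R k) \<longlongrightarrow> S 0 v) (at_right 0)"
    by (rule right_difference_quotient[OF orbit_integral_deriv[of 0 1]])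
       (auto simp: eventually_at_right_field intro!: exI[of _ "1"])
  ultimately have "((\<lambda>k. (orbit_integral v (h + k) - orbit_integral v h) /\<^sub>R k - (orbit_integral v (0 + k) - orbit_integral v 0) /\<^sub>R k) \<longlongrightarrow> S h v - S 0 v) (at_right 0)"
    by (rule tendsto_diff)
  moreover have "eventually (\<lambda>k. (orbit_integral v (h + k) - orbit_integral v h) /\<^sub>R k - (orbit_integral v (0 + k) - orbit_integral v 0) /\<^sub>R k
     = (S k (orbit_integral v h) - orbit_integral v h) /\<^sub>R k) (at_right 0)"
    unfolding eventually_at_filter
    by (rule always_eventually) (use h in \<open>auto simp: orbit_integral_shift orbit_integral_def[of v 0] algebra_simps\<close>)
  ultimately have "((\<lambda>k. (S k (orbit_integral v h) - orbit_integral v h) /\<^sub>R k) \<longlongrightarrow> S h v - S 0 v) (at_right 0)"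
    by (rule Lim_transform_eventually)
  then show "orbit_integral v h \<in> D" "G (orbit_integral v h) = S h v - v" unfolding gen by auto
qed

lemma orbit_mean_tendsto: "(\<lambda>n. real (Suc n) *\<^sub>R orbit_integral v (1 / real (Suc n))) \<longlonglongrightarrow> v"
proof -
  have "((\<lambda>k. (orbit_integral v (0 + k) - orbit_integral v 0) /\<^sub>R k) \<longlongrightarrow> S 0 v) (at_right 0)"
    by (rule right_difference_quotient[OF orbit_integral_deriv[of 0 1]])
       (auto simp: eventually_at_right_field intro!: exI[of _ "1"])
  moreover have "filterlim (\<lambda>n. 1 / real (Suc n)) (at_right 0) sequentially"
    using LIMSEQ_inverse_real_of_nat by (auto simp: filterlim_at divide_inverse)
  ultimately have "((\<lambda>n. (orbit_integral v (0 + 1 / real (Suc n)) - orbit_integral v 0) /\<^sub>R (1 / real (Suc n))) \<longlonglongrightarrow> S 0 v)"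
    by (rule filterlim_compose)
  then show ?thesis by (simp add: orbit_integral_def[of v 0] divide_inverse)
qed

lemma closure_D: "closure D = UNIV"
proof -
  have "v \<in> closure D" for v
    unfolding closure_sequential
  proof (intro exI conjI allI)
    show "real (Suc n) *\<^sub>R orbit_integral v (1 / real (Suc n)) \<in> D" for n
      by (intro D_scaleR(1) orbit_integral_D(1)) simp
  qed (rule orbit_mean_tendsto)
  then show ?thesis by blast
qed

text \<open>The domain of the square of the generator. On it the orbit of \<open>G v\<close> is differentiable, too.\<close>

definition D2 :: "'a set" where
  "D2 = {v \<in> D. G v \<in> D}"

lemma closure_D2: "closure D2 = UNIV"
proof -
  have "D \<subseteq> closure D2"
  proof
    fix v assume v: "v \<in> D"
    have "real (Suc n) *\<^sub>R orbit_integral v (1 / real (Suc n)) \<in> D2" for n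
    proof -
      have h: "0 \<le> 1 / real (Suc n)" by simp
      note o = orbit_integral_D[OF h, of v]
      have "S (1 / real (Suc n)) v - v \<in> D" by (rule D_diff(1)[OF S_D(1)[OF v h] v])
      then show ?thesis
        unfolding D2_def using D_scaleR(1)[OF o(1)] D_scaleR(2)[OF o(1)] D_scaleR(1) o(2) by simp
    qed
    then have "\<forall>n. real (Suc n) *\<^sub>R orbit_integral v (1 / real (Suc n)) \<in> D2" by blast
    then show "v \<in> closure D2"
      unfolding closure_sequential
      by (intro exI[where x = "\<lambda>n. real (Suc n) *\<^sub>R orbit_integral v (1 / real (Suc n))"] conjI orbit_mean_tendsto)
  qed
  then have "closure D \<subseteq> closure D2" by (simp add: closure_minimal)
  then show ?thesis unfolding closure_D by blast
qed

lemma D2_approx: obtains f where "\<And>n. f n \<in> D2" "f \<longlonglongrightarrow> v"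
proof -
  have "v \<in> closure D2" unfolding closure_D2 by (rule UNIV_I)
  then obtain f where "\<forall>n. f n \<in> D2" "f \<longlonglongrightarrow> v" unfolding closure_sequential by blast
  then show thesis using that by blast
qed

end

section \<open>Decay and smoothing of the Kawahara semigroup\<close>

lemma power_powr: "0 < x \<Longrightarrow> (x ^ n) powr a = x powr (real n * a)" for x :: real
  by (simp only: powr_realpow[symmetric] powr_powr)

lemma powr_scaling:
  fixes P t :: real assumes P: "P > 0" and t: "t > 0"
  shows "(2/5 * (5 / P) * t) powr (-5/2) = P powr (5/2) * (2 powr (-5/2) * t powr (-5/2))"
proof -
  have e: "2/5 * (5 / P) * t = (2 * t) / P" by simp
  have "((2 * t) / P) powr (-5/2) = (2 * t) powr (-5/2) / P powr (-5/2)"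
    by (rule powr_divide)
  also have "P powr (-5/2) = inverse (P powr (5/2))"
    using powr_minus[of P "5/2"] by simp
  also have "(2 * t) powr (-5/2) / inverse (P powr (5/2)) = (2 * t) powr (-5/2) * P powr (5/2)"
    by (simp only: divide_inverse inverse_inverse_eq)
  also have "(2 * t) powr (-5/2) = 2 powr (-5/2) * t powr (-5/2)"
    by (rule powr_mult)
  finally show ?thesis unfolding e by (simp only: mult_ac)
qed

lemma powr_minus_five_halves: "t powr (-5/2) = (1 / sqrt t) ^ 5" if t: "t > 0" for t :: real
proof -
  have "(1 / sqrt t) ^ 5 = (t powr (-1/2)) ^ 5"
    using powr_half_sqrt[of t] powr_minus_divide[of t "1/2"] t by simp
  also have "\<dots> = (t powr (-1/2)) powr (real 5)"
    using t by (intro powr_realpow[symmetric]) auto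
  also have "\<dots> = t powr (-5/2)" by (simp only: powr_powr) simp
  finally show ?thesis by simp
qed

lemma powr_nash_const:
  fixes k C N :: real assumes "C > 0" "N > 0"
  shows "(k powr (7/5) * (C * N\<^sup>2) powr (2/5)) powr (5/2) = k powr (7/2) * (C * N\<^sup>2)"
proof -
  have "(k powr (7/5) * (C * N\<^sup>2) powr (2/5)) powr (5/2) = (k powr (7/5)) powr (5/2) * ((C * N\<^sup>2) powr (2/5)) powr (5/2)"
    by (rule powr_mult)
  also have "\<dots> = k powr (7/2) * (C * N\<^sup>2) powr 1" by (simp only: powr_powr) simp
  also have "(C * N\<^sup>2) powr 1 = C * N\<^sup>2" using assms by (intro powr_one) auto
  finally show ?thesis .
qed

lemma powr_energy: "(k * Z\<^sup>2) powr (7/5) = k powr (7/5) * (Z ^ 7) powr (2/5)" if "Z > 0" for k Z :: real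
proof -
  have "(Z\<^sup>2) powr (7/5) = (Z ^ 7) powr (2/5)"
    unfolding power_powr[OF that] by simp
  then show ?thesis using powr_mult[of k "Z\<^sup>2" "7/5"] by (simp only:)
qed

lemma powr_dissipation: "(A * D ^ 5) powr (2/5) = A powr (2/5) * D\<^sup>2" if "D > 0" for A D :: real
proof -
  have "(D ^ 5) powr (2/5) = D powr 2" unfolding power_powr[OF that] by simp
  also have "\<dots> = D\<^sup>2" using that by simp
  finally show ?thesis using powr_mult[of A "D ^ 5" "2/5"] by (simp only:)
qed

lemma collect_powers: "x * (n ^ 3 * (y * n\<^sup>2 * (1 / s) ^ 5)) = x * y * (1 / s * n) ^ 5" for x y n s :: real
proof -
  have "n ^ 5 = n ^ 3 * n\<^sup>2" by (simp add: power_add[symmetric])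
  then show ?thesis by (simp only: power_mult_distrib mult_ac)
qed

text \<open>Where \<open>e\<close> is positive, \<open>e\<^sup>-\<^sup>2\<^sup>/\<^sup>5\<close> grows at least linearly with slope \<open>2/5 k\<close>. The bound does not involve \<open>e 0\<close>.\<close>

lemma nash_ode:
  fixes e :: "real \<Rightarrow> real"
  assumes e: "\<And>s. 0 \<le> s \<Longrightarrow> (e has_real_derivative e' s) (at s within {0..})"
    and pos: "\<And>s. 0 \<le> s \<Longrightarrow> 0 \<le> e s"
    and le: "\<And>s. 0 \<le> s \<Longrightarrow> e' s \<le> - k * e s powr (7/5)" and k: "k > 0" and t: "t > 0"
  shows "e t \<le> (2/5 * k * t) powr (-5/2)"
proof (cases "e t = 0")
  case True
  then show ?thesis by simp
next
  case False
  have mono: "e t \<le> e s" if s: "0 \<le> s" "s \<le> t" for s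
  proof -
    have "e' x \<le> 0" if "0 \<le> x" for x using le[OF that] k by (smt (verit) powr_ge_zero mult_nonneg_nonneg minus_mult_left)
    moreover have "e (s + (t - s)) \<le> e (s + 0)"
    proof (rule nonincreasing_of_deriv[where f = "\<lambda>r. e (s + r)" and f' = "\<lambda>r. e' (s + r)"])
      fix r assume r: "0 \<le> r" "r \<le> t - s"
      have "((\<lambda>x. s + x) has_real_derivative 1) (at r within {0..})" by (auto intro!: derivative_eq_intros)
      moreover have "(e has_real_derivative e' (s + r)) (at (s + r) within (\<lambda>x. s + x) ` {0..})"
        by (rule DERIV_subset[OF e]) (use r s in auto)
      ultimately show "((\<lambda>r. e (s + r)) has_real_derivative e' (s + r)) (at r within {0..})"
        using DERIV_chain[of e "e' (s + r)" "\<lambda>x. s + x" r 1 "{0..}"] DERIV_image_chain[of e "e' (s + r)" "\<lambda>x. s + x" r "{0..}" 1]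
        by (simp add: comp_def)
    qed (use s calculation in auto)
    ultimately show ?thesis by simp
  qed
  have et: "e t > 0" using False pos[of t] t by simp
  have ep: "e s > 0" if "0 \<le> s" "s \<le> t" for s using mono[OF that] et by linarith
  define f where "f s = 2/5 * k * s - e s powr (-2/5)" for s
  have "f t \<le> f 0"
  proof (rule nonincreasing_of_deriv)
    fix s assume s: "0 \<le> s" "s \<le> t"
    show "(f has_real_derivative (2/5 * k - (-2/5) * e s powr (-2/5 - 1) * e' s)) (at s within {0..})"
      unfolding f_def[abs_def]
      by (rule derivative_eq_intros e[OF s(1)] refl | use ep[OF s] in simp)+
    have "e s powr (-7/5) * e' s \<le> e s powr (-7/5) * (- k * e s powr (7/5))"
      by (intro mult_left_mono le s) simp
    also have "\<dots> = - k"
      using ep[OF s] by (simp add: powr_minus field_simps)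
    finally show "2/5 * k - (-2/5) * e s powr (-2/5 - 1) * e' s \<le> 0" by simp
  qed (use t in simp)
  then have "2/5 * k * t \<le> e t powr (-2/5)" unfolding f_def by (smt (verit) powr_ge_zero mult_zero_right)
  then have "(e t powr (-2/5)) powr (-5/2) \<le> (2/5 * k * t) powr (-5/2)"
    using k t by (intro powr_mono2') auto
  then show ?thesis using et by (simp add: powr_powr)
qed

locale kawahara_semigroup = contraction_semigroup S "kawahara_dom \<alpha>" kawahara_op
  for S :: "real \<Rightarrow> L2I \<Rightarrow> L2I" and \<alpha> :: real +
  assumes alpha: "\<bar>\<alpha>\<bar> < 1"
    and S_scaleC: "0 \<le> t \<Longrightarrow> S t (scaleC_L2 c v) = scaleC_L2 c (S t v)"
begin

lemma energy_deriv:
  assumes d: "\<And>t. 0 \<le> t \<Longrightarrow> (d has_vector_derivative kawahara_op (d t)) (at t within {0..})" and t: "0 \<le> t"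
  shows "((\<lambda>t. inner (weight \<alpha> (d t)) (d t)) has_real_derivative 2 * inner (weight \<alpha> (d t)) (kawahara_op (d t))) (at t within {0..})"
proof -
  have "((\<lambda>t. inner (weight \<alpha> (d t)) (d t)) has_vector_derivative
    inner (weight \<alpha> (d t)) (kawahara_op (d t)) + inner (weight \<alpha> (kawahara_op (d t))) (d t)) (at t within {0..})"
    by (intro bounded_bilinear.has_vector_derivative[OF bounded_bilinear_inner]
        bounded_linear.has_vector_derivative[OF bounded_linear_weight] d t)
  moreover have "inner (weight \<alpha> (kawahara_op (d t))) (d t) = inner (weight \<alpha> (d t)) (kawahara_op (d t))"
    using inner_weight_commute[of \<alpha> "kawahara_op (d t)" "d t"] by (simp add: inner_commute)
  ultimately show ?thesis by (simp add: has_real_derivative_iff_has_vector_derivative)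
qed

text \<open>Twice the rate is the quotient of the dissipation \<open>3 \<parallel>v\<parallel>\<^sup>2\<close> and the upper bound \<open>1 + 1 / (1 - \<alpha>\<^sup>2)\<close> of the weight;
  the amplitude compares the weighted with the plain norm.\<close>

definition rate :: real where
  "rate = 3 / (2 * (1 + 1 / (1 - \<alpha>\<^sup>2)))"

definition amp :: real where
  "amp = sqrt (1 + 1 / (1 - \<alpha>\<^sup>2))"

lemma rate_amp: "rate > 0" "amp \<ge> 1"
proof -
  have "\<alpha>\<^sup>2 < 1" using alpha by (simp add: abs_square_less_1)
  then have "1 / (1 - \<alpha>\<^sup>2) \<ge> 0" by simp
  then show "rate > 0" "amp \<ge> 1" by (auto simp: rate_def amp_def intro: divide_pos_pos add_pos_nonneg)
qed

text \<open>Stated for arbitrary differentiable solutions in the domain, since besides decay it gives uniqueness: a solution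
  starting at \<open>0\<close> stays there.\<close>

lemma energy_decay:
  assumes d: "\<And>t. 0 \<le> t \<Longrightarrow> (d has_vector_derivative kawahara_op (d t)) (at t within {0..})"
    and dom: "\<And>t. 0 \<le> t \<Longrightarrow> d t \<in> kawahara_dom \<alpha>" and t: "0 \<le> t"
  shows "norm (d t) \<le> amp * exp (- rate * t) * norm (d 0)"
proof -
  define K where "K = 1 + 1 / (1 - \<alpha>\<^sup>2)"
  have "\<alpha>\<^sup>2 < 1" using alpha by (simp add: abs_square_less_1)
  then have K: "K > 0" by (simp add: K_def add_pos_pos)
  have rK: "2 * rate * K = 3" using K by (simp add: rate_def K_def[symmetric])
  define E where "E s = inner (weight \<alpha> (d s)) (d s)" for s
  have "E t * exp (2 * rate * t) \<le> E 0 * exp (2 * rate * 0)"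
  proof (rule nonincreasing_of_deriv)
    fix s assume s: "0 \<le> s" "s \<le> t"
    let ?x = "inner (weight \<alpha> (d s)) (kawahara_op (d s))"
    show "((\<lambda>s. E s * exp (2 * rate * s)) has_real_derivative (2 * ?x * exp (2 * rate * s) + exp (2 * rate * s) * (2 * rate) * E s)) (at s within {0..})"
      unfolding E_def by (rule derivative_eq_intros energy_deriv[OF d s(1)] refl | simp)+
    have "?x \<le> - (5/2) * (norm (wderiv 2 (d s)))\<^sup>2 - (3/2) * (norm (wderiv 1 (d s)))\<^sup>2"
      by (rule dissipation[OF alpha dom[OF s(1)]])
    moreover have "(norm (d s))\<^sup>2 \<le> (norm (wderiv 1 (d s)))\<^sup>2"
      by (intro power_mono kawahara_poincare(1)[OF dom[OF s(1)]]) simp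
    moreover have "rate * E s \<le> rate * (K * (norm (d s))\<^sup>2)"
      unfolding E_def K_def using rate_amp(1) by (intro mult_left_mono weight_bounds[OF alpha]) simp
    moreover have "rate * (K * (norm (d s))\<^sup>2) = 3/2 * (norm (d s))\<^sup>2" using rK by simp
    ultimately have "2 * ?x + 2 * rate * E s \<le> 0" using zero_le_power2[of "norm (wderiv 2 (d s))"] by linarith
    then have "exp (2 * rate * s) * (2 * ?x + 2 * rate * E s) \<le> 0"
      by (simp add: mult_nonneg_nonpos)
    then show "2 * ?x * exp (2 * rate * s) + exp (2 * rate * s) * (2 * rate) * E s \<le> 0"
      by (simp add: algebra_simps)
  qed (rule t)
  then have "E t \<le> E 0 * exp (- 2 * rate * t)" by (simp add: exp_minus field_simps)
  moreover have "(norm (d t))\<^sup>2 \<le> E t" unfolding E_def by (rule weight_bounds[OF alpha])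
  moreover have "E 0 * exp (- 2 * rate * t) \<le> K * (norm (d 0))\<^sup>2 * exp (- 2 * rate * t)"
    unfolding E_def K_def by (intro mult_right_mono weight_bounds[OF alpha]) simp
  ultimately have "(norm (d t))\<^sup>2 \<le> K * (norm (d 0))\<^sup>2 * exp (- 2 * rate * t)" by linarith
  also have "\<dots> = (amp * exp (- rate * t) * norm (d 0))\<^sup>2"
    using K by (simp add: amp_def K_def[symmetric] power_mult_distrib exp_double[symmetric] mult_ac flip: exp_of_nat_mult)
  finally show ?thesis by (rule power2_le_imp_le) (use rate_amp in simp)
qed

lemma S_decay:
  assumes t: "0 \<le> t" shows "norm (S t v) \<le> amp * exp (- rate * t) * norm v"
proof -
  obtain f where f: "\<And>n. f n \<in> D2" "f \<longlonglongrightarrow> v" by (rule D2_approx[of v]) blast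
  have "norm (S t (f n)) \<le> amp * exp (- rate * t) * norm (f n)" for n
  proof -
    have fn: "f n \<in> kawahara_dom \<alpha>" using f(1)[of n] by (simp add: D2_def)
    show ?thesis
      using energy_decay[of "\<lambda>t. S t (f n)" t] S_has_vector_derivative[OF fn] S_D[OF fn] t by simp
  qed
  moreover have "(\<lambda>n. norm (S t (f n))) \<longlonglongrightarrow> norm (S t v)"
    by (intro tendsto_norm bounded_linear.tendsto[OF S_bounded_linear[OF t]] f)
  moreover have "(\<lambda>n. amp * exp (- rate * t) * norm (f n)) \<longlonglongrightarrow> amp * exp (- rate * t) * norm v"
    by (intro tendsto_intros f)
  ultimately show ?thesis by (intro LIMSEQ_le) auto
qed

text \<open>The energy \<open>e\<close> of \<open>z = S(s) G v\<close> satisfies \<open>e' \<le> - 5 \<parallel>z\<^sub>x\<^sub>x\<parallel>\<^sup>2\<close>. As \<open>z = G S(s) v\<close> and \<open>\<parallel>S(s) v\<parallel> \<le> \<parallel>v\<parallel>\<close>, the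
  Nash inequality turns the right-hand side into \<open>- k e\<^sup>7\<^sup>/\<^sup>5\<close> with \<open>k\<close> depending on \<open>\<parallel>v\<parallel>\<close> only.\<close>

lemma smoothing_generator:
  obtains K where "K \<ge> 0"
    "\<And>v t. v \<in> D2 \<Longrightarrow> t > 0 \<Longrightarrow> (norm (kawahara_op (S t v)))\<^sup>2 \<le> K * (norm v)\<^sup>2 * (1 / sqrt t) ^ 5"
proof -
  obtain C0 where C0: "C0 \<ge> 0"
    "\<And>w. w \<in> kawahara_dom \<alpha> \<Longrightarrow> kawahara_op w \<in> kawahara_dom \<alpha> \<Longrightarrow>
      norm (kawahara_op w) ^ 7 \<le> C0 * (norm (wderiv 2 (kawahara_op w)) ^ 5 * (norm w)\<^sup>2)"
    by (rule nash_inequality[OF alpha]) blast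
  define C where "C = C0 + 1"
  have C: "C > 0" using C0 by (simp add: C_def)
  define k1 where "k1 = 1 + 1 / (1 - \<alpha>\<^sup>2)"
  have "\<alpha>\<^sup>2 < 1" using alpha by (simp add: abs_square_less_1)
  then have k1: "k1 > 0" by (simp add: k1_def add_pos_pos)
  define K where "K = k1 powr (7/2) * C * 2 powr (-5/2)"
  have "(norm (kawahara_op (S t v)))\<^sup>2 \<le> K * (norm v)\<^sup>2 * (1 / sqrt t) ^ 5" if v: "v \<in> D2" and t: "t > 0" for v t
  proof (cases "v = 0")
    case True
    have "kawahara_op (0 :: L2I) = 0" using D_scaleR(2)[of v 0] v by (simp add: D2_def)
    then show ?thesis using True t by simp
  next
    case False
    define N where "N = norm v"
    have N: "N > 0" using False by (simp add: N_def)
    have vD: "v \<in> kawahara_dom \<alpha>" "kawahara_op v \<in> kawahara_dom \<alpha>" using v by (auto simp: D2_def)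
    define z where "z s = S s (kawahara_op v)" for s
    have zd: "z s \<in> kawahara_dom \<alpha>" "z s = kawahara_op (S s v)" "kawahara_op (z s) = S s (kawahara_op (kawahara_op v))" if "0 \<le> s" for s
      using S_D[OF vD(1) that] S_D[OF vD(2) that] by (auto simp: z_def)
    have zv: "(z has_vector_derivative kawahara_op (z s)) (at s within {0..})" if "0 \<le> s" for s
      using S_has_vector_derivative[OF vD(2) that] S_D[OF vD(2) that] by (simp add: z_def[abs_def])
    define P where "P = k1 powr (7/5) * (C * N\<^sup>2) powr (2/5)"
    have P: "P > 0" using k1 C N by (simp add: P_def)
    define e where "e s = inner (weight \<alpha> (z s)) (z s)" for s
    have en: "(norm (z s))\<^sup>2 \<le> e s" "e s \<le> k1 * (norm (z s))\<^sup>2" for s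
      unfolding e_def k1_def by (rule weight_bounds[OF alpha])+
    have "e t \<le> (2/5 * (5 / P) * t) powr (-5/2)"
    proof (rule nash_ode[OF _ _ _ _ t])
      show "(e has_real_derivative 2 * inner (weight \<alpha> (z s)) (kawahara_op (z s))) (at s within {0..})" if "0 \<le> s" for s
        unfolding e_def[abs_def] using energy_deriv[OF zv that] by simp
      show "0 \<le> e s" for s using en(1)[of s] by (meson order_trans zero_le_power2)
      show "0 < 5 / P" using P by simp
      fix s :: real assume s: "0 \<le> s"
      let ?D = "norm (wderiv 2 (z s))" and ?Z = "norm (z s)"
      have "2 * inner (weight \<alpha> (z s)) (kawahara_op (z s)) \<le> - 5 * ?D\<^sup>2"
        using dissipation[OF alpha zd(1)[OF s]] zero_le_power2[of "norm (wderiv 1 (z s))"] by linarith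
      also have "- 5 * ?D\<^sup>2 \<le> - (5 / P) * e s powr (7/5)"
      proof -
        have Sv: "S s v \<in> kawahara_dom \<alpha>" "norm (S s v) \<le> N" using S_D(1)[OF vD(1) s] S_norm[OF s, of v] by (auto simp: N_def)
        have "?Z ^ 7 \<le> C0 * (?D ^ 5 * (norm (S s v))\<^sup>2)"
          using C0(2)[OF Sv(1)] zd(1,2)[OF s] by simp
        also have "\<dots> \<le> C * (?D ^ 5 * N\<^sup>2)"
          using Sv C0(1) by (intro mult_mono power_mono) (auto simp: C_def)
        finally have Z7: "?Z ^ 7 \<le> (C * N\<^sup>2) * ?D ^ 5" by (simp add: mult_ac)
        have "e s powr (7/5) \<le> (k1 * ?Z\<^sup>2) powr (7/5)"
          using en[of s] by (intro powr_mono2) (auto intro: order_trans[OF zero_le_power2])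
        also have "\<dots> = k1 powr (7/5) * (?Z ^ 7) powr (2/5)"
        proof (cases "?Z = 0")
          case False
          then have "?Z > 0" by simp
          then show ?thesis by (rule powr_energy)
        qed simp
        also have "\<dots> \<le> k1 powr (7/5) * ((C * N\<^sup>2) * ?D ^ 5) powr (2/5)"
          using Z7 by (intro mult_left_mono powr_mono2) auto
        also have "\<dots> = P * ?D\<^sup>2"
        proof (cases "?D = 0")
          case False
          then have "?D > 0" by simp
          then show ?thesis unfolding powr_dissipation[OF \<open>?D > 0\<close>] by (simp add: P_def)
        qed simp
        finally show ?thesis using P by (simp add: field_simps)
      qed
      finally show "2 * inner (weight \<alpha> (z s)) (kawahara_op (z s)) \<le> - (5 / P) * e s powr (7/5)" .
    qed
    also have "(2/5 * (5 / P) * t) powr (-5/2) = K * N\<^sup>2 * (1 / sqrt t) ^ 5"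
    proof -
      have "(2/5 * (5 / P) * t) powr (-5/2) = P powr (5/2) * (2 powr (-5/2) * t powr (-5/2))"
        by (rule powr_scaling[OF P t])
      also have "P powr (5/2) = k1 powr (7/2) * (C * N\<^sup>2)"
        unfolding P_def by (rule powr_nash_const[OF C N])
      also have "t powr (-5/2) = (1 / sqrt t) ^ 5" by (rule powr_minus_five_halves[OF t])
      finally show ?thesis by (simp only: K_def mult_ac)
    qed
    finally have "e t \<le> K * N\<^sup>2 * (1 / sqrt t) ^ 5" .
    then show ?thesis using en(1)[of t] zd(2)[of t] t by (simp add: N_def)
  qed
  moreover have "K \<ge> 0" using C by (simp add: K_def)
  ultimately show thesis using that by blast
qed

text \<open>Interpolation of \<open>\<parallel>w\<^sub>x\<^sub>x\<parallel>\<^sup>5\<close> between \<open>\<parallel>w\<parallel>\<^sup>3\<close> and \<open>\<parallel>G w\<parallel>\<^sup>2\<close> for \<open>w = S(t) v\<close> gives \<open>t\<^sup>-\<^sup>5\<^sup>/\<^sup>2\<close>, whose fifth root is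
  integrable at \<open>0\<close>.\<close>

lemma smoothing_dom:
  obtains M where "M \<ge> 0"
    "\<And>v t. v \<in> D2 \<Longrightarrow> t > 0 \<Longrightarrow> norm (wderiv 2 (S t v)) \<le> M / sqrt t * norm v"
proof -
  obtain K where K: "K \<ge> 0"
    "\<And>v t. v \<in> D2 \<Longrightarrow> t > 0 \<Longrightarrow> (norm (kawahara_op (S t v)))\<^sup>2 \<le> K * (norm v)\<^sup>2 * (1 / sqrt t) ^ 5"
    by (rule smoothing_generator) blast
  obtain C where C: "C \<ge> 0"
    "\<And>v. v \<in> kawahara_dom \<alpha> \<Longrightarrow> norm (wderiv 2 v) ^ 5 \<le> C * (norm v ^ 3 * (norm (kawahara_op v))\<^sup>2)"
    by (rule kawahara_interpolation[OF alpha]) blast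
  define M where "M = C * K + 1"
  have M: "M \<ge> 1" using C K by (simp add: M_def)
  have "norm (wderiv 2 (S t v)) \<le> M / sqrt t * norm v" if v: "v \<in> D2" and t: "t > 0" for v t
  proof -
    have Sv: "S t v \<in> kawahara_dom \<alpha>" using v t by (auto simp: D2_def S_D)
    have "norm (wderiv 2 (S t v)) ^ 5 \<le> C * (norm (S t v) ^ 3 * (norm (kawahara_op (S t v)))\<^sup>2)" by (rule C(2)[OF Sv])
    also have "\<dots> \<le> C * (norm v ^ 3 * (K * (norm v)\<^sup>2 * (1 / sqrt t) ^ 5))"
      using C(1) K t by (intro mult_left_mono mult_mono power_mono S_norm K(2)[OF v]) auto
    also have "\<dots> = C * K * (1 / sqrt t * norm v) ^ 5" by (rule collect_powers)
    also have "\<dots> \<le> M ^ 5 * (1 / sqrt t * norm v) ^ 5"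
    proof (rule mult_right_mono)
      have "C * K \<le> M ^ 1" by (simp add: M_def)
      also have "M ^ 1 \<le> M ^ 5" using M by (intro power_increasing) auto
      finally show "C * K \<le> M ^ 5" .
    qed (use t in simp)
    also have "\<dots> = (M / sqrt t * norm v) ^ 5" by (simp add: power_mult_distrib power_divide)
    finally show ?thesis by (rule power_le_imp_le_base[of _ 4, simplified]) (use M t in simp)
  qed
  then show thesis using that[of M] M by auto
qed

end

section \<open>The Banach space \<open>H\<^sup>2(0,1)\<close>\<close>

lemma has_weak_deriv_zero: "has_weak_deriv n 0 0"
  unfolding has_weak_deriv_iff
  using bounded_linear_test_pairing[THEN bounded_linear.linear, THEN linear_0] test_fun_funpow by simp

lemma sobolev_zero: "0 \<in> sobolev m"
  using has_weak_deriv_zero by (auto simp: sobolev_def)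

lemma sobolev_add: "v \<in> sobolev m \<Longrightarrow> w \<in> sobolev m \<Longrightarrow> v + w \<in> sobolev m"
  unfolding sobolev_def using has_weak_deriv_add by blast

lemma sobolev_scaleR: "v \<in> sobolev m \<Longrightarrow> r *\<^sub>R v \<in> sobolev m"
  unfolding sobolev_def using has_weak_deriv_scaleR by blast

lemma wderiv_add: "v \<in> sobolev m \<Longrightarrow> w \<in> sobolev m \<Longrightarrow> j \<le> m \<Longrightarrow> wderiv j (v + w) = wderiv j v + wderiv j w"
  by (intro wderiv_eqI has_weak_deriv_add has_weak_deriv_wderiv)

lemma wderiv_scaleR: "v \<in> sobolev m \<Longrightarrow> j \<le> m \<Longrightarrow> wderiv j (r *\<^sub>R v) = r *\<^sub>R wderiv j v"
  by (rule wderiv_eqI[OF has_weak_deriv_scaleR[OF has_weak_deriv_wderiv]])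

text \<open>\<open>H\<^sup>2(0,1)\<close> as a type of its own, so that continuity and completeness refer to the stronger norm.\<close>

typedef H2I = "sobolev 2" morphisms emb to_H2
  by (rule exI[of _ 0]) (rule sobolev_zero)

lemma emb_in_sobolev [simp, intro]: "emb v \<in> sobolev 2"
  by (rule emb)

lemma emb_to_H2: "v \<in> sobolev 2 \<Longrightarrow> emb (to_H2 v) = v"
  by (rule to_H2_inverse)

lemma sobolev_norm_L2_set: "sobolev_norm m v = L2_set (\<lambda>j. norm (wderiv j v)) {..m}"
  by (simp add: sobolev_norm_def L2_set_def)

lemma norm_wderiv_le_sobolev_norm: "j \<le> m \<Longrightarrow> norm (wderiv j v) \<le> sobolev_norm m v"
  unfolding sobolev_norm_L2_set by (rule member_le_L2_set) auto

lemma sobolev_norm_le_sum: "sobolev_norm 2 v \<le> norm v + norm (wderiv 1 v) + norm (wderiv 2 v)"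
  unfolding sobolev_norm_L2_set
  by (rule order_trans[OF L2_set_le_sum]) (simp_all add: eval_nat_numeral)

instantiation H2I :: real_vector
begin

definition zero_H2I :: H2I where "0 = to_H2 0"
definition plus_H2I :: "H2I \<Rightarrow> H2I \<Rightarrow> H2I" where "v + w = to_H2 (emb v + emb w)"
definition scaleR_H2I :: "real \<Rightarrow> H2I \<Rightarrow> H2I" where "r *\<^sub>R v = to_H2 (r *\<^sub>R emb v)"
definition uminus_H2I :: "H2I \<Rightarrow> H2I" where "- v = (-1) *\<^sub>R (v :: H2I)"
definition minus_H2I :: "H2I \<Rightarrow> H2I \<Rightarrow> H2I" where "v - w = v + - (w :: H2I)"

lemma emb_zero: "emb 0 = 0" and emb_plus: "emb (v + w) = emb v + emb w" and emb_scaleR: "emb (r *\<^sub>R v) = r *\<^sub>R emb v"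
  by (simp_all add: zero_H2I_def plus_H2I_def scaleR_H2I_def emb_to_H2 sobolev_zero sobolev_add sobolev_scaleR)

lemma emb_uminus: "emb (- v) = - emb v" and emb_minus: "emb (v - w) = emb v - emb w"
  by (simp_all add: uminus_H2I_def minus_H2I_def emb_scaleR emb_plus)

instance
  by standard (simp_all add: emb_inject[symmetric] emb_zero emb_plus emb_scaleR emb_uminus emb_minus algebra_simps)

end

instantiation H2I :: real_normed_vector
begin

definition norm_H2I :: "H2I \<Rightarrow> real" where "norm v = sobolev_norm 2 (emb v)"
definition dist_H2I :: "H2I \<Rightarrow> H2I \<Rightarrow> real" where "dist v w = norm (v - w :: H2I)"
definition sgn_H2I :: "H2I \<Rightarrow> H2I" where "sgn v = v /\<^sub>R norm (v :: H2I)"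
definition uniformity_H2I :: "(H2I \<times> H2I) filter" where
  "uniformity_H2I = (INF e\<in>{0 <..}. principal {(v, w). dist v w < e})"
definition open_H2I :: "H2I set \<Rightarrow> bool" where
  "open_H2I U \<longleftrightarrow> (\<forall>v\<in>U. \<forall>\<^sub>F (v', w) in uniformity. v' = v \<longrightarrow> w \<in> U)"

instance
proof
  fix u v w :: H2I and a b :: real and U :: "H2I set"
  show "dist u v = norm (u - v)" by (rule dist_H2I_def)
  show "sgn u = u /\<^sub>R norm u" by (rule sgn_H2I_def)
  show "uniformity = (INF e\<in>{0 <..}. principal {(x, y :: H2I). dist x y < e})" by (rule uniformity_H2I_def)
  show "open U = (\<forall>x\<in>U. \<forall>\<^sub>F (x', y) in uniformity. x' = x \<longrightarrow> y \<in> U)" by (rule open_H2I_def)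
  show "norm u = 0 \<longleftrightarrow> u = 0"
  proof
    assume "norm u = 0"
    then have "norm (emb u) \<le> 0"
      using norm_wderiv_le_sobolev_norm[of 0 2 "emb u"] by (simp add: norm_H2I_def)
    then show "u = 0" by (simp add: emb_inject[symmetric] emb_zero)
  next
    assume "u = 0"
    then show "norm u = 0"
      by (simp add: norm_H2I_def sobolev_norm_def emb_zero wderiv_eqI[OF has_weak_deriv_zero])
  qed
  show "norm (a *\<^sub>R u) = \<bar>a\<bar> * norm u"
  proof -
    have "norm (a *\<^sub>R u) = L2_set (\<lambda>j. \<bar>a\<bar> * norm (wderiv j (emb u))) {..2}"
      unfolding norm_H2I_def sobolev_norm_L2_set
      by (rule L2_set_cong) (simp_all add: emb_scaleR wderiv_scaleR[OF emb_in_sobolev])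
    then show ?thesis by (simp add: norm_H2I_def sobolev_norm_L2_set L2_set_right_distrib)
  qed
  show "norm (u + v) \<le> norm u + norm v"
  proof -
    have "norm (u + v) \<le> L2_set (\<lambda>j. norm (wderiv j (emb u)) + norm (wderiv j (emb v))) {..2}"
      unfolding norm_H2I_def sobolev_norm_L2_set
      by (rule L2_set_mono) (simp_all add: emb_plus wderiv_add[OF emb_in_sobolev emb_in_sobolev] norm_triangle_ineq)
    also have "\<dots> \<le> norm u + norm v"
      unfolding norm_H2I_def sobolev_norm_L2_set by (rule L2_set_triangle_ineq)
    finally show ?thesis .
  qed
qed

end

definition dx :: "H2I \<Rightarrow> L2I" where "dx v = wderiv 1 (emb v)"

lemma bounded_linear_wderiv_emb:
  assumes "j \<le> 2" shows "bounded_linear (\<lambda>v. wderiv j (emb v))"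
  by (rule bounded_linear_intro[where K = 1])
     (use assms norm_wderiv_le_sobolev_norm in \<open>auto simp: emb_plus emb_scaleR norm_H2I_def wderiv_add[OF emb_in_sobolev emb_in_sobolev] wderiv_scaleR[OF emb_in_sobolev]\<close>)

lemma bounded_linear_emb: "bounded_linear emb"
  using bounded_linear_wderiv_emb[of 0] by simp

lemma bounded_linear_dx: "bounded_linear dx"
  using bounded_linear_wderiv_emb[of 1] by (simp add: dx_def[abs_def])

lemma norm_emb_le: "norm (emb v) \<le> norm v"
  using norm_wderiv_le_sobolev_norm[of 0 2 "emb v"] by (simp add: norm_H2I_def)

lemma norm_dx_le: "norm (dx v) \<le> norm v"
  using norm_wderiv_le_sobolev_norm[of 1 2 "emb v"] by (simp add: norm_H2I_def dx_def)

lemma H2_weak_deriv: "has_weak_deriv 1 (emb v) (dx v)" "has_weak_deriv 1 (dx v) (wderiv 2 (emb v))"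
proof -
  show 1: "has_weak_deriv 1 (emb v) (dx v)"
    unfolding dx_def by (rule has_weak_deriv_wderiv[OF emb_in_sobolev]) simp
  have "has_weak_deriv (Suc 1) (emb v) (wderiv 2 (emb v))"
    using has_weak_deriv_wderiv[OF emb_in_sobolev, of 2 v] by (simp add: eval_nat_numeral)
  from has_weak_deriv_step[OF 1 this] show "has_weak_deriv 1 (dx v) (wderiv 2 (emb v))" .
qed

instance H2I :: banach
proof
  fix X :: "nat \<Rightarrow> H2I" assume C: "Cauchy X"
  have "\<exists>w. (\<lambda>n. wderiv j (emb (X n))) \<longlonglongrightarrow> w" if "j \<le> 2" for j
    using bounded_linear.Cauchy[OF bounded_linear_wderiv_emb[OF that] C] by (simp add: Cauchy_convergent_iff convergent_def)
  then obtain w where w: "\<And>j. j \<le> 2 \<Longrightarrow> (\<lambda>n. wderiv j (emb (X n))) \<longlonglongrightarrow> w j" by metis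
  have w0: "(\<lambda>n. emb (X n)) \<longlonglongrightarrow> w 0" using w[of 0] by simp
  have d: "has_weak_deriv j (w 0) (w j)" if "j \<le> 2" for j
    by (rule has_weak_deriv_limit[OF has_weak_deriv_wderiv[OF emb_in_sobolev that] w0 w[OF that]])
  then have "w 0 \<in> sobolev 2" by (auto simp: sobolev_def)
  then have e: "emb (to_H2 (w 0)) = w 0" by (rule emb_to_H2)
  have wd: "wderiv j (emb (X n - to_H2 (w 0))) = wderiv j (emb (X n)) - w j" if "j \<le> 2" for j n
    using bounded_linear.linear[OF bounded_linear_wderiv_emb[OF that], THEN linear_diff, of "X n" "to_H2 (w 0)"]
      wderiv_eqI[OF d[OF that]] by (simp add: e)
  have "(\<lambda>n. norm (X n - to_H2 (w 0))) \<longlonglongrightarrow> 0"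
  proof (rule Lim_null_comparison)
    show "eventually (\<lambda>n. norm (norm (X n - to_H2 (w 0))) \<le> norm (wderiv 0 (emb (X n)) - w 0) + norm (wderiv 1 (emb (X n)) - w 1)
        + norm (wderiv 2 (emb (X n)) - w 2)) sequentially"
    proof (intro always_eventually allI)
      fix n
      show "norm (norm (X n - to_H2 (w 0))) \<le> norm (wderiv 0 (emb (X n)) - w 0) + norm (wderiv 1 (emb (X n)) - w 1)
        + norm (wderiv 2 (emb (X n)) - w 2)"
        unfolding real_norm_def abs_norm_cancel
        using sobolev_norm_le_sum[of "emb (X n - to_H2 (w 0))"] wd[of 0 n] wd[of 1 n] wd[of 2 n]
        by (simp add: norm_H2I_def)
    qed
    have "(\<lambda>n. norm (wderiv 0 (emb (X n)) - w 0) + norm (wderiv 1 (emb (X n)) - w 1) + norm (wderiv 2 (emb (X n)) - w 2))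
      \<longlonglongrightarrow> norm (w 0 - w 0) + norm (w 1 - w 1) + norm (w 2 - w 2)"
      by (intro tendsto_intros w) auto
    then show "(\<lambda>n. norm (wderiv 0 (emb (X n)) - w 0) + norm (wderiv 1 (emb (X n)) - w 1) + norm (wderiv 2 (emb (X n)) - w 2))
      \<longlonglongrightarrow> 0" by simp
  qed
  then show "convergent X"
    unfolding convergent_def using tendsto_norm_zero_iff LIM_zero_iff by blast
qed

section \<open>Bounded mild solutions of the inhomogeneous linear equation\<close>

context kawahara_semigroup
begin

text \<open>The estimate on the dense set \<open>D2\<close> makes \<open>S(t) f\<^sub>n\<close> a Cauchy sequence in \<open>H\<^sup>2\<close> whenever \<open>f\<^sub>n\<close> converges in \<open>L\<^sup>2\<close>.\<close>

lemma S_in_H2: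
  obtains M where "M > 0" "\<And>v t. t > 0 \<Longrightarrow> S t v \<in> sobolev 2"
    "\<And>v t. t > 0 \<Longrightarrow> norm (to_H2 (S t v)) \<le> M / sqrt t * norm v"
proof -
  obtain M0 where M0: "M0 \<ge> 0" "\<And>v t. v \<in> D2 \<Longrightarrow> t > 0 \<Longrightarrow> norm (wderiv 2 (S t v)) \<le> M0 / sqrt t * norm v"
    by (rule smoothing_dom) blast
  define M where "M = 3 * M0 + 1"
  have M: "M > 0" using M0 by (simp add: M_def)
  have mem: "S t v \<in> sobolev 2" if v: "v \<in> D2" and t: "t > 0" for v t
  proof -
    have "S t v \<in> kawahara_dom \<alpha>" using v t by (auto simp: D2_def S_D)
    then show ?thesis by (auto simp: kawahara_dom_def sobolev_def)
  qed
  have bound: "norm (to_H2 (S t v)) \<le> M / sqrt t * norm v" if v: "v \<in> D2" and t: "t > 0" for v t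
  proof -
    have Sv: "S t v \<in> kawahara_dom \<alpha>" using v t by (auto simp: D2_def S_D)
    have "norm (to_H2 (S t v)) \<le> norm (S t v) + norm (wderiv 1 (S t v)) + norm (wderiv 2 (S t v))"
      unfolding norm_H2I_def emb_to_H2[OF mem[OF v t]] by (rule sobolev_norm_le_sum)
    also have "\<dots> \<le> 3 * norm (wderiv 2 (S t v))" using kawahara_poincare[OF Sv] by linarith
    also have "\<dots> \<le> 3 * (M0 / sqrt t * norm v)" using M0(2)[OF v t] by simp
    also have "\<dots> \<le> M / sqrt t * norm v"
    proof -
      have "3 * (M0 / sqrt t * norm v) = (3 * M0) / sqrt t * norm v" by simp
      also have "\<dots> \<le> M / sqrt t * norm v" using t by (intro mult_right_mono divide_right_mono) (auto simp: M_def)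
      finally show ?thesis .
    qed
    finally show ?thesis .
  qed
  have D2diff: "v - w \<in> D2" if "v \<in> D2" "w \<in> D2" for v w using that by (auto simp: D2_def D_diff)
  have all: "S t v \<in> sobolev 2 \<and> norm (to_H2 (S t v)) \<le> M / sqrt t * norm v" if t: "t > 0" for v t
  proof -
    obtain f where f: "\<And>n. f n \<in> D2" "f \<longlonglongrightarrow> v" by (rule D2_approx[of v]) blast
    define X where "X n = to_H2 (S t (f n))" for n
    have eX: "emb (X n) = S t (f n)" for n unfolding X_def by (rule emb_to_H2[OF mem[OF f(1) t]])
    have dX: "dist (X m) (X n) \<le> M / sqrt t * dist (f m) (f n)" for m n
    proof -
      have "X m - X n = to_H2 (S t (f m - f n))"
        using t by (simp only: emb_inject[symmetric] emb_minus eX emb_to_H2[OF mem[OF D2diff[OF f(1) f(1)] t]]) (simp add: S_diff)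
      then show ?thesis using bound[OF D2diff[OF f(1) f(1)] t] by (simp add: dist_norm)
    qed
    have "Cauchy X"
    proof (rule metric_CauchyI)
      fix e :: real assume e: "0 < e"
      have "0 < e / (M / sqrt t)" using e M t by simp
      then obtain N where N: "\<And>m n. m \<ge> N \<Longrightarrow> n \<ge> N \<Longrightarrow> dist (f m) (f n) < e / (M / sqrt t)"
        using metric_CauchyD[OF LIMSEQ_imp_Cauchy[OF f(2)]] by blast
      have "dist (X m) (X n) < e" if "m \<ge> N" "n \<ge> N" for m n
      proof -
        define c where "c = M / sqrt t"
        have c: "c > 0" using M t by (simp add: c_def)
        have "dist (X m) (X n) \<le> c * dist (f m) (f n)" using dX[of m n] by (simp add: c_def)
        also have "\<dots> < e" using N[OF that] c unfolding c_def[symmetric] by (simp add: pos_less_divide_eq mult.commute)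
        finally show ?thesis .
      qed
      then show "\<exists>N. \<forall>m\<ge>N. \<forall>n\<ge>N. dist (X m) (X n) < e" by blast
    qed
    then obtain L where L: "X \<longlonglongrightarrow> L" by (auto simp: Cauchy_convergent_iff convergent_def)
    have "(\<lambda>n. emb (X n)) \<longlonglongrightarrow> emb L" by (rule bounded_linear.tendsto[OF bounded_linear_emb L])
    moreover have "(\<lambda>n. emb (X n)) \<longlonglongrightarrow> S t v"
      unfolding eX by (rule bounded_linear.tendsto[OF S_bounded_linear f(2)]) (use t in simp)
    ultimately have eL: "emb L = S t v" by (rule LIMSEQ_unique)
    have "norm L \<le> M / sqrt t * norm v"
    proof (rule LIMSEQ_le)
      show "(\<lambda>n. norm (X n)) \<longlonglongrightarrow> norm L" by (intro tendsto_intros L)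
      show "(\<lambda>n. M / sqrt t * norm (f n)) \<longlonglongrightarrow> M / sqrt t * norm v" by (intro tendsto_intros f)
      show "\<exists>N. \<forall>n\<ge>N. norm (X n) \<le> M / sqrt t * norm (f n)" using bound[OF f(1) t] by (auto simp: X_def)
    qed
    moreover have "to_H2 (S t v) = L" by (simp add: eL[symmetric] emb_inverse)
    moreover have "S t v \<in> sobolev 2" by (simp add: eL[symmetric])
    ultimately show ?thesis by simp
  qed
  show thesis by (rule that[OF M]) (use all in auto)
qed

definition smooth_const :: real where
  "smooth_const = (SOME M. M > 0 \<and> (\<forall>v t. t > 0 \<longrightarrow> S t v \<in> sobolev 2 \<and> norm (to_H2 (S t v)) \<le> M / sqrt t * norm v))"

definition T :: "real \<Rightarrow> L2I \<Rightarrow> H2I" where "T t v = to_H2 (S t v)"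

lemma smooth_const: "smooth_const > 0"
  and emb_T: "t > 0 \<Longrightarrow> emb (T t v) = S t v"
  and norm_T: "t > 0 \<Longrightarrow> norm (T t v) \<le> smooth_const / sqrt t * norm v"
proof -
  have "\<exists>M. M > 0 \<and> (\<forall>v t. t > 0 \<longrightarrow> S t v \<in> sobolev 2 \<and> norm (to_H2 (S t v)) \<le> M / sqrt t * norm v)"
    by (rule S_in_H2) blast
  from someI_ex[OF this] show "smooth_const > 0" "t > 0 \<Longrightarrow> emb (T t v) = S t v"
    "t > 0 \<Longrightarrow> norm (T t v) \<le> smooth_const / sqrt t * norm v"
    unfolding smooth_const_def[symmetric] by (auto simp: T_def emb_to_H2)
qed

lemma T_diff: "t > 0 \<Longrightarrow> T t (v - w) = T t v - T t w"
  by (simp add: emb_inject[symmetric] emb_minus emb_T S_diff)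

definition duhamel :: "(real \<Rightarrow> L2I) \<Rightarrow> real \<Rightarrow> real \<Rightarrow> L2I" where
  "duhamel F r t = integral {r..t} (\<lambda>s. S (t - s) (F s))"

text \<open>Responses on the whole line to the source \<open>F\<close>: there is no initial value, and boundedness takes its place.\<close>

definition mild :: "(real \<Rightarrow> L2I) \<Rightarrow> (real \<Rightarrow> L2I) \<Rightarrow> bool" where
  "mild F d \<longleftrightarrow> (\<forall>r t. r \<le> t \<longrightarrow> ((\<lambda>s. S (t - s) (F s)) has_integral (d t - S (t - r) (d r))) {r..t})"

lemma duhamel_has_integral:
  assumes "continuous_on UNIV F"
  shows "((\<lambda>s. S (t - s) (F s)) has_integral duhamel F r t) {r..t}"
  unfolding duhamel_def
  by (intro integrable_integral integrable_continuous_real continuous_intros continuous_on_subset[OF assms]) auto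

lemma mild_iff:
  assumes "continuous_on UNIV F"
  shows "mild F d \<longleftrightarrow> (\<forall>r t. r \<le> t \<longrightarrow> d t = S (t - r) (d r) + duhamel F r t)"
proof -
  have "((\<lambda>s. S (t - s) (F s)) has_integral (d t - S (t - r) (d r))) {r..t} \<longleftrightarrow> d t = S (t - r) (d r) + duhamel F r t" for r t
  proof
    assume "((\<lambda>s. S (t - s) (F s)) has_integral (d t - S (t - r) (d r))) {r..t}"
    from has_integral_unique[OF this duhamel_has_integral[OF assms]]
    show "d t = S (t - r) (d r) + duhamel F r t" by (simp add: diff_eq_eq add.commute)
  next
    assume "d t = S (t - r) (d r) + duhamel F r t"
    then have "d t - S (t - r) (d r) = duhamel F r t" by simp
    then show "((\<lambda>s. S (t - s) (F s)) has_integral (d t - S (t - r) (d r))) {r..t}"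
      using duhamel_has_integral[OF assms, of t r] by simp
  qed
  then show ?thesis unfolding mild_def by simp
qed

lemma duhamel_split:
  assumes F: "continuous_on UNIV F" and "r \<le> q" "q \<le> t"
  shows "duhamel F r t = S (t - q) (duhamel F r q) + duhamel F q t"
proof -
  have "((\<lambda>s. S (t - q) (S (q - s) (F s))) has_integral S (t - q) (duhamel F r q)) {r..q}"
    using has_integral_linear[OF duhamel_has_integral[OF F, of q r] S_bounded_linear[of "t - q"]] assms by (simp add: comp_def)
  then have "((\<lambda>s. S (t - s) (F s)) has_integral S (t - q) (duhamel F r q)) {r..q}"
    by (rule has_integral_eq[rotated]) (use assms in \<open>auto simp: S_plus[symmetric]\<close>)
  from has_integral_combine[OF assms(2,3) this duhamel_has_integral[OF F, of t q]] duhamel_has_integral[OF F, of t r]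
  show ?thesis by (rule has_integral_unique[rotated])
qed

lemma norm_duhamel_short:
  assumes F: "continuous_on UNIV F" and B: "\<And>s. norm (F s) \<le> B" and "r \<le> t"
  shows "norm (duhamel F r t) \<le> B * (t - r)"
proof -
  have "0 \<le> B" using B[of 0] norm_ge_zero order_trans by blast
  moreover have "norm (S (t - s) (F s)) \<le> B" if "s \<in> {r..t}" for s
    using S_norm[of "t - s" "F s"] B[of s] that by (auto intro: order_trans)
  ultimately show ?thesis
    using has_integral_bound_real[where S = "{}", OF _ _ duhamel_has_integral[OF F, of t r], of B] assms(3) by auto
qed

lemma norm_duhamel:
  assumes F: "continuous_on UNIV F" and B: "\<And>s. norm (F s) \<le> B" and "r \<le> t"
  shows "norm (duhamel F r t) \<le> B * (amp / rate)"
proof -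
  have B0: "0 \<le> B" using B[of 0] norm_ge_zero order_trans by blast
  define g where "g s = B * (amp * exp (- rate * (t - s)))" for s
  define H where "H s = B * (amp / rate) * exp (- rate * (t - s))" for s
  have gi: "(g has_integral (H t - H r)) {r..t}"
  proof (rule fundamental_theorem_of_calculus[OF assms(3)])
    fix s
    have "(H has_real_derivative g s) (at s within {r..t})"
      unfolding H_def[abs_def] g_def using rate_amp by (auto intro!: derivative_eq_intros)
    then show "(H has_vector_derivative g s) (at s within {r..t})"
      by (simp add: has_real_derivative_iff_has_vector_derivative)
  qed
  have "norm (duhamel F r t) \<le> integral {r..t} g"
    unfolding duhamel_def
  proof (rule integral_norm_bound_integral)
    show "(\<lambda>s. S (t - s) (F s)) integrable_on {r..t}" using duhamel_has_integral[OF F] by blast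
    show "g integrable_on {r..t}" using gi by blast
    fix s assume s: "s \<in> {r..t}"
    have "norm (S (t - s) (F s)) \<le> amp * exp (- rate * (t - s)) * norm (F s)" by (rule S_decay) (use s in simp)
    also have "\<dots> \<le> amp * exp (- rate * (t - s)) * B" using rate_amp by (intro mult_left_mono B) auto
    finally show "norm (S (t - s) (F s)) \<le> g s" by (simp add: g_def mult_ac)
  qed
  also have "\<dots> = H t - H r" using gi by (rule integral_unique)
  also have "\<dots> \<le> B * (amp / rate)"
    using B0 rate_amp by (simp add: H_def)
  finally show ?thesis .
qed

text \<open>The interval is cut dyadically towards its end point. On the piece at distance \<open>l\<close> from the end, of length \<open>l\<close>, smoothing
  costs a factor \<open>l\<^sup>-\<^sup>1\<^sup>/\<^sup>2\<close>, so the pieces sum like a geometric series. This avoids integrating in \<open>H\<^sup>2\<close>.\<close>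

lemma duhamel_H2:
  assumes F: "continuous_on UNIV F" and B: "\<And>s. norm (F s) \<le> B" and "r \<le> t"
  obtains k where "emb k = duhamel F r t" "norm k \<le> 3 * smooth_const * B * sqrt (t - r)"
proof (cases "r = t")
  case True
  then have "duhamel F r t = 0" by (simp add: duhamel_def)
  then show thesis using True by (intro that[of 0]) (simp_all add: emb_zero)
next
  case False
  have B0: "0 \<le> B" using B[of 0] norm_ge_zero order_trans by blast
  define L where "L = t - r"
  have L: "L > 0" using False assms(3) by (simp add: L_def)
  define m where "m n = t - L / 2 ^ n" for n :: nat
  have m0: "m 0 = r" by (simp add: m_def L_def)
  have half: "L / 2 ^ n = 2 * (L / 2 ^ Suc n)" for n by simp
  have step: "m (Suc n) - m n = L / 2 ^ Suc n" "t - m (Suc n) = L / 2 ^ Suc n" for n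
    by (simp_all add: m_def)
  have pos: "L / 2 ^ n > 0" for n using L by simp
  have mle: "m n \<le> m (Suc n)" "m n \<le> t" for n using step(1)[of n] pos[of "Suc n"] pos[of n] by (auto simp: m_def)
  define I where "I n = T (L / 2 ^ Suc n) (duhamel F (m n) (m (Suc n)))" for n
  have eI: "emb (I n) = duhamel F (m n) t - duhamel F (m (Suc n)) t" for n
    using duhamel_split[OF F mle(1)[of n] mle(2)[of "Suc n"]] step(2)[of n] pos[of "Suc n"]
    by (simp add: I_def emb_T)
  have nI: "norm (I n) \<le> smooth_const * B * sqrt L * (3/4) ^ Suc n" for n
  proof -
    let ?l = "L / 2 ^ Suc n"
    have "norm (I n) \<le> smooth_const / sqrt ?l * norm (duhamel F (m n) (m (Suc n)))"
      unfolding I_def by (rule norm_T[OF pos])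
    also have "\<dots> \<le> smooth_const / sqrt ?l * (B * ?l)"
      using norm_duhamel_short[OF F B mle(1)[of n]] step(1)[of n] smooth_const pos[of "Suc n"]
      by (intro mult_left_mono) auto
    also have "\<dots> = smooth_const * B * sqrt ?l"
      using real_div_sqrt[of ?l] pos[of "Suc n"] by (simp add: field_simps)
    also have "\<dots> \<le> smooth_const * B * (sqrt L * (3/4) ^ Suc n)"
    proof (rule mult_left_mono)
      \<comment> \<open>\<open>3/4\<close> is a rational upper bound for the ratio \<open>1 / sqrt 2\<close> of the series\<close>
      have "(1 :: real) / 2 ^ Suc n \<le> ((3/4) ^ Suc n)\<^sup>2" for n :: nat
      proof -
        have "(1/2 :: real) ^ Suc n \<le> (9/16) ^ Suc n" by (intro power_mono) auto
        also have "(9/16 :: real) ^ Suc n = ((3/4) ^ Suc n)\<^sup>2"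
          by (simp add: power_mult_distrib[symmetric] power2_eq_square del: power_Suc)
        finally show ?thesis by (simp add: power_one_over)
      qed
      then have "sqrt (1 / 2 ^ Suc n) \<le> (3/4) ^ Suc n" by (intro real_le_lsqrt) auto
      then show "sqrt ?l \<le> sqrt L * (3/4) ^ Suc n"
        using L real_sqrt_mult[of L "1 / 2 ^ Suc n"] by (simp add: mult_left_mono del: power_Suc)
    qed (use smooth_const B0 in simp)
    finally show ?thesis by (simp add: mult_ac)
  qed
  define c where "c = smooth_const * B * sqrt L"
  have gs: "(\<lambda>n. c * (3/4) ^ Suc n) sums (c * 3)"
    using sums_mult[OF geometric_sums[of "3/4 :: real"], of "c * (3/4)"] by (simp add: mult_ac)
  have sI: "summable (\<lambda>n. norm (I n))"
    by (rule summable_comparison_test'[OF sums_summable[OF gs], of 0]) (use nI in \<open>simp add: c_def\<close>)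
  have "I sums suminf I" using summable_norm_cancel[OF sI] by (rule summable_sums)
  then have "(\<lambda>n. emb (\<Sum>i<n. I i)) \<longlonglongrightarrow> emb (suminf I)"
    unfolding sums_def by (rule bounded_linear.tendsto[OF bounded_linear_emb])
  moreover have "emb (\<Sum>i<n. I i) = duhamel F r t - duhamel F (m n) t" for n
    by (induction n) (simp_all add: emb_zero emb_plus eI m0)
  moreover have "(\<lambda>n. duhamel F r t - duhamel F (m n) t) \<longlonglongrightarrow> duhamel F r t - 0"
  proof (intro tendsto_diff tendsto_const)
    show "(\<lambda>n. duhamel F (m n) t) \<longlonglongrightarrow> 0"
    proof (rule Lim_null_comparison)
      show "eventually (\<lambda>n. norm (duhamel F (m n) t) \<le> (B * L) * (1/2) ^ n) sequentially"
      proof (intro always_eventually allI)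
        fix n
        have "norm (duhamel F (m n) t) \<le> B * (t - m n)" by (rule norm_duhamel_short[OF F B mle(2)])
        also have "t - m n = L * (1/2) ^ n" by (simp add: m_def power_one_over)
        finally show "norm (duhamel F (m n) t) \<le> (B * L) * (1/2) ^ n" by (simp only: mult.assoc)
      qed
      show "(\<lambda>n. (B * L) * (1/2) ^ n) \<longlonglongrightarrow> 0"
        by (intro tendsto_mult_right_zero LIMSEQ_realpow_zero) auto
    qed
  qed
  ultimately have "emb (suminf I) = duhamel F r t" using LIMSEQ_unique by auto
  moreover have "norm (suminf I) \<le> c * 3"
  proof -
    have "norm (suminf I) \<le> (\<Sum>n. norm (I n))" by (rule summable_norm[OF sI])
    also have "\<dots> \<le> (\<Sum>n. c * (3/4) ^ Suc n)"
      by (rule suminf_le[OF _ sI sums_summable[OF gs]]) (use nI in \<open>simp add: c_def\<close>)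
    also have "\<dots> = c * 3" using gs by (rule sums_unique[symmetric])
    finally show ?thesis .
  qed
  ultimately show thesis by (intro that[of "suminf I"]) (simp_all add: c_def L_def)
qed

lemma mild_diff:
  assumes "mild F d" "mild F' d'" shows "mild (\<lambda>s. F s - F' s) (\<lambda>s. d s - d' s)"
  unfolding mild_def
proof (intro allI impI)
  fix r t :: real assume rt: "r \<le> t"
  have "((\<lambda>s. S (t - s) (F s) - S (t - s) (F' s)) has_integral (d t - S (t - r) (d r)) - (d' t - S (t - r) (d' r))) {r..t}"
    using assms rt by (intro has_integral_diff) (auto simp: mild_def)
  then have "((\<lambda>s. S (t - s) (F s - F' s)) has_integral (d t - S (t - r) (d r)) - (d' t - S (t - r) (d' r))) {r..t}"
    by (rule has_integral_eq[rotated]) (simp add: S_diff)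
  then show "((\<lambda>s. S (t - s) (F s - F' s)) has_integral d t - d' t - S (t - r) (d r - d' r)) {r..t}"
    using rt by (simp add: S_diff algebra_simps)
qed

lemma exp_decay_tendsto_0: "((\<lambda>r. exp (- rate * (t - r))) \<longlongrightarrow> 0) at_bot"
proof -
  have "filterlim (\<lambda>r. rate * r - rate * t) at_bot at_bot"
  proof (rule filterlim_at_bot[THEN iffD2], rule allI)
    fix Z
    have "eventually (\<lambda>r. r \<le> (Z + rate * t) / rate) at_bot" by (rule eventually_le_at_bot)
    then show "eventually (\<lambda>r. rate * r - rate * t \<le> Z) at_bot"
      by eventually_elim (use rate_amp(1) in \<open>simp add: pos_le_divide_eq algebra_simps\<close>)
  qed
  from filterlim_compose[OF exp_at_bot this] show ?thesis by (simp add: algebra_simps)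
qed

text \<open>Compare with a time \<open>r\<close> in the remote past: the contribution of \<open>d r\<close> decays exponentially, however large the bound \<open>b\<close> is.\<close>

lemma mild_norm_le:
  assumes F: "continuous_on UNIV F" and B: "\<And>s. norm (F s) \<le> B" and d: "mild F d" and b: "\<And>t. norm (d t) \<le> b"
  shows "norm (d t) \<le> B * (amp / rate)"
proof (rule tendsto_lowerbound)
  show "((\<lambda>r. amp * exp (- rate * (t - r)) * b + B * (amp / rate)) \<longlongrightarrow> B * (amp / rate)) at_bot"
    using tendsto_add[OF tendsto_mult[OF tendsto_mult[OF tendsto_const[of amp] exp_decay_tendsto_0] tendsto_const[of b]] tendsto_const[of "B * (amp / rate)"]]
    by simp
  have "norm (d t) \<le> amp * exp (- rate * (t - r)) * b + B * (amp / rate)" if r: "r \<le> t" for r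
  proof -
    have "d t = S (t - r) (d r) + duhamel F r t" using d r unfolding mild_iff[OF F] by blast
    then have "norm (d t) \<le> norm (S (t - r) (d r)) + norm (duhamel F r t)" by (metis norm_triangle_ineq)
    also have "norm (S (t - r) (d r)) \<le> amp * exp (- rate * (t - r)) * norm (d r)" by (rule S_decay) (use r in simp)
    also have "\<dots> \<le> amp * exp (- rate * (t - r)) * b" using rate_amp by (intro mult_left_mono b) auto
    also have "norm (duhamel F r t) \<le> B * (amp / rate)" by (rule norm_duhamel[OF F B r])
    finally show ?thesis by simp
  qed
  then show "eventually (\<lambda>r. norm (d t) \<le> amp * exp (- rate * (t - r)) * b + B * (amp / rate)) at_bot"
    using eventually_le_at_bot[of t] by (rule eventually_mono[rotated])
qed simp

text \<open>Restart the equation at time \<open>t - \<sigma>\<close>. The free parameter trades the singular factor in front of the \<open>L\<^sup>2\<close> bound of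
  the response against the size of the source.\<close>

lemma mild_H2:
  assumes F: "continuous_on UNIV F" and B: "\<And>s. norm (F s) \<le> B" and d: "mild F d" and b: "\<And>t. norm (d t) \<le> b"
    and \<sigma>: "\<sigma> > 0"
  obtains k where "emb k = d t" "norm k \<le> smooth_const / sqrt \<sigma> * b + 3 * smooth_const * B * sqrt \<sigma>"
proof -
  obtain k where k: "emb k = duhamel F (t - \<sigma>) t" "norm k \<le> 3 * smooth_const * B * sqrt (t - (t - \<sigma>))"
    by (rule duhamel_H2[OF F B, of "t - \<sigma>" t]) (use \<sigma> in auto)
  have "d t = S \<sigma> (d (t - \<sigma>)) + duhamel F (t - \<sigma>) t"
    using d[unfolded mild_iff[OF F], rule_format, of "t - \<sigma>" t] \<sigma> by simp
  then have e: "emb (T \<sigma> (d (t - \<sigma>)) + k) = d t" using k(1) \<sigma> by (simp add: emb_plus emb_T)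
  have "norm (T \<sigma> (d (t - \<sigma>))) \<le> smooth_const / sqrt \<sigma> * norm (d (t - \<sigma>))" by (rule norm_T[OF \<sigma>])
  also have "\<dots> \<le> smooth_const / sqrt \<sigma> * b" using smooth_const \<sigma> by (intro mult_left_mono b) auto
  finally have "norm (T \<sigma> (d (t - \<sigma>)) + k) \<le> smooth_const / sqrt \<sigma> * b + 3 * smooth_const * B * sqrt \<sigma>"
    using k(2) norm_triangle_ineq[of "T \<sigma> (d (t - \<sigma>))" k] by simp
  with e show thesis by (rule that)
qed

definition gain_const :: real where
  "gain_const = smooth_const * (amp / rate) + 3 * smooth_const"

lemma gain_const_pos: "gain_const > 0"
  using smooth_const rate_amp by (auto simp: gain_const_def intro!: add_nonneg_pos mult_nonneg_nonneg divide_nonneg_pos)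

lemma mild_H2_le:
  assumes F: "continuous_on UNIV F" and B: "\<And>s. norm (F s) \<le> B" and d: "mild F d" and b: "\<And>t. norm (d t) \<le> b"
  shows "d t \<in> sobolev 2" "norm (to_H2 (d t)) \<le> gain_const * B"
proof -
  obtain k where k: "emb k = d t" "norm k \<le> smooth_const / sqrt 1 * (B * (amp / rate)) + 3 * smooth_const * B * sqrt 1"
    by (rule mild_H2[OF F B d mild_norm_le[OF F B d b], of 1 t]) auto
  show "d t \<in> sobolev 2" by (simp add: k(1)[symmetric])
  have "to_H2 (d t) = k" by (simp add: k(1)[symmetric] emb_inverse)
  then show "norm (to_H2 (d t)) \<le> gain_const * B" using k(2) by (simp add: gain_const_def algebra_simps)
qed

text \<open>Restarting slightly before \<open>t\<close>, at time \<open>q\<close>, makes the contribution of the source small in \<open>H\<^sup>2\<close>; the remaining part is a smoothed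
  orbit, hence continuous in \<open>H\<^sup>2\<close>.\<close>

lemma mild_continuous_H2:
  assumes F: "continuous_on UNIV F" and B: "\<And>s. norm (F s) \<le> B" and d: "mild F d" and b: "\<And>t. norm (d t) \<le> b"
  shows "continuous_on UNIV (\<lambda>t. to_H2 (d t))"
proof (rule continuous_at_imp_continuous_on, rule ballI)
  fix t :: real
  have B0: "0 \<le> B" using B[of 0] norm_ge_zero order_trans by blast
  show "isCont (\<lambda>t. to_H2 (d t)) t"
    unfolding continuous_at_eps_delta
  proof (intro allI impI)
    fix e :: real assume e: "0 < e"
    define c where "c = 3 * smooth_const * B + 1"
    have c: "c > 0" using smooth_const B0 by (simp add: c_def add_nonneg_pos)
    define \<sigma> where "\<sigma> = (e / (4 * c))\<^sup>2 / 2"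
    have \<sigma>: "\<sigma> > 0" using e c by (simp add: \<sigma>_def)
    have sq: "c * sqrt (2 * \<sigma>) = e / 4" using e c by (simp add: \<sigma>_def)
    define q where "q = t - \<sigma>"
    define v where "v = d q"
    have "((\<lambda>s. S (s - q - \<sigma>/2) v) \<longlongrightarrow> S (t - q - \<sigma>/2) v) (at t)"
    proof -
      have co: "continuous_on {q + \<sigma>/2<..} (\<lambda>s. S (s - q - \<sigma>/2) v)"
        by (intro continuous_on_compose2[OF continuous_on_S] continuous_intros) auto
      have op: "open {q + \<sigma>/2<..}" "t \<in> {q + \<sigma>/2<..}" using \<sigma> by (auto simp: q_def)
      have "\<forall>x\<in>{q + \<sigma>/2<..}. isCont (\<lambda>s. S (s - q - \<sigma>/2) v) x"
        using co unfolding continuous_on_eq_continuous_at[OF op(1)] .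
      then have "isCont (\<lambda>s. S (s - q - \<sigma>/2) v) t" by (rule bspec) (rule op(2))
      then show ?thesis unfolding isCont_def .
    qed
    moreover have "0 < e / 4 / (smooth_const / sqrt (\<sigma>/2))" using e smooth_const \<sigma> by simp
    ultimately have "eventually (\<lambda>s. dist (S (s - q - \<sigma>/2) v) (S (t - q - \<sigma>/2) v) < e / 4 / (smooth_const / sqrt (\<sigma>/2))) (at t)"
      by (rule tendstoD)
    then obtain \<delta> where \<delta>: "\<delta> > 0" "\<And>s. s \<noteq> t \<Longrightarrow> dist s t < \<delta> \<Longrightarrow>
        norm (S (s - q - \<sigma>/2) v - S (t - q - \<sigma>/2) v) < e / 4 / (smooth_const / sqrt (\<sigma>/2))"
      unfolding eventually_at by (auto simp: dist_norm)
    have close: "norm (to_H2 (d s) - T (s - q) v) \<le> e / 4" if s: "q < s" "s \<le> q + 2 * \<sigma>" for s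
    proof -
      obtain k where k: "emb k = duhamel F q s" "norm k \<le> 3 * smooth_const * B * sqrt (s - q)"
        by (rule duhamel_H2[OF F B, of q s]) (use s in auto)
      have "d s = S (s - q) v + duhamel F q s"
        using d s unfolding mild_iff[OF F] v_def by (meson less_imp_le)
      then have "emb (T (s - q) v + k) = d s" using k(1) s by (simp add: emb_plus emb_T)
      then have "to_H2 (d s) = T (s - q) v + k" by (metis emb_inverse)
      moreover have "norm k \<le> c * sqrt (2 * \<sigma>)"
      proof (rule order_trans[OF k(2)])
        show "3 * smooth_const * B * sqrt (s - q) \<le> c * sqrt (2 * \<sigma>)"
          using s smooth_const B0 by (intro mult_mono) (auto simp: c_def)
      qed
      ultimately show ?thesis using sq by simp
    qed
    have "dist (to_H2 (d s)) (to_H2 (d t)) < e" if s: "dist s t < min \<delta> (\<sigma>/2)" for s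
    proof (cases "s = t")
      case True
      then show ?thesis using e by simp
    next
      case False
      have qs: "q + \<sigma>/2 < s" "s \<le> q + 2 * \<sigma>" "q < t" "t \<le> q + 2 * \<sigma>" using s \<sigma> by (auto simp: q_def dist_real_def abs_if split: if_splits)
      have T: "T (s - q) v = T (\<sigma>/2) (S (s - q - \<sigma>/2) v)" if "q + \<sigma>/2 < s" for s
      proof -
        have "S (s - q) v = S (\<sigma>/2) (S (s - q - \<sigma>/2) v)" using S_plus[of "\<sigma>/2" "s - q - \<sigma>/2" v] that \<sigma> by simp
        then show ?thesis by (simp add: T_def)
      qed
      have "norm (T (s - q) v - T (t - q) v) \<le> e / 4"
      proof -
        have "T (s - q) v - T (t - q) v = T (\<sigma>/2) (S (s - q - \<sigma>/2) v - S (t - q - \<sigma>/2) v)"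
          using T[of s] T[of t] qs \<sigma> by (simp add: T_diff q_def)
        then have "norm (T (s - q) v - T (t - q) v) \<le> smooth_const / sqrt (\<sigma>/2) * norm (S (s - q - \<sigma>/2) v - S (t - q - \<sigma>/2) v)"
          using norm_T[of "\<sigma>/2"] \<sigma> by simp
        also have "\<dots> \<le> smooth_const / sqrt (\<sigma>/2) * (e / 4 / (smooth_const / sqrt (\<sigma>/2)))"
          using \<delta>(2)[OF False] s smooth_const \<sigma> by (intro mult_left_mono) auto
        also have "\<dots> = e / 4" using smooth_const \<sigma> by simp
        finally show ?thesis .
      qed
      moreover have "norm (to_H2 (d s) - T (s - q) v) \<le> e / 4" "norm (to_H2 (d t) - T (t - q) v) \<le> e / 4"
        using close qs \<sigma> by auto
      moreover have "to_H2 (d s) - to_H2 (d t) = (to_H2 (d s) - T (s - q) v) + (T (s - q) v - T (t - q) v) - (to_H2 (d t) - T (t - q) v)" by simp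
      moreover have "norm (x + y - z) \<le> norm x + norm y + norm z" for x y z :: H2I
        by (meson norm_triangle_ineq norm_triangle_ineq4 order_trans add_right_mono)
      ultimately have "norm (to_H2 (d s) - to_H2 (d t)) \<le> e / 4 + e / 4 + e / 4"
        by (smt (verit))
      then show ?thesis using e by (simp add: dist_norm)
    qed
    then show "\<exists>\<delta>>0. \<forall>s. dist s t < \<delta> \<longrightarrow> dist (to_H2 (d s)) (to_H2 (d t)) < e"
      using \<delta>(1) \<sigma> by (intro exI[of _ "min \<delta> (\<sigma>/2)"]) auto
  qed
qed

text \<open>The response is the limit of the solutions that start from \<open>0\<close> at time \<open>- n\<close>.\<close>

lemma mild_exists:
  assumes F: "continuous_on UNIV F" and B: "\<And>s. norm (F s) \<le> B"
  obtains d where "mild F d" "\<And>t. norm (d t) \<le> B * (amp / rate)"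
proof -
  have B0: "0 \<le> B" using B[of 0] norm_ge_zero order_trans by blast
  have C: "Cauchy (\<lambda>n. duhamel F (- real n) t)" for t
  proof (rule metric_CauchyI)
    fix e :: real assume e: "0 < e"
    define c where "c = amp * (B * (amp / rate))"
    have "((\<lambda>r. c * exp (- rate * (t - r))) \<longlongrightarrow> c * 0) at_bot" by (intro tendsto_intros exp_decay_tendsto_0)
    then have "eventually (\<lambda>r. c * exp (- rate * (t - r)) < e) at_bot" using e by (auto dest: order_tendstoD)
    then obtain r0 where r0: "\<And>r. r \<le> r0 \<Longrightarrow> c * exp (- rate * (t - r)) < e" by (auto simp: eventually_at_bot_linorder)
    obtain N :: nat where N: "real N \<ge> max (- r0) (- t)" using real_arch_simple by blast
    have *: "dist (duhamel F (- real m) t) (duhamel F (- real n) t) < e" if mn: "N \<le> n" "n \<le> m" for m n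
    proof -
      have nt: "- real n \<le> t" "- real n \<le> r0" using N mn(1) by linarith+
      have "duhamel F (- real m) t = S (t - (- real n)) (duhamel F (- real m) (- real n)) + duhamel F (- real n) t"
        by (rule duhamel_split[OF F]) (use mn nt in auto)
      then have "dist (duhamel F (- real m) t) (duhamel F (- real n) t) = norm (S (t - (- real n)) (duhamel F (- real m) (- real n)))"
        by (simp add: dist_norm)
      also have "\<dots> \<le> amp * exp (- rate * (t - (- real n))) * norm (duhamel F (- real m) (- real n))" by (rule S_decay) (use nt in simp)
      also have "\<dots> \<le> amp * exp (- rate * (t - (- real n))) * (B * (amp / rate))"
        using rate_amp mn by (intro mult_left_mono norm_duhamel[OF F B]) auto
      also have "\<dots> = c * exp (- rate * (t - (- real n)))" by (simp add: c_def mult_ac)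
      also have "\<dots> < e" by (rule r0) (rule nt)
      finally show ?thesis .
    qed
    have "dist (duhamel F (- real m) t) (duhamel F (- real n) t) < e" if "N \<le> m" "N \<le> n" for m n
      using *[of n m] *[of m n] that by (cases "n \<le> m") (auto simp: dist_commute)
    then show "\<exists>N. \<forall>m\<ge>N. \<forall>n\<ge>N. dist (duhamel F (- real m) t) (duhamel F (- real n) t) < e" by blast
  qed
  then obtain d where d: "\<And>t. (\<lambda>n. duhamel F (- real n) t) \<longlonglongrightarrow> d t"
    unfolding Cauchy_convergent_iff convergent_def by metis
  have "mild F d"
    unfolding mild_iff[OF F]
  proof (intro allI impI)
    fix r t :: real assume rt: "r \<le> t"
    obtain N :: nat where N: "real N \<ge> - r" using real_arch_simple by blast
    have "(\<lambda>n. S (t - r) (duhamel F (- real n) r) + duhamel F r t) \<longlonglongrightarrow> S (t - r) (d r) + duhamel F r t"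
      by (intro tendsto_add tendsto_const bounded_linear.tendsto[OF S_bounded_linear d]) (use rt in simp)
    moreover have "eventually (\<lambda>n. S (t - r) (duhamel F (- real n) r) + duhamel F r t = duhamel F (- real n) t) sequentially"
      using eventually_ge_at_top[of N]
    proof eventually_elim
      case (elim n)
      then have "- real n \<le> r" using N by linarith
      then show ?case using duhamel_split[OF F _ rt] by metis
    qed
    ultimately have "(\<lambda>n. duhamel F (- real n) t) \<longlonglongrightarrow> S (t - r) (d r) + duhamel F r t"
      by (rule Lim_transform_eventually)
    then show "d t = S (t - r) (d r) + duhamel F r t" using d LIMSEQ_unique by blast
  qed
  moreover have "norm (d t) \<le> B * (amp / rate)" for t
  proof (rule LIMSEQ_le_const2[OF tendsto_norm[OF d]])
    obtain N :: nat where N: "real N \<ge> - t" using real_arch_simple by blast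
    show "\<exists>N. \<forall>n\<ge>N. norm (duhamel F (- real n) t) \<le> B * (amp / rate)"
      using N by (intro exI[of _ N] allI impI norm_duhamel[OF F B]) linarith
  qed
  ultimately show thesis by (rule that)
qed

end

section \<open>Rapidly oscillating forcing and complex conjugation\<close>

context kawahara_semigroup
begin

text \<open>Differentiate \<open>\<zeta>(s) S(t - s) A\<close> in \<open>s\<close>. The formula trades \<open>\<zeta>'\<close> for \<open>\<zeta>\<close> in the source.\<close>

lemma mild_product:
  assumes A: "A \<in> kawahara_dom \<alpha>"
    and \<zeta>: "\<And>s. (\<zeta> has_vector_derivative \<zeta>' s) (at s)" and c: "continuous_on UNIV \<zeta>'"
  shows "mild (\<lambda>s. scaleC_L2 (\<zeta>' s) A - scaleC_L2 (\<zeta> s) (kawahara_op A)) (\<lambda>s. scaleC_L2 (\<zeta> s) A)"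
  unfolding mild_def
proof (intro allI impI)
  fix r t :: real assume rt: "r \<le> t"
  have "((\<lambda>s. scaleC_L2 (\<zeta> s) (- S (t - s) (kawahara_op A)) + scaleC_L2 (\<zeta>' s) (S (t - s) A)) has_integral
     scaleC_L2 (\<zeta> t) (S (t - t) A) - scaleC_L2 (\<zeta> r) (S (t - r) A)) {r..t}"
  proof (rule fundamental_theorem_of_calculus[OF rt])
    fix s assume s: "s \<in> {r..t}"
    have "((\<lambda>s. t - s) has_vector_derivative (-1)) (at s within {r..t})"
      by (auto intro!: derivative_eq_intros)
    moreover have "((\<lambda>\<tau>. S \<tau> A) has_vector_derivative S (t - s) (kawahara_op A)) (at (t - s) within (\<lambda>s. t - s) ` {r..t})"
      by (rule has_vector_derivative_within_subset[OF S_has_vector_derivative[OF A]]) (use s in auto)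
    ultimately have "((\<lambda>\<tau>. S \<tau> A) \<circ> (\<lambda>s. t - s) has_vector_derivative (-1) *\<^sub>R S (t - s) (kawahara_op A)) (at s within {r..t})"
      by (rule vector_diff_chain_within)
    then have "((\<lambda>s. S (t - s) A) has_vector_derivative - S (t - s) (kawahara_op A)) (at s within {r..t})"
      by (simp add: comp_def)
    then show "((\<lambda>s. scaleC_L2 (\<zeta> s) (S (t - s) A)) has_vector_derivative
        scaleC_L2 (\<zeta> s) (- S (t - s) (kawahara_op A)) + scaleC_L2 (\<zeta>' s) (S (t - s) A)) (at s within {r..t})"
      by (intro bounded_bilinear.has_vector_derivative[OF bounded_bilinear_scaleC_L2]
          has_vector_derivative_at_within[OF \<zeta>])
  qed
  then have "((\<lambda>s. S (t - s) (scaleC_L2 (\<zeta>' s) A - scaleC_L2 (\<zeta> s) (kawahara_op A))) has_integral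
     scaleC_L2 (\<zeta> t) (S (t - t) A) - scaleC_L2 (\<zeta> r) (S (t - r) A)) {r..t}"
    by (rule has_integral_eq[rotated])
       (simp add: S_diff S_scaleC bounded_bilinear.minus_right[OF bounded_bilinear_scaleC_L2])
  then show "((\<lambda>s. S (t - s) (scaleC_L2 (\<zeta>' s) A - scaleC_L2 (\<zeta> s) (kawahara_op A))) has_integral
     scaleC_L2 (\<zeta> t) A - S (t - r) (scaleC_L2 (\<zeta> r) A)) {r..t}"
    using rt by (simp add: S_scaleC)
qed

text \<open>Split \<open>\<zeta>' A = \<zeta>' A' + \<zeta>' (A - A')\<close> and apply \<open>mild_product\<close> to the first part.\<close>

lemma oscillation_bound_L2:
  assumes A': "A' \<in> kawahara_dom \<alpha>"
    and \<zeta>: "\<And>s. (\<zeta> has_vector_derivative \<zeta>' s) (at s)" and c: "continuous_on UNIV \<zeta>'"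
    and b: "\<And>s. cmod (\<zeta> s) \<le> \<delta>" "\<And>s. cmod (\<zeta>' s) \<le> B"
    and d: "mild (\<lambda>s. scaleC_L2 (\<zeta>' s) A) d" "\<And>t. norm (d t) \<le> D"
  shows "norm (d t) \<le> \<delta> * norm A' + (B * norm (A - A') + \<delta> * norm (kawahara_op A')) * (amp / rate)"
proof -
  interpret bounded_bilinear scaleC_L2 by (rule bounded_bilinear_scaleC_L2)
  have c\<zeta>: "continuous_on UNIV \<zeta>"
    using \<zeta> by (intro continuous_at_imp_continuous_on) (auto intro: has_vector_derivative_continuous)
  have "0 \<le> \<delta>" "0 \<le> B" using b[of 0] norm_ge_zero order_trans by blast+
  define F where "F s = scaleC_L2 (\<zeta>' s) (A - A') + scaleC_L2 (\<zeta> s) (kawahara_op A')" for s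
  have F: "continuous_on UNIV F" unfolding F_def[abs_def] by (intro continuous_intros continuous_on c c\<zeta>)
  have FB: "norm (F s) \<le> B * norm (A - A') + \<delta> * norm (kawahara_op A')" for s
  proof -
    have "norm (F s) \<le> cmod (\<zeta>' s) * norm (A - A') + cmod (\<zeta> s) * norm (kawahara_op A')"
      unfolding F_def by (rule order_trans[OF norm_triangle_ineq]) simp
    also have "\<dots> \<le> B * norm (A - A') + \<delta> * norm (kawahara_op A')"
      by (intro add_mono mult_right_mono b) auto
    finally show ?thesis .
  qed
  have "mild F (\<lambda>s. d s - scaleC_L2 (\<zeta> s) A')"
    using mild_diff[OF d(1) mild_product[OF A' \<zeta> c]] by (simp add: F_def[abs_def] diff_right algebra_simps)
  moreover have nA: "norm (scaleC_L2 (\<zeta> s) A') \<le> \<delta> * norm A'" for s by (simp add: b mult_right_mono)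
  have "norm (d s - scaleC_L2 (\<zeta> s) A') \<le> D + \<delta> * norm A'" for s
    using norm_triangle_ineq4[of "d s" "scaleC_L2 (\<zeta> s) A'"] d(2)[of s] nA[of s] by linarith
  ultimately have "norm (d t - scaleC_L2 (\<zeta> t) A') \<le> (B * norm (A - A') + \<delta> * norm (kawahara_op A')) * (amp / rate)"
    by (rule mild_norm_le[OF F FB])
  then show ?thesis using norm_triangle_ineq2[of "d t" "scaleC_L2 (\<zeta> t) A'"] nA[of t] by linarith
qed

text \<open>The lifting polynomial is not in the domain of the generator, but it is approximated there by some \<open>A'\<close>. The choices are made in this
  order: the restart time \<open>\<sigma>\<close> from \<open>\<eta>\<close> and \<open>B\<close>, then \<open>A'\<close>, whose norm under the generator may be huge, and last \<open>\<delta>\<close>.\<close>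

lemma oscillation_small:
  assumes \<eta>: "\<eta> > 0" and B: "B \<ge> 0"
  obtains \<delta> where "\<delta> > 0"
    "\<And>\<zeta> \<zeta>' d D t. (\<And>s. (\<zeta> has_vector_derivative \<zeta>' s) (at s)) \<Longrightarrow> continuous_on UNIV \<zeta>' \<Longrightarrow>
      (\<And>s. cmod (\<zeta> s) \<le> \<delta>) \<Longrightarrow> (\<And>s. cmod (\<zeta>' s) \<le> B) \<Longrightarrow>
      mild (\<lambda>s. scaleC_L2 (\<zeta>' s) A) d \<Longrightarrow> (\<And>t. norm (d t) \<le> D) \<Longrightarrow> norm (to_H2 (d t)) \<le> \<eta>"
proof -
  define c where "c = 3 * smooth_const * (B * norm A) + 1"
  have c: "c > 0" using smooth_const B by (simp add: c_def add_nonneg_pos)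
  define \<sigma> where "\<sigma> = (\<eta> / (2 * c))\<^sup>2"
  have \<sigma>: "\<sigma> > 0" and s\<sigma>: "sqrt \<sigma> = \<eta> / (2 * c)" using \<eta> c by (simp_all add: \<sigma>_def)
  define \<eta>' where "\<eta>' = \<eta> / 2 * sqrt \<sigma> / smooth_const"
  have \<eta>': "\<eta>' > 0" using \<eta> \<sigma> smooth_const by (simp add: \<eta>'_def)
  define r where "r = amp / rate"
  have r: "r > 0" using rate_amp by (simp add: r_def)
  define \<kappa> where "\<kappa> = \<eta>' / (2 * ((B + 1) * r))"
  have \<kappa>: "\<kappa> > 0" using \<eta>' B r by (simp add: \<kappa>_def)
  have "A \<in> closure (kawahara_dom \<alpha>)" by (simp add: closure_D)
  then obtain A' where A': "A' \<in> kawahara_dom \<alpha>" "dist A' A < \<kappa>"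
    using \<kappa> unfolding closure_approachable by blast
  define m where "m = norm A' + norm (kawahara_op A') * r"
  have m: "m \<ge> 0" using r by (simp add: m_def)
  define \<delta> where "\<delta> = \<eta>' / (2 * (m + 1))"
  have \<delta>: "\<delta> > 0" using \<eta>' m by (simp add: \<delta>_def)
  have "norm (to_H2 (d t)) \<le> \<eta>"
    if \<zeta>: "\<And>s. (\<zeta> has_vector_derivative \<zeta>' s) (at s)" "continuous_on UNIV \<zeta>'"
      and b: "\<And>s. cmod (\<zeta> s) \<le> \<delta>" "\<And>s. cmod (\<zeta>' s) \<le> B"
      and d: "mild (\<lambda>s. scaleC_L2 (\<zeta>' s) A) d" "\<And>t. norm (d t) \<le> D" for \<zeta> \<zeta>' d D t
  proof -
    have L: "norm (d t) \<le> \<eta>'" for t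
    proof -
      have "norm (d t) \<le> \<delta> * norm A' + (B * norm (A - A') + \<delta> * norm (kawahara_op A')) * r"
        unfolding r_def by (rule oscillation_bound_L2[OF A'(1) \<zeta> b d])
      also have "\<dots> = \<delta> * m + B * r * norm (A - A')" by (simp add: m_def algebra_simps)
      also have "\<dots> \<le> \<eta>' / 2 + \<eta>' / 2"
      proof (rule add_mono)
        have "\<delta> * m \<le> \<delta> * (m + 1)" using \<delta> by simp
        also have "\<dots> = \<eta>' / 2" using m by (simp add: \<delta>_def field_simps)
        finally show "\<delta> * m \<le> \<eta>' / 2" .
        have "B * r * norm (A - A') \<le> ((B + 1) * r) * \<kappa>"
          using A'(2) B r \<kappa> by (intro mult_mono) (auto simp: dist_norm norm_minus_commute)
        also have "\<dots> = \<eta>' / 2"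
        proof -
          have "(B + 1) * r \<noteq> 0" using B r by simp
          moreover have "x * (e / (2 * x)) = e / 2" if "x \<noteq> 0" for x e :: real using that by simp
          ultimately show ?thesis unfolding \<kappa>_def by blast
        qed
        finally show "B * r * norm (A - A') \<le> \<eta>' / 2" .
      qed
      finally show ?thesis by simp
    qed
    have F: "continuous_on UNIV (\<lambda>s. scaleC_L2 (\<zeta>' s) A)"
      by (intro bounded_bilinear.continuous_on[OF bounded_bilinear_scaleC_L2] \<zeta> continuous_intros)
    have FB: "norm (scaleC_L2 (\<zeta>' s) A) \<le> B * norm A" for s by (simp add: b mult_right_mono)
    obtain k where k: "emb k = d t" "norm k \<le> smooth_const / sqrt \<sigma> * \<eta>' + 3 * smooth_const * (B * norm A) * sqrt \<sigma>"
      by (rule mild_H2[OF F FB d(1) L \<sigma>])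
    have "smooth_const / sqrt \<sigma> * \<eta>' = \<eta> / 2" using smooth_const \<sigma> by (simp add: \<eta>'_def field_simps)
    moreover have "3 * smooth_const * (B * norm A) * sqrt \<sigma> \<le> c * sqrt \<sigma>"
      using \<sigma> by (intro mult_right_mono) (auto simp: c_def)
    moreover have "c * sqrt \<sigma> = \<eta> / 2" using c by (simp add: s\<sigma>)
    moreover have "norm (to_H2 (d t)) = norm k" by (simp add: k(1)[symmetric] emb_inverse)
    ultimately show ?thesis using k(2) by linarith
  qed
  with \<delta> show thesis by (rule that)
qed

text \<open>The difference of the two sides is a solution with initial value \<open>0\<close>, so the energy estimate makes it vanish.\<close>

lemma S_cnj:
  assumes t: "0 \<le> t" shows "S t (cnj_L2 v) = cnj_L2 (S t v)"
proof -
  interpret cnj: bounded_linear cnj_L2 by (rule bounded_linear_cnj_L2)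
  have dom: "S t (cnj_L2 v) = cnj_L2 (S t v)" if v: "v \<in> kawahara_dom \<alpha>" for v
  proof -
    define d where "d s = S s (cnj_L2 v) - cnj_L2 (S s v)" for s
    have D: "d s \<in> kawahara_dom \<alpha>" "kawahara_op (d s) = S s (kawahara_op (cnj_L2 v)) - cnj_L2 (S s (kawahara_op v))" if "0 \<le> s" for s
    proof -
      have a: "S s (cnj_L2 v) \<in> kawahara_dom \<alpha>" "cnj_L2 (S s v) \<in> kawahara_dom \<alpha>"
        using S_D[OF kawahara_cnj(1)[OF v] that] kawahara_cnj(1)[OF S_D(1)[OF v that]] by auto
      show "d s \<in> kawahara_dom \<alpha>" unfolding d_def by (rule D_diff(1)[OF a])
      show "kawahara_op (d s) = S s (kawahara_op (cnj_L2 v)) - cnj_L2 (S s (kawahara_op v))"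
        unfolding d_def D_diff(2)[OF a]
        using S_D(2)[OF kawahara_cnj(1)[OF v] that] kawahara_cnj(2)[OF S_D(1)[OF v that]] S_D(2)[OF v that] by simp
    qed
    have "(d has_vector_derivative kawahara_op (d s)) (at s within {0..})" if "0 \<le> s" for s
      unfolding D(2)[OF that] unfolding d_def[abs_def]
      by (intro has_vector_derivative_diff S_has_vector_derivative[OF kawahara_cnj(1)[OF v] that]
          cnj.has_vector_derivative S_has_vector_derivative[OF v that])
    from energy_decay[OF this D(1) t] show ?thesis by (simp add: d_def)
  qed
  obtain f where f: "\<And>n. f n \<in> D2" "f \<longlonglongrightarrow> v" by (rule D2_approx[of v]) blast
  have "(\<lambda>n. S t (cnj_L2 (f n))) \<longlonglongrightarrow> S t (cnj_L2 v)"
    by (intro bounded_linear.tendsto[OF S_bounded_linear[OF t]] cnj.tendsto f)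
  moreover have "(\<lambda>n. S t (cnj_L2 (f n))) \<longlonglongrightarrow> cnj_L2 (S t v)"
  proof -
    have "S t (cnj_L2 (f n)) = cnj_L2 (S t (f n))" for n using f(1)[of n] by (intro dom) (simp add: D2_def)
    then show ?thesis
      using cnj.tendsto[OF bounded_linear.tendsto[OF S_bounded_linear[OF t] f(2)]] by simp
  qed
  ultimately show ?thesis by (rule LIMSEQ_unique)
qed

end

section \<open>The nonlinearity\<close>

lemma H2_sup_bound: "AE x in lebI. cmod (rep_L2 (emb v) x) \<le> 2 * norm v"
proof -
  have "AE x in lebI. x \<in> {0..1}" by (rule AE_I2) simp
  with weak_deriv_primitive(2)[OF H2_weak_deriv(1)[of v]] show ?thesis
    by eventually_elim (use trace_le[OF H2_weak_deriv(1)[of v]] norm_emb_le[of v] norm_dx_le[of v] in force)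
qed

definition prod_dx :: "H2I \<Rightarrow> H2I \<Rightarrow> L2I" where
  "prod_dx u v = abs_L2 (\<lambda>x. rep_L2 (emb u) x * rep_L2 (dx v) x)"

lemma sq_integrable_prod_dx: "sq_integrable (\<lambda>x. rep_L2 (emb u) x * rep_L2 (dx v) x)"
  by (rule sq_integrable_mult_bounded[OF sq_integrable_rep rep_measurable H2_sup_bound])

lemma rep_prod_dx: "AE x in lebI. rep_L2 (prod_dx u v) x = rep_L2 (emb u) x * rep_L2 (dx v) x"
  unfolding prod_dx_def by (rule rep_abs_L2[OF sq_integrable_prod_dx])

lemma norm_prod_dx_le: "norm (prod_dx u v) \<le> 2 * norm u * norm v"
proof -
  have "norm (prod_dx u v) \<le> (2 * norm u) * norm (abs_L2 (rep_L2 (dx v)))"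
    unfolding prod_dx_def by (rule norm_mult_bounded_le[OF sq_integrable_rep rep_measurable H2_sup_bound]) simp
  also have "\<dots> \<le> 2 * norm u * norm v" using norm_dx_le[of v] by (simp add: mult_left_mono)
  finally show ?thesis .
qed

lemma bounded_bilinear_prod_dx: "bounded_bilinear prod_dx"
proof (rule bounded_bilinear.intro)
  fix u u' v v' :: H2I and r :: real
  interpret dx: bounded_linear dx by (rule bounded_linear_dx)
  show "prod_dx (u + u') v = prod_dx u v + prod_dx u' v"
    by (rule L2_eqI) (use rep_prod_dx[of "u + u'" v] rep_prod_dx[of u v] rep_prod_dx[of u' v] rep_plus[of "emb u" "emb u'"]
      rep_plus[of "prod_dx u v" "prod_dx u' v"] in \<open>eventually_elim, simp add: emb_plus algebra_simps\<close>)
  show "prod_dx u (v + v') = prod_dx u v + prod_dx u v'"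
    by (rule L2_eqI) (use rep_prod_dx[of u "v + v'"] rep_prod_dx[of u v] rep_prod_dx[of u v'] rep_plus[of "dx v" "dx v'"]
      rep_plus[of "prod_dx u v" "prod_dx u v'"] in \<open>eventually_elim, simp add: dx.add algebra_simps\<close>)
  show "prod_dx (r *\<^sub>R u) v = r *\<^sub>R prod_dx u v"
    by (rule L2_eqI) (use rep_prod_dx[of "r *\<^sub>R u" v] rep_prod_dx[of u v] rep_scaleR[of r "emb u"]
      rep_scaleR[of r "prod_dx u v"] in \<open>eventually_elim, simp add: emb_scaleR algebra_simps\<close>)
  show "prod_dx u (r *\<^sub>R v) = r *\<^sub>R prod_dx u v"
    by (rule L2_eqI) (use rep_prod_dx[of u "r *\<^sub>R v"] rep_prod_dx[of u v] rep_scaleR[of r "dx v"]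
      rep_scaleR[of r "prod_dx u v"] in \<open>eventually_elim, simp add: dx.scaleR algebra_simps\<close>)
  show "\<exists>K. \<forall>u v. norm (prod_dx u v) \<le> norm u * norm v * K"
    using norm_prod_dx_le by (intro exI[of _ 2]) (simp add: mult_ac)
qed

lemma lift_A_has_derivative:
  "(lift_A \<alpha> has_real_derivative 2 * ((\<alpha> - 1) / (\<alpha> + 1)) * x + 2 / (\<alpha> + 1)) (at x)"
proof -
  have "((\<lambda>x. a * x\<^sup>2 + b * x - 1) has_real_derivative 2 * a * x + b) (at x)" for a b :: real
    by (auto intro!: derivative_eq_intros)
  then show ?thesis unfolding lift_A_def[abs_def] .
qed

lemma deriv_lift_A: "deriv (lift_A \<alpha>) = (\<lambda>x. 2 * ((\<alpha> - 1) / (\<alpha> + 1)) * x + 2 / (\<alpha> + 1))"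
  using DERIV_imp_deriv[OF lift_A_has_derivative] by blast

lemma continuous_lift_A [continuous_intros]: "continuous_on X (lift_A \<alpha>)" "continuous_on X (deriv (lift_A \<alpha>))"
proof -
  show "continuous_on X (lift_A \<alpha>)" unfolding lift_A_def[abs_def] by (intro continuous_intros)
  show "continuous_on X (deriv (lift_A \<alpha>))" unfolding deriv_lift_A by (intro continuous_intros)
qed

lemma sq_integrable_continuous:
  fixes f :: "real \<Rightarrow> complex"
  assumes "continuous_on {0..1} f" shows "sq_integrable f"
proof -
  have "continuous_on {0..1} (\<lambda>x. (cmod (f x))\<^sup>2)" using assms by (intro continuous_intros)
  from lebI_integral_continuous(1)[OF this] lebI_integral_continuous(1)[OF assms] show ?thesis
    unfolding sq_integrable_def by (auto dest: borel_measurable_integrable)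
qed

definition lift_L2 :: "real \<Rightarrow> L2I" where
  "lift_L2 \<alpha> = abs_L2 (\<lambda>x. of_real (lift_A \<alpha> x))"

definition lift_sq_L2 :: "real \<Rightarrow> L2I" where
  "lift_sq_L2 \<alpha> = abs_L2 (\<lambda>x. of_real (lift_A \<alpha> x) * of_real (deriv (lift_A \<alpha>) x))"

lemma rep_lift_L2: "AE x in lebI. rep_L2 (lift_L2 \<alpha>) x = of_real (lift_A \<alpha> x)"
  "AE x in lebI. rep_L2 (lift_sq_L2 \<alpha>) x = of_real (lift_A \<alpha> x) * of_real (deriv (lift_A \<alpha>) x)"
  unfolding lift_L2_def lift_sq_L2_def
  by (intro rep_abs_L2 sq_integrable_continuous continuous_intros)+

lemma primitive_of_of_real:
  fixes F f :: "real \<Rightarrow> real"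
  assumes "primitive_of F f" shows "primitive_of (\<lambda>x. complex_of_real (F x)) (\<lambda>x. complex_of_real (f x))"
proof -
  have p: "prim (\<lambda>x. complex_of_real (f x)) y = complex_of_real (prim f y)" for y
    unfolding prim_def by (subst integral_complex_of_real[symmetric]) (rule Bochner_Integration.integral_cong, auto)
  show ?thesis
    using primitive_ofD(1)[OF assms] primitive_ofD(2)[OF assms] unfolding primitive_of_def p
    by (metis integrable_of_real of_real_add)
qed

lemma lift_in_sobolev: "lift_L2 \<alpha> \<in> sobolev 2"
proof -
  define c where "c = 2 * ((\<alpha> - 1) / (\<alpha> + 1))"
  have p1: "primitive_of (\<lambda>x. complex_of_real (lift_A \<alpha> x)) (\<lambda>x. complex_of_real (deriv (lift_A \<alpha>) x))"
    by (intro primitive_of_of_real primitive_of_C1 continuous_lift_A) (use lift_A_has_derivative in \<open>simp add: deriv_lift_A\<close>)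
  have p2: "primitive_of (\<lambda>x. complex_of_real (deriv (lift_A \<alpha>) x)) (\<lambda>x. complex_of_real c)"
    unfolding deriv_lift_A c_def
  proof (intro primitive_of_of_real primitive_of_C1)
    have "((\<lambda>x. a * x + b) has_real_derivative a) (at x)" for a b x :: real
      by (auto intro!: derivative_eq_intros)
    then show "((\<lambda>x. 2 * ((\<alpha> - 1) / (\<alpha> + 1)) * x + 2 / (\<alpha> + 1)) has_real_derivative 2 * ((\<alpha> - 1) / (\<alpha> + 1))) (at x)" for x .
  qed (intro continuous_intros)
  have w1: "has_weak_deriv 1 (lift_L2 \<alpha>) (abs_L2 (\<lambda>x. complex_of_real (deriv (lift_A \<alpha>) x)))"
    unfolding lift_L2_def by (intro has_weak_deriv_of_primitive p1 sq_integrable_continuous continuous_intros)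
  have w2: "has_weak_deriv 1 (abs_L2 (\<lambda>x. complex_of_real (deriv (lift_A \<alpha>) x))) (abs_L2 (\<lambda>x. complex_of_real c))"
    by (intro has_weak_deriv_of_primitive p2 sq_integrable_const)
  have w3: "has_weak_deriv 2 (lift_L2 \<alpha>) (abs_L2 (\<lambda>x. complex_of_real c))"
    using has_weak_deriv_Suc[OF w1 w2] by (simp add: eval_nat_numeral)
  have "\<exists>w. has_weak_deriv j (lift_L2 \<alpha>) w" if "j \<le> 2" for j
  proof -
    have "j = 0 \<or> j = 1 \<or> j = 2" using that by linarith
    then show ?thesis
    proof (elim disjE)
      assume "j = 0"
      then show ?thesis using has_weak_deriv_0 by blast
    qed (use w1 w3 in blast)+
  qed
  then show ?thesis by (simp add: sobolev_def)
qed

definition mult_lift :: "real \<Rightarrow> L2I \<Rightarrow> L2I" where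
  "mult_lift \<alpha> = mult_op (\<lambda>x. of_real (lift_A \<alpha> x))"

definition mult_lift' :: "real \<Rightarrow> L2I \<Rightarrow> L2I" where
  "mult_lift' \<alpha> = mult_op (\<lambda>x. of_real (deriv (lift_A \<alpha>) x))"

lemma lift_multiplier:
  "bounded_multiplier (\<lambda>x. of_real (lift_A \<alpha> x))" "bounded_multiplier (\<lambda>x. of_real (deriv (lift_A \<alpha>) x))"
  by (intro bounded_multiplier_continuous continuous_intros)+

lemma bounded_linear_mult_lift: "bounded_linear (mult_lift \<alpha>)" "bounded_linear (mult_lift' \<alpha>)"
  unfolding mult_lift_def mult_lift'_def by (intro bounded_linear_mult_op lift_multiplier)+

definition drift :: "real \<Rightarrow> H2I \<Rightarrow> L2I" where
  "drift \<alpha> y = mult_lift \<alpha> (dx y) + mult_lift' \<alpha> (emb y)"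

lemma bounded_linear_drift: "bounded_linear (drift \<alpha>)"
  unfolding drift_def[abs_def]
  by (intro bounded_linear_add bounded_linear_compose[OF bounded_linear_mult_lift(1) bounded_linear_dx]
      bounded_linear_compose[OF bounded_linear_mult_lift(2) bounded_linear_emb])

text \<open>The nonlinearity without the source \<open>\<phi>' A\<close>, at a fixed time with \<open>p = \<phi>(t)\<close>. The source is kept apart because nothing but
  boundedness is known about \<open>\<phi>'\<close>.\<close>

definition rhs :: "real \<Rightarrow> complex \<Rightarrow> H2I \<Rightarrow> L2I" where
  "rhs \<alpha> p y = - prod_dx y y + scaleC_L2 p (drift \<alpha> y) - scaleC_L2 (p\<^sup>2) (lift_sq_L2 \<alpha>)"

lemma abs_L2_eq_rep:
  assumes "f \<in> borel_measurable lebI" "AE x in lebI. rep_L2 v x = f x"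
  shows "abs_L2 f = v"
proof -
  have "integrable lebI (\<lambda>x. (cmod (f x))\<^sup>2)"
  proof (rule integrable_cong_AE_imp)
    show "integrable lebI (\<lambda>x. (cmod (rep_L2 v x))\<^sup>2)" by (rule sq_integrable_integrable) simp
    show "(\<lambda>x. (cmod (f x))\<^sup>2) \<in> borel_measurable lebI" using assms(1) by measurable
    show "AE x in lebI. (cmod (rep_L2 v x))\<^sup>2 = (cmod (f x))\<^sup>2" using assms(2) by eventually_elim simp
  qed
  then have "sq_integrable f" using assms(1) by (simp add: sq_integrable_def)
  then have "abs_L2 f = abs_L2 (rep_L2 v)"
    using assms(2) by (intro abs_L2_eqI) (auto elim: eventually_mono)
  then show ?thesis by simp
qed

lemma rep_rhs:
  "AE x in lebI. rep_L2 (rhs \<alpha> p y) x = - (rep_L2 (emb y) x * rep_L2 (dx y) x)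
     + p * (of_real (lift_A \<alpha> x) * rep_L2 (dx y) x + of_real (deriv (lift_A \<alpha>) x) * rep_L2 (emb y) x)
     - p\<^sup>2 * (of_real (lift_A \<alpha> x) * of_real (deriv (lift_A \<alpha>) x))"
proof -
  let ?D = "drift \<alpha> y" and ?Q = "lift_sq_L2 \<alpha>" and ?P = "prod_dx y y"
  show ?thesis
    unfolding rhs_def
    using rep_minus[of "- ?P + scaleC_L2 p ?D" "scaleC_L2 (p\<^sup>2) ?Q"] rep_plus[of "- ?P" "scaleC_L2 p ?D"] rep_uminus[of ?P]
      rep_prod_dx[of y y] rep_scaleC[of p ?D] rep_scaleC[of "p\<^sup>2" ?Q]
      rep_lift_L2(2)[of \<alpha>] rep_plus[of "mult_lift \<alpha> (dx y)" "mult_lift' \<alpha> (emb y)", folded drift_def]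
      rep_mult_op[OF lift_multiplier(1)[of \<alpha>], of "dx y", folded mult_lift_def]
      rep_mult_op[OF lift_multiplier(2)[of \<alpha>], of "emb y", folded mult_lift'_def]
    by eventually_elim (simp only:)
qed

lemma nonlin_eq:
  "nonlin \<alpha> \<phi> (\<lambda>s. emb (y s)) s = rhs \<alpha> (\<phi> s) (y s) + scaleC_L2 (vector_derivative \<phi> (at s)) (lift_L2 \<alpha>)"
  unfolding nonlin_def
proof (rule abs_L2_eq_rep)
  have m: "(\<lambda>x. complex_of_real (lift_A \<alpha> x)) \<in> borel_measurable lebI" "(\<lambda>x. complex_of_real (deriv (lift_A \<alpha>) x)) \<in> borel_measurable lebI"
    using lift_multiplier[of \<alpha>] by (auto simp: bounded_multiplier_def)
  show "(\<lambda>x. - rep_L2 (emb (y s)) x * rep_L2 (wderiv 1 (emb (y s))) x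
     - coeff_a \<alpha> \<phi> x s * rep_L2 (wderiv 1 (emb (y s))) x
     - coeff_b \<alpha> \<phi> x s * rep_L2 (emb (y s)) x
     + force_f \<alpha> \<phi> x s) \<in> borel_measurable lebI"
    unfolding coeff_a_def coeff_b_def force_f_def
    by (intro borel_measurable_add borel_measurable_diff borel_measurable_times borel_measurable_uminus m rep_measurable borel_measurable_const)
  define p where "p = \<phi> s"
  define p' where "p' = vector_derivative \<phi> (at s)"
  define z where "z = y s"
  show "AE x in lebI. rep_L2 (rhs \<alpha> (\<phi> s) (y s) + scaleC_L2 (vector_derivative \<phi> (at s)) (lift_L2 \<alpha>)) x =
     - rep_L2 (emb (y s)) x * rep_L2 (wderiv 1 (emb (y s))) x
     - coeff_a \<alpha> \<phi> x s * rep_L2 (wderiv 1 (emb (y s))) x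
     - coeff_b \<alpha> \<phi> x s * rep_L2 (emb (y s)) x
     + force_f \<alpha> \<phi> x s"
    unfolding dx_def[symmetric] coeff_a_def coeff_b_def force_f_def p_def[symmetric] p'_def[symmetric] z_def[symmetric]
    using rep_plus[of "rhs \<alpha> p z" "scaleC_L2 p' (lift_L2 \<alpha>)"] rep_scaleC[of p' "lift_L2 \<alpha>"] rep_lift_L2(1)[of \<alpha>] rep_rhs[of \<alpha> p z]
    by eventually_elim (simp add: algebra_simps)
qed

text \<open>The expression is quadratic in \<open>(p, y)\<close>, so differences carry a factor that is small for small data.\<close>

lemma rhs_lipschitz:
  obtains \<kappa> where "\<kappa> > 0"
    "\<And>p q y z. norm (rhs \<alpha> p y - rhs \<alpha> q z) \<le> \<kappa> * (norm y + norm z + cmod p) * norm (y - z) + \<kappa> * cmod (p - q) * (norm z + cmod p + cmod q)"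
proof -
  interpret P: bounded_bilinear prod_dx by (rule bounded_bilinear_prod_dx)
  interpret C: bounded_bilinear scaleC_L2 by (rule bounded_bilinear_scaleC_L2)
  interpret D: bounded_linear "drift \<alpha>" by (rule bounded_linear_drift)
  obtain K where K: "K > 0" "\<And>y. norm (drift \<alpha> y) \<le> norm y * K" using D.pos_bounded by blast
  define \<kappa> where "\<kappa> = 2 + K + norm (lift_sq_L2 \<alpha>)"
  have \<kappa>: "\<kappa> \<ge> 2" "\<kappa> \<ge> K" "\<kappa> \<ge> norm (lift_sq_L2 \<alpha>)" using K by (auto simp: \<kappa>_def)
  have "norm (rhs \<alpha> p y - rhs \<alpha> q z) \<le> \<kappa> * (norm y + norm z + cmod p) * norm (y - z) + \<kappa> * cmod (p - q) * (norm z + cmod p + cmod q)" for p q y z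
  proof -
    let ?w = "norm (y - z)"
    have "rhs \<alpha> p y - rhs \<alpha> q z = (- prod_dx (y - z) y - prod_dx z (y - z))
        + (scaleC_L2 p (drift \<alpha> (y - z)) + scaleC_L2 (p - q) (drift \<alpha> z)) - scaleC_L2 ((p - q) * (p + q)) (lift_sq_L2 \<alpha>)"
    proof -
      have "(p - q) * (p + q) = p\<^sup>2 - q\<^sup>2" by (simp add: power2_eq_square algebra_simps)
      then show ?thesis
        by (simp add: rhs_def P.diff_left P.diff_right C.diff_left C.diff_right D.diff)
    qed
    also have "norm \<dots> \<le> (norm (prod_dx (y - z) y) + norm (prod_dx z (y - z)))
        + (norm (scaleC_L2 p (drift \<alpha> (y - z))) + norm (scaleC_L2 (p - q) (drift \<alpha> z))) + norm (scaleC_L2 ((p - q) * (p + q)) (lift_sq_L2 \<alpha>))"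
    proof -
      have "norm (- a - b + (c + d) - e) \<le> (norm a + norm b) + (norm c + norm d) + norm e" for a b c d e :: L2I
      proof -
        have "norm (- a - b) \<le> norm a + norm b" using norm_triangle_ineq4[of "- a" b] by simp
        moreover have "norm (c + d) \<le> norm c + norm d" by (rule norm_triangle_ineq)
        ultimately show ?thesis
          using norm_triangle_ineq4[of "- a - b + (c + d)" e] norm_triangle_ineq[of "- a - b" "c + d"] by linarith
      qed
      then show ?thesis .
    qed
    also have "\<dots> \<le> (2 * ?w * norm y + 2 * norm z * ?w) + (cmod p * (?w * K) + cmod (p - q) * (norm z * K))
        + cmod (p - q) * (cmod p + cmod q) * norm (lift_sq_L2 \<alpha>)"
      unfolding norm_scaleC_L2 norm_mult
      by (intro add_mono norm_prod_dx_le mult_left_mono mult_right_mono K norm_triangle_ineq) auto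
    also have "\<dots> \<le> (\<kappa> * ?w * norm y + \<kappa> * norm z * ?w) + (cmod p * (?w * \<kappa>) + cmod (p - q) * (norm z * \<kappa>))
        + cmod (p - q) * (cmod p + cmod q) * \<kappa>"
      by (intro add_mono mult_right_mono mult_left_mono \<kappa>) auto
    also have "\<dots> = \<kappa> * (norm y + norm z + cmod p) * ?w + \<kappa> * cmod (p - q) * (norm z + cmod p + cmod q)"
      by (simp add: algebra_simps)
    finally show ?thesis .
  qed
  moreover have "\<kappa> > 0" using \<kappa> by simp
  ultimately show thesis using that by blast
qed

lemma rhs_zero [simp]: "rhs \<alpha> 0 0 = 0"
  using bounded_bilinear.zero_left[OF bounded_bilinear_prod_dx] bounded_bilinear.zero_left[OF bounded_bilinear_scaleC_L2]
  by (simp add: rhs_def)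

lemma continuous_on_rhs:
  assumes "continuous_on X p" "continuous_on X y" shows "continuous_on X (\<lambda>s. rhs \<alpha> (p s) (y s))"
  unfolding rhs_def
  by (intro continuous_intros bounded_bilinear.continuous_on[OF bounded_bilinear_prod_dx]
      bounded_bilinear.continuous_on[OF bounded_bilinear_scaleC_L2] bounded_linear.continuous_on[OF bounded_linear_drift] assms)

section \<open>Quasi-periodicity as uniform continuity along almost-periods\<close>

definition near_period :: "nat \<Rightarrow> (nat \<Rightarrow> real) \<Rightarrow> real \<Rightarrow> real \<Rightarrow> bool" where
  "near_period k \<omega> \<delta> h \<longleftrightarrow> (\<forall>i<k. \<exists>m::int. \<bar>h * \<omega> i - 2 * pi * m\<bar> < \<delta>)"

text \<open>A form of quasi-periodicity that speaks of translates only. It passes through the solution operator, which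
  commutes with translations but knows nothing of a torus.\<close>

definition recurrent :: "nat \<Rightarrow> (nat \<Rightarrow> real) \<Rightarrow> (real \<Rightarrow> 'a::real_normed_vector) \<Rightarrow> bool" where
  "recurrent k \<omega> u \<longleftrightarrow> (\<forall>e>0. \<exists>\<delta>>0. \<forall>h. near_period k \<omega> \<delta> h \<longrightarrow> (\<forall>t. norm (u (t + h) - u t) \<le> e))"

lemma periodic_int:
  assumes per: "\<forall>v\<in>topspace (Euclidean_space k). \<forall>i<k. \<Phi> (v(i := v i + 2 * pi)) = \<Phi> v"
    and v: "v \<in> topspace (Euclidean_space k)" and i: "i < k"
  shows "\<Phi> (v(i := v i + 2 * pi * of_int m)) = \<Phi> v"
proof (induction m rule: int_induct[where k = 0])
  case base
  then show ?case by simp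
next
  case (step1 j)
  let ?w = "v(i := v i + 2 * pi * of_int j)"
  have w: "?w \<in> topspace (Euclidean_space k)" using v i by (auto simp: topspace_Euclidean_space)
  have "v(i := v i + 2 * pi * of_int (j + 1)) = ?w(i := ?w i + 2 * pi)" by (auto simp: algebra_simps)
  then show ?case using per w i step1(2) by metis
next
  case (step2 j)
  let ?w = "v(i := v i + 2 * pi * of_int (j - 1))"
  have w: "?w \<in> topspace (Euclidean_space k)" using v i by (auto simp: topspace_Euclidean_space)
  have "v(i := v i + 2 * pi * of_int j) = ?w(i := ?w i + 2 * pi)" by (auto simp: algebra_simps)
  then show ?case using per w i step2(2) by metis
qed

lemma periodic_int_all:
  assumes per: "\<forall>v\<in>topspace (Euclidean_space k). \<forall>i<k. \<Phi> (v(i := v i + 2 * pi)) = \<Phi> v"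
    and v: "v \<in> topspace (Euclidean_space k)" and j: "j \<le> k"
  shows "\<Phi> (\<lambda>i. if i < j then v i + 2 * pi * of_int (m i) else v i) = \<Phi> v"
  using j
proof (induction j)
  case 0
  then show ?case by simp
next
  case (Suc j)
  let ?w = "\<lambda>i. if i < j then v i + 2 * pi * of_int (m i) else v i"
  have w: "?w \<in> topspace (Euclidean_space k)" using v Suc.prems by (auto simp: topspace_Euclidean_space)
  have eq: "(\<lambda>i. if i < Suc j then v i + 2 * pi * of_int (m i) else v i) = ?w(j := ?w j + 2 * pi * of_int (m j))"
    by (auto simp: less_Suc_eq)
  have "\<Phi> (?w(j := ?w j + 2 * pi * of_int (m j))) = \<Phi> ?w"
    by (rule periodic_int[OF per w]) (use Suc.prems in simp)
  also have "\<Phi> ?w = \<Phi> v" by (rule Suc.IH) (use Suc.prems in simp)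
  finally show ?case unfolding eq .
qed

lemma compact_box: "compact {v :: nat \<Rightarrow> real. (\<forall>i<k. v i \<in> {a..b}) \<and> (\<forall>i\<ge>k. v i = 0)}"
proof -
  have "compactin (powertop_real UNIV) (PiE UNIV (\<lambda>i::nat. if i < k then {a..b} else {0}))"
    unfolding compactin_PiE by (auto simp: compactin_euclidean_iff)
  moreover have "PiE UNIV (\<lambda>i::nat. if i < k then {a..b} else {0}) = {v. (\<forall>i<k. v i \<in> {a..b}) \<and> (\<forall>i\<ge>k. v i = 0)}"
  proof (intro set_eqI iffI)
    fix v assume "v \<in> PiE UNIV (\<lambda>i::nat. if i < k then {a..b} else {0})"
    then have "v i \<in> (if i < k then {a..b} else {0})" for i by (rule PiE_mem) simp
    from this show "v \<in> {v. (\<forall>i<k. v i \<in> {a..b}) \<and> (\<forall>i\<ge>k. v i = 0)}"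
      by (simp add: if_splits)
  next
    fix v assume "v \<in> {v. (\<forall>i<k. v i \<in> {a..b}) \<and> (\<forall>i\<ge>k. v i = (0::real))}"
    then show "v \<in> PiE UNIV (\<lambda>i::nat. if i < k then {a..b} else {0})" by auto
  qed
  ultimately show ?thesis by (simp add: euclidean_product_topology)
qed

text \<open>The distance on \<open>nat \<Rightarrow> real\<close> is a weighted sum over the coordinates with total weight \<open>2\<close>.\<close>

lemma dist_fun_le:
  fixes v w :: "nat \<Rightarrow> real"
  assumes "\<And>i. dist (v i) (w i) \<le> d" "d \<ge> 0" shows "dist v w \<le> 2 * d"
proof -
  have "(\<lambda>n. (1/2) ^ n * d) sums (2 * d)"
    using sums_mult2[OF geometric_sums[of "1/2 :: real"], of d] by simp
  moreover have "(1/2) ^ n * min (dist (v (from_nat n)) (w (from_nat n))) 1 \<le> (1/2) ^ n * d" for n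
    using assms(1)[of "from_nat n"] by (intro mult_left_mono) auto
  moreover have "summable (\<lambda>n. (1/2) ^ n * min (dist (v (from_nat n)) (w (from_nat n))) 1)"
    by (rule summable_comparison_test'[of "\<lambda>n. (1/2) ^ n"]) (auto simp: mult_left_le)
  ultimately show ?thesis
    unfolding dist_fun_def by (metis (lifting) sums_iff suminf_le)
qed

text \<open>Modulo \<open>2 \<pi>\<close> the orbit points of \<open>t\<close> and \<open>t + h\<close> are close to each other in a compact box, on which the torus function is
  uniformly continuous. The box exceeds a period cell by \<open>1\<close> on each side, so that it contains both points.\<close>

lemma quasi_periodic_imp_recurrent:
  assumes \<omega>: "\<omega> \<in> topspace (Euclidean_space k)" and q: "quasi_periodic_wrt k \<omega> \<phi>"
  shows "recurrent k \<omega> \<phi>"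
proof -
  obtain \<Phi> where \<Phi>: "continuous_map (Euclidean_space k) euclideanreal \<Phi>"
    and per: "\<forall>v\<in>topspace (Euclidean_space k). \<forall>i<k. \<Phi> (v(i := v i + 2 * pi)) = \<Phi> v"
    and \<phi>: "\<And>t. \<phi> t = \<Phi> (\<lambda>i. t * \<omega> i)"
    using q unfolding quasi_periodic_wrt_def by blast
  define C where "C = {v :: nat \<Rightarrow> real. (\<forall>i<k. v i \<in> {-1..2*pi+1}) \<and> (\<forall>i\<ge>k. v i = 0)}"
  have CE: "C \<subseteq> topspace (Euclidean_space k)" by (auto simp: C_def topspace_Euclidean_space)
  have "continuous_on C \<Phi>" using \<Phi> CE by (simp add: continuous_map_Euclidean_space_iff continuous_on_subset)
  then have uc: "uniformly_continuous_on C \<Phi>"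
    unfolding C_def by (rule compact_uniformly_continuous[OF _ compact_box])
  show ?thesis
    unfolding recurrent_def
  proof (intro allI impI)
    fix e :: real assume e: "0 < e"
    from uc e obtain d where d: "d > 0" "\<And>v w. v \<in> C \<Longrightarrow> w \<in> C \<Longrightarrow> dist w v < d \<Longrightarrow> dist (\<Phi> w) (\<Phi> v) < e"
      unfolding uniformly_continuous_on_def by metis
    define \<delta> where "\<delta> = min 1 (d / 3)"
    have \<delta>: "\<delta> > 0" "\<delta> \<le> 1" "2 * \<delta> < d" using d(1) by (auto simp: \<delta>_def)
    have "norm (\<phi> (t + h) - \<phi> t) \<le> e" if h: "near_period k \<omega> \<delta> h" for h t
    proof -
      from h obtain m where m: "\<And>i. i < k \<Longrightarrow> \<bar>h * \<omega> i - 2 * pi * of_int (m i)\<bar> < \<delta>"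
        unfolding near_period_def by metis
      define n where "n i = \<lfloor>t * \<omega> i / (2 * pi)\<rfloor>" for i
      have \<omega>0: "\<omega> i = 0" if "\<not> i < k" for i using \<omega> that by (auto simp: topspace_Euclidean_space)
      define a where "a i = (if i < k then t * \<omega> i + 2 * pi * of_int (- n i) else t * \<omega> i)" for i
      define b where "b i = (if i < k then (t + h) * \<omega> i + 2 * pi * of_int (- n i - m i) else (t + h) * \<omega> i)" for i
      have top: "(\<lambda>i. s * \<omega> i) \<in> topspace (Euclidean_space k)" for s using \<omega> by (auto simp: topspace_Euclidean_space)
      have \<Phi>a: "\<Phi> a = \<phi> t" unfolding a_def[abs_def] \<phi> by (rule periodic_int_all[OF per top]) simp
      have \<Phi>b: "\<Phi> b = \<phi> (t + h)" unfolding b_def[abs_def] \<phi> by (rule periodic_int_all[OF per top]) simp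
      have a01: "0 \<le> a i" "a i < 2 * pi" if "i < k" for i
      proof -
        have "of_int (n i) \<le> t * \<omega> i / (2 * pi)" "t * \<omega> i / (2 * pi) < of_int (n i) + 1"
          unfolding n_def by linarith+
        then have "of_int (n i) * (2 * pi) \<le> t * \<omega> i" "t * \<omega> i < (of_int (n i) + 1) * (2 * pi)"
          using pi_gt_zero by (simp_all add: pos_le_divide_eq pos_divide_less_eq)
        then show "0 \<le> a i" "a i < 2 * pi" using that by (auto simp: a_def algebra_simps)
      qed
      have ba: "\<bar>b i - a i\<bar> < \<delta>" if "i < k" for i
        using m[OF that] that by (simp add: a_def b_def algebra_simps)
      have "a \<in> C" unfolding C_def
      proof (intro CollectI conjI allI impI)
        show "a i \<in> {-1..2*pi+1}" if "i < k" for i using a01[OF that] by simp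
        show "a i = 0" if "k \<le> i" for i using that \<omega>0 by (simp add: a_def)
      qed
      moreover have "b \<in> C" unfolding C_def
      proof (intro CollectI conjI allI impI)
        show "b i \<in> {-1..2*pi+1}" if "i < k" for i using a01[OF that] ba[OF that] \<delta>(2) unfolding abs_less_iff by simp
        show "b i = 0" if "k \<le> i" for i using that \<omega>0 by (simp add: b_def)
      qed
      moreover have "dist b a < d"
      proof -
        have "dist (b i) (a i) \<le> \<delta>" for i
          using ba[of i] \<omega>0[of i] \<delta>(1) by (cases "i < k") (auto simp: dist_real_def a_def b_def)
        then have "dist b a \<le> 2 * \<delta>" using \<delta>(1) by (intro dist_fun_le) auto
        then show ?thesis using \<delta>(3) by linarith
      qed
      ultimately have "dist (\<Phi> b) (\<Phi> a) < e" by (intro d(2))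
      then show ?thesis by (simp add: \<Phi>a \<Phi>b dist_norm)
    qed
    then show "\<exists>\<delta>>0. \<forall>h. near_period k \<omega> \<delta> h \<longrightarrow> (\<forall>t. norm (\<phi> (t + h) - \<phi> t) \<le> e)"
      using \<delta>(1) by blast
  qed
qed

text \<open>Kronecker's theorem, with time rescaled by \<open>2 \<pi>\<close>. It wants distinct numbers independent over the
  integers; both properties follow from rational independence.\<close>

lemma kronecker_orbit_dense:
  assumes \<omega>: "frequency_vector k \<omega>" and \<delta>: "\<delta> > 0"
  shows "\<exists>t. \<forall>i<k. \<exists>m::int. \<bar>t * \<omega> i - \<theta> i - 2 * pi * m\<bar> < \<delta>"
proof -
  have ind: "\<And>m :: nat \<Rightarrow> rat. (\<Sum>i<k. of_rat (m i) * \<omega> i) = 0 \<Longrightarrow> i < k \<Longrightarrow> m i = 0" for i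
    using \<omega> by (auto simp: frequency_vector_def)
  have inj: "inj_on \<omega> {..<k}"
  proof (rule inj_onI)
    fix i j assume ij: "i \<in> {..<k}" "j \<in> {..<k}" "\<omega> i = \<omega> j"
    show "i = j"
    proof (rule ccontr)
      assume ne: "i \<noteq> j"
      define m :: "nat \<Rightarrow> rat" where "m = (\<lambda>l. if l = i then 1 else if l = j then -1 else 0)"
      have "(\<Sum>l<k. of_rat (m l) * \<omega> l) = (\<Sum>l\<in>{i, j}. of_rat (m l) * \<omega> l)"
        by (rule sum.mono_neutral_right) (use ij in \<open>auto simp: m_def\<close>)
      also have "\<dots> = 0" using ne ij(3) by (simp add: m_def of_rat_minus)
      finally have "m i = 0" using ind[of m i] ij by simp
      then show False by (simp add: m_def)
    qed
  qed
  interpret Z: Modules.module "(\<lambda>r. (*) (real_of_int r))"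
    by (simp add: Modules.module.intro distrib_left mult.commute)
  have indep: "Z.independent (\<omega> ` {..<k})"
    unfolding Z.dependent_explicit
  proof (rule notI, elim exE conjE bexE)
    fix T u v
    assume T: "finite T" "T \<subseteq> \<omega> ` {..<k}" and z: "(\<Sum>v\<in>T. real_of_int (u v) * v) = 0" and v: "v \<in> T" "u v \<noteq> 0"
    define m :: "nat \<Rightarrow> rat" where "m i = (if \<omega> i \<in> T then of_int (u (\<omega> i)) else 0)" for i
    have "(\<Sum>i<k. of_rat (m i) * \<omega> i) = (\<Sum>i\<in>{i\<in>{..<k}. \<omega> i \<in> T}. real_of_int (u (\<omega> i)) * \<omega> i)"
      by (intro sum.mono_neutral_cong_right) (auto simp: m_def)
    also have "\<dots> = (\<Sum>v\<in>\<omega> ` {i\<in>{..<k}. \<omega> i \<in> T}. real_of_int (u v) * v)"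
      by (subst sum.reindex) (auto intro: inj_on_subset[OF inj])
    also have "\<omega> ` {i\<in>{..<k}. \<omega> i \<in> T} = T" using T(2) by auto
    finally have z': "(\<Sum>i<k. of_rat (m i) * \<omega> i) = 0" using z by simp
    obtain i where i: "i < k" "v = \<omega> i" using T(2) v(1) by auto
    have "m i = 0" by (rule ind[OF z' i(1)])
    then show False using v i by (simp add: m_def)
  qed
  have \<delta>': "\<delta> / (2 * pi) > 0" using \<delta> by simp
  obtain s h where s: "\<And>i. i < k \<Longrightarrow> \<bar>s * \<omega> i - of_int (h i) - \<theta> i / (2 * pi)\<bar> < \<delta> / (2 * pi)"
    using Kronecker_thm_1[OF indep inj \<delta>', of "\<lambda>i. \<theta> i / (2 * pi)"] by blast
  have "\<bar>(2 * pi * s) * \<omega> i - \<theta> i - 2 * pi * of_int (h i)\<bar> < \<delta>" if "i < k" for i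
  proof -
    have "(2 * pi * s) * \<omega> i - \<theta> i - 2 * pi * of_int (h i) = (2 * pi) * (s * \<omega> i - of_int (h i) - \<theta> i / (2 * pi))"
      by (simp add: algebra_simps)
    then have "\<bar>(2 * pi * s) * \<omega> i - \<theta> i - 2 * pi * of_int (h i)\<bar> = (2 * pi) * \<bar>s * \<omega> i - of_int (h i) - \<theta> i / (2 * pi)\<bar>"
      by (simp add: abs_mult)
    also have "\<dots> < (2 * pi) * (\<delta> / (2 * pi))" using s[OF that] pi_gt_zero by (intro mult_strict_left_mono) auto
    finally show ?thesis using pi_gt_zero by simp
  qed
  then show ?thesis by blast
qed

lemma H2_trace_bounds:
  assumes "x \<in> {0..1}" "x' \<in> {0..1}"
  shows "cmod (trace_at (emb v) x) \<le> 2 * norm v"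
    and "cmod (trace_at (emb v) x - trace_at (emb w) x) \<le> 2 * norm (v - w)"
    and "cmod (trace_at (emb v) x - trace_at (emb v) x') \<le> 2 * norm v * \<bar>x - x'\<bar>"
proof -
  have b: "cmod (trace_at (emb v) x) \<le> 2 * norm v" for v
    using trace_le[OF H2_weak_deriv(1) assms(1), of v] norm_emb_le[of v] norm_dx_le[of v] by linarith
  show "cmod (trace_at (emb v) x) \<le> 2 * norm v" by (rule b)
  have "trace_at (emb (v - w)) x = trace_at (emb v) x - trace_at (emb w) x"
  proof (rule trace_at_eqI[OF _ _ assms(1)])
    show "continuous_on {0..1} (\<lambda>x. trace_at (emb v) x - trace_at (emb w) x)"
      by (intro continuous_intros primitive_of_continuous[OF weak_deriv_primitive(1)[OF H2_weak_deriv(1)]])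
    show "AE x in lebI. rep_L2 (emb (v - w)) x = trace_at (emb v) x - trace_at (emb w) x"
      using weak_deriv_primitive(2)[OF H2_weak_deriv(1)[of v]] weak_deriv_primitive(2)[OF H2_weak_deriv(1)[of w]]
        rep_minus[of "emb v" "emb w"] by eventually_elim (simp add: emb_minus)
  qed
  then show "cmod (trace_at (emb v) x - trace_at (emb w) x) \<le> 2 * norm (v - w)" using b[of "v - w"] by simp
  have n2: "norm (wderiv 2 (emb v)) \<le> norm v" using norm_wderiv_le_sobolev_norm[of 2 2 "emb v"] by (simp add: norm_H2I_def)
  have "cmod (trace_at (emb v) x - trace_at (emb v) x') \<le> (norm (dx v) + norm (wderiv 2 (emb v))) * \<bar>x - x'\<bar>"
    by (rule trace_lipschitz[OF H2_weak_deriv assms])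
  also have "\<dots> \<le> (2 * norm v) * \<bar>x - x'\<bar>" using norm_dx_le[of v] n2 by (intro mult_right_mono) auto
  finally show "cmod (trace_at (emb v) x - trace_at (emb v) x') \<le> 2 * norm v * \<bar>x - x'\<bar>" .
qed

text \<open>Choose times \<open>\<tau> n \<theta>\<close> at which the orbit is within \<open>1 / (n + 1)\<close> of \<open>\<theta>\<close>. Recurrence makes the values at these times a
  Cauchy sequence, and the limit depends on \<open>\<theta>\<close> with the same modulus of continuity.\<close>

lemma recurrent_extension:
  fixes U :: "real \<Rightarrow> 'a::banach"
  assumes \<omega>: "frequency_vector k \<omega>" and U: "recurrent k \<omega> U"
  obtains V where "\<And>t. V (\<lambda>i. t * \<omega> i) = U t"
    "\<And>e. e > 0 \<Longrightarrow> \<exists>\<delta>>0. \<forall>\<theta> \<theta>'. (\<forall>i<k. \<exists>m::int. \<bar>\<theta> i - \<theta>' i - 2 * pi * m\<bar> < \<delta>) \<longrightarrow> norm (V \<theta> - V \<theta>') \<le> e"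
proof -
  have "\<exists>t. \<forall>i<k. \<exists>m::int. \<bar>t * \<omega> i - \<theta> i - 2 * pi * m\<bar> < 1 / real (Suc n)" for \<theta> n
    by (rule kronecker_orbit_dense[OF \<omega>]) simp
  note ex = this
  define \<tau> where "\<tau> n \<theta> = (SOME t. \<forall>i<k. \<exists>m::int. \<bar>t * \<omega> i - \<theta> i - 2 * pi * m\<bar> < 1 / real (Suc n))" for n \<theta>
  have \<tau>: "\<forall>i<k. \<exists>m::int. \<bar>\<tau> n \<theta> * \<omega> i - \<theta> i - 2 * pi * m\<bar> < 1 / real (Suc n)" for n \<theta>
    unfolding \<tau>_def by (rule someI_ex) (rule ex)
  have close: "\<exists>N. \<forall>\<theta> \<theta>'. (\<forall>i<k. \<exists>m::int. \<bar>\<theta> i - \<theta>' i - 2 * pi * m\<bar> < 1 / real (Suc N)) \<longrightarrow>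
      (\<forall>n\<ge>N. \<forall>n'\<ge>N. norm (U (\<tau> n \<theta>) - U (\<tau> n' \<theta>')) \<le> e) \<and>
      (\<forall>n\<ge>N. \<forall>t. (\<forall>i. \<theta>' i = t * \<omega> i) \<longrightarrow> norm (U (\<tau> n \<theta>) - U t) \<le> e)" if e: "e > 0" for e
  proof -
    obtain \<delta> where \<delta>: "\<delta> > 0" "\<And>h t. near_period k \<omega> \<delta> h \<Longrightarrow> norm (U (t + h) - U t) \<le> e"
      using U e unfolding recurrent_def by meson
    have "0 < \<delta> / 3" using \<delta>(1) by simp
    from reals_Archimedean[OF this] obtain N where N: "1 / real (Suc N) < \<delta> / 3" unfolding inverse_eq_divide by (elim exE)
    have le: "1 / real (Suc n) \<le> 1 / real (Suc N)" if "n \<ge> N" for n using that by (simp add: frac_le)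
    have "(\<forall>n\<ge>N. \<forall>n'\<ge>N. norm (U (\<tau> n \<theta>) - U (\<tau> n' \<theta>')) \<le> e) \<and>
      (\<forall>n\<ge>N. \<forall>t. (\<forall>i. \<theta>' i = t * \<omega> i) \<longrightarrow> norm (U (\<tau> n \<theta>) - U t) \<le> e)"
      if \<theta>: "\<forall>i<k. \<exists>m::int. \<bar>\<theta> i - \<theta>' i - 2 * pi * m\<bar> < 1 / real (Suc N)" for \<theta> \<theta>'
    proof (intro conjI allI impI)
      fix n n' assume n: "N \<le> n" "N \<le> n'"
      have "near_period k \<omega> \<delta> (\<tau> n \<theta> - \<tau> n' \<theta>')"
        unfolding near_period_def
      proof (intro allI impI)
        fix i assume i: "i < k"
        obtain m1 m2 m3 :: int where "\<bar>\<tau> n \<theta> * \<omega> i - \<theta> i - 2 * pi * m1\<bar> < 1 / real (Suc n)"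
          "\<bar>\<tau> n' \<theta>' * \<omega> i - \<theta>' i - 2 * pi * m2\<bar> < 1 / real (Suc n')" "\<bar>\<theta> i - \<theta>' i - 2 * pi * m3\<bar> < 1 / real (Suc N)"
          using \<tau>[of n \<theta>] \<tau>[of n' \<theta>'] \<theta> i by metis
        then have "\<bar>(\<tau> n \<theta> * \<omega> i - \<theta> i - 2 * pi * m1) - (\<tau> n' \<theta>' * \<omega> i - \<theta>' i - 2 * pi * m2) + (\<theta> i - \<theta>' i - 2 * pi * m3)\<bar> < \<delta>"
          using N le[OF n(1)] le[OF n(2)] by linarith
        moreover have "(\<tau> n \<theta> * \<omega> i - \<theta> i - 2 * pi * m1) - (\<tau> n' \<theta>' * \<omega> i - \<theta>' i - 2 * pi * m2) + (\<theta> i - \<theta>' i - 2 * pi * m3)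
          = (\<tau> n \<theta> - \<tau> n' \<theta>') * \<omega> i - 2 * pi * of_int (m1 - m2 + m3)" by (simp add: algebra_simps)
        ultimately show "\<exists>m::int. \<bar>(\<tau> n \<theta> - \<tau> n' \<theta>') * \<omega> i - 2 * pi * m\<bar> < \<delta>" by metis
      qed
      from \<delta>(2)[OF this, of "\<tau> n' \<theta>'"] show "norm (U (\<tau> n \<theta>) - U (\<tau> n' \<theta>')) \<le> e" by simp
    next
      fix n t assume n: "N \<le> n" and t: "\<forall>i. \<theta>' i = t * \<omega> i"
      have "near_period k \<omega> \<delta> (\<tau> n \<theta> - t)"
        unfolding near_period_def
      proof (intro allI impI)
        fix i assume i: "i < k"
        obtain m1 m3 :: int where "\<bar>\<tau> n \<theta> * \<omega> i - \<theta> i - 2 * pi * m1\<bar> < 1 / real (Suc n)"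
          "\<bar>\<theta> i - \<theta>' i - 2 * pi * m3\<bar> < 1 / real (Suc N)"
          using \<tau>[of n \<theta>] \<theta> i by metis
        then have "\<bar>(\<tau> n \<theta> * \<omega> i - \<theta> i - 2 * pi * m1) + (\<theta> i - \<theta>' i - 2 * pi * m3)\<bar> < \<delta>"
          using N le[OF n] \<delta>(1) by linarith
        moreover have "(\<tau> n \<theta> * \<omega> i - \<theta> i - 2 * pi * m1) + (\<theta> i - \<theta>' i - 2 * pi * m3)
          = (\<tau> n \<theta> - t) * \<omega> i - 2 * pi * of_int (m1 + m3)" using t by (simp add: algebra_simps)
        ultimately show "\<exists>m::int. \<bar>(\<tau> n \<theta> - t) * \<omega> i - 2 * pi * m\<bar> < \<delta>" by metis
      qed
      from \<delta>(2)[OF this, of t] show "norm (U (\<tau> n \<theta>) - U t) \<le> e" by simp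
    qed
    then show ?thesis by blast
  qed
  have refl: "\<forall>i<k. \<exists>m::int. \<bar>\<theta> i - \<theta> i - 2 * pi * m\<bar> < 1 / real (Suc N)" for \<theta> :: "nat \<Rightarrow> real" and N
    by (auto intro!: exI[of _ "0::int"])
  have "Cauchy (\<lambda>n. U (\<tau> n \<theta>))" for \<theta>
  proof (rule metric_CauchyI)
    fix e :: real assume e: "0 < e"
    then obtain N where N: "\<forall>n\<ge>N. \<forall>n'\<ge>N. norm (U (\<tau> n \<theta>) - U (\<tau> n' \<theta>)) \<le> e / 2"
      using close[of "e/2"] refl[of \<theta>] by (metis half_gt_zero)
    have "dist (U (\<tau> n \<theta>)) (U (\<tau> n' \<theta>)) < e" if n: "n \<ge> N" "n' \<ge> N" for n n'
    proof -
      have "norm (U (\<tau> n \<theta>) - U (\<tau> n' \<theta>)) \<le> e / 2" using N n by blast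
      then show ?thesis using e by (simp add: dist_norm)
    qed
    then show "\<exists>M. \<forall>m\<ge>M. \<forall>n\<ge>M. dist (U (\<tau> m \<theta>)) (U (\<tau> n \<theta>)) < e" by blast
  qed
  then obtain V where V: "\<And>\<theta>. (\<lambda>n. U (\<tau> n \<theta>)) \<longlonglongrightarrow> V \<theta>"
    unfolding Cauchy_convergent_iff convergent_def by metis
  show thesis
  proof (rule that[of V])
    fix t
    have "norm (V (\<lambda>i. t * \<omega> i) - U t) \<le> e" if e: "e > 0" for e
    proof -
      obtain N where N: "\<forall>n\<ge>N. norm (U (\<tau> n (\<lambda>i. t * \<omega> i)) - U t) \<le> e"
      proof -
        obtain N where N: "\<And>\<theta> \<theta>'. (\<forall>i<k. \<exists>m::int. \<bar>\<theta> i - \<theta>' i - 2 * pi * m\<bar> < 1 / real (Suc N)) \<Longrightarrow>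
            \<forall>n\<ge>N. \<forall>t. (\<forall>i. \<theta>' i = t * \<omega> i) \<longrightarrow> norm (U (\<tau> n \<theta>) - U t) \<le> e"
          using close[OF e] by blast
        from N[OF refl[of "\<lambda>i. t * \<omega> i"]] have "\<forall>n\<ge>N. norm (U (\<tau> n (\<lambda>i. t * \<omega> i)) - U t) \<le> e" by simp
        then show thesis by (rule that)
      qed
      show ?thesis
        by (rule LIMSEQ_le_const2[OF tendsto_norm[OF tendsto_diff[OF V tendsto_const]]]) (use N in blast)
    qed
    then have "norm (V (\<lambda>i. t * \<omega> i) - U t) \<le> 0" by (rule field_le_epsilon) simp
    then show "V (\<lambda>i. t * \<omega> i) = U t" by simp
  next
    fix e :: real assume e: "e > 0"
    obtain N where N: "\<And>\<theta> \<theta>'. (\<forall>i<k. \<exists>m::int. \<bar>\<theta> i - \<theta>' i - 2 * pi * m\<bar> < 1 / real (Suc N)) \<Longrightarrow>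
       (\<forall>n\<ge>N. \<forall>n'\<ge>N. norm (U (\<tau> n \<theta>) - U (\<tau> n' \<theta>')) \<le> e)"
      using close[OF e] by blast
    have "norm (V \<theta> - V \<theta>') \<le> e" if "\<forall>i<k. \<exists>m::int. \<bar>\<theta> i - \<theta>' i - 2 * pi * m\<bar> < 1 / real (Suc N)" for \<theta> \<theta>'
      by (rule LIMSEQ_le_const2[OF tendsto_norm[OF tendsto_diff[OF V V]]]) (use N[OF that] in blast)
    then show "\<exists>\<delta>>0. \<forall>\<theta> \<theta>'. (\<forall>i<k. \<exists>m::int. \<bar>\<theta> i - \<theta>' i - 2 * pi * m\<bar> < \<delta>) \<longrightarrow> norm (V \<theta> - V \<theta>') \<le> e"
      by (intro exI[of _ "1 / real (Suc N)"]) auto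
  qed
qed

lemma continuous_on_trace:
  fixes V :: "'b::topological_space \<Rightarrow> H2I"
  assumes V: "continuous_on B V" and A: "A \<subseteq> {0..1}"
  shows "continuous_on (A \<times> B) (\<lambda>(x, \<theta>). Re (trace_at (emb (V \<theta>)) x))"
  unfolding continuous_on_def
proof (rule ballI)
  fix w assume "w \<in> A \<times> B"
  then obtain x0 \<theta>0 where w: "w = (x0, \<theta>0)" and x0: "x0 \<in> A" and \<theta>0: "\<theta>0 \<in> B" by (rule SigmaE)
  let ?F = "at (x0, \<theta>0) within A \<times> B"
  have fst: "((\<lambda>z. fst z) \<longlongrightarrow> x0) ?F" by (intro tendsto_eq_intros) auto
  have "continuous_on (A \<times> B) (\<lambda>z. V (snd z))"
    by (rule continuous_on_compose2[OF V continuous_on_snd[OF continuous_on_id]]) auto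
  then have Vs: "((\<lambda>z. V (snd z)) \<longlongrightarrow> V \<theta>0) ?F" using x0 \<theta>0 by (auto simp: continuous_on_def)
  have "((\<lambda>z. 2 * norm (V (snd z) - V \<theta>0) + 2 * norm (V \<theta>0) * \<bar>fst z - x0\<bar>) \<longlongrightarrow> 2 * norm (V \<theta>0 - V \<theta>0) + 2 * norm (V \<theta>0) * \<bar>x0 - x0\<bar>) ?F"
    by (intro tendsto_intros Vs fst)
  then have lim: "((\<lambda>z. 2 * norm (V (snd z) - V \<theta>0) + 2 * norm (V \<theta>0) * \<bar>fst z - x0\<bar>) \<longlongrightarrow> 0) ?F" by simp
  have inAB: "eventually (\<lambda>z. z \<in> A \<times> B) ?F" by (auto simp: eventually_at_topological)
  have "((\<lambda>z. Re (trace_at (emb (V (snd z))) (fst z)) - Re (trace_at (emb (V \<theta>0)) x0)) \<longlongrightarrow> 0) ?F"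
  proof (rule Lim_null_comparison[OF _ lim])
    show "eventually (\<lambda>z. norm (Re (trace_at (emb (V (snd z))) (fst z)) - Re (trace_at (emb (V \<theta>0)) x0))
        \<le> 2 * norm (V (snd z) - V \<theta>0) + 2 * norm (V \<theta>0) * \<bar>fst z - x0\<bar>) ?F"
      using inAB
    proof eventually_elim
      case (elim z)
      then have z: "fst z \<in> {0..1}" "x0 \<in> {0..1}" using A x0 by auto
      have "norm (Re (trace_at (emb (V (snd z))) (fst z)) - Re (trace_at (emb (V \<theta>0)) x0))
         \<le> cmod (trace_at (emb (V (snd z))) (fst z) - trace_at (emb (V \<theta>0)) x0)"
        by (metis abs_Re_le_cmod minus_complex.sel(1) real_norm_def)
      also have "\<dots> \<le> cmod (trace_at (emb (V (snd z))) (fst z) - trace_at (emb (V \<theta>0)) (fst z)) + cmod (trace_at (emb (V \<theta>0)) (fst z) - trace_at (emb (V \<theta>0)) x0)"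
        using norm_triangle_ineq[of "trace_at (emb (V (snd z))) (fst z) - trace_at (emb (V \<theta>0)) (fst z)" "trace_at (emb (V \<theta>0)) (fst z) - trace_at (emb (V \<theta>0)) x0"] by simp
      also have "\<dots> \<le> 2 * norm (V (snd z) - V \<theta>0) + 2 * norm (V \<theta>0) * \<bar>fst z - x0\<bar>"
        by (intro add_mono H2_trace_bounds[OF z])
      finally show ?case .
    qed
  qed
  then have "((\<lambda>z. Re (trace_at (emb (V (snd z))) (fst z))) \<longlongrightarrow> Re (trace_at (emb (V \<theta>0)) x0)) ?F"
    by (rule LIM_zero_cancel)
  then show "((\<lambda>(x, \<theta>). Re (trace_at (emb (V \<theta>)) x)) \<longlongrightarrow> (case w of (x, \<theta>) \<Rightarrow> Re (trace_at (emb (V \<theta>)) x))) (at w within A \<times> B)"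
    by (simp add: w case_prod_beta')
qed

text \<open>The torus function for the continuous representative is \<open>(x, \<theta>) \<mapsto> Re (V \<theta>)(x)\<close>, with \<open>V\<close> the extension of \<open>U\<close> to the torus.\<close>

lemma recurrent_imp_qp_solution:
  fixes U :: "real \<Rightarrow> H2I"
  assumes \<omega>: "frequency_vector k \<omega>" and U: "continuous_on UNIV U" and real: "\<And>t. cnj_L2 (emb (U t)) = emb (U t)"
    and rec: "recurrent k \<omega> U"
  shows "qp_solution k \<omega> (\<lambda>t. emb (U t))"
proof -
  obtain V where Vt: "\<And>t. V (\<lambda>i. t * \<omega> i) = U t"
    and V: "\<And>e. e > 0 \<Longrightarrow> \<exists>\<delta>>0. \<forall>\<theta> \<theta>'. (\<forall>i<k. \<exists>m::int. \<bar>\<theta> i - \<theta>' i - 2 * pi * m\<bar> < \<delta>) \<longrightarrow> norm (V \<theta> - V \<theta>') \<le> e"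
    by (rule recurrent_extension[OF \<omega> rec]) blast
  let ?E = "topspace (Euclidean_space k)"
  have cV: "continuous_on ?E V"
    unfolding continuous_on_def
  proof (intro ballI tendstoI)
    fix \<theta> :: "nat \<Rightarrow> real" and e :: real assume "0 < e"
    then obtain \<delta> where \<delta>: "\<delta> > 0" "\<And>\<theta> \<theta>'. (\<forall>i<k. \<exists>m::int. \<bar>\<theta> i - \<theta>' i - 2 * pi * m\<bar> < \<delta>) \<Longrightarrow> norm (V \<theta> - V \<theta>') \<le> e / 2"
      using V[of "e/2"] by (metis half_gt_zero)
    have "eventually (\<lambda>\<theta>'. \<forall>i\<in>{..<k}. dist (\<theta>' i) (\<theta> i) < \<delta>) (at \<theta> within ?E)"
    proof (intro eventually_ball_finite ballI tendstoD[OF _ \<delta>(1)])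
      fix i
      have "continuous_on UNIV (\<lambda>\<theta> :: nat \<Rightarrow> real. \<theta> i)" by (rule continuous_on_product_coordinates)
      then have "((\<lambda>\<theta> :: nat \<Rightarrow> real. \<theta> i) \<longlongrightarrow> \<theta> i) (at \<theta> within UNIV)" unfolding continuous_on_def by (rule bspec) simp
      then show "((\<lambda>\<theta>. \<theta> i) \<longlongrightarrow> \<theta> i) (at \<theta> within ?E)" by (rule tendsto_within_subset) simp
    qed simp
    then show "eventually (\<lambda>\<theta>'. dist (V \<theta>') (V \<theta>) < e) (at \<theta> within ?E)"
    proof eventually_elim
      case (elim \<theta>')
      have "norm (V \<theta>' - V \<theta>) \<le> e / 2"
        by (rule \<delta>(2)) (use elim in \<open>auto simp: dist_real_def intro!: exI[of _ "0::int"]\<close>)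
      then show ?case using \<open>0 < e\<close> by (simp add: dist_norm)
    qed
  qed
  define g where "g x t = Re (trace_at (emb (U t)) x)" for x t
  define F where "F x \<theta> = Re (trace_at (emb (V \<theta>)) x)" for x \<theta>
  have g: "AE x in lebI. rep_L2 (emb (U t)) x = of_real (g x t)" for t
    using weak_deriv_primitive(2)[OF H2_weak_deriv(1)[of "U t"]] rep_cnj_L2[of "emb (U t)", unfolded real]
    by eventually_elim (simp add: g_def complex_eq_iff)
  have "unif_quasi_periodic_wrt k \<omega> g"
    unfolding unif_quasi_periodic_wrt_def
  proof (intro conjI exI[of _ F])
    show "continuous_on ({0<..<1} \<times> UNIV) (\<lambda>(x, t). g x t)"
      unfolding g_def by (rule continuous_on_trace[OF U]) auto
    have e: "prod_topology (top_of_set {0<..<1}) (Euclidean_space k) = top_of_set ({0<..<1::real} \<times> ?E)"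
      unfolding Euclidean_space_def topspace_Euclidean_space euclidean_product_topology
      by (simp add: subtopology_Times[symmetric] topspace_Euclidean_space euclidean_product_topology)
    show "continuous_map (prod_topology (top_of_set {0<..<1}) (Euclidean_space k)) euclideanreal (\<lambda>(x, v). F x v)"
      unfolding e continuous_map_iff_continuous F_def by (rule continuous_on_trace[OF cV]) auto
    show "\<forall>x\<in>{0<..<1}. \<forall>v\<in>?E. \<forall>i<k. F x (v(i := v i + 2 * pi)) = F x v"
    proof (intro ballI allI impI)
      fix x :: real and v i
      have "norm (V (v(i := v i + 2 * pi)) - V v) \<le> e" if e: "e > 0" for e
      proof -
        obtain \<delta> where \<delta>: "\<delta> > 0" "\<And>\<theta> \<theta>'. (\<forall>i<k. \<exists>m::int. \<bar>\<theta> i - \<theta>' i - 2 * pi * m\<bar> < \<delta>) \<Longrightarrow> norm (V \<theta> - V \<theta>') \<le> e"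
          using V[OF e] by blast
        show ?thesis
        proof (rule \<delta>(2), intro allI impI)
          fix j
          show "\<exists>m::int. \<bar>(v(i := v i + 2 * pi)) j - v j - 2 * pi * m\<bar> < \<delta>"
            by (rule exI[of _ "if j = i then 1 else 0"]) (use \<delta>(1) in simp)
        qed
      qed
      then have "norm (V (v(i := v i + 2 * pi)) - V v) \<le> 0" by (rule field_le_epsilon) simp
      then show "F x (v(i := v i + 2 * pi)) = F x v" by (simp add: F_def)
    qed
    show "\<forall>x\<in>{0<..<1}. \<forall>t. g x t = F x (\<lambda>i. t * \<omega> i)" by (simp add: g_def F_def Vt)
  qed
  then show ?thesis unfolding qp_solution_def using g by blast
qed

section \<open>Complex structure of \<open>H\<^sup>2(0,1)\<close>\<close>

lemma sobolev_scaleC: "v \<in> sobolev m \<Longrightarrow> scaleC_L2 c v \<in> sobolev m"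
  unfolding sobolev_def using has_weak_deriv_scaleC by blast

lemma wderiv_scaleC: "v \<in> sobolev m \<Longrightarrow> j \<le> m \<Longrightarrow> wderiv j (scaleC_L2 c v) = scaleC_L2 c (wderiv j v)"
  by (rule wderiv_eqI[OF has_weak_deriv_scaleC[OF has_weak_deriv_wderiv]])

definition scaleC_H2 :: "complex \<Rightarrow> H2I \<Rightarrow> H2I" where
  "scaleC_H2 c v = to_H2 (scaleC_L2 c (emb v))"

definition cnj_H2 :: "H2I \<Rightarrow> H2I" where
  "cnj_H2 v = to_H2 (cnj_L2 (emb v))"

definition lift_H2 :: "real \<Rightarrow> H2I" where
  "lift_H2 \<alpha> = to_H2 (lift_L2 \<alpha>)"

lemma emb_scaleC: "emb (scaleC_H2 c v) = scaleC_L2 c (emb v)"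
  and emb_cnj: "emb (cnj_H2 v) = cnj_L2 (emb v)"
  and emb_lift: "emb (lift_H2 \<alpha>) = lift_L2 \<alpha>"
  by (simp_all add: scaleC_H2_def cnj_H2_def lift_H2_def emb_to_H2 sobolev_scaleC sobolev_cnj lift_in_sobolev)

lemma to_H2_emb_diff: "v \<in> sobolev 2 \<Longrightarrow> w \<in> sobolev 2 \<Longrightarrow> emb (to_H2 v - to_H2 w) = v - w"
  by (simp add: emb_minus emb_to_H2)

lemma norm_scaleC_H2: "norm (scaleC_H2 c v) = cmod c * norm v"
proof -
  have "norm (scaleC_H2 c v) = L2_set (\<lambda>j. cmod c * norm (wderiv j (emb v))) {..2}"
    unfolding norm_H2I_def sobolev_norm_L2_set
    by (rule L2_set_cong) (simp_all add: emb_scaleC wderiv_scaleC[OF emb_in_sobolev])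
  then show ?thesis by (simp add: norm_H2I_def sobolev_norm_L2_set L2_set_right_distrib)
qed

lemma norm_cnj_H2: "norm (cnj_H2 v) = norm v"
  unfolding norm_H2I_def sobolev_norm_L2_set
  by (rule L2_set_cong) (simp_all add: emb_cnj wderiv_cnj[OF emb_in_sobolev])

lemma dx_cnj: "dx (cnj_H2 v) = cnj_L2 (dx v)"
  by (simp add: dx_def emb_cnj wderiv_cnj[OF emb_in_sobolev])

lemma bounded_linear_cnj_H2: "bounded_linear cnj_H2"
proof (rule bounded_linear_intro[where K = 1])
  interpret bounded_linear cnj_L2 by (rule bounded_linear_cnj_L2)
  show "cnj_H2 (v + w) = cnj_H2 v + cnj_H2 w" for v w
    by (simp add: emb_inject[symmetric] emb_cnj emb_plus add)
  show "cnj_H2 (r *\<^sub>R v) = r *\<^sub>R cnj_H2 v" for r v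
    by (simp add: emb_inject[symmetric] emb_cnj emb_scaleR scaleR)
qed (simp add: norm_cnj_H2)

lemma bounded_bilinear_scaleC_H2: "bounded_bilinear scaleC_H2"
proof (rule bounded_bilinear.intro)
  interpret bounded_bilinear scaleC_L2 by (rule bounded_bilinear_scaleC_L2)
  fix v w :: H2I and r :: real and c c' :: complex
  show "scaleC_H2 (c + c') v = scaleC_H2 c v + scaleC_H2 c' v"
    by (simp add: emb_inject[symmetric] emb_scaleC emb_plus add_left)
  show "scaleC_H2 c (v + w) = scaleC_H2 c v + scaleC_H2 c w"
    by (simp add: emb_inject[symmetric] emb_scaleC emb_plus add_right)
  show "scaleC_H2 (r *\<^sub>R c) v = r *\<^sub>R scaleC_H2 c v"
    by (simp only: emb_inject[symmetric] emb_scaleC emb_scaleR scaleR_left)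
  show "scaleC_H2 c (r *\<^sub>R v) = r *\<^sub>R scaleC_H2 c v"
    by (simp only: emb_inject[symmetric] emb_scaleC emb_scaleR scaleR_right)
  show "\<exists>K. \<forall>c v. norm (scaleC_H2 c v) \<le> norm c * norm v * K"
    by (intro exI[of _ 1]) (simp add: norm_scaleC_H2)
qed

lemma cnj_scaleC_L2: "cnj_L2 (scaleC_L2 c v) = scaleC_L2 (cnj c) (cnj_L2 v)"
  by (rule L2_eqI) (use rep_cnj_L2[of "scaleC_L2 c v"] rep_scaleC[of c v] rep_scaleC[of "cnj c" "cnj_L2 v"] rep_cnj_L2[of v]
    in \<open>eventually_elim, simp\<close>)

lemma cnj_lift_L2: "cnj_L2 (lift_L2 \<alpha>) = lift_L2 \<alpha>"
  by (rule L2_eqI) (use rep_cnj_L2[of "lift_L2 \<alpha>"] rep_lift_L2(1)[of \<alpha>] in \<open>eventually_elim, simp\<close>)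

lemma rhs_cnj: "rhs \<alpha> (cnj p) (cnj_H2 y) = cnj_L2 (rhs \<alpha> p y)"
proof (rule L2_eqI)
  show "AE x in lebI. rep_L2 (rhs \<alpha> (cnj p) (cnj_H2 y)) x = rep_L2 (cnj_L2 (rhs \<alpha> p y)) x"
    using rep_rhs[of \<alpha> "cnj p" "cnj_H2 y", unfolded emb_cnj dx_cnj] rep_rhs[of \<alpha> p y] rep_cnj_L2[of "rhs \<alpha> p y"]
      rep_cnj_L2[of "emb y"] rep_cnj_L2[of "dx y"]
    by eventually_elim simp
qed

section \<open>Bounded solutions of the shifted equation\<close>

definition boundary_data :: "real \<Rightarrow> (real \<Rightarrow> complex) \<Rightarrow> (real \<Rightarrow> complex) \<Rightarrow> bool" where
  "boundary_data \<epsilon> \<phi> \<phi>' \<longleftrightarrow> (\<forall>s. (\<phi> has_vector_derivative \<phi>' s) (at s)) \<and> continuous_on UNIV \<phi>' \<and>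
     (\<forall>s. cmod (\<phi> s) \<le> \<epsilon>) \<and> (\<forall>s. cmod (\<phi>' s) \<le> \<epsilon>)"

lemma boundary_data_continuous: "boundary_data \<epsilon> \<phi> \<phi>' \<Longrightarrow> continuous_on UNIV \<phi>"
  unfolding boundary_data_def
  by (intro continuous_at_imp_continuous_on) (auto intro: has_vector_derivative_continuous)

lemma shift_vector_derivative:
  "(\<phi> has_vector_derivative d) (at (s + h)) \<Longrightarrow> ((\<lambda>s. \<phi> (s + h)) has_vector_derivative d) (at s)"
proof -
  assume d: "(\<phi> has_vector_derivative d) (at (s + h))"
  have "((\<lambda>s. s + h) has_vector_derivative 1) (at s)" by (auto intro!: derivative_eq_intros)
  from vector_diff_chain_at[OF this d] show ?thesis by (simp add: comp_def)
qed

lemma boundary_data_shift: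
  assumes "boundary_data \<epsilon> \<phi> \<phi>'" shows "boundary_data \<epsilon> (\<lambda>s. \<phi> (s + h)) (\<lambda>s. \<phi>' (s + h))"
  using assms unfolding boundary_data_def
  by (auto intro!: shift_vector_derivative continuous_on_compose2[of UNIV \<phi>' UNIV "\<lambda>s. s + h"] continuous_intros)

context kawahara_semigroup
begin

definition lip :: real where
  "lip = (SOME \<kappa>. \<kappa> > 0 \<and> (\<forall>p q y z. norm (rhs \<alpha> p y - rhs \<alpha> q z) \<le>
     \<kappa> * (norm y + norm z + cmod p) * norm (y - z) + \<kappa> * cmod (p - q) * (norm z + cmod p + cmod q)))"

lemma lip: "lip > 0"
  "norm (rhs \<alpha> p y - rhs \<alpha> q z) \<le>
     lip * (norm y + norm z + cmod p) * norm (y - z) + lip * cmod (p - q) * (norm z + cmod p + cmod q)"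
proof -
  have "\<exists>\<kappa>. \<kappa> > 0 \<and> (\<forall>p q y z. norm (rhs \<alpha> p y - rhs \<alpha> q z) \<le>
     \<kappa> * (norm y + norm z + cmod p) * norm (y - z) + \<kappa> * cmod (p - q) * (norm z + cmod p + cmod q))"
    by (rule rhs_lipschitz[of \<alpha>]) blast
  from someI_ex[OF this, folded lip_def]
  show "lip > 0" "norm (rhs \<alpha> p y - rhs \<alpha> q z) \<le>
     lip * (norm y + norm z + cmod p) * norm (y - z) + lip * cmod (p - q) * (norm z + cmod p + cmod q)"
    by blast+
qed

definition forcing :: "(real \<Rightarrow> complex) \<Rightarrow> (real \<Rightarrow> complex) \<Rightarrow> (real \<Rightarrow> H2I) \<Rightarrow> real \<Rightarrow> L2I" where
  "forcing \<phi> \<phi>' y s = rhs \<alpha> (\<phi> s) (y s) + scaleC_L2 (\<phi>' s) (lift_L2 \<alpha>)"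

definition solves :: "(real \<Rightarrow> complex) \<Rightarrow> (real \<Rightarrow> complex) \<Rightarrow> (real \<Rightarrow> H2I) \<Rightarrow> bool" where
  "solves \<phi> \<phi>' y \<longleftrightarrow> continuous_on UNIV y \<and> mild (forcing \<phi> \<phi>' y) (\<lambda>t. emb (y t))"

definition source_bound :: "real \<Rightarrow> real \<Rightarrow> real" where
  "source_bound R \<epsilon> = lip * (R + \<epsilon>) * R + lip * \<epsilon> * \<epsilon> + norm (lift_L2 \<alpha>) * \<epsilon>"

text \<open>The first coefficient is small with \<open>R\<close> and \<open>\<epsilon>\<close>, which yields the contraction. The second term vanishes if the data agree.\<close>

lemma rhs_diff_le:
  assumes "norm y \<le> R" "norm z \<le> R" "cmod p \<le> \<epsilon>" "cmod q \<le> \<epsilon>" "cmod (p - q) \<le> \<delta>"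
  shows "norm (rhs \<alpha> p y - rhs \<alpha> q z) \<le> lip * (2 * R + \<epsilon>) * norm (y - z) + lip * \<delta> * (R + 2 * \<epsilon>)"
proof -
  have nn: "0 \<le> R" "0 \<le> \<epsilon>" "0 \<le> \<delta>" using assms norm_ge_zero order_trans by blast+
  have "lip * (norm y + norm z + cmod p) * norm (y - z) \<le> lip * (2 * R + \<epsilon>) * norm (y - z)"
    using assms lip(1) by (intro mult_right_mono mult_left_mono) auto
  moreover have "lip * cmod (p - q) * (norm z + cmod p + cmod q) \<le> lip * \<delta> * (R + 2 * \<epsilon>)"
    using assms lip(1) nn by (intro mult_mono mult_left_mono) auto
  ultimately show ?thesis using lip(2)[of p y q z] by linarith
qed

lemma forcing_continuous:
  assumes "boundary_data \<epsilon> \<phi> \<phi>'" "continuous_on UNIV y" shows "continuous_on UNIV (forcing \<phi> \<phi>' y)"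
  unfolding forcing_def[abs_def]
  using assms boundary_data_continuous[OF assms(1)]
  by (intro continuous_intros continuous_on_rhs bounded_bilinear.continuous_on[OF bounded_bilinear_scaleC_L2])
     (auto simp: boundary_data_def)

lemma forcing_bound:
  assumes D: "boundary_data \<epsilon> \<phi> \<phi>'" and R: "norm (y s) \<le> R"
  shows "norm (forcing \<phi> \<phi>' y s) \<le> source_bound R \<epsilon>"
proof -
  have b: "cmod (\<phi> s) \<le> \<epsilon>" "cmod (\<phi>' s) \<le> \<epsilon>" using D by (auto simp: boundary_data_def)
  have nn: "0 \<le> R" "0 \<le> \<epsilon>" using R b norm_ge_zero order_trans by blast+
  have "norm (rhs \<alpha> (\<phi> s) (y s)) \<le> lip * (norm (y s) + cmod (\<phi> s)) * norm (y s) + lip * cmod (\<phi> s) * cmod (\<phi> s)"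
    using lip(2)[of "\<phi> s" "y s" 0 0] by simp
  also have "\<dots> \<le> lip * (R + \<epsilon>) * R + lip * \<epsilon> * \<epsilon>"
    using lip(1) nn b R by (intro add_mono mult_mono) auto
  finally have "norm (rhs \<alpha> (\<phi> s) (y s)) \<le> lip * (R + \<epsilon>) * R + lip * \<epsilon> * \<epsilon>" .
  moreover have "norm (scaleC_L2 (\<phi>' s) (lift_L2 \<alpha>)) \<le> norm (lift_L2 \<alpha>) * \<epsilon>"
    using mult_left_mono[OF b(2) norm_ge_zero[of "lift_L2 \<alpha>"]] by (simp add: mult.commute)
  ultimately show ?thesis
    unfolding forcing_def source_bound_def
    using norm_triangle_ineq[of "rhs \<alpha> (\<phi> s) (y s)" "scaleC_L2 (\<phi>' s) (lift_L2 \<alpha>)"] by linarith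
qed

text \<open>The smoothing estimate turns an \<open>L\<^sup>2\<close> bound of the source into an \<open>H\<^sup>2\<close> bound of the response, so that the response map
  is a contraction on a ball of bounded continuous functions with values in \<open>H\<^sup>2\<close>.\<close>

lemma solution_exists:
  assumes D: "boundary_data \<epsilon> \<phi> \<phi>'" and R: "R \<ge> 0"
    and inv: "gain_const * source_bound R \<epsilon> \<le> R" and contr: "gain_const * lip * (2 * R + \<epsilon>) \<le> 1/2"
  obtains y where "solves \<phi> \<phi>' y" "\<And>t. norm (y t) \<le> R"
proof -
  define sol where "sol y = (SOME d. mild (forcing \<phi> \<phi>' y) d \<and> (\<exists>b. \<forall>t. norm (d t) \<le> b))" for y
  define \<Gamma> where "\<Gamma> f = Bcontfun (\<lambda>t. to_H2 (sol (apply_bcontfun f) t))" for f :: "real \<Rightarrow>\<^sub>C H2I"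
  have b\<phi>: "cmod (\<phi> s) \<le> \<epsilon>" for s using D by (simp add: boundary_data_def)
  have f: "norm (apply_bcontfun f t) \<le> R" if "f \<in> cball 0 R" for f :: "real \<Rightarrow>\<^sub>C H2I" and t
    using that norm_bounded[of f t] by simp
  have cf: "continuous_on UNIV (forcing \<phi> \<phi>' (apply_bcontfun f))" for f
    by (rule forcing_continuous[OF D]) (rule continuous_on_apply_bcontfun)
  have sol: "mild (forcing \<phi> \<phi>' (apply_bcontfun f)) (sol (apply_bcontfun f))" "\<exists>b. \<forall>t. norm (sol (apply_bcontfun f) t) \<le> b"
    if fR: "f \<in> cball 0 R" for f
  proof -
    obtain d where "mild (forcing \<phi> \<phi>' (apply_bcontfun f)) d" "\<And>t. norm (d t) \<le> source_bound R \<epsilon> * (amp / rate)"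
      by (rule mild_exists[OF cf forcing_bound[OF D f[OF fR]]]) blast
    then have "\<exists>d. mild (forcing \<phi> \<phi>' (apply_bcontfun f)) d \<and> (\<exists>b. \<forall>t. norm (d t) \<le> b)" by blast
    from someI_ex[OF this, folded sol_def]
    show "mild (forcing \<phi> \<phi>' (apply_bcontfun f)) (sol (apply_bcontfun f))" "\<exists>b. \<forall>t. norm (sol (apply_bcontfun f) t) \<le> b"
      by blast+
  qed
  have sol2: "sol (apply_bcontfun f) t \<in> sobolev 2" "norm (to_H2 (sol (apply_bcontfun f) t)) \<le> R"
    "continuous_on UNIV (\<lambda>t. to_H2 (sol (apply_bcontfun f) t))" if fR: "f \<in> cball 0 R" for f t
  proof -
    obtain b where b: "\<And>t. norm (sol (apply_bcontfun f) t) \<le> b" using sol(2)[OF fR] by blast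
    note m = cf forcing_bound[OF D f[OF fR]] sol(1)[OF fR] b
    show "sol (apply_bcontfun f) t \<in> sobolev 2" by (rule mild_H2_le(1)[OF m])
    show "norm (to_H2 (sol (apply_bcontfun f) t)) \<le> R" by (rule order_trans[OF mild_H2_le(2)[OF m] inv])
    show "continuous_on UNIV (\<lambda>t. to_H2 (sol (apply_bcontfun f) t))" by (rule mild_continuous_H2[OF m])
  qed
  have ap: "apply_bcontfun (\<Gamma> f) t = to_H2 (sol (apply_bcontfun f) t)" if "f \<in> cball 0 R" for f t
    unfolding \<Gamma>_def using Bcontfun_inverse[OF bcontfun_normI[OF sol2(3)[OF that] sol2(2)[OF that]]] by simp
  have "\<exists>!f\<in>cball 0 R. \<Gamma> f = f"
  proof (rule Banach_fix[where c = "1/2"])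
    show "complete (cball 0 R :: (real \<Rightarrow>\<^sub>C H2I) set)" by (simp add: complete_eq_closed)
    show "cball (0 :: real \<Rightarrow>\<^sub>C H2I) R \<noteq> {}" using R by simp
    show "\<Gamma> ` cball 0 R \<subseteq> cball 0 R"
    proof (rule image_subsetI)
      fix f assume f: "f \<in> cball (0 :: real \<Rightarrow>\<^sub>C H2I) R"
      have "norm (\<Gamma> f) \<le> R" by (rule norm_bound) (use ap[OF f] sol2(2)[OF f] in simp)
      then show "\<Gamma> f \<in> cball 0 R" by simp
    qed
    fix f g :: "real \<Rightarrow>\<^sub>C H2I" assume fg: "f \<in> cball (0 :: real \<Rightarrow>\<^sub>C H2I) R" "g \<in> cball 0 R"
    show "dist (\<Gamma> f) (\<Gamma> g) \<le> 1/2 * dist f g"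
    proof (rule dist_bound)
      fix t
      let ?F = "\<lambda>s. forcing \<phi> \<phi>' (apply_bcontfun f) s - forcing \<phi> \<phi>' (apply_bcontfun g) s"
      let ?d = "\<lambda>s. sol (apply_bcontfun f) s - sol (apply_bcontfun g) s"
      obtain b b' where b: "\<And>t. norm (sol (apply_bcontfun f) t) \<le> b" "\<And>t. norm (sol (apply_bcontfun g) t) \<le> b'"
        using sol(2)[OF fg(1)] sol(2)[OF fg(2)] by blast
      have F: "norm (?F s) \<le> lip * (2 * R + \<epsilon>) * dist f g" for s
      proof -
        have "norm (?F s) = norm (rhs \<alpha> (\<phi> s) (apply_bcontfun f s) - rhs \<alpha> (\<phi> s) (apply_bcontfun g s))"
          by (simp add: forcing_def)
        also have "\<dots> \<le> lip * (2 * R + \<epsilon>) * norm (apply_bcontfun f s - apply_bcontfun g s) + lip * 0 * (R + 2 * \<epsilon>)"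
          by (rule rhs_diff_le) (use f[OF fg(1)] f[OF fg(2)] b\<phi> in auto)
        also have "\<dots> \<le> lip * (2 * R + \<epsilon>) * dist f g + lip * 0 * (R + 2 * \<epsilon>)"
        proof -
          have "0 \<le> \<epsilon>" using b\<phi>[of 0] norm_ge_zero order_trans by blast
          then show ?thesis
            using lip(1) R dist_bounded[of f s g] by (intro add_mono mult_left_mono) (auto simp: dist_norm)
        qed
        finally show ?thesis by simp
      qed
      have "norm (?d t) \<le> b + b'" for t using norm_triangle_ineq4 b add_mono order_trans by meson
      then have "norm (to_H2 (?d t)) \<le> gain_const * (lip * (2 * R + \<epsilon>) * dist f g)"
        by (intro mild_H2_le(2)[OF _ F mild_diff[OF sol(1)[OF fg(1)] sol(1)[OF fg(2)]]] continuous_on_diff cf)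
      also have "\<dots> = (gain_const * lip * (2 * R + \<epsilon>)) * dist f g" by simp
      also have "\<dots> \<le> 1/2 * dist f g" by (rule mult_right_mono[OF contr]) simp
      also have "to_H2 (?d t) = apply_bcontfun (\<Gamma> f) t - apply_bcontfun (\<Gamma> g) t"
        unfolding ap[OF fg(1)] ap[OF fg(2)] to_H2_emb_diff[OF sol2(1)[OF fg(1)] sol2(1)[OF fg(2)], symmetric]
        by (rule emb_inverse)
      finally show "dist (apply_bcontfun (\<Gamma> f) t) (apply_bcontfun (\<Gamma> g) t) \<le> 1/2 * dist f g"
        by (simp add: dist_norm)
    qed
  qed auto
  then obtain f where ff: "f \<in> cball 0 R" "\<Gamma> f = f" by blast
  have "emb (apply_bcontfun f t) = sol (apply_bcontfun f) t" for t
    using ap[OF ff(1), of t] sol2(1)[OF ff(1), of t] by (simp add: ff(2) emb_to_H2)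
  then have "solves \<phi> \<phi>' (apply_bcontfun f)"
    using sol(1)[OF ff(1)] continuous_on_apply_bcontfun[of UNIV f] by (simp add: solves_def)
  then show thesis by (rule that) (rule f[OF ff(1)])
qed

text \<open>The difference of two solutions is the response to the difference of the nonlinearities, which the contraction absorbs, plus the
  response to \<open>(\<phi>' - \<psi>') A\<close>. The latter enters through its size \<open>\<eta>\<close> and not through the size of \<open>\<phi>' - \<psi>'\<close>.\<close>

lemma solution_perturbation:
  assumes D: "boundary_data \<epsilon> \<phi> \<phi>'" "boundary_data \<epsilon> \<psi> \<psi>'"
    and y: "solves \<phi> \<phi>' y" "\<And>t. norm (y t) \<le> R" and z: "solves \<psi> \<psi>' z" "\<And>t. norm (z t) \<le> R"
    and contr: "gain_const * lip * (2 * R + \<epsilon>) \<le> 1/2"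
    and \<delta>: "\<And>t. cmod (\<phi> t - \<psi> t) \<le> \<delta>"
    and osc: "\<And>d D t. mild (\<lambda>s. scaleC_L2 (\<phi>' s - \<psi>' s) (lift_L2 \<alpha>)) d \<Longrightarrow> (\<And>t. norm (d t) \<le> D) \<Longrightarrow>
        norm (to_H2 (d t)) \<le> \<eta>"
  shows "norm (y t - z t) \<le> 2 * (gain_const * lip * \<delta> * (R + 2 * \<epsilon>) + \<eta>)"
proof -
  have b: "cmod (\<phi> s) \<le> \<epsilon>" "cmod (\<psi> s) \<le> \<epsilon>" for s using D by (auto simp: boundary_data_def)
  have nn: "0 \<le> \<epsilon>" "0 \<le> R" using b(1)[of 0] y(2)[of 0] norm_ge_zero order_trans by blast+
  define K where "K = gain_const * lip * \<delta> * (R + 2 * \<epsilon>) + \<eta>"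
  define W where "W = (SUP t. norm (y t - z t))"
  have yz: "norm (y t - z t) \<le> R + R" for t
    using norm_triangle_ineq4[of "y t" "z t"] y(2)[of t] z(2)[of t] by linarith
  have bd: "bdd_above (range (\<lambda>t. norm (y t - z t)))" using yz by (intro bdd_aboveI2)
  have W: "norm (y t - z t) \<le> W" for t unfolding W_def by (rule cSUP_upper[OF UNIV_I bd])
  define F where "F s = rhs \<alpha> (\<phi> s) (y s) - rhs \<alpha> (\<psi> s) (z s)" for s
  have cF: "continuous_on UNIV F"
    unfolding F_def[abs_def] using y(1) z(1) boundary_data_continuous[OF D(1)] boundary_data_continuous[OF D(2)]
    by (intro continuous_on_diff continuous_on_rhs) (auto simp: solves_def)
  have FB: "norm (F s) \<le> lip * (2 * R + \<epsilon>) * W + lip * \<delta> * (R + 2 * \<epsilon>)" for s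
  proof -
    have "norm (F s) \<le> lip * (2 * R + \<epsilon>) * norm (y s - z s) + lip * \<delta> * (R + 2 * \<epsilon>)"
      unfolding F_def by (rule rhs_diff_le[OF y(2) z(2) b \<delta>])
    also have "\<dots> \<le> lip * (2 * R + \<epsilon>) * W + lip * \<delta> * (R + 2 * \<epsilon>)"
      using lip(1) nn by (intro add_right_mono mult_left_mono W) auto
    finally show ?thesis .
  qed
  obtain d where d: "mild F d" "\<And>t. norm (d t) \<le> (lip * (2 * R + \<epsilon>) * W + lip * \<delta> * (R + 2 * \<epsilon>)) * (amp / rate)"
    by (rule mild_exists[OF cF FB]) blast
  let ?B = "(lip * (2 * R + \<epsilon>) * W + lip * \<delta> * (R + 2 * \<epsilon>)) * (amp / rate)"
  note dH = mild_H2_le[OF cF FB d]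
  define r where "r t = emb (y t - z t) - d t" for t
  have "mild (\<lambda>s. (forcing \<phi> \<phi>' y s - forcing \<psi> \<psi>' z s) - F s) (\<lambda>t. (emb (y t) - emb (z t)) - d t)"
    using y(1) z(1) by (intro mild_diff d(1)) (auto simp: solves_def)
  then have "mild (\<lambda>s. scaleC_L2 (\<phi>' s - \<psi>' s) (lift_L2 \<alpha>)) r"
    by (simp add: r_def[abs_def] forcing_def F_def emb_minus algebra_simps
        bounded_bilinear.diff_left[OF bounded_bilinear_scaleC_L2])
  moreover have "norm (r t) \<le> (R + R) + ?B" for t
    unfolding r_def using norm_triangle_ineq4[of "emb (y t - z t)" "d t"] norm_emb_le[of "y t - z t"] yz[of t] d(2)[of t] by linarith
  ultimately have rH: "norm (to_H2 (r t)) \<le> \<eta>" for t by (rule osc)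
  have "norm (y t - z t) \<le> W / 2 + K" for t
  proof -
    have "to_H2 (r t) = (y t - z t) - to_H2 (d t)"
      unfolding r_def using to_H2_emb_diff[OF emb_in_sobolev dH(1), of "y t - z t" t, symmetric] by (simp add: emb_inverse)
    then have "norm (y t - z t) \<le> norm (to_H2 (r t)) + norm (to_H2 (d t))"
      using norm_triangle_ineq[of "to_H2 (r t)" "to_H2 (d t)"] by simp
    also have "\<dots> \<le> \<eta> + gain_const * (lip * (2 * R + \<epsilon>) * W + lip * \<delta> * (R + 2 * \<epsilon>))"
      by (rule add_mono[OF rH dH(2)])
    also have "\<dots> = (gain_const * lip * (2 * R + \<epsilon>)) * W + K" by (simp add: K_def algebra_simps)
    also have "\<dots> \<le> 1/2 * W + K"
      using contr order_trans[OF norm_ge_zero W] by (intro add_mono mult_right_mono) auto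
    finally show ?thesis by simp
  qed
  then have "W \<le> W / 2 + K" unfolding W_def by (intro cSUP_least) auto
  then show ?thesis using W[of t] by (simp add: K_def)
qed

lemma solution_unique:
  assumes D: "boundary_data \<epsilon> \<phi> \<phi>'"
    and y: "solves \<phi> \<phi>' y" "\<And>t. norm (y t) \<le> R" and z: "solves \<phi> \<phi>' z" "\<And>t. norm (z t) \<le> R"
    and contr: "gain_const * lip * (2 * R + \<epsilon>) \<le> 1/2"
  shows "y = z"
proof
  fix t
  have "norm (y t - z t) \<le> 2 * (gain_const * lip * 0 * (R + 2 * \<epsilon>) + 0)"
  proof (rule solution_perturbation[OF D D y z contr])
    fix d D t assume d: "mild (\<lambda>s. scaleC_L2 (\<phi>' s - \<phi>' s) (lift_L2 \<alpha>)) d" "\<And>t. norm (d t) \<le> D"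
    have "norm (to_H2 (d t)) \<le> gain_const * 0"
      by (rule mild_H2_le(2)[OF _ _ d]) (simp_all add: bounded_bilinear.zero_left[OF bounded_bilinear_scaleC_L2])
    then show "norm (to_H2 (d t)) \<le> 0" by simp
  qed simp
  then show "y t = z t" by simp
qed

lemma mild_shift:
  assumes "mild F d" shows "mild (\<lambda>s. F (s + h)) (\<lambda>s. d (s + h))"
  unfolding mild_def
proof (intro allI impI)
  fix r t :: real assume "r \<le> t"
  then have "((\<lambda>s. S (t + h - s) (F s)) has_integral (d (t + h) - S (t + h - (r + h)) (d (r + h)))) (cbox (r + h) (t + h))"
    using assms unfolding mild_def cbox_interval by (meson add_right_mono)
  from has_integral_affinity[OF this, of 1 h]
  have "((\<lambda>s. S (t + h - (s + h)) (F (s + h))) has_integral (d (t + h) - S (t + h - (r + h)) (d (r + h)))) ((\<lambda>s. s - h) ` {r + h..t + h})"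
    by simp
  moreover have "(\<lambda>s. s - h) ` {r + h..t + h} = {r..t}" by (simp add: image_diff_atLeastAtMost[of h])
  ultimately show "((\<lambda>s. S (t - s) (F (s + h))) has_integral (d (t + h) - S (t - r) (d (r + h)))) {r..t}"
    by simp
qed

lemma mild_cnj:
  assumes "mild F d" shows "mild (\<lambda>s. cnj_L2 (F s)) (\<lambda>s. cnj_L2 (d s))"
  unfolding mild_def
proof (intro allI impI)
  interpret cnj: bounded_linear cnj_L2 by (rule bounded_linear_cnj_L2)
  fix r t :: real assume rt: "r \<le> t"
  have "((\<lambda>s. S (t - s) (F s)) has_integral (d t - S (t - r) (d r))) {r..t}" using assms rt by (simp add: mild_def)
  from has_integral_linear[OF this bounded_linear_cnj_L2]
  have "((\<lambda>s. S (t - s) (cnj_L2 (F s))) has_integral cnj_L2 (d t - S (t - r) (d r))) {r..t}"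
    by (rule has_integral_eq[rotated]) (simp add: S_cnj)
  then show "((\<lambda>s. S (t - s) (cnj_L2 (F s))) has_integral (cnj_L2 (d t) - S (t - r) (cnj_L2 (d r)))) {r..t}"
    using rt by (simp add: cnj.diff S_cnj)
qed

lemma solves_shift:
  assumes "solves \<phi> \<phi>' y" shows "solves (\<lambda>s. \<phi> (s + h)) (\<lambda>s. \<phi>' (s + h)) (\<lambda>s. y (s + h))"
proof -
  have "continuous_on UNIV (\<lambda>s. y (s + h))"
    using assms by (intro continuous_on_compose2[of UNIV y UNIV "\<lambda>s. s + h"] continuous_intros) (auto simp: solves_def)
  moreover have "mild (\<lambda>s. forcing \<phi> \<phi>' y (s + h)) (\<lambda>t. emb (y (t + h)))"
    using assms by (intro mild_shift) (simp add: solves_def)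
  ultimately show ?thesis by (simp add: solves_def forcing_def[abs_def])
qed

lemma solves_cnj:
  assumes "solves \<phi> \<phi>' y" shows "solves (\<lambda>s. cnj (\<phi> s)) (\<lambda>s. cnj (\<phi>' s)) (\<lambda>s. cnj_H2 (y s))"
proof -
  have "continuous_on UNIV (\<lambda>s. cnj_H2 (y s))"
    using assms by (intro bounded_linear.continuous_on[OF bounded_linear_cnj_H2]) (simp add: solves_def)
  moreover have "mild (\<lambda>s. cnj_L2 (forcing \<phi> \<phi>' y s)) (\<lambda>t. cnj_L2 (emb (y t)))"
    using assms by (intro mild_cnj) (simp add: solves_def)
  moreover have "cnj_L2 (forcing \<phi> \<phi>' y s) = forcing (\<lambda>s. cnj (\<phi> s)) (\<lambda>s. cnj (\<phi>' s)) (\<lambda>s. cnj_H2 (y s)) s" for s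
    by (simp add: forcing_def rhs_cnj cnj_scaleC_L2 cnj_lift_L2 linear_add[OF bounded_linear.linear[OF bounded_linear_cnj_L2]])
  ultimately show ?thesis by (simp add: solves_def emb_cnj)
qed

text \<open>If \<open>h\<close> is an almost-period of \<open>\<phi>\<close>, then \<open>\<phi>(t + h) - \<phi>(t)\<close> is uniformly small while its derivative is bounded by
  \<open>2 \<epsilon>\<close>. So \<open>oscillation_small\<close> provides the \<open>\<eta>\<close> in the comparison of the solution with its translate.\<close>

lemma recurrent_solution:
  assumes D: "boundary_data \<epsilon> \<phi> \<phi>'" and y: "solves \<phi> \<phi>' y" "\<And>t. norm (y t) \<le> R"
    and contr: "gain_const * lip * (2 * R + \<epsilon>) \<le> 1/2"
    and rec: "recurrent k \<omega> \<phi>"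
  shows "recurrent k \<omega> y"
  unfolding recurrent_def
proof (intro allI impI)
  fix e :: real assume e: "0 < e"
  have \<epsilon>: "0 \<le> \<epsilon>" and R: "0 \<le> R"
    using D y(2)[of 0] norm_ge_zero[of "\<phi> 0"] norm_ge_zero[of "y 0"] order_trans unfolding boundary_data_def by blast+
  define K where "K = gain_const * lip * (R + 2 * \<epsilon>)"
  have K: "K \<ge> 0" using gain_const_pos lip(1) \<epsilon> R by (simp add: K_def)
  have e4: "e / 4 > 0" "2 * \<epsilon> \<ge> 0" using e \<epsilon> by auto
  obtain \<delta>0 where \<delta>0: "\<delta>0 > 0" "\<And>\<zeta> \<zeta>' d D t. (\<And>s. (\<zeta> has_vector_derivative \<zeta>' s) (at s)) \<Longrightarrow> continuous_on UNIV \<zeta>' \<Longrightarrow>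
      (\<And>s. cmod (\<zeta> s) \<le> \<delta>0) \<Longrightarrow> (\<And>s. cmod (\<zeta>' s) \<le> 2 * \<epsilon>) \<Longrightarrow>
      mild (\<lambda>s. scaleC_L2 (\<zeta>' s) (lift_L2 \<alpha>)) d \<Longrightarrow> (\<And>t. norm (d t) \<le> D) \<Longrightarrow> norm (to_H2 (d t)) \<le> e / 4"
    by (rule oscillation_small[OF e4, of "lift_L2 \<alpha>"]) blast
  define \<delta>1 where "\<delta>1 = min \<delta>0 (e / (4 * (K + 1)))"
  have \<delta>1: "\<delta>1 > 0" "\<delta>1 \<le> \<delta>0" "\<delta>1 \<le> e / (4 * (K + 1))" using \<delta>0(1) e K by (auto simp: \<delta>1_def)
  have K\<delta>: "K * \<delta>1 \<le> e / 4"
  proof -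
    have "K * \<delta>1 \<le> (K + 1) * \<delta>1" using \<delta>1(1) by simp
    also have "\<dots> \<le> (K + 1) * (e / (4 * (K + 1)))" by (rule mult_left_mono[OF \<delta>1(3)]) (use K in simp)
    also have "\<dots> = e / 4"
    proof -
      have "K + 1 \<noteq> 0" using K by simp
      moreover have "x * (e / (4 * x)) = e / 4" if "x \<noteq> 0" for x :: real using that by simp
      ultimately show ?thesis by blast
    qed
    finally show ?thesis .
  qed
  obtain \<delta> where \<delta>: "\<delta> > 0" "\<And>h t. near_period k \<omega> \<delta> h \<Longrightarrow> norm (\<phi> (t + h) - \<phi> t) \<le> \<delta>1"
    using rec \<delta>1(1) unfolding recurrent_def by meson
  have "norm (y (t + h) - y t) \<le> e" if h: "near_period k \<omega> \<delta> h" for h t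
  proof -
    have small: "cmod (\<phi> (s + h) - \<phi> s) \<le> \<delta>1" for s by (rule \<delta>(2)[OF h])
    have "norm (y (t + h) - y t) \<le> 2 * (gain_const * lip * \<delta>1 * (R + 2 * \<epsilon>) + e / 4)"
    proof (rule solution_perturbation[OF boundary_data_shift[OF D] D solves_shift[OF y(1)] y(2) y contr small])
      fix d B t
      assume d: "mild (\<lambda>s. scaleC_L2 (\<phi>' (s + h) - \<phi>' s) (lift_L2 \<alpha>)) d" "\<And>t. norm (d t) \<le> B"
      show "norm (to_H2 (d t)) \<le> e / 4"
      proof (rule \<delta>0(2)[OF _ _ _ _ d])
        show "((\<lambda>s. \<phi> (s + h) - \<phi> s) has_vector_derivative \<phi>' (s + h) - \<phi>' s) (at s)" for s
          using D boundary_data_shift[OF D, of h] by (intro has_vector_derivative_diff) (auto simp: boundary_data_def)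
        show "continuous_on UNIV (\<lambda>s. \<phi>' (s + h) - \<phi>' s)"
          using D boundary_data_shift[OF D, of h] by (intro continuous_on_diff) (auto simp: boundary_data_def)
        show "cmod (\<phi> (s + h) - \<phi> s) \<le> \<delta>0" for s using small[of s] \<delta>1(2) by linarith
        have b: "cmod (\<phi>' s) \<le> \<epsilon>" for s using D by (simp add: boundary_data_def)
        show "cmod (\<phi>' (s + h) - \<phi>' s) \<le> 2 * \<epsilon>" for s
          using norm_triangle_ineq4[of "\<phi>' (s + h)" "\<phi>' s"] b[of s] b[of "s + h"] by linarith
      qed
    qed
    also have "\<dots> = 2 * (K * \<delta>1 + e / 4)" by (simp add: K_def mult_ac)
    finally show ?thesis using K\<delta> by simp
  qed
  then show "\<exists>\<delta>>0. \<forall>h. near_period k \<omega> \<delta> h \<longrightarrow> (\<forall>t. norm (y (t + h) - y t) \<le> e)" using \<delta>(1) by blast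
qed

text \<open>Conjugation commutes with the semigroup and with the nonlinearity, so the conjugate is a solution for the same data in the same ball.\<close>

lemma real_solution:
  assumes D: "boundary_data \<epsilon> \<phi> \<phi>'" and y: "solves \<phi> \<phi>' y" "\<And>t. norm (y t) \<le> R"
    and contr: "gain_const * lip * (2 * R + \<epsilon>) \<le> 1/2"
    and real: "\<And>t. cnj (\<phi> t) = \<phi> t"
  shows "cnj_H2 (y t) = y t"
proof -
  have "cnj (\<phi>' s) = \<phi>' s" for s
  proof -
    have "((\<lambda>s. cnj (\<phi> s)) has_vector_derivative cnj (\<phi>' s)) (at s)"
      using D by (intro bounded_linear.has_vector_derivative[OF bounded_linear_cnj]) (simp add: boundary_data_def)
    then have "(\<phi> has_vector_derivative cnj (\<phi>' s)) (at s)" by (simp add: real)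
    moreover have "(\<phi> has_vector_derivative \<phi>' s) (at s)" using D by (simp add: boundary_data_def)
    ultimately show ?thesis by (rule vector_derivative_unique_at)
  qed
  then have "solves \<phi> \<phi>' (\<lambda>s. cnj_H2 (y s))" using solves_cnj[OF y(1)] by (simp add: real)
  then have "(\<lambda>s. cnj_H2 (y s)) = y"
    by (rule solution_unique[OF D _ _ y contr]) (simp add: norm_cnj_H2 y(2))
  then show ?thesis by (rule fun_cong)
qed

end

section \<open>Return to the original unknown\<close>

lemma in_X_obtain:
  assumes "in_X u"
  obtains U where "u = (\<lambda>t. emb (U t))" "continuous_on UNIV U" "bdd_above (range (\<lambda>t. norm (U t)))"
    "norm_X u = (SUP t. norm (U t))"
proof
  define U where "U t = to_H2 (u t)" for t
  have eU: "emb (U t) = u t" for t using assms by (simp add: U_def in_X_def emb_to_H2)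
  show "u = (\<lambda>t. emb (U t))" by (simp add: eU)
  have n: "norm (U t) = sobolev_norm 2 (u t)" for t by (simp add: norm_H2I_def eU)
  show "bdd_above (range (\<lambda>t. norm (U t)))" using assms by (simp add: n in_X_def)
  show "norm_X u = (SUP t. norm (U t))" by (simp add: n norm_X_def)
  have "((\<lambda>s. norm (U s - U t)) \<longlongrightarrow> 0) (at t)" for t
    using assms by (simp add: in_X_def norm_H2I_def emb_minus eU)
  then have "(U \<longlongrightarrow> U t) (at t)" for t by (simp add: tendsto_norm_zero_iff LIM_zero_iff)
  then show "continuous_on UNIV U" by (simp add: continuous_on_def)
qed

lemma in_X_emb:
  assumes "continuous_on UNIV U" "bdd_above (range (\<lambda>t. norm (U t)))" shows "in_X (\<lambda>t. emb (U t))"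
proof -
  have "((\<lambda>s. norm (U s - U t)) \<longlongrightarrow> 0) (at t)" for t
    using assms(1) by (simp add: continuous_on_def tendsto_norm_zero_iff LIM_zero_iff)
  then show ?thesis using assms(2) by (simp add: in_X_def norm_H2I_def emb_minus)
qed

lemma norm_X_emb: "norm_X (\<lambda>t. emb (U t)) = (SUP t. norm (U t))"
  by (simp add: norm_X_def norm_H2I_def)

lemma shifted_emb: "shifted \<alpha> \<phi> (\<lambda>t. emb (U t)) t = emb (U t + scaleC_H2 (\<phi> t) (lift_H2 \<alpha>))"
proof -
  have "abs_L2 (\<lambda>x. of_real (lift_A \<alpha> x) * \<phi> t) = scaleC_L2 (\<phi> t) (lift_L2 \<alpha>)"
  proof (rule abs_L2_eq_rep)
    show "(\<lambda>x. complex_of_real (lift_A \<alpha> x) * \<phi> t) \<in> borel_measurable lebI"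
      using lift_multiplier(1)[of \<alpha>] by (intro borel_measurable_times) (auto simp: bounded_multiplier_def)
    show "AE x in lebI. rep_L2 (scaleC_L2 (\<phi> t) (lift_L2 \<alpha>)) x = of_real (lift_A \<alpha> x) * \<phi> t"
      using rep_scaleC[of "\<phi> t" "lift_L2 \<alpha>"] rep_lift_L2(1)[of \<alpha>] by eventually_elim (simp add: mult.commute)
  qed
  then show ?thesis by (simp add: shifted_def emb_plus emb_scaleC emb_lift)
qed

lemma C1_norm_boundary_data:
  assumes C1: "\<phi> C1_differentiable_on UNIV" and n: "C1_norm \<phi> \<le> ennreal \<epsilon>" and \<epsilon>: "\<epsilon> > 0"
  shows "boundary_data \<epsilon> \<phi> (\<lambda>t. vector_derivative \<phi> (at t))"
proof -
  obtain D where D: "\<And>x. (\<phi> has_vector_derivative D x) (at x)" "continuous_on UNIV D"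
    using C1 unfolding C1_differentiable_on_def by blast
  have eq: "(\<lambda>t. vector_derivative \<phi> (at t)) = D" using vector_derivative_at[OF D(1)] by blast
  have "ennreal (cmod (\<phi> t)) \<le> ennreal \<epsilon>" "ennreal (cmod (vector_derivative \<phi> (at t))) \<le> ennreal \<epsilon>" for t
  proof -
    have "ennreal (cmod (\<phi> t)) \<le> (SUP t. ennreal (cmod (\<phi> t)))" by (rule SUP_upper) simp
    also have "\<dots> \<le> C1_norm \<phi>" by (simp add: C1_norm_def)
    finally show "ennreal (cmod (\<phi> t)) \<le> ennreal \<epsilon>" using n by (rule order_trans)
    have "ennreal (cmod (vector_derivative \<phi> (at t))) \<le> (SUP t. ennreal (cmod (vector_derivative \<phi> (at t))))"
      by (rule SUP_upper) simp
    also have "\<dots> \<le> C1_norm \<phi>" by (simp add: C1_norm_def)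
    finally show "ennreal (cmod (vector_derivative \<phi> (at t))) \<le> ennreal \<epsilon>" using n by (rule order_trans)
  qed
  then have "cmod (\<phi> t) \<le> \<epsilon>" "cmod (D t) \<le> \<epsilon>" for t
    using \<epsilon> by (simp_all add: eq[symmetric])
  then show ?thesis using D by (simp add: boundary_data_def eq)
qed

context kawahara_semigroup
begin

lemma mild_solution_iff:
  assumes U: "continuous_on UNIV U" "bdd_above (range (\<lambda>t. norm (U t)))" and \<phi>: "continuous_on UNIV \<phi>"
  shows "mild_solution S \<alpha> \<phi> (\<lambda>t. emb (U t)) \<longleftrightarrow>
    solves \<phi> (\<lambda>t. vector_derivative \<phi> (at t)) (\<lambda>t. U t + scaleC_H2 (\<phi> t) (lift_H2 \<alpha>))"
proof -
  have c: "continuous_on UNIV (\<lambda>t. U t + scaleC_H2 (\<phi> t) (lift_H2 \<alpha>))"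
    by (intro continuous_on_add U bounded_bilinear.continuous_on[OF bounded_bilinear_scaleC_H2] \<phi> continuous_on_const)
  have s: "shifted \<alpha> \<phi> (\<lambda>t. emb (U t)) = (\<lambda>t. emb (U t + scaleC_H2 (\<phi> t) (lift_H2 \<alpha>)))"
    by (rule ext) (rule shifted_emb)
  show ?thesis
    unfolding mild_solution_def solves_def mild_def Let_def s forcing_def nonlin_eq
    using in_X_emb[OF U] c by blast
qed

text \<open>This passes from \<open>y\<close> back to \<open>u\<close>.\<close>

lemma recurrent_lift:
  assumes "recurrent k \<omega> y" "recurrent k \<omega> \<phi>"
  shows "recurrent k \<omega> (\<lambda>t. y t - scaleC_H2 (\<phi> t) v)"
  unfolding recurrent_def
proof (intro allI impI)
  interpret bounded_bilinear scaleC_H2 by (rule bounded_bilinear_scaleC_H2)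
  fix e :: real assume e: "0 < e"
  define m where "m = 2 * (norm v + 1)"
  have m: "m > 0" by (simp add: m_def add_nonneg_pos)
  obtain \<delta>1 where \<delta>1: "\<delta>1 > 0" "\<And>h t. near_period k \<omega> \<delta>1 h \<Longrightarrow> norm (y (t + h) - y t) \<le> e / 2"
    using assms(1) e unfolding recurrent_def by (meson half_gt_zero)
  obtain \<delta>2 where \<delta>2: "\<delta>2 > 0" "\<And>h t. near_period k \<omega> \<delta>2 h \<Longrightarrow> norm (\<phi> (t + h) - \<phi> t) \<le> e / m"
    using assms(2) e m unfolding recurrent_def by (meson divide_pos_pos)
  have "norm ((y (t + h) - scaleC_H2 (\<phi> (t + h)) v) - (y t - scaleC_H2 (\<phi> t) v)) \<le> e"
    if "near_period k \<omega> (min \<delta>1 \<delta>2) h" for h t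
  proof -
    have h: "near_period k \<omega> \<delta>1 h" "near_period k \<omega> \<delta>2 h" using that unfolding near_period_def by (meson min_less_iff_conj)+
    have "(y (t + h) - scaleC_H2 (\<phi> (t + h)) v) - (y t - scaleC_H2 (\<phi> t) v) = (y (t + h) - y t) - scaleC_H2 (\<phi> (t + h) - \<phi> t) v"
      by (simp add: diff_left)
    also have "norm \<dots> \<le> norm (y (t + h) - y t) + cmod (\<phi> (t + h) - \<phi> t) * norm v"
      by (rule order_trans[OF norm_triangle_ineq4]) (simp add: norm_scaleC_H2)
    also have "\<dots> \<le> e / 2 + e / m * (norm v + 1)"
      using e m by (intro add_mono mult_mono \<delta>1(2) \<delta>2(2) h) auto
    also have "e / m * (norm v + 1) = e / 2"
    proof -
      have "norm v + 1 \<noteq> 0" using norm_ge_zero[of v] by linarith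
      moreover have "e / (2 * x) * x = e / 2" if "x \<noteq> 0" for x :: real using that by simp
      ultimately show ?thesis unfolding m_def by blast
    qed
    finally show ?thesis by simp
  qed
  then show "\<exists>\<delta>>0. \<forall>h. near_period k \<omega> \<delta> h \<longrightarrow>
      (\<forall>t. norm ((y (t + h) - scaleC_H2 (\<phi> (t + h)) v) - (y t - scaleC_H2 (\<phi> t) v)) \<le> e)"
    using \<delta>1(1) \<delta>2(1) by (intro exI[of _ "min \<delta>1 \<delta>2"]) auto
qed

text \<open>For a radius proportional to \<open>\<epsilon>\<close> the smallness conditions of \<open>solution_exists\<close> and \<open>solution_perturbation\<close> become linear in
  \<open>\<epsilon>\<close>, so they hold below a threshold while the factor \<open>C\<close> stays fixed.\<close>

theorem quasi_periodic_response:
  obtains C \<epsilon>\<^sub>0 where "C > 0" "\<epsilon>\<^sub>0 > 0"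
    "\<And>\<epsilon> \<phi>. 0 < \<epsilon> \<Longrightarrow> \<epsilon> \<le> \<epsilon>\<^sub>0 \<Longrightarrow> \<phi> C1_differentiable_on UNIV \<Longrightarrow> C1_norm \<phi> \<le> ennreal \<epsilon> \<Longrightarrow>
      \<exists>!u. mild_solution S \<alpha> \<phi> u \<and> norm_X u \<le> C * \<epsilon>"
    "\<And>\<epsilon> \<phi> u k \<omega>. 0 < \<epsilon> \<Longrightarrow> \<epsilon> \<le> \<epsilon>\<^sub>0 \<Longrightarrow> \<phi> C1_differentiable_on UNIV \<Longrightarrow> C1_norm \<phi> \<le> ennreal \<epsilon> \<Longrightarrow>
      mild_solution S \<alpha> \<phi> u \<Longrightarrow> norm_X u \<le> C * \<epsilon> \<Longrightarrow> frequency_vector k \<omega> \<Longrightarrow> qp_data k \<omega> \<phi> \<Longrightarrow> qp_solution k \<omega> u"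
proof -
  let ?A = "lift_H2 \<alpha>"
  \<comment> \<open>Existence takes place in the ball of radius \<open>\<rho>1 * \<epsilon>\<close> for \<open>y\<close>. Since \<open>u\<close> and \<open>y\<close> differ by at most
    \<open>n * \<epsilon>\<close>, the solution \<open>u\<close> obeys the bound \<open>C * \<epsilon>\<close>, and any competitor with this bound has its \<open>y\<close> in the ball of
    radius \<open>\<rho>2 * \<epsilon>\<close>, where uniqueness has to hold.\<close>
  define J where "J = gain_const"
  define n where "n = norm ?A"
  define c0 where "c0 = norm (lift_L2 \<alpha>)"
  define \<rho>1 where "\<rho>1 = J * (1 + c0)"
  define C where "C = \<rho>1 + n"
  define \<rho>2 where "\<rho>2 = C + n"
  define E1 where "E1 = 1 / (lip * ((\<rho>1 + 1) * \<rho>1 + 1))"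
  define E2 where "E2 = 1 / (2 * (J * lip * (2 * \<rho>2 + 1)))"
  have J: "J > 0" using gain_const_pos by (simp add: J_def)
  have nn: "n \<ge> 0" "c0 \<ge> 0" by (simp_all add: n_def c0_def)
  have \<rho>1: "\<rho>1 > 0" using J nn by (simp add: \<rho>1_def add_pos_nonneg)
  have C: "C > 0" using \<rho>1 nn by (simp add: C_def)
  have \<rho>2: "\<rho>2 > 0" "\<rho>1 \<le> \<rho>2" using C nn by (simp_all add: \<rho>2_def C_def)
  have q1: "lip * ((\<rho>1 + 1) * \<rho>1 + 1) > 0" using lip(1) \<rho>1 by (intro mult_pos_pos add_pos_pos) auto
  have q2: "J * lip * (2 * \<rho>2 + 1) > 0" using lip(1) \<rho>2 J by (intro mult_pos_pos add_pos_pos) auto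
  have E: "E1 > 0" "E2 > 0" using q1 q2 by (simp_all add: E1_def E2_def)
  have main: "\<exists>!u. mild_solution S \<alpha> \<phi> u \<and> norm_X u \<le> C * \<epsilon>"
    "\<And>u k \<omega>. mild_solution S \<alpha> \<phi> u \<Longrightarrow> norm_X u \<le> C * \<epsilon> \<Longrightarrow> frequency_vector k \<omega> \<Longrightarrow> qp_data k \<omega> \<phi> \<Longrightarrow> qp_solution k \<omega> u"
    if \<epsilon>: "0 < \<epsilon>" "\<epsilon> \<le> min E1 E2" and C1: "\<phi> C1_differentiable_on UNIV" "C1_norm \<phi> \<le> ennreal \<epsilon>" for \<epsilon> \<phi>
  proof -
    define \<phi>' where "\<phi>' t = vector_derivative \<phi> (at t)" for t
    have D: "boundary_data \<epsilon> \<phi> \<phi>'"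
      using C1_norm_boundary_data[OF C1 \<epsilon>(1)] by (simp add: \<phi>'_def[abs_def])
    note c\<phi> = boundary_data_continuous[OF D]
    have lift: "norm (scaleC_H2 (\<phi> t) ?A) \<le> n * \<epsilon>" for t
      using D mult_left_mono[OF _ nn(1), of "cmod (\<phi> t)" \<epsilon>] by (simp add: boundary_data_def norm_scaleC_H2 n_def mult.commute)
    have inv: "J * source_bound (\<rho>1 * \<epsilon>) \<epsilon> \<le> \<rho>1 * \<epsilon>"
    proof -
      have "source_bound (\<rho>1 * \<epsilon>) \<epsilon> = \<epsilon> * (lip * ((\<rho>1 + 1) * \<rho>1 + 1) * \<epsilon> + c0)"
        by (simp add: source_bound_def c0_def algebra_simps)
      also have "\<dots> \<le> \<epsilon> * (1 + c0)"
        using \<epsilon> pos_le_divide_eq[OF q1, of \<epsilon> 1] by (intro mult_left_mono) (auto simp: E1_def mult.commute)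
      finally have "J * source_bound (\<rho>1 * \<epsilon>) \<epsilon> \<le> J * (\<epsilon> * (1 + c0))" using J by (intro mult_left_mono) auto
      then show ?thesis by (simp add: \<rho>1_def mult_ac)
    qed
    have contr2: "J * lip * (2 * (\<rho>2 * \<epsilon>) + \<epsilon>) \<le> 1/2"
    proof -
      have "\<epsilon> * (2 * (J * lip * (2 * \<rho>2 + 1))) \<le> 1"
        using \<epsilon>(2) q2 pos_le_divide_eq[of "2 * (J * lip * (2 * \<rho>2 + 1))" \<epsilon> 1] by (simp add: E2_def)
      then show ?thesis by (simp add: algebra_simps)
    qed
    have contr1: "J * lip * (2 * (\<rho>1 * \<epsilon>) + \<epsilon>) \<le> 1/2"
    proof -
      have "J * lip * (2 * (\<rho>1 * \<epsilon>) + \<epsilon>) \<le> J * lip * (2 * (\<rho>2 * \<epsilon>) + \<epsilon>)"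
        using \<rho>2(2) J lip(1) \<epsilon>(1) by (intro mult_left_mono add_mono mult_right_mono) auto
      then show ?thesis using contr2 by linarith
    qed
    have char: "\<exists>U. u = (\<lambda>t. emb (U t)) \<and> continuous_on UNIV U \<and> solves \<phi> \<phi>' (\<lambda>t. U t + scaleC_H2 (\<phi> t) ?A) \<and>
        (\<forall>t. norm (U t + scaleC_H2 (\<phi> t) ?A) \<le> \<rho>2 * \<epsilon>)"
      if u: "mild_solution S \<alpha> \<phi> u" "norm_X u \<le> C * \<epsilon>" for u
    proof -
      have "in_X u" using u(1) by (simp add: mild_solution_def)
      then obtain U where U: "u = (\<lambda>t. emb (U t))" "continuous_on UNIV U" "bdd_above (range (\<lambda>t. norm (U t)))"
        "norm_X u = (SUP t. norm (U t))" by (rule in_X_obtain)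
      have "solves \<phi> \<phi>' (\<lambda>t. U t + scaleC_H2 (\<phi> t) ?A)"
        using u(1) unfolding U(1) mild_solution_iff[OF U(2,3) c\<phi>] \<phi>'_def[abs_def] .
      moreover have "norm (U t + scaleC_H2 (\<phi> t) ?A) \<le> \<rho>2 * \<epsilon>" for t
      proof -
        have "norm (U t) \<le> C * \<epsilon>" using cSUP_upper[OF UNIV_I U(3), of t] u(2) U(4) by linarith
        then show ?thesis
          using norm_triangle_ineq[of "U t" "scaleC_H2 (\<phi> t) ?A"] lift[of t] by (simp add: \<rho>2_def algebra_simps)
      qed
      ultimately show ?thesis using U by blast
    qed
    obtain y where y: "solves \<phi> \<phi>' y" "\<And>t. norm (y t) \<le> \<rho>1 * \<epsilon>"
      by (rule solution_exists[OF D _ inv[unfolded J_def] contr1[unfolded J_def]]) (use \<rho>1 \<epsilon> in auto)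
    define U where "U t = y t - scaleC_H2 (\<phi> t) ?A" for t
    have nU: "norm (U t) \<le> C * \<epsilon>" for t
      using norm_triangle_ineq4[of "y t" "scaleC_H2 (\<phi> t) ?A"] y(2)[of t] lift[of t] by (simp add: U_def C_def algebra_simps)
    have bU: "bdd_above (range (\<lambda>t. norm (U t)))" using nU by (intro bdd_aboveI2)
    have cU: "continuous_on UNIV U"
      unfolding U_def[abs_def] using y(1)
      by (intro continuous_on_diff bounded_bilinear.continuous_on[OF bounded_bilinear_scaleC_H2] c\<phi> continuous_on_const)
         (simp add: solves_def)
    have ex: "mild_solution S \<alpha> \<phi> (\<lambda>t. emb (U t)) \<and> norm_X (\<lambda>t. emb (U t)) \<le> C * \<epsilon>"
    proof
      show "mild_solution S \<alpha> \<phi> (\<lambda>t. emb (U t))"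
        unfolding mild_solution_iff[OF cU bU c\<phi>] using y(1) by (simp add: U_def \<phi>'_def[abs_def])
      show "norm_X (\<lambda>t. emb (U t)) \<le> C * \<epsilon>" unfolding norm_X_emb by (rule cSUP_least) (use nU in auto)
    qed
    have uniq: "u = v" if u: "mild_solution S \<alpha> \<phi> u \<and> norm_X u \<le> C * \<epsilon>" and v: "mild_solution S \<alpha> \<phi> v \<and> norm_X v \<le> C * \<epsilon>" for u v
    proof -
      obtain U where U: "u = (\<lambda>t. emb (U t))" "solves \<phi> \<phi>' (\<lambda>t. U t + scaleC_H2 (\<phi> t) ?A)"
        "\<And>t. norm (U t + scaleC_H2 (\<phi> t) ?A) \<le> \<rho>2 * \<epsilon>" using char u by blast
      obtain V where V: "v = (\<lambda>t. emb (V t))" "solves \<phi> \<phi>' (\<lambda>t. V t + scaleC_H2 (\<phi> t) ?A)"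
        "\<And>t. norm (V t + scaleC_H2 (\<phi> t) ?A) \<le> \<rho>2 * \<epsilon>" using char v by blast
      have "(\<lambda>t. U t + scaleC_H2 (\<phi> t) ?A) = (\<lambda>t. V t + scaleC_H2 (\<phi> t) ?A)"
        by (rule solution_unique[OF D U(2,3) V(2,3) contr2[unfolded J_def]])
      then have "U t = V t" for t by (auto dest: fun_cong[of _ _ t])
      then show ?thesis by (simp add: U(1) V(1))
    qed
    have qp: "qp_solution k \<omega> u"
      if u: "mild_solution S \<alpha> \<phi> u" "norm_X u \<le> C * \<epsilon>" and \<omega>: "frequency_vector k \<omega>" and q: "qp_data k \<omega> \<phi>" for u k \<omega>
    proof -
      obtain U where U: "u = (\<lambda>t. emb (U t))" "continuous_on UNIV U" "solves \<phi> \<phi>' (\<lambda>t. U t + scaleC_H2 (\<phi> t) ?A)"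
        "\<And>t. norm (U t + scaleC_H2 (\<phi> t) ?A) \<le> \<rho>2 * \<epsilon>" using char[OF u] by blast
      obtain \<phi>0 where \<phi>0: "\<phi> = (\<lambda>t. of_real (\<phi>0 t))" "quasi_periodic_wrt k \<omega> \<phi>0" using q by (auto simp: qp_data_def)
      have "\<omega> \<in> topspace (Euclidean_space k)" using \<omega> by (simp add: frequency_vector_def)
      from quasi_periodic_imp_recurrent[OF this \<phi>0(2)] have rec: "recurrent k \<omega> \<phi>"
        unfolding recurrent_def \<phi>0(1) by (simp flip: of_real_diff)
      have real: "cnj (\<phi> t) = \<phi> t" for t by (simp add: \<phi>0(1))
      note contr = contr2[unfolded J_def]
      have "recurrent k \<omega> (\<lambda>t. (U t + scaleC_H2 (\<phi> t) ?A) - scaleC_H2 (\<phi> t) ?A)"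
        by (rule recurrent_lift[OF recurrent_solution[OF D U(3,4) contr rec] rec])
      then have "recurrent k \<omega> U" by simp
      moreover have "cnj_L2 (emb (U t)) = emb (U t)" for t
      proof -
        interpret cnj: bounded_linear cnj_L2 by (rule bounded_linear_cnj_L2)
        have "cnj_L2 (emb (U t + scaleC_H2 (\<phi> t) ?A)) = emb (U t + scaleC_H2 (\<phi> t) ?A)"
          using real_solution[OF D U(3,4) contr real, of t] by (metis emb_cnj)
        moreover have "cnj_L2 (emb (scaleC_H2 (\<phi> t) ?A)) = emb (scaleC_H2 (\<phi> t) ?A)"
          by (simp add: emb_scaleC emb_lift cnj_scaleC_L2 cnj_lift_L2 real)
        ultimately show ?thesis by (simp add: emb_plus cnj.add)
      qed
      ultimately show ?thesis unfolding U(1) using recurrent_imp_qp_solution[OF \<omega> U(2)] by blast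
    qed
    show "\<exists>!u. mild_solution S \<alpha> \<phi> u \<and> norm_X u \<le> C * \<epsilon>"
      by (rule ex1I[where a = "\<lambda>t. emb (U t)"], rule ex, rule uniq[OF _ ex])
    show "qp_solution k \<omega> u"
      if "mild_solution S \<alpha> \<phi> u" "norm_X u \<le> C * \<epsilon>" "frequency_vector k \<omega>" "qp_data k \<omega> \<phi>" for u k \<omega>
      using that by (rule qp)
  qed
  have "min E1 E2 > 0" using E by simp
  from C this main show thesis by (rule that)
qed

end

lemma scaleR_eq_scaleC: "r *\<^sub>R v = scaleC_L2 (of_real r) v"
  by (rule L2_eqI) (use rep_scaleR[of r v] rep_scaleC[of "of_real r" v] in \<open>eventually_elim, simp add: scaleR_conv_of_real\<close>)

theorem theorem1p4:
  fixes \<alpha> :: real and S :: "real \<Rightarrow> L2I \<Rightarrow> L2I"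
  assumes "\<bar>\<alpha>\<bar> < 1"
    and "C0_contraction_semigroup S"
    and "generated_by S (kawahara_dom \<alpha>) kawahara_op"
  shows "\<exists>C>0. \<exists>\<epsilon>\<^sub>0>0. \<forall>\<epsilon>. 0 < \<epsilon> \<and> \<epsilon> \<le> \<epsilon>\<^sub>0 \<longrightarrow>
    (\<forall>\<phi>. \<phi> C1_differentiable_on UNIV \<and> C1_norm \<phi> \<le> ennreal \<epsilon> \<longrightarrow>
      (\<exists>!u. mild_solution S \<alpha> \<phi> u \<and> norm_X u \<le> C * \<epsilon>) \<and>
      (\<forall>u. mild_solution S \<alpha> \<phi> u \<and> norm_X u \<le> C * \<epsilon> \<longrightarrow>
        ((\<exists>k \<omega>. frequency_vector k \<omega> \<and> qp_data k \<omega> \<phi>) \<longrightarrow>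
          (\<exists>k \<omega>. frequency_vector k \<omega> \<and> qp_solution k \<omega> u)) \<and>
        (\<forall>k \<omega>. frequency_vector k \<omega> \<and> qp_data k \<omega> \<phi> \<longrightarrow> qp_solution k \<omega> u)))"
proof -
  interpret kawahara_semigroup S \<alpha>
  proof unfold_locales
    fix s t r :: real and v w :: L2I and c :: complex
    show "S t (v + w) = S t v + S t w" if "0 \<le> t" using assms(2) that unfolding C0_contraction_semigroup_def by blast
    show "S t (scaleC_L2 c v) = scaleC_L2 c (S t v)" if "0 \<le> t" using assms(2) that unfolding C0_contraction_semigroup_def by blast
    show "S t (r *\<^sub>R v) = r *\<^sub>R S t v" if "0 \<le> t"
      unfolding scaleR_eq_scaleC using assms(2) that unfolding C0_contraction_semigroup_def by blast
    show "norm (S t v) \<le> norm v" if "0 \<le> t" using assms(2) that unfolding C0_contraction_semigroup_def by blast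
    show "S 0 v = v" using assms(2) unfolding C0_contraction_semigroup_def by blast
    show "S (s + t) v = S s (S t v)" if "0 \<le> s" "0 \<le> t" using assms(2) that unfolding C0_contraction_semigroup_def by blast
    show "((\<lambda>t. S t v) \<longlongrightarrow> v) (at_right 0)" using assms(2) unfolding C0_contraction_semigroup_def by blast
    show "((\<lambda>h. (S h v - v) /\<^sub>R h) \<longlongrightarrow> w) (at_right 0) \<longleftrightarrow> v \<in> kawahara_dom \<alpha> \<and> w = kawahara_op v"
      using assms(3) unfolding generated_by_def by blast
    show "\<bar>\<alpha>\<bar> < 1" by (rule assms(1))
  qed
  show ?thesis
  proof (rule quasi_periodic_response)
    fix C \<epsilon>\<^sub>0 :: real assume C: "C > 0" "\<epsilon>\<^sub>0 > 0"
    and ex1: "\<And>\<epsilon> \<phi>. 0 < \<epsilon> \<Longrightarrow> \<epsilon> \<le> \<epsilon>\<^sub>0 \<Longrightarrow> \<phi> C1_differentiable_on UNIV \<Longrightarrow> C1_norm \<phi> \<le> ennreal \<epsilon> \<Longrightarrow>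
      \<exists>!u. mild_solution S \<alpha> \<phi> u \<and> norm_X u \<le> C * \<epsilon>"
    and qp: "\<And>\<epsilon> \<phi> u k \<omega>. 0 < \<epsilon> \<Longrightarrow> \<epsilon> \<le> \<epsilon>\<^sub>0 \<Longrightarrow> \<phi> C1_differentiable_on UNIV \<Longrightarrow> C1_norm \<phi> \<le> ennreal \<epsilon> \<Longrightarrow>
      mild_solution S \<alpha> \<phi> u \<Longrightarrow> norm_X u \<le> C * \<epsilon> \<Longrightarrow> frequency_vector k \<omega> \<Longrightarrow> qp_data k \<omega> \<phi> \<Longrightarrow> qp_solution k \<omega> u"
    show ?thesis
    proof (rule exI[of _ C], rule conjI[OF C(1)], rule exI[of _ \<epsilon>\<^sub>0], rule conjI[OF C(2)], intro allI impI conjI)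
      fix \<epsilon> :: real and \<phi> assume \<epsilon>: "0 < \<epsilon> \<and> \<epsilon> \<le> \<epsilon>\<^sub>0" and \<phi>: "\<phi> C1_differentiable_on UNIV \<and> C1_norm \<phi> \<le> ennreal \<epsilon>"
      note h = \<epsilon>[THEN conjunct1] \<epsilon>[THEN conjunct2] \<phi>[THEN conjunct1] \<phi>[THEN conjunct2]
      show "\<exists>!u. mild_solution S \<alpha> \<phi> u \<and> norm_X u \<le> C * \<epsilon>" by (rule ex1[OF h])
      fix u assume u: "mild_solution S \<alpha> \<phi> u \<and> norm_X u \<le> C * \<epsilon>"
      note q = qp[OF h u[THEN conjunct1] u[THEN conjunct2]]
      show "qp_solution k \<omega> u" if "frequency_vector k \<omega> \<and> qp_data k \<omega> \<phi>" for k \<omega> using q that by blast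
      show "\<exists>k \<omega>. frequency_vector k \<omega> \<and> qp_solution k \<omega> u" if "\<exists>k \<omega>. frequency_vector k \<omega> \<and> qp_data k \<omega> \<phi>"
        using q that by blast
    qed
  qed
qed

end
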